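(* Let $d=2$ and consider the finite element discretization of the Stokes fictitious domain problem described in the context, with $\Gamma_h$ quasi-uniform and with the two discrete inf-sup conditions $$\sup_{0\ne\mathbf{v}_h\in V_h}\frac{(\nabla\cdot\mathbf{v}_h,q_h)_\Omega}{\|\mathbf{v}_h\|_{1,\Omega}}\ge\beta_1\|q_h\|_{0,\Omega}\quad\forall q_h\in Q_h\text{ with }\int_\Omega q_h=0,$$ $$\sup_{0\ne\mathbf{v}_h\in K_{0,h}}\frac{\langle\boldsymbol{\mu}_h,\mathbf{v}_h\rangle_\Gamma}{\|\mathbf{v}_h\|_{1,\Omega}}\ge\beta_2\|\boldsymbol{\mu}_h\|_{-\frac12,\Gamma}\quad\forall\boldsymbol{\mu}_h\in\Lambda_h$$ holding with constants $\beta_1,\beta_2>0$ independent of $h_\Omega$ and $h_\Gamma$. Let $\gamma,\delta>0$ be fixed. If $Q:=M_p$ and $W:=M_\lambda^2$, then the lower bound $\min(\eta,\epsilon,\theta)$ in the inclusion of the non-zero spectrum of $\mathcal{P}_{\gamma\delta}^{-1}\mathcal{A}_{\gamma\delta}$ in $[\min(\eta,\epsilon,\theta),1]$ is bounded away from zero by a positive constant independent of the discretization parameters $h_\Omega$ and $h_\Gamma$.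
   Context: Setting. $\Omega\subset\mathbb{R}^d$ is a Lipschitz domain, $\omega\Subset\Omega$ is closed and bounded with Lipschitz boundary $\Gamma=\partial\omega$. $\Omega_h$ is a quadrilateral mesh of $\Omega$ with mesh size $h_\Omega$ and, independently, $\Gamma_h$ is a mesh of $\Gamma$ made of line segments with mesh size $h_\Gamma$ (the geometrical error is neglected, i.e. $\Gamma_h$ is regarded as a partition of $\Gamma$). Quasi-uniform means that all elements of $\Gamma_h$ have diameter between $\sigma h_\Gamma$ and $h_\Gamma$ with $\sigma>0$ independent of the mesh. $(\cdot,\cdot)_\Omega$ is the $L^2(\Omega)$ inner product, $\langle\cdot,\cdot\rangle_\Gamma$ the duality between $[H^{1/2}(\Gamma)]^d$ and its dual $[H^{-1/2}(\Gamma)]^d$ (given by the $L^2(\Gamma)$ product for $L^2$ functions), $\|\cdot\|_{s,D}$ the norm of $H^s(D)$, and $\|\cdot\|_{-\frac12,\Gamma}$ the dual norm of $\|\cdot\|_{\frac12,\Gamma}$. Spaces. $V_h\subset[H^1_0(\Omega)]^d$ is the space of continuous piecewise $\mathcal{Q}_2$ vector fields vanishing on $\partial\Omega$, $Q_h$ is the space of continuous piecewise $\mathcal{Q}_1$ functions on $\Omega_h$ (no zero-average constraint), $\Lambda_h=\{\boldsymbol{\mu}_h\in[L^2(\Gamma)]^d:\boldsymbol{\mu}_h|_K\in[\mathcal{Q}_1(K)]^d\ \forall K\in\Gamma_h\}$, and $K_{0,h}=\{\mathbf{v}_h\in V_h:(\nabla\cdot\mathbf{v}_h,q_h)_\Omega=0\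 \forall q_h\in Q_h\}$. Their nodal (Lagrange) bases are $\{\boldsymbol{\varphi}_i\}_{i=1}^n$, $\{\phi_k\}_{k=1}^m$, $\{\boldsymbol{\psi}_\alpha\}_{\alpha=1}^l$. Matrices. $A_{ij}=(\nabla\boldsymbol{\varphi}_i,\nabla\boldsymbol{\varphi}_j)_\Omega$, $B_{ki}=-(\nabla\cdot\boldsymbol{\varphi}_i,\phi_k)_\Omega$, $C_{\alpha i}=\langle\boldsymbol{\varphi}_i,\boldsymbol{\psi}_\alpha\rangle_\Gamma$, $(M_p)_{kj}=(\phi_k,\phi_j)_\Omega$, $(M_\lambda)_{\alpha\beta}=\int_\Gamma\boldsymbol{\psi}_\alpha\cdot\boldsymbol{\psi}_\beta$. For $\gamma,\delta>0$ and symmetric positive definite $Q,W$, set $A_{\gamma\delta}=A+\gamma B^TQ^{-1}B+\delta C^TW^{-1}C$, $$\mathcal{A}_{\gamma\delta}=\begin{bmatrix}A_{\gamma\delta}&B^T&C^T\\ B&0&0\\ C&0&0\end{bmatrix},\qquad \mathcal{P}_{\gamma\delta}=\begin{bmatrix}A_{\gamma\delta}&B^T&C^T\\ 0&-\frac1\gamma Q&0\\ 0&0&-\frac1\delta W\end{bmatrix}.$$ Quantities $\eta,\epsilon,\theta$. Let $\mathcal{E}\subset\mathbb{R}^n$ be the set of first components $x$ of real eigenvectors $(x;y;z)$ of $\mathcal{P}_{\gamma\delta}^{-1}\mathcal{A}_{\gamma\delta}$ associated with eigenvalues different from $0$ and $1$ (all eigenvalues are real). Then $\eta$ is the minimum of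 $\frac{\gamma x^TB^TQ^{-1}Bx}{x^T(A+\gamma B^TQ^{-1}B)x}$ over $x\in\mathcal{E}\cap(\ker C\setminus\ker B)$; $\epsilon$ is the minimum of $\frac{\delta x^TC^TW^{-1}Cx}{x^T(A+\delta C^TW^{-1}C)x}$ over $x\in\mathcal{E}\cap(\ker B\setminus\ker C)$; $\theta$ is the minimum of $\frac{x^T(\gamma B^TQ^{-1}B+\delta C^TW^{-1}C)x}{x^TA_{\gamma\delta}x}$ over $x\in\mathcal{E}\setminus(\ker B\cup\ker C)$. A minimum over an empty set is set equal to $1$. The constant in the conclusion may depend on $\Omega,\Gamma,\gamma,\delta,\beta_1,\beta_2$, and $\sigma$, but not on $h_\Omega,h_\Gamma$. *)

theory Defs
  imports "HOL-Analysis.Analysis" "Jordan_Normal_Form.Spectral_Radius"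
    "Jordan_Normal_Form.Matrix_Kernel" "Jordan_Normal_Form.Gauss_Jordan_Elimination"
begin

no_notation Matrix.vec_index (infixl \<open>$\<close> 100)
no_notation Matrix.scalar_prod (infix \<open>\<bullet>\<close> 70)
hide_const (open) Finite_Cartesian_Product.vec Finite_Cartesian_Product.mat


section \<open>Geometry and meshes\<close>

text \<open>Near each boundary point, in suitable orthonormal coordinates, the set is the epigraph of a
  Lipschitz function. Stating this for interior and closure covers both the open set
  \<open>\<Omega>\<close> and the closed set \<open>\<omega>\<close>.\<close>

definition lipschitz_boundary :: "(real^2) set \<Rightarrow> bool" where
  "lipschitz_boundary S \<longleftrightarrow> (\<forall>p\<in>frontier S. \<exists>r>0. \<exists>e1 e2 g L.
     norm e1 = 1 \<and> norm e2 = 1 \<and> e1 \<bullet> e2 = 0 \<and> L-lipschitz_on (UNIV :: real set) g \<and>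
     interior S \<inter> ball p r = {x\<in>ball p r. g (x \<bullet> e1) < x \<bullet> e2} \<and>
     closure S \<inter> ball p r = {x\<in>ball p r. g (x \<bullet> e1) \<le> x \<bullet> e2})"

definition lipschitz_domain :: "(real^2) set \<Rightarrow> bool" where
  "lipschitz_domain \<Omega> \<longleftrightarrow>
     open \<Omega> \<and> connected \<Omega> \<and> \<Omega> \<noteq> {} \<and> bounded \<Omega> \<and> lipschitz_boundary \<Omega>"

text \<open>A quadrilateral is given by its vertices in counterclockwise order.\<close>

type_synonym quad = "(real^2) \<times> (real^2) \<times> (real^2) \<times> (real^2)"

definition cross2 :: "real^2 \<Rightarrow> real^2 \<Rightarrow> real" where
  "cross2 u v = u $ 1 * v $ 2 - u $ 2 * v $ 1"

fun strictly_convex_quad :: "quad \<Rightarrow> bool" where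
  "strictly_convex_quad (a, b, c, d) \<longleftrightarrow>
     cross2 (b - a) (d - a) > 0 \<and> cross2 (c - b) (a - b) > 0 \<and>
     cross2 (d - c) (b - c) > 0 \<and> cross2 (a - d) (c - d) > 0"

fun quad_vertices :: "quad \<Rightarrow> (real^2) set" where
  "quad_vertices (a, b, c, d) = {a, b, c, d}"

fun quad_edges :: "quad \<Rightarrow> (real^2) set set" where
  "quad_edges (a, b, c, d) =
     {closed_segment a b, closed_segment b c, closed_segment c d, closed_segment d a}"

text \<open>The reference element is the unit square \<open>cbox 0 1\<close>.\<close>

fun bilinear_map :: "quad \<Rightarrow> real^2 \<Rightarrow> real^2" where
  "bilinear_map (a, b, c, d) \<xi> =
     ((1 - \<xi> $ 1) * (1 - \<xi> $ 2)) *\<^sub>R a + (\<xi> $ 1 * (1 - \<xi> $ 2)) *\<^sub>R b +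
     (\<xi> $ 1 * \<xi> $ 2) *\<^sub>R c + ((1 - \<xi> $ 1) * \<xi> $ 2) *\<^sub>R d"

definition quad_elem :: "quad \<Rightarrow> (real^2) set" where
  "quad_elem K = bilinear_map K ` cbox 0 1"

definition quad_mesh :: "(real^2) set \<Rightarrow> quad set \<Rightarrow> bool" where
  "quad_mesh \<Omega> T \<longleftrightarrow> finite T \<and> (\<forall>K\<in>T. strictly_convex_quad K) \<and>
     (\<Union>K\<in>T. quad_elem K) = closure \<Omega> \<and>
     (\<forall>K\<in>T. \<forall>L\<in>T. K \<noteq> L \<longrightarrow>
        quad_elem K \<inter> quad_elem L = {} \<or>
        (\<exists>p\<in>quad_vertices K \<inter> quad_vertices L. quad_elem K \<inter> quad_elem L = {p}) \<or>
        (\<exists>e\<in>quad_edges K \<inter> quad_edges L. quad_elem K \<inter> quad_elem L = e))"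

text \<open>A mesh of \<open>\<Gamma>\<close> is a set of pairs of end points of segments; the segments partition \<open>\<Gamma>\<close>
  exactly, up to common end points.\<close>

type_synonym edge = "(real^2) \<times> (real^2)"

definition segment_mesh :: "(real^2) set \<Rightarrow> edge set \<Rightarrow> bool" where
  "segment_mesh \<Gamma> T \<longleftrightarrow> finite T \<and> (\<forall>(a, b)\<in>T. a \<noteq> b) \<and>
     (\<Union>(a, b)\<in>T. closed_segment a b) = \<Gamma> \<and>
     (\<forall>(a, b)\<in>T. \<forall>(c, d)\<in>T. (a, b) \<noteq> (c, d) \<longrightarrow>
        closed_segment a b \<inter> closed_segment c d \<subseteq> {a, b} \<inter> {c, d})"

definition mesh_size :: "edge set \<Rightarrow> real" where
  "mesh_size T = Max ((\<lambda>(a, b). dist a b) ` T)"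

definition quasi_uniform :: "real \<Rightarrow> edge set \<Rightarrow> bool" where
  "quasi_uniform \<sigma> T \<longleftrightarrow>
     (\<forall>(a, b)\<in>T. \<sigma> * mesh_size T \<le> dist a b \<and> dist a b \<le> mesh_size T)"


section \<open>Norms and pairings\<close>

text \<open>These are applied to continuous, piecewise smooth functions, whose weak gradient is the
  classical gradient, defined off the null set of element boundaries. The inner product on
  \<^typ>\<open>real^2^2\<close> is the Frobenius product.\<close>

definition grad :: "(real^2 \<Rightarrow> real^2) \<Rightarrow> real^2 \<Rightarrow> real^2^2" where
  "grad v x = matrix (frechet_derivative v (at x))"

definition divergence :: "(real^2 \<Rightarrow> real^2) \<Rightarrow> real^2 \<Rightarrow> real" where
  "divergence v x = trace (grad v x)"

definition L2_inner :: "(real^2) set \<Rightarrow> (real^2 \<Rightarrow> 'a::real_inner) \<Rightarrow> (real^2 \<Rightarrow> 'a) \<Rightarrow> real" where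
  "L2_inner \<Omega> f g = (LINT x:\<Omega>|lebesgue. f x \<bullet> g x)"

definition L2_norm :: "(real^2) set \<Rightarrow> (real^2 \<Rightarrow> 'a::real_inner) \<Rightarrow> real" where
  "L2_norm \<Omega> f = sqrt (L2_inner \<Omega> f f)"

definition H1_norm :: "(real^2) set \<Rightarrow> (real^2 \<Rightarrow> real^2) \<Rightarrow> real" where
  "H1_norm \<Omega> v = sqrt ((L2_norm \<Omega> v)\<^sup>2 + (L2_norm \<Omega> (grad v))\<^sup>2)"

text \<open>Arc length measure on the union \<open>\<Gamma>\<close> of the segments of a mesh, as a Borel measure on the
  plane. It depends on \<open>\<Gamma>\<close> only, not on the mesh partitioning it.\<close>

definition arc_measure :: "edge set \<Rightarrow> (real^2) measure" where
  "arc_measure T = measure_of UNIV (sets borel)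
     (\<lambda>S. \<Sum>(a, b)\<in>T. ennreal (dist a b) * emeasure lborel {t\<in>{0..1}. linepath a b t \<in> S})"

definition pairing :: "edge set \<Rightarrow> (real^2 \<Rightarrow> real^2) \<Rightarrow> (real^2 \<Rightarrow> real^2) \<Rightarrow> real" where
  "pairing T \<mu> w = (\<integral>x. \<mu> x \<bullet> w x \<partial>arc_measure T)"

text \<open>Squared Sobolev--Slobodeckij norm of order \<open>1/2\<close> on the one-dimensional set \<open>\<Gamma>\<close>; the
  exponent of the distance is \<open>1 + 2 * (1/2)\<close>.\<close>

definition Hhalf_sq :: "edge set \<Rightarrow> (real^2 \<Rightarrow> real^2) \<Rightarrow> ennreal" where
  "Hhalf_sq T w =
     (\<integral>\<^sup>+x. ennreal ((norm (w x))\<^sup>2) \<partial>arc_measure T) +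
     (\<integral>\<^sup>+x. (\<integral>\<^sup>+y. ennreal ((norm (w x - w y))\<^sup>2 / (dist x y)\<^sup>2) \<partial>arc_measure T) \<partial>arc_measure T)"

definition Hhalf :: "edge set \<Rightarrow> (real^2 \<Rightarrow> real^2) set" where
  "Hhalf T = {w \<in> borel_measurable borel. Hhalf_sq T w < \<infinity>}"

definition Hhalf_norm :: "edge set \<Rightarrow> (real^2 \<Rightarrow> real^2) \<Rightarrow> real" where
  "Hhalf_norm T w = sqrt (enn2real (Hhalf_sq T w))"

definition Hminushalf_norm :: "edge set \<Rightarrow> (real^2 \<Rightarrow> real^2) \<Rightarrow> real" where
  "Hminushalf_norm T \<mu> = (SUP w\<in>{w\<in>Hhalf T. Hhalf_norm T w \<le> 1}. pairing T \<mu> w)"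


section \<open>Finite element spaces and nodal bases\<close>

definition Q_poly :: "nat \<Rightarrow> (real^2 \<Rightarrow> real) set" where
  "Q_poly k = {p. \<exists>c. p = (\<lambda>\<xi>. \<Sum>i\<le>k. \<Sum>j\<le>k. c i j * (\<xi> $ 1) ^ i * (\<xi> $ 2) ^ j)}"

text \<open>The usual mapped elements: \<open>q\<close> composed with the bilinear map of each element is in
  \<open>Q_poly k\<close>. Finite element functions are extended by zero outside the closure of \<open>\<Omega>\<close>, so that
  equality of functions on the plane is equality on the closure.\<close>

definition fe_space :: "nat \<Rightarrow> (real^2) set \<Rightarrow> quad set \<Rightarrow> (real^2 \<Rightarrow> real) set" where
  "fe_space k \<Omega> T = {q. continuous_on (closure \<Omega>) q \<and>
     (\<forall>K\<in>T. \<exists>p\<in>Q_poly k. \<forall>\<xi>\<in>cbox 0 1. q (bilinear_map K \<xi>) = p \<xi>) \<and>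
     (\<forall>x. x \<notin> closure \<Omega> \<longrightarrow> q x = 0)}"

definition Q_space :: "(real^2) set \<Rightarrow> quad set \<Rightarrow> (real^2 \<Rightarrow> real) set" where
  "Q_space \<Omega> T = fe_space 1 \<Omega> T"

definition V_space :: "(real^2) set \<Rightarrow> quad set \<Rightarrow> (real^2 \<Rightarrow> real^2) set" where
  "V_space \<Omega> T = {v. (\<forall>c. (\<lambda>x. v x $ c) \<in> fe_space 2 \<Omega> T) \<and> (\<forall>x\<in>frontier \<Omega>. v x = 0)}"

definition K0_space :: "(real^2) set \<Rightarrow> quad set \<Rightarrow> (real^2 \<Rightarrow> real^2) set" where
  "K0_space \<Omega> T =
     {v\<in>V_space \<Omega> T. \<forall>q\<in>Q_space \<Omega> T. L2_inner \<Omega> (divergence v) q = 0}"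

text \<open>The multipliers are discontinuous at the nodes of the mesh; as representatives of their
  \<open>L\<^sup>2\<close> classes take the ones vanishing outside the open segments.\<close>

definition Lambda_space :: "edge set \<Rightarrow> (real^2 \<Rightarrow> real^2) set" where
  "Lambda_space T = {\<mu>.
     (\<forall>(a, b)\<in>T. \<exists>u w. \<forall>t\<in>{0<..<1}. \<mu> (linepath a b t) = (1 - t) *\<^sub>R u + t *\<^sub>R w) \<and>
     (\<forall>x. x \<notin> (\<Union>(a, b)\<in>T. open_segment a b) \<longrightarrow> \<mu> x = 0)}"

definition lagrange_nodes :: "nat \<Rightarrow> quad set \<Rightarrow> (real^2) set" where
  "lagrange_nodes k T =
     {bilinear_map K (vector [real i / real k, real j / real k]) | K i j. K \<in> T \<and> i \<le> k \<and> j \<le> k}"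

definition Q_basis :: "(real^2) set \<Rightarrow> quad set \<Rightarrow> (real^2 \<Rightarrow> real) set" where
  "Q_basis \<Omega> T = {\<phi>\<in>Q_space \<Omega> T. \<exists>N\<in>lagrange_nodes 1 T.
     \<forall>N'\<in>lagrange_nodes 1 T. \<phi> N' = (if N' = N then 1 else 0)}"

definition V_basis :: "(real^2) set \<Rightarrow> quad set \<Rightarrow> (real^2 \<Rightarrow> real^2) set" where
  "V_basis \<Omega> T = {\<phi>\<in>V_space \<Omega> T. \<exists>N\<in>lagrange_nodes 2 T - frontier \<Omega>. \<exists>c.
     \<forall>N'\<in>lagrange_nodes 2 T. \<phi> N' = (if N' = N then axis c 1 else 0)}"

text \<open>Component \<open>c\<close> of the affine function on the segment with value \<open>1\<close> at \<open>a\<close> and \<open>0\<close> at \<open>b\<close>.\<close>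

definition segment_shape :: "real^2 \<Rightarrow> real^2 \<Rightarrow> 2 \<Rightarrow> real^2 \<Rightarrow> real^2" where
  "segment_shape a b c x = (if x \<in> open_segment a b then axis c (dist x b / dist a b) else 0)"

definition Lambda_basis :: "edge set \<Rightarrow> (real^2 \<Rightarrow> real^2) set" where
  "Lambda_basis T = {segment_shape a b c | a b c. (a, b) \<in> T \<or> (b, a) \<in> T}"

definition enumerates :: "'a list \<Rightarrow> 'a set \<Rightarrow> bool" where
  "enumerates xs S \<longleftrightarrow> distinct xs \<and> set xs = S"


section \<open>Discrete inf-sup conditions\<close>

text \<open>The suprema are taken in \<^typ>\<open>ereal\<close>, so that they are meaningful without assuming
  boundedness.\<close>

definition inf_sup_div :: "real \<Rightarrow> (real^2) set \<Rightarrow> quad set \<Rightarrow> bool" where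
  "inf_sup_div \<beta> \<Omega> T \<longleftrightarrow> (\<forall>q\<in>Q_space \<Omega> T. (LINT x:\<Omega>|lebesgue. q x) = 0 \<longrightarrow>
     (SUP v\<in>V_space \<Omega> T - {\<lambda>_. 0}. ereal (L2_inner \<Omega> (divergence v) q / H1_norm \<Omega> v))
       \<ge> ereal (\<beta> * L2_norm \<Omega> q))"

definition inf_sup_mult :: "real \<Rightarrow> (real^2) set \<Rightarrow> quad set \<Rightarrow> edge set \<Rightarrow> bool" where
  "inf_sup_mult \<beta> \<Omega> T T\<^sub>\<Gamma> \<longleftrightarrow> (\<forall>\<mu>\<in>Lambda_space T\<^sub>\<Gamma>.
     (SUP v\<in>K0_space \<Omega> T - {\<lambda>_. 0}. ereal (pairing T\<^sub>\<Gamma> \<mu> v / H1_norm \<Omega> v))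
       \<ge> ereal (\<beta> * Hminushalf_norm T\<^sub>\<Gamma> \<mu>))"


section \<open>Matrices\<close>

definition A_matrix :: "(real^2) set \<Rightarrow> (real^2 \<Rightarrow> real^2) list \<Rightarrow> real mat" where
  "A_matrix \<Omega> \<phi>s = Matrix.mat (length \<phi>s) (length \<phi>s)
     (\<lambda>(i, j). L2_inner \<Omega> (grad (\<phi>s ! i)) (grad (\<phi>s ! j)))"

definition B_matrix ::
  "(real^2) set \<Rightarrow> (real^2 \<Rightarrow> real^2) list \<Rightarrow> (real^2 \<Rightarrow> real) list \<Rightarrow> real mat" where
  "B_matrix \<Omega> \<phi>s ps = Matrix.mat (length ps) (length \<phi>s)
     (\<lambda>(k, i). - L2_inner \<Omega> (divergence (\<phi>s ! i)) (ps ! k))"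

definition C_matrix ::
  "edge set \<Rightarrow> (real^2 \<Rightarrow> real^2) list \<Rightarrow> (real^2 \<Rightarrow> real^2) list \<Rightarrow> real mat" where
  "C_matrix T \<phi>s \<psi>s = Matrix.mat (length \<psi>s) (length \<phi>s)
     (\<lambda>(\<alpha>, i). pairing T (\<phi>s ! i) (\<psi>s ! \<alpha>))"

definition Mp_matrix :: "(real^2) set \<Rightarrow> (real^2 \<Rightarrow> real) list \<Rightarrow> real mat" where
  "Mp_matrix \<Omega> ps = Matrix.mat (length ps) (length ps)
     (\<lambda>(k, j). L2_inner \<Omega> (ps ! k) (ps ! j))"

definition Mlambda_matrix :: "edge set \<Rightarrow> (real^2 \<Rightarrow> real^2) list \<Rightarrow> real mat" where
  "Mlambda_matrix T \<psi>s = Matrix.mat (length \<psi>s) (length \<psi>s)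
     (\<lambda>(\<alpha>, \<beta>). pairing T (\<psi>s ! \<alpha>) (\<psi>s ! \<beta>))"

abbreviation minv :: "'a::field mat \<Rightarrow> 'a mat" where
  "minv M \<equiv> the (mat_inverse M)"

text \<open>\<open>aug s B Q\<close> is \<open>s B\<^sup>T Q\<^sup>-\<^sup>1 B\<close>.\<close>

definition aug :: "real \<Rightarrow> real mat \<Rightarrow> real mat \<Rightarrow> real mat" where
  "aug s B Q = s \<cdot>\<^sub>m (transpose_mat B * minv Q * B)"

definition A_aug ::
  "real \<Rightarrow> real \<Rightarrow> real mat \<Rightarrow> real mat \<Rightarrow> real mat \<Rightarrow> real mat \<Rightarrow> real mat \<Rightarrow> real mat" where
  "A_aug \<gamma> \<delta> A B C Q W = A + aug \<gamma> B Q + aug \<delta> C W"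

definition system_matrix ::
  "real \<Rightarrow> real \<Rightarrow> real mat \<Rightarrow> real mat \<Rightarrow> real mat \<Rightarrow> real mat \<Rightarrow> real mat \<Rightarrow> real mat" where
  "system_matrix \<gamma> \<delta> A B C Q W =
     (let r = dim_row B + dim_row C in
      four_block_mat (A_aug \<gamma> \<delta> A B C Q W) (transpose_mat (B @\<^sub>r C)) (B @\<^sub>r C) (0\<^sub>m r r))"

definition precond_matrix ::
  "real \<Rightarrow> real \<Rightarrow> real mat \<Rightarrow> real mat \<Rightarrow> real mat \<Rightarrow> real mat \<Rightarrow> real mat \<Rightarrow> real mat" where
  "precond_matrix \<gamma> \<delta> A B C Q W =
     (let m = dim_row B; l = dim_row C; n = dim_row A in
      four_block_mat (A_aug \<gamma> \<delta> A B C Q W) (transpose_mat (B @\<^sub>r C)) (0\<^sub>m (m + l) n)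
        (four_block_mat ((- 1 / \<gamma>) \<cdot>\<^sub>m Q) (0\<^sub>m m l) (0\<^sub>m l m) ((- 1 / \<delta>) \<cdot>\<^sub>m W)))"

definition precond_system ::
  "real \<Rightarrow> real \<Rightarrow> real mat \<Rightarrow> real mat \<Rightarrow> real mat \<Rightarrow> real mat \<Rightarrow> real mat \<Rightarrow> real mat" where
  "precond_system \<gamma> \<delta> A B C Q W = minv (precond_matrix \<gamma> \<delta> A B C Q W) * system_matrix \<gamma> \<delta> A B C Q W"


section \<open>The lower spectral bound\<close>

definition eig_comps ::
  "real \<Rightarrow> real \<Rightarrow> real mat \<Rightarrow> real mat \<Rightarrow> real mat \<Rightarrow> real mat \<Rightarrow> real mat \<Rightarrow> real Matrix.vec set" where
  "eig_comps \<gamma> \<delta> A B C Q W = {vec_first v (dim_row A) | v k.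
     eigenvector (precond_system \<gamma> \<delta> A B C Q W) v k \<and> k \<noteq> 0 \<and> k \<noteq> 1}"

definition quad_form :: "real mat \<Rightarrow> real Matrix.vec \<Rightarrow> real" where
  "quad_form M x = scalar_prod x (M *\<^sub>v x)"

text \<open>On the sets below the quotients take only finitely many values, as each of them equals the
  eigenvalue belonging to \<open>x\<close>.\<close>

definition min_or_one :: "real set \<Rightarrow> real" where
  "min_or_one S = (if S = {} then 1 else Min S)"

definition eta ::
  "real \<Rightarrow> real \<Rightarrow> real mat \<Rightarrow> real mat \<Rightarrow> real mat \<Rightarrow> real mat \<Rightarrow> real mat \<Rightarrow> real" where
  "eta \<gamma> \<delta> A B C Q W = min_or_one
     ((\<lambda>x. quad_form (aug \<gamma> B Q) x / quad_form (A + aug \<gamma> B Q) x) `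
       (eig_comps \<gamma> \<delta> A B C Q W \<inter> (mat_kernel C - mat_kernel B)))"

definition epsilon ::
  "real \<Rightarrow> real \<Rightarrow> real mat \<Rightarrow> real mat \<Rightarrow> real mat \<Rightarrow> real mat \<Rightarrow> real mat \<Rightarrow> real" where
  "epsilon \<gamma> \<delta> A B C Q W = min_or_one
     ((\<lambda>x. quad_form (aug \<delta> C W) x / quad_form (A + aug \<delta> C W) x) `
       (eig_comps \<gamma> \<delta> A B C Q W \<inter> (mat_kernel B - mat_kernel C)))"

definition theta ::
  "real \<Rightarrow> real \<Rightarrow> real mat \<Rightarrow> real mat \<Rightarrow> real mat \<Rightarrow> real mat \<Rightarrow> real mat \<Rightarrow> real" where
  "theta \<gamma> \<delta> A B C Q W = min_or_one
     ((\<lambda>x. quad_form (aug \<gamma> B Q + aug \<delta> C W) x / quad_form (A_aug \<gamma> \<delta> A B C Q W) x) `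
       (eig_comps \<gamma> \<delta> A B C Q W - (mat_kernel B \<union> mat_kernel C)))"

definition lower_bound ::
  "real \<Rightarrow> real \<Rightarrow> real mat \<Rightarrow> real mat \<Rightarrow> real mat \<Rightarrow> real mat \<Rightarrow> real mat \<Rightarrow> real" where
  "lower_bound \<gamma> \<delta> A B C Q W =
     Min {eta \<gamma> \<delta> A B C Q W, epsilon \<gamma> \<delta> A B C Q W, theta \<gamma> \<delta> A B C Q W}"

end

theory Submission
  imports Defs
begin

text \<open>An eigenvalue \<open>k\<close> of the preconditioned matrix different from \<open>0\<close> and \<open>1\<close> lies in \<open>(0, 1)\<close>, and
  with \<open>s = (1 - k) / k\<close> its eigenvector is a discrete velocity, pressure and multiplier
  \<open>(u, p, \<lambda>)\<close> with \<open>a(v, u) = - (div v, p) + \<langle>\<lambda>, v\<rangle>\<close> for all \<open>v\<close>,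
  \<open>(q, p) = - s \<gamma> (div u, q)\<close> for all \<open>q\<close>, and \<open>W z = s \<delta> C x\<close>. Hence
  \<open>s a(u, u) = \<parallel>p\<parallel>\<^sup>2 / \<gamma> + z\<^sup>T W z / \<delta>\<close>, and it suffices to bound both terms by the energy.
  Testing with the kernel of the divergence, the second inf-sup condition bounds the dual norm of
  \<open>\<lambda>\<close>. As \<open>W\<close> is the squared mass matrix, \<open>z\<^sup>T W z\<close> is at most a multiple of
  \<open>h\<^sup>2\<close> times the sum of the squared end point values of \<open>\<lambda>\<close>, which the
  dual norm controls by an inverse inequality: test with \<open>\<lambda>\<close> times a quadratic bubble on each segment.
  The pressure has mean zero, because the divergence of \<open>u\<close> has, and is bounded by
  the first inf-sup condition and the trace inequality. The trace inequality compares the values of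
  a piecewise smooth function at two points of the interface along oblique lines.\<close>

text \<open>The obstacle is uniformity: constants may depend on the geometry, but on neither mesh.
  The trace constant and the kernel integrals are computed on one reference mesh \<open>T0\<close>
  of the interface and carried over to all others, as the arc length measure depends on the
  interface only. Discrete velocities vanish on the boundary, so their extension by zero is
  continuous on the plane; the trace estimate and the mean value of the divergence come from
  integration along full lines, and the quadrilaterals matter only as a skeleton that almost every
  line meets finitely often. The bubble is forced: multipliers jump at the nodes, and a function
  with jumps has infinite Slobodeckij norm of order 1/2. Vanishing linearly at the end points, the
  bubble just absorbs the tail of the kernel \<open>1 / (dist x y)\<^sup>2\<close>. The square of
  the mass matrix is a matter of scaling: the mass matrix behaves like the mesh size times the
  identity, so \<open>W\<close> carries the square of the mesh size, the power with which the dual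
  norm controls end point values. Existence and span of the nodal bases are proved, not
  assumed.\<close>

lemmas cart_eq_iff = Finite_Cartesian_Product.vec_eq_iff

section \<open>Spectrum of the preconditioned saddle point matrix\<close>

definition spd :: "nat => real mat => bool" where
 "spd n A \<longleftrightarrow> A \<in> carrier_mat n n \<and> transpose_mat A = A \<and>
  (\<forall>x\<in>carrier_vec n. x ~= 0\<^sub>v n --> 0 < quad_form A x)"

text \<open>\<open>minv\<close> unwraps an option and means something for invertible matrices only.
  A trivial kernel forces a nonzero determinant, hence a unit of the matrix ring, which rules out
  \<open>None\<close>.\<close>

lemma minv_trivial_kernel:
 fixes A :: "'a::field mat"
 assumes A: "A \<in> carrier_mat n n"
  and ker: "!!x. x \<in> carrier_vec n ==> A *\<^sub>v x = 0\<^sub>v n ==> x = 0\<^sub>v n"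
 shows "A * minv A = 1\<^sub>m n" "minv A * A = 1\<^sub>m n" "minv A \<in> carrier_mat n n"
proof -
 have "det A ~= 0"
  using det_0_iff_vec_prod_zero_field[OF A] ker by auto
 then have "A \<in> Units (ring_mat TYPE('a) n ())"
  by (rule det_non_zero_imp_unit[OF A])
 then have "mat_inverse A ~= None"
  using mat_inverse(1)[OF A, of "()"] by auto
 then obtain B where "mat_inverse A = Some B" by auto
 from mat_inverse(2)[OF A this] this
 show "A * minv A = 1\<^sub>m n" "minv A * A = 1\<^sub>m n" "minv A \<in> carrier_mat n n" by auto
qed

lemma spd_carrier: "spd n A ==> A \<in> carrier_mat n n"
 by (simp add: spd_def)

lemma spd_form_commute:
 assumes "spd n A" "x \<in> carrier_vec n" "y \<in> carrier_vec n"
 shows "scalar_prod x (A *\<^sub>v y) = scalar_prod y (A *\<^sub>v x)"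
proof -
 have A: "A \<in> carrier_mat n n" "transpose_mat A = A" using assms by (auto simp: spd_def)
 have "scalar_prod x (A *\<^sub>v y) = scalar_prod (A *\<^sub>v x) y"
  using transpose_vec_mult_scalar[OF A(1) assms(3,2)] A(2) by simp
 also have "\<dots> = scalar_prod y (A *\<^sub>v x)"
  using A assms by (intro comm_scalar_prod[of _ n]) auto
 finally show ?thesis .
qed

lemma spd_nonneg:
 assumes "spd n A" "x \<in> carrier_vec n"
 shows "0 <= scalar_prod x (A *\<^sub>v x)"
proof (cases "x = 0\<^sub>v n")
 case True
 then show ?thesis using spd_carrier[OF assms(1)] by simp
next
 case False
 then show ?thesis using assms unfolding spd_def quad_form_def by (simp add: less_imp_le)
qed

lemma spd_eq_0:
 assumes "spd n A" "x \<in> carrier_vec n" "scalar_prod x (A *\<^sub>v x) = 0"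
 shows "x = 0\<^sub>v n"
 using assms unfolding spd_def quad_form_def by force

lemma spd_minv:
 assumes "spd n A"
 shows "A * minv A = 1\<^sub>m n" "minv A * A = 1\<^sub>m n" "spd n (minv A)"
proof -
 have A: "A \<in> carrier_mat n n" "transpose_mat A = A" using assms by (auto simp: spd_def)
 have "x = 0\<^sub>v n" if "x \<in> carrier_vec n" "A *\<^sub>v x = 0\<^sub>v n" for x
  using that by (intro spd_eq_0[OF assms]) auto
 then have inv: "A * minv A = 1\<^sub>m n" "minv A * A = 1\<^sub>m n" "minv A \<in> carrier_mat n n"
  using minv_trivial_kernel[OF A(1)] by blast+
 show i1: "A * minv A = 1\<^sub>m n" and i2: "minv A * A = 1\<^sub>m n" by (fact inv)+
 have I: "minv A \<in> carrier_mat n n" by (fact inv)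
 have app: "A *\<^sub>v (minv A *\<^sub>v x) = x" if "x \<in> carrier_vec n" for x
  using assoc_mult_mat_vec[OF A(1) I that] i1 that by simp
 \<comment> \<open>The transpose of \<open>minv A\<close> is a left inverse of the symmetric
   \<open>A\<close>, and one-sided inverses coincide.\<close>
 have "transpose_mat (minv A) * A = 1\<^sub>m n"
  using transpose_mult[OF A(1) I] i1 A by simp
 then have "transpose_mat (minv A) * A * minv A = minv A" using I by simp
 then have sym: "transpose_mat (minv A) = minv A"
  using A I i1 by (subst (asm) assoc_mult_mat[of _ n n _ n _ n]) auto
 have "0 < quad_form (minv A) x" if x: "x \<in> carrier_vec n" "x ~= 0\<^sub>v n" for x
 proof -
  let ?y = "minv A *\<^sub>v x"
  have y: "?y \<in> carrier_vec n" using I x by auto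
  have "A *\<^sub>v 0\<^sub>v n = 0\<^sub>v n" using A by auto
  then have "?y ~= 0\<^sub>v n" using app[OF x(1)] x(2) by auto
  then have "0 < scalar_prod ?y (A *\<^sub>v ?y)" using assms y unfolding spd_def quad_form_def by auto
  then show ?thesis using app[OF x(1)] comm_scalar_prod[OF y x(1)] by (simp add: quad_form_def)
 qed
 then show "spd n (minv A)" using I sym by (auto simp: spd_def)
qed

lemma spd_minv_apply:
 assumes "spd n A" "x \<in> carrier_vec n"
 shows "A *\<^sub>v (minv A *\<^sub>v x) = x" "minv A *\<^sub>v (A *\<^sub>v x) = x"
proof -
 have c: "A \<in> carrier_mat n n" "minv A \<in> carrier_mat n n"
  using assms spd_minv(3) by (auto simp: spd_def)
 show "A *\<^sub>v (minv A *\<^sub>v x) = x" "minv A *\<^sub>v (A *\<^sub>v x) = x"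
  using assoc_mult_mat_vec[OF c assms(2)] assoc_mult_mat_vec[OF c(2,1) assms(2)]
   spd_minv[OF assms(1)] assms(2) by simp_all
qed

text \<open>Moves the triple product into a form where \<open>B\<close> acts on both arguments, so
  that later arguments handle \<open>minv Q\<close> only and never the product matrix.\<close>

lemma aug_form:
 assumes B: "B \<in> carrier_mat m n" and Q: "spd m Q"
  and w: "w \<in> carrier_vec n" and x: "x \<in> carrier_vec n"
 shows "scalar_prod w (aug s B Q *\<^sub>v x) = s * scalar_prod (B *\<^sub>v w) (minv Q *\<^sub>v (B *\<^sub>v x))"
  and "aug s B Q \<in> carrier_mat n n"
proof -
 have I: "minv Q \<in> carrier_mat m m" using spd_minv(3)[OF Q] by (simp add: spd_def)
 show c: "aug s B Q \<in> carrier_mat n n" using B I by (simp add: aug_def)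
 have "(transpose_mat B * minv Q * B) *\<^sub>v x = transpose_mat B *\<^sub>v (minv Q *\<^sub>v (B *\<^sub>v x))"
  using B I x by (subst assoc_mult_mat_vec[of _ n m _ n], auto)
 moreover have "aug s B Q *\<^sub>v x = s \<cdot>\<^sub>v ((transpose_mat B * minv Q * B) *\<^sub>v x)"
  using B I x by (auto simp: aug_def intro!: eq_vecI)
 ultimately have e: "aug s B Q *\<^sub>v x = s \<cdot>\<^sub>v (transpose_mat B *\<^sub>v (minv Q *\<^sub>v (B *\<^sub>v x)))"
  by simp
 let ?z = "minv Q *\<^sub>v (B *\<^sub>v x)"
 have z: "?z \<in> carrier_vec m" using I B x by auto
 have "scalar_prod w (transpose_mat B *\<^sub>v ?z) = scalar_prod (transpose_mat B *\<^sub>v ?z) w"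
  using B w z by (intro comm_scalar_prod[of _ n]) auto
 also have "\<dots> = scalar_prod ?z (B *\<^sub>v w)" by (rule transpose_vec_mult_scalar[OF B w z])
 also have "\<dots> = scalar_prod (B *\<^sub>v w) ?z" using B w z by (intro comm_scalar_prod[of _ m]) auto
 finally show "scalar_prod w (aug s B Q *\<^sub>v x) = s * scalar_prod (B *\<^sub>v w) ?z"
  using e w B z by simp
qed

lemma form_eq_imp_eq:
 assumes "x \<in> carrier_vec n" "y \<in> carrier_vec n"
  and "!!w. w \<in> carrier_vec n ==> scalar_prod w x = scalar_prod w (y :: real Matrix.vec)"
 shows "x = y"
proof (rule eq_vecI)
 fix i assume "i < dim_vec y"
 then show "vec_index x i = vec_index y i"
  using assms(1,2) assms(3)[of "unit_vec n i"] by simp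
qed (use assms in auto)

text \<open>Pure linear algebra, with definiteness as the only structure. The system matrix may be
  singular: for the Stokes problem constant pressures lie in the kernel of
  \<open>transpose_mat B\<close>, which is why the eigenvalue 0 is set aside.\<close>

locale saddle_point =
 fixes n m l :: nat and A B C Q W :: "real mat" and \<gamma> \<delta> :: real
 assumes A: "spd n A" and Q: "spd m Q" and W: "spd l W"
  and B: "B \<in> carrier_mat m n" and C: "C \<in> carrier_mat l n"
  and \<gamma>: "0 < \<gamma>" and \<delta>: "0 < \<delta>"
begin

abbreviation "AA \<equiv> A_aug \<gamma> \<delta> A B C Q W"
abbreviation "SS \<equiv> system_matrix \<gamma> \<delta> A B C Q W"
abbreviation "PP \<equiv> precond_matrix \<gamma> \<delta> A B C Q W"
abbreviation "MM \<equiv> precond_system \<gamma> \<delta> A B C Q W"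

lemma carriers [simp]:
 "A \<in> carrier_mat n n" "Q \<in> carrier_mat m m" "W \<in> carrier_mat l l"
 "B \<in> carrier_mat m n" "C \<in> carrier_mat l n"
 "AA \<in> carrier_mat n n" "SS \<in> carrier_mat (n + (m + l)) (n + (m + l))"
 "PP \<in> carrier_mat (n + (m + l)) (n + (m + l))"
 "aug \<gamma> B Q \<in> carrier_mat n n" "aug \<delta> C W \<in> carrier_mat n n"
 "minv Q \<in> carrier_mat m m" "minv W \<in> carrier_mat l l"
proof -
 show c: "A \<in> carrier_mat n n" "Q \<in> carrier_mat m m" "W \<in> carrier_mat l l"
  "B \<in> carrier_mat m n" "C \<in> carrier_mat l n"
  using A Q W B C by (auto simp: spd_def)
 show d: "aug \<gamma> B Q \<in> carrier_mat n n" "aug \<delta> C W \<in> carrier_mat n n"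
  using aug_form(2)[OF B Q zero_carrier_vec zero_carrier_vec]
   aug_form(2)[OF C W zero_carrier_vec zero_carrier_vec] by auto
 then show AA: "AA \<in> carrier_mat n n" using c by (auto simp: A_aug_def)
 show "SS \<in> carrier_mat (n + (m + l)) (n + (m + l))"
  using c AA by (auto simp: system_matrix_def Let_def)
 show "PP \<in> carrier_mat (n + (m + l)) (n + (m + l))"
  using c AA by (auto simp: precond_matrix_def Let_def)
 show "minv Q \<in> carrier_mat m m" "minv W \<in> carrier_mat l l"
  using spd_minv(3)[OF Q] spd_minv(3)[OF W] by (auto simp: spd_def)
qed

lemmas mult_carriers [simp] =
 mult_mat_vec_carrier[OF carriers(1)] mult_mat_vec_carrier[OF carriers(2)]
 mult_mat_vec_carrier[OF carriers(3)] mult_mat_vec_carrier[OF carriers(4)]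
 mult_mat_vec_carrier[OF carriers(5)] mult_mat_vec_carrier[OF carriers(6)]
 mult_mat_vec_carrier[OF carriers(9)] mult_mat_vec_carrier[OF carriers(10)]
 mult_mat_vec_carrier[OF carriers(11)] mult_mat_vec_carrier[OF carriers(12)]

lemma dims [simp]:
 "dim_row A = n" "dim_row B = m" "dim_row C = l" "dim_col A = n" "dim_col B = n" "dim_col C = n"
 "dim_row AA = n" "dim_col AA = n"
 using carriers(1,4,5,6) unfolding carrier_mat_def by blast+

lemma AA_form:
 assumes "w \<in> carrier_vec n" "x \<in> carrier_vec n"
 shows "scalar_prod w (AA *\<^sub>v x) = scalar_prod w (A *\<^sub>v x) +
  \<gamma> * scalar_prod (B *\<^sub>v w) (minv Q *\<^sub>v (B *\<^sub>v x)) +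
  \<delta> * scalar_prod (C *\<^sub>v w) (minv W *\<^sub>v (C *\<^sub>v x))"
proof -
 have "AA *\<^sub>v x = A *\<^sub>v x + aug \<gamma> B Q *\<^sub>v x + aug \<delta> C W *\<^sub>v x"
  using assms unfolding A_aug_def by (simp add: add_mult_distrib_mat_vec[of _ n n])
 then show ?thesis
  using assms aug_form(1)[OF B Q assms, of \<gamma>] aug_form(1)[OF C W assms, of \<delta>]
  by (simp add: scalar_prod_add_distrib[of _ n])
qed

lemma spd_AA: "spd n AA"
proof -
 note BQ = spd_nonneg[OF spd_minv(3)[OF Q]] and CW = spd_nonneg[OF spd_minv(3)[OF W]]
 have pos: "0 < quad_form AA x" if x: "x \<in> carrier_vec n" "x ~= 0\<^sub>v n" for x
 proof -
  have "0 < scalar_prod x (A *\<^sub>v x)" using A x unfolding spd_def quad_form_def by auto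
  moreover have "0 <= \<gamma> * scalar_prod (B *\<^sub>v x) (minv Q *\<^sub>v (B *\<^sub>v x))"
   using \<gamma> BQ[of "B *\<^sub>v x"] x mult_mat_vec_carrier[OF B] by auto
  moreover have "0 <= \<delta> * scalar_prod (C *\<^sub>v x) (minv W *\<^sub>v (C *\<^sub>v x))"
   using \<delta> CW[of "C *\<^sub>v x"] x mult_mat_vec_carrier[OF C] by auto
  ultimately show ?thesis using AA_form[OF x(1,1)] unfolding quad_form_def by linarith
 qed
 have comm: "scalar_prod x (AA *\<^sub>v y) = scalar_prod y (AA *\<^sub>v x)"
  if "x \<in> carrier_vec n" "y \<in> carrier_vec n" for x y
  using that spd_form_commute[OF A that]
   spd_form_commute[OF spd_minv(3)[OF Q], of "B *\<^sub>v x" "B *\<^sub>v y"]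
   spd_form_commute[OF spd_minv(3)[OF W], of "C *\<^sub>v x" "C *\<^sub>v y"]
   mult_mat_vec_carrier[OF B] mult_mat_vec_carrier[OF C]
  by (simp add: AA_form)
 \<comment> \<open>Symmetry is read off the symmetric form at unit vectors, so no transposes of
   products have to be computed.\<close>
 have entry: "scalar_prod (unit_vec n i) (AA *\<^sub>v unit_vec n j) = AA $$ (i, j)"
  if "i < n" "j < n" for i j
  using that by (simp add: scalar_prod_left_unit[of _ n] scalar_prod_right_unit[of _ n])
 have "transpose_mat AA = AA"
 proof (rule eq_matI)
  fix i j assume ij: "i < dim_row AA" "j < dim_col AA"
  then have ij: "i < n" "j < n" by simp_all
  then show "transpose_mat AA $$ (i, j) = AA $$ (i, j)"
   using entry[of i j] entry[of j i] comm[of "unit_vec n i" "unit_vec n j"]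
   by simp
 qed simp_all
 then show ?thesis using pos by (auto simp: spd_def)
qed

lemma SS_mult:
 assumes "x \<in> carrier_vec n" "y \<in> carrier_vec m" "z \<in> carrier_vec l"
 shows "SS *\<^sub>v (x @\<^sub>v (y @\<^sub>v z)) =
  (AA *\<^sub>v x + transpose_mat (B @\<^sub>r C) *\<^sub>v (y @\<^sub>v z)) @\<^sub>v ((B *\<^sub>v x) @\<^sub>v (C *\<^sub>v x))"
proof -
 have bc: "B @\<^sub>r C \<in> carrier_mat (m + l) n" by (rule carrier_append_rows[OF B C])
 have v: "B *\<^sub>v x @\<^sub>v C *\<^sub>v x \<in> carrier_vec (m + l)"
  using assms by (intro append_carrier_vec) auto
 have zero: "0\<^sub>m (m + l) (m + l) *\<^sub>v (y @\<^sub>v z) = 0\<^sub>v (m + l)" using assms by auto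
 show ?thesis
  unfolding system_matrix_def Let_def dims
  by (subst four_block_mat_mult_vec[of _ n n _ "m + l" _ "m + l"])
   (use assms bc v in \<open>auto simp: mat_mult_append[OF B C] append_carrier_vec zero\<close>)
qed

lemma PP_mult:
 assumes "x \<in> carrier_vec n" "y \<in> carrier_vec m" "z \<in> carrier_vec l"
 shows "PP *\<^sub>v (x @\<^sub>v (y @\<^sub>v z)) =
  (AA *\<^sub>v x + transpose_mat (B @\<^sub>r C) *\<^sub>v (y @\<^sub>v z)) @\<^sub>v
   (((- 1 / \<gamma>) \<cdot>\<^sub>v (Q *\<^sub>v y)) @\<^sub>v ((- 1 / \<delta>) \<cdot>\<^sub>v (W *\<^sub>v z)))"
proof -
 have bc: "B @\<^sub>r C \<in> carrier_mat (m + l) n" by (rule carrier_append_rows[OF B C])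
 have zero: "0\<^sub>m (m + l) n *\<^sub>v x = 0\<^sub>v (m + l)" using assms by auto
 have sm: "(k \<cdot>\<^sub>m M) *\<^sub>v v = k \<cdot>\<^sub>v (M *\<^sub>v v)"
  if "M \<in> carrier_mat p p" "v \<in> carrier_vec p" for k and M :: "real mat" and v p
  using that by (auto intro!: eq_vecI)
 have D: "four_block_mat (- 1 / \<gamma> \<cdot>\<^sub>m Q) (0\<^sub>m m l) (0\<^sub>m l m) (- 1 / \<delta> \<cdot>\<^sub>m W) *\<^sub>v (y @\<^sub>v z) =
  ((- 1 / \<gamma>) \<cdot>\<^sub>v (Q *\<^sub>v y)) @\<^sub>v ((- 1 / \<delta>) \<cdot>\<^sub>v (W *\<^sub>v z))"
  by (subst mult_mat_vec_split[of _ m _ l]) (use assms in \<open>auto simp: sm[OF carriers(2)] sm[OF carriers(3)]\<close>)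
 have yz: "y @\<^sub>v z \<in> carrier_vec (m + l)" using assms by auto
 have v: "((- 1 / \<gamma>) \<cdot>\<^sub>v (Q *\<^sub>v y)) @\<^sub>v ((- 1 / \<delta>) \<cdot>\<^sub>v (W *\<^sub>v z)) \<in> carrier_vec (m + l)"
  using assms by (auto intro!: append_carrier_vec)
 show ?thesis
  unfolding precond_matrix_def Let_def dims
  by (subst four_block_mat_mult_vec[of _ n n _ "m + l" _ "m + l"], unfold D)
   (use assms bc yz v in \<open>auto simp: zero\<close>)
qed

lemma coupling_form:
 assumes "w \<in> carrier_vec n" "y \<in> carrier_vec m" "z \<in> carrier_vec l"
 shows "scalar_prod w (transpose_mat (B @\<^sub>r C) *\<^sub>v (y @\<^sub>v z)) =
  scalar_prod (B *\<^sub>v w) y + scalar_prod (C *\<^sub>v w) z"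
proof -
 have bc: "B @\<^sub>r C \<in> carrier_mat (m + l) n" by (rule carrier_append_rows[OF B C])
 have yz: "y @\<^sub>v z \<in> carrier_vec (m + l)" using assms by auto
 have "scalar_prod w (transpose_mat (B @\<^sub>r C) *\<^sub>v (y @\<^sub>v z)) =
  scalar_prod (transpose_mat (B @\<^sub>r C) *\<^sub>v (y @\<^sub>v z)) w"
  using mult_mat_vec_carrier[OF transpose_carrier_mat[THEN iffD2, OF bc] yz] assms by (intro comm_scalar_prod[of _ n]) auto
 also have "\<dots> = scalar_prod (y @\<^sub>v z) ((B @\<^sub>r C) *\<^sub>v w)"
  by (rule transpose_vec_mult_scalar[OF bc assms(1) yz])
 also have "\<dots> = scalar_prod y (B *\<^sub>v w) + scalar_prod z (C *\<^sub>v w)"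
  unfolding mat_mult_append[OF B C assms(1)]
  by (rule scalar_prod_append) (use assms mult_mat_vec_carrier[OF B] mult_mat_vec_carrier[OF C] in auto)
 also have "scalar_prod y (B *\<^sub>v w) = scalar_prod (B *\<^sub>v w) y"
  using assms mult_mat_vec_carrier[OF B] by (intro comm_scalar_prod[of _ m]) auto
 also have "scalar_prod z (C *\<^sub>v w) = scalar_prod (C *\<^sub>v w) z"
  using assms mult_mat_vec_carrier[OF C] by (intro comm_scalar_prod[of _ l]) auto
 finally show ?thesis .
qed

lemma split_vec:
 assumes "v \<in> carrier_vec (n + (m + l))"
 obtains x y z where "x \<in> carrier_vec n" "y \<in> carrier_vec m" "z \<in> carrier_vec l"
  "v = x @\<^sub>v (y @\<^sub>v z)" "x = vec_first v n"
proof -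
 have "v = vec_first v n @\<^sub>v vec_last v (m + l)"
  using assms by (metis vec_first_last_append)
 moreover have "vec_last v (m + l) = vec_first (vec_last v (m + l)) m @\<^sub>v vec_last (vec_last v (m + l)) l"
  by (metis vec_first_last_append vec_last_carrier)
 ultimately show ?thesis
  using that[of "vec_first v n" "vec_first (vec_last v (m + l)) m" "vec_last (vec_last v (m + l)) l"]
  by simp
qed

text \<open>The preconditioner is block upper triangular with definite diagonal blocks. A kernel
  vector is eliminated from the bottom up: the last rows give \<open>y\<close> and \<open>z\<close>,
  then the first row gives \<open>x\<close>.\<close>

lemma minv_PP:
 "PP * minv PP = 1\<^sub>m (n + (m + l))" "minv PP \<in> carrier_mat (n + (m + l)) (n + (m + l))"
proof -
 have ker: "v = 0\<^sub>v (n + (m + l))"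
  if v: "v \<in> carrier_vec (n + (m + l))" and 0: "PP *\<^sub>v v = 0\<^sub>v (n + (m + l))" for v
 proof -
  obtain x y z where xyz: "x \<in> carrier_vec n" "y \<in> carrier_vec m" "z \<in> carrier_vec l"
   "v = x @\<^sub>v (y @\<^sub>v z)" by (rule split_vec[OF v])
  have zero: "0\<^sub>v (n + (m + l)) = 0\<^sub>v n @\<^sub>v (0\<^sub>v m @\<^sub>v (0\<^sub>v l :: real Matrix.vec))"
   by (auto intro!: eq_vecI)
  have bc: "B @\<^sub>r C \<in> carrier_mat (m + l) n" by (rule carrier_append_rows[OF B C])
  have yzc: "y @\<^sub>v z \<in> carrier_vec (m + l)" using xyz by auto
  have xc: "AA *\<^sub>v x + transpose_mat (B @\<^sub>r C) *\<^sub>v (y @\<^sub>v z) \<in> carrier_vec n"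
   using mult_mat_vec_carrier[OF transpose_carrier_mat[THEN iffD2, OF bc] yzc] xyz by auto
  have yc: "(- 1 / \<gamma>) \<cdot>\<^sub>v (Q *\<^sub>v y) \<in> carrier_vec m" using xyz by auto
  from 0 have e: "AA *\<^sub>v x + transpose_mat (B @\<^sub>r C) *\<^sub>v (y @\<^sub>v z) = 0\<^sub>v n"
   "(- 1 / \<gamma>) \<cdot>\<^sub>v (Q *\<^sub>v y) = 0\<^sub>v m" "(- 1 / \<delta>) \<cdot>\<^sub>v (W *\<^sub>v z) = 0\<^sub>v l"
   unfolding xyz(4) PP_mult[OF xyz(1-3)] zero
   using append_vec_eq[OF xc zero_carrier_vec] append_vec_eq[OF yc zero_carrier_vec] by auto
  have "scalar_prod y ((- 1 / \<gamma>) \<cdot>\<^sub>v (Q *\<^sub>v y)) = 0" unfolding e(2) using xyz by simp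
  then have "scalar_prod y (Q *\<^sub>v y) = 0"
   using xyz \<gamma> by (subst (asm) scalar_prod_smult_distrib[of _ m]) auto
  from spd_eq_0[OF Q xyz(2) this] have y: "y = 0\<^sub>v m" .
  have "scalar_prod z ((- 1 / \<delta>) \<cdot>\<^sub>v (W *\<^sub>v z)) = 0" unfolding e(3) using xyz by simp
  then have "scalar_prod z (W *\<^sub>v z) = 0"
   using xyz \<delta> by (subst (asm) scalar_prod_smult_distrib[of _ l]) auto
  from spd_eq_0[OF W xyz(3) this] have z: "z = 0\<^sub>v l" .
  have "scalar_prod x (AA *\<^sub>v x + transpose_mat (B @\<^sub>r C) *\<^sub>v (y @\<^sub>v z)) = 0"
   unfolding e using xyz by simp
  then have "scalar_prod x (AA *\<^sub>v x) = 0"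
   using xyz mult_mat_vec_carrier[OF transpose_carrier_mat[THEN iffD2, OF bc] yzc]
    coupling_form[OF xyz(1-3)] y z
   by (subst (asm) scalar_prod_add_distrib[of _ n]) auto
  from spd_eq_0[OF spd_AA xyz(1) this] y z show ?thesis by (simp add: xyz(4) zero)
 qed
 from minv_trivial_kernel[OF carriers(8) ker]
 show "PP * minv PP = 1\<^sub>m (n + (m + l))" "minv PP \<in> carrier_mat (n + (m + l)) (n + (m + l))"
  by auto
qed

lemma MM_carrier [simp]: "MM \<in> carrier_mat (n + (m + l)) (n + (m + l))"
 using minv_PP(2) by (auto simp: precond_system_def)

text \<open>Multiplication by \<open>PP\<close> removes its inverse and leaves the three block rows,
  tested with arbitrary vectors. All spectral arguments use this weak form only.\<close>

lemma MM_weak: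
 assumes v: "v = x @\<^sub>v (y @\<^sub>v z)" and v': "MM *\<^sub>v v = x' @\<^sub>v (y' @\<^sub>v z')"
  and c: "x \<in> carrier_vec n" "y \<in> carrier_vec m" "z \<in> carrier_vec l"
  and c': "x' \<in> carrier_vec n" "y' \<in> carrier_vec m" "z' \<in> carrier_vec l"
 shows "w \<in> carrier_vec n ==>
   scalar_prod w (AA *\<^sub>v x) + scalar_prod (B *\<^sub>v w) y + scalar_prod (C *\<^sub>v w) z =
   scalar_prod w (AA *\<^sub>v x') + scalar_prod (B *\<^sub>v w) y' + scalar_prod (C *\<^sub>v w) z'"
  and "q \<in> carrier_vec m ==> scalar_prod q (B *\<^sub>v x) = - (1 / \<gamma>) * scalar_prod q (Q *\<^sub>v y')"
  and "\<mu> \<in> carrier_vec l ==> scalar_prod \<mu> (C *\<^sub>v x) = - (1 / \<delta>) * scalar_prod \<mu> (W *\<^sub>v z')"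
proof -
 have vc: "v \<in> carrier_vec (n + (m + l))" using v c by auto
 have "SS *\<^sub>v v = 1\<^sub>m (n + (m + l)) *\<^sub>v (SS *\<^sub>v v)" using vc mult_mat_vec_carrier[OF carriers(7)] by auto
 also have "\<dots> = PP *\<^sub>v (minv PP *\<^sub>v (SS *\<^sub>v v))"
  unfolding minv_PP(1)[symmetric]
  using vc mult_mat_vec_carrier[OF carriers(7) vc] minv_PP(2) by (intro assoc_mult_mat_vec[OF carriers(8)]) auto
 also have "minv PP *\<^sub>v (SS *\<^sub>v v) = MM *\<^sub>v v"
  unfolding precond_system_def using vc minv_PP(2) by (simp add: assoc_mult_mat_vec[OF _ carriers(7)])
 finally have eq: "SS *\<^sub>v (x @\<^sub>v (y @\<^sub>v z)) = PP *\<^sub>v (x' @\<^sub>v (y' @\<^sub>v z'))"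
  using v v' by simp
 have bc: "B @\<^sub>r C \<in> carrier_mat (m + l) n" by (rule carrier_append_rows[OF B C])
 have yz: "y @\<^sub>v z \<in> carrier_vec (m + l)" "y' @\<^sub>v z' \<in> carrier_vec (m + l)" using c c' by auto
 have k: "transpose_mat (B @\<^sub>r C) *\<^sub>v (y @\<^sub>v z) \<in> carrier_vec n"
  "transpose_mat (B @\<^sub>r C) *\<^sub>v (y' @\<^sub>v z') \<in> carrier_vec n"
  "AA *\<^sub>v x \<in> carrier_vec n" "AA *\<^sub>v x' \<in> carrier_vec n"
  using mult_mat_vec_carrier[OF transpose_carrier_mat[THEN iffD2, OF bc] yz(1)]
   mult_mat_vec_carrier[OF transpose_carrier_mat[THEN iffD2, OF bc] yz(2)] c c' by auto
 have k1: "AA *\<^sub>v x + transpose_mat (B @\<^sub>r C) *\<^sub>v (y @\<^sub>v z) \<in> carrier_vec n"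
  "AA *\<^sub>v x' + transpose_mat (B @\<^sub>r C) *\<^sub>v (y' @\<^sub>v z') \<in> carrier_vec n"
  using k by auto
 have k2: "B *\<^sub>v x \<in> carrier_vec m" "(- 1 / \<gamma>) \<cdot>\<^sub>v (Q *\<^sub>v y') \<in> carrier_vec m"
  using c c' mult_mat_vec_carrier[OF B c(1)] by auto
 from eq have e: "AA *\<^sub>v x + transpose_mat (B @\<^sub>r C) *\<^sub>v (y @\<^sub>v z) =
   AA *\<^sub>v x' + transpose_mat (B @\<^sub>r C) *\<^sub>v (y' @\<^sub>v z')"
  "B *\<^sub>v x = (- 1 / \<gamma>) \<cdot>\<^sub>v (Q *\<^sub>v y')" "C *\<^sub>v x = (- 1 / \<delta>) \<cdot>\<^sub>v (W *\<^sub>v z')"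
  unfolding SS_mult[OF c] PP_mult[OF c']
  using append_vec_eq[OF k1] append_vec_eq[OF k2] by auto
 show "scalar_prod w (AA *\<^sub>v x) + scalar_prod (B *\<^sub>v w) y + scalar_prod (C *\<^sub>v w) z =
   scalar_prod w (AA *\<^sub>v x') + scalar_prod (B *\<^sub>v w) y' + scalar_prod (C *\<^sub>v w) z'"
  if w: "w \<in> carrier_vec n"
  using arg_cong[OF e(1), of "scalar_prod w"] w k coupling_form[OF w c(2,3)] coupling_form[OF w c'(2,3)]
  by (simp add: scalar_prod_add_distrib[of _ n])
 show "scalar_prod q (B *\<^sub>v x) = - (1 / \<gamma>) * scalar_prod q (Q *\<^sub>v y')" if "q \<in> carrier_vec m"
  unfolding e(2) using that c' by (subst scalar_prod_smult_distrib[of _ m]) auto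
 show "scalar_prod \<mu> (C *\<^sub>v x) = - (1 / \<delta>) * scalar_prod \<mu> (W *\<^sub>v z')" if "\<mu> \<in> carrier_vec l"
  unfolding e(3) using that c' by (subst scalar_prod_smult_distrib[of _ l]) auto
qed

text \<open>\<open>v1\<close> and \<open>v2\<close> play the real and imaginary parts of an
  eigenvector for \<open>a + i b\<close>; they are kept apart because definiteness is a statement
  about real vectors. The eigenvalue is found to be real as in the Hermitian case, by testing with
  the conjugate. The choice \<open>v2 = 0\<close>, \<open>b = 0\<close> covers real
  eigenvectors.\<close>

lemma eigen_pair:
 assumes v: "v1 \<in> carrier_vec (n + (m + l))" "v2 \<in> carrier_vec (n + (m + l))"
  and ne: "v1 ~= 0\<^sub>v (n + (m + l)) \<or> v2 ~= 0\<^sub>v (n + (m + l))"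
  and e1: "MM *\<^sub>v v1 = a \<cdot>\<^sub>v v1 + (- b) \<cdot>\<^sub>v v2"
  and e2: "MM *\<^sub>v v2 = b \<cdot>\<^sub>v v1 + a \<cdot>\<^sub>v v2"
  and k: "a ~= 0 \<or> b ~= 0" "a ~= 1 \<or> b ~= 0"
 shows "b = 0" "0 < a"
proof -
 obtain x1 y1 z1 where s1: "x1 \<in> carrier_vec n" "y1 \<in> carrier_vec m" "z1 \<in> carrier_vec l"
  "v1 = x1 @\<^sub>v (y1 @\<^sub>v z1)" by (rule split_vec[OF v(1)])
 obtain x2 y2 z2 where s2: "x2 \<in> carrier_vec n" "y2 \<in> carrier_vec m" "z2 \<in> carrier_vec l"
  "v2 = x2 @\<^sub>v (y2 @\<^sub>v z2)" by (rule split_vec[OF v(2)])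
 have comb: "\<alpha> \<cdot>\<^sub>v v1 + \<beta> \<cdot>\<^sub>v v2 =
  (\<alpha> \<cdot>\<^sub>v x1 + \<beta> \<cdot>\<^sub>v x2) @\<^sub>v ((\<alpha> \<cdot>\<^sub>v y1 + \<beta> \<cdot>\<^sub>v y2) @\<^sub>v (\<alpha> \<cdot>\<^sub>v z1 + \<beta> \<cdot>\<^sub>v z2))" for \<alpha> \<beta>
  using s1 s2 by (intro eq_vecI) (auto split: if_splits)
 have lin: "scalar_prod w (M *\<^sub>v (\<alpha> \<cdot>\<^sub>v u1 + \<beta> \<cdot>\<^sub>v u2)) =
   \<alpha> * scalar_prod w (M *\<^sub>v u1) + \<beta> * scalar_prod w (M *\<^sub>v u2)"
  if "M \<in> carrier_mat p p" "w \<in> carrier_vec p" "u1 \<in> carrier_vec p" "u2 \<in> carrier_vec p"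
  for M :: "real mat" and w u1 u2 p \<alpha> \<beta>
 proof -
  have "M *\<^sub>v (\<alpha> \<cdot>\<^sub>v u1 + \<beta> \<cdot>\<^sub>v u2) = \<alpha> \<cdot>\<^sub>v (M *\<^sub>v u1) + \<beta> \<cdot>\<^sub>v (M *\<^sub>v u2)"
   using that by (simp add: mult_add_distrib_mat_vec[of _ p p] mult_mat_vec[of _ p p])
  then show ?thesis
   using that mult_mat_vec_carrier[OF that(1)] by (simp add: scalar_prod_add_distrib[of _ p])
 qed
 have lin': "scalar_prod w (\<alpha> \<cdot>\<^sub>v u1 + \<beta> \<cdot>\<^sub>v u2) = \<alpha> * scalar_prod w u1 + \<beta> * scalar_prod w u2"
  if "w \<in> carrier_vec p" "u1 \<in> carrier_vec p" "u2 \<in> carrier_vec p" for w u1 u2 :: "real Matrix.vec" and p \<alpha> \<beta>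
  using that by (simp add: scalar_prod_add_distrib[of _ p])
 define r1 where "r1 w = scalar_prod w (AA *\<^sub>v x1) + scalar_prod (B *\<^sub>v w) y1 + scalar_prod (C *\<^sub>v w) z1" for w
 define r2 where "r2 w = scalar_prod w (AA *\<^sub>v x2) + scalar_prod (B *\<^sub>v w) y2 + scalar_prod (C *\<^sub>v w) z2" for w
 note c = s1(1-3) s2(1-3)
 note w1 = MM_weak[OF s1(4) e1[unfolded comb] s1(1-3)]
 note w2 = MM_weak[OF s2(4) e2[unfolded comb] s2(1-3)]
 have 1: "r1 w = a * r1 w - b * r2 w" if "w \<in> carrier_vec n" for w
  using w1(1)[OF _ _ _ that] that c
  by (simp add: r1_def r2_def lin[of _ n] lin'[of _ m] lin'[of _ l] algebra_simps)
 have 2: "r2 w = b * r1 w + a * r2 w" if "w \<in> carrier_vec n" for w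
 proof -
  have "r2 w = (b * scalar_prod w (AA *\<^sub>v x1) + a * scalar_prod w (AA *\<^sub>v x2)) +
    (b * scalar_prod (B *\<^sub>v w) y1 + a * scalar_prod (B *\<^sub>v w) y2) +
    (b * scalar_prod (C *\<^sub>v w) z1 + a * scalar_prod (C *\<^sub>v w) z2)"
   using w2(1)[OF _ _ _ that] that c by (simp add: r2_def lin[of _ n] lin'[of _ m] lin'[of _ l])
  also have "\<dots> = b * r1 w + a * r2 w" by (simp add: r1_def r2_def algebra_simps)
  finally show ?thesis .
 qed
 \<comment> \<open>The complex residual \<open>r1 + i r2\<close> of the first row is annihilated by
   \<open>1 - (a + i b)\<close>; multiplication by the conjugate leaves the factor
   \<open>(1 - a)\<^sup>2 + b\<^sup>2\<close>, which is nonzero as the eigenvalue is not 1.\<close>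
 have r0: "r1 w = 0" "r2 w = 0" if "w \<in> carrier_vec n" for w
 proof -
  have p: "(1 - a) * r1 w = - b * r2 w" "(1 - a) * r2 w = b * r1 w"
   using 1[OF that] 2[OF that] by (simp_all add: algebra_simps)
  have "((1 - a)\<^sup>2 + b\<^sup>2) * r1 w = (1 - a) * ((1 - a) * r1 w) + b * (b * r1 w)"
   by (simp add: power2_eq_square algebra_simps)
  also have "\<dots> = 0" unfolding p by (simp add: p(2)[symmetric])
  finally have "((1 - a)\<^sup>2 + b\<^sup>2) * r1 w = 0" .
  moreover have "((1 - a)\<^sup>2 + b\<^sup>2) * r2 w = (1 - a) * ((1 - a) * r2 w) + b * (b * r2 w)"
   by (simp add: power2_eq_square algebra_simps)
  moreover have "\<dots> = b * ((1 - a) * r1 w) + b * (b * r2 w)" unfolding p(2) by simp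
  moreover have "\<dots> = 0" unfolding p(1) by simp
  moreover have "(1 - a)\<^sup>2 + b\<^sup>2 ~= 0" using k(2) by (auto simp: sum_power2_eq_zero_iff)
  ultimately show "r1 w = 0" "r2 w = 0" by auto
 qed
 have B1: "scalar_prod q (B *\<^sub>v x1) = - (1 / \<gamma>) * (a * scalar_prod q (Q *\<^sub>v y1) - b * scalar_prod q (Q *\<^sub>v y2))"
  "scalar_prod q (B *\<^sub>v x2) = - (1 / \<gamma>) * (b * scalar_prod q (Q *\<^sub>v y1) + a * scalar_prod q (Q *\<^sub>v y2))"
  if "q \<in> carrier_vec m" for q
  using w1(2)[OF _ _ _ that] w2(2)[OF _ _ _ that] that c by (simp_all add: lin[of _ m])
 have C1: "scalar_prod q (C *\<^sub>v x1) = - (1 / \<delta>) * (a * scalar_prod q (W *\<^sub>v z1) - b * scalar_prod q (W *\<^sub>v z2))"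
  "scalar_prod q (C *\<^sub>v x2) = - (1 / \<delta>) * (b * scalar_prod q (W *\<^sub>v z1) + a * scalar_prod q (W *\<^sub>v z2))"
  if "q \<in> carrier_vec l" for q
  using w1(3)[OF _ _ _ that] w2(3)[OF _ _ _ that] that c by (simp_all add: lin[of _ l])
 have cB: "scalar_prod (B *\<^sub>v u) q = scalar_prod q (B *\<^sub>v u)"
  if "u \<in> carrier_vec n" "q \<in> carrier_vec m" for u q
  using that by (intro comm_scalar_prod[of _ m]) auto
 have cC: "scalar_prod (C *\<^sub>v u) q = scalar_prod q (C *\<^sub>v u)"
  if "u \<in> carrier_vec n" "q \<in> carrier_vec l" for u q
  using that by (intro comm_scalar_prod[of _ l]) auto
 define qy where "qy = scalar_prod y1 (Q *\<^sub>v y1) + scalar_prod y2 (Q *\<^sub>v y2)"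
 define wz where "wz = scalar_prod z1 (W *\<^sub>v z1) + scalar_prod z2 (W *\<^sub>v z2)"
 define rh where "rh = qy / \<gamma> + wz / \<delta>"
 have Qc: "scalar_prod y2 (Q *\<^sub>v y1) = scalar_prod y1 (Q *\<^sub>v y2)" using c by (intro spd_form_commute[OF Q])
 have Wc: "scalar_prod z2 (W *\<^sub>v z1) = scalar_prod z1 (W *\<^sub>v z2)" using c by (intro spd_form_commute[OF W])
 have Ac: "scalar_prod x2 (AA *\<^sub>v x1) = scalar_prod x1 (AA *\<^sub>v x2)" using c by (intro spd_form_commute[OF spd_AA])
 \<comment> \<open>\<open>E1\<close> and \<open>E2\<close> are the real and imaginary parts of the
   first row tested with the conjugate of \<open>x1 + i x2\<close>, after the other rows have
   replaced \<open>B\<close> and \<open>C\<close> by \<open>Q\<close> and \<open>W\<close>.\<close>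
 have E1: "scalar_prod x1 (AA *\<^sub>v x1) + scalar_prod x2 (AA *\<^sub>v x2) = a * rh"
  using r0(1)[of x1] r0(2)[of x2] c
  by (simp add: r1_def r2_def cB cC B1 C1 rh_def qy_def wz_def Qc Wc algebra_simps add_divide_distrib)
 have E2: "b * rh = 0"
  using r0(1)[of x2] r0(2)[of x1] c
  by (simp add: r1_def r2_def cB cC B1 C1 rh_def qy_def wz_def Qc Wc Ac algebra_simps add_divide_distrib)
 have nn: "0 <= scalar_prod y1 (Q *\<^sub>v y1)" "0 <= scalar_prod y2 (Q *\<^sub>v y2)"
  "0 <= scalar_prod z1 (W *\<^sub>v z1)" "0 <= scalar_prod z2 (W *\<^sub>v z2)"
  "0 <= scalar_prod x1 (AA *\<^sub>v x1)" "0 <= scalar_prod x2 (AA *\<^sub>v x2)"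
  using spd_nonneg[OF Q] spd_nonneg[OF W] spd_nonneg[OF spd_AA] c by auto
 have q0: "0 <= qy" "0 <= wz" using nn by (auto simp: qy_def wz_def)
 then have rh0: "0 <= rh" using \<gamma> \<delta> by (simp add: rh_def)
 \<comment> \<open>If \<open>rh\<close> vanished, definiteness would annihilate the \<open>y\<close>
   and \<open>z\<close> parts, \<open>E1\<close> the \<open>x\<close> parts, and the eigenvector
   would be zero.\<close>
 have "rh ~= 0"
 proof
  assume rh: "rh = 0"
  have "0 <= qy / \<gamma>" "0 <= wz / \<delta>" using q0 \<gamma> \<delta> by simp_all
  then have "qy / \<gamma> = 0" "wz / \<delta> = 0" using rh unfolding rh_def by linarith+
  then have "qy = 0" "wz = 0" using \<gamma> \<delta> by simp_all
  moreover have "scalar_prod x1 (AA *\<^sub>v x1) + scalar_prod x2 (AA *\<^sub>v x2) = 0" using E1 rh by simp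
  ultimately have "scalar_prod y1 (Q *\<^sub>v y1) = 0" "scalar_prod y2 (Q *\<^sub>v y2) = 0"
   "scalar_prod z1 (W *\<^sub>v z1) = 0" "scalar_prod z2 (W *\<^sub>v z2) = 0"
   "scalar_prod x1 (AA *\<^sub>v x1) = 0" "scalar_prod x2 (AA *\<^sub>v x2) = 0"
   using nn unfolding qy_def wz_def by linarith+
  then have "x1 = 0\<^sub>v n" "x2 = 0\<^sub>v n" "y1 = 0\<^sub>v m" "y2 = 0\<^sub>v m" "z1 = 0\<^sub>v l" "z2 = 0\<^sub>v l"
   by (auto intro!: spd_eq_0[OF Q] spd_eq_0[OF W] spd_eq_0[OF spd_AA] c)
  moreover have "0\<^sub>v n @\<^sub>v (0\<^sub>v m @\<^sub>v 0\<^sub>v l) = (0\<^sub>v (n + (m + l)) :: real Matrix.vec)"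
   by (auto intro!: eq_vecI)
  ultimately show False using ne s1(4) s2(4) by simp
 qed
 with rh0 have rh: "0 < rh" by simp
 with E2 show b: "b = 0" by simp
 have "0 <= a * rh" using E1 nn by linarith
 then have "0 <= a" using rh by (simp add: zero_le_mult_iff)
 then show "0 < a" using k(1) b by simp
qed

text \<open>For \<open>k ~= 1\<close> the first block row is homogeneous, and the other rows turn
  the augmentation terms into multiples of the coupling terms. The augmentation therefore merges
  with the couplings, and \<open>A\<close> sees \<open>k - 1\<close> times them; this factor is
  absorbed into the \<open>y\<close> and \<open>z\<close> that are returned. What remains is a
  problem without augmentation and the Rayleigh quotient identity for \<open>k\<close>.\<close>

lemma real_eigenvector:
 assumes ev: "eigenvector MM v k" and k: "k ~= 0" "k ~= 1"
 obtains x y z where "x = vec_first v n" "x \<in> carrier_vec n" "x ~= 0\<^sub>v n" "0 < k" "k < 1"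
  "y \<in> carrier_vec m" "z \<in> carrier_vec l"
  "quad_form (aug \<gamma> B Q) x + quad_form (aug \<delta> C W) x = k * quad_form AA x" "0 < quad_form AA x"
  "quad_form AA x = quad_form A x + quad_form (aug \<gamma> B Q) x + quad_form (aug \<delta> C W) x"
  "!!w. w \<in> carrier_vec n ==>
   scalar_prod w (A *\<^sub>v x) = scalar_prod (B *\<^sub>v w) y + scalar_prod (C *\<^sub>v w) z"
  "!!q. q \<in> carrier_vec m ==>
   scalar_prod q (Q *\<^sub>v y) = (1 - k) / k * \<gamma> * scalar_prod q (B *\<^sub>v x)"
  "!!\<mu>. \<mu> \<in> carrier_vec l ==>
   scalar_prod \<mu> (W *\<^sub>v z) = (1 - k) / k * \<delta> * scalar_prod \<mu> (C *\<^sub>v x)"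
proof -
 have v: "v \<in> carrier_vec (n + (m + l))" "v ~= 0\<^sub>v (n + (m + l))" "MM *\<^sub>v v = k \<cdot>\<^sub>v v"
  using ev MM_carrier unfolding eigenvector_def by auto
 have dMM: "dim_row MM = n + (m + l)" "dim_col MM = n + (m + l)"
  using MM_carrier unfolding carrier_mat_def by blast+
 have kpos: "0 < k"
 proof (rule eigen_pair(2)[OF v(1) zero_carrier_vec])
  show "MM *\<^sub>v v = k \<cdot>\<^sub>v v + - 0 \<cdot>\<^sub>v 0\<^sub>v (n + (m + l))" using v by (auto intro!: eq_vecI)
  show "MM *\<^sub>v 0\<^sub>v (n + (m + l)) = 0 \<cdot>\<^sub>v v + k \<cdot>\<^sub>v 0\<^sub>v (n + (m + l))"
   using v(1) by (auto intro!: eq_vecI simp: dMM scalar_prod_def)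
 qed (use v k in auto)
 obtain x y z where s: "x \<in> carrier_vec n" "y \<in> carrier_vec m" "z \<in> carrier_vec l"
  "v = x @\<^sub>v (y @\<^sub>v z)" "x = vec_first v n" by (rule split_vec[OF v(1)])
 have comb: "k \<cdot>\<^sub>v v = (k \<cdot>\<^sub>v x) @\<^sub>v ((k \<cdot>\<^sub>v y) @\<^sub>v (k \<cdot>\<^sub>v z))"
  using s(1-4) by (intro eq_vecI) (auto split: if_splits)
 have sm: "scalar_prod w (M *\<^sub>v (k \<cdot>\<^sub>v u)) = k * scalar_prod w (M *\<^sub>v u)"
  if "M \<in> carrier_mat p p" "w \<in> carrier_vec p" "u \<in> carrier_vec p" for M :: "real mat" and w u p k
  using that by (simp add: mult_mat_vec[of _ p p])
 note w = MM_weak[OF s(4) v(3)[unfolded comb] s(1-3)]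
 have R: "scalar_prod w (AA *\<^sub>v x) = - (scalar_prod (B *\<^sub>v w) y + scalar_prod (C *\<^sub>v w) z)"
  if "w \<in> carrier_vec n" for w
 proof -
  have "(1 - k) * (scalar_prod w (AA *\<^sub>v x) + scalar_prod (B *\<^sub>v w) y + scalar_prod (C *\<^sub>v w) z) = 0"
  proof -
   have "scalar_prod w (AA *\<^sub>v x) + scalar_prod (B *\<^sub>v w) y + scalar_prod (C *\<^sub>v w) z =
    k * scalar_prod w (AA *\<^sub>v x) + k * scalar_prod (B *\<^sub>v w) y + k * scalar_prod (C *\<^sub>v w) z"
    using w(1)[OF _ _ _ that] that s(1-3) by (simp add: sm[of _ n])
   then have "scalar_prod w (AA *\<^sub>v x) + scalar_prod (B *\<^sub>v w) y + scalar_prod (C *\<^sub>v w) z =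
    k * (scalar_prod w (AA *\<^sub>v x) + scalar_prod (B *\<^sub>v w) y + scalar_prod (C *\<^sub>v w) z)"
    unfolding distrib_left by assumption
   then show ?thesis by (metis left_diff_distrib mult_1 diff_self)
  qed
  then show ?thesis using k(2) by (simp add: add_eq_0_iff)
 qed
 have Bx: "scalar_prod q (B *\<^sub>v x) = - (k / \<gamma>) * scalar_prod q (Q *\<^sub>v y)" if "q \<in> carrier_vec m" for q
  using w(2)[OF _ _ _ that] that s(1-3) by (simp add: sm[of _ m])
 have Cx: "scalar_prod q (C *\<^sub>v x) = - (k / \<delta>) * scalar_prod q (W *\<^sub>v z)" if "q \<in> carrier_vec l" for q
  using w(3)[OF _ _ _ that] that s(1-3) by (simp add: sm[of _ l])
 have "B *\<^sub>v x = Q *\<^sub>v (- (k / \<gamma>) \<cdot>\<^sub>v y)"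
  by (rule form_eq_imp_eq[of _ m]) (use s(1-3) Bx in \<open>auto simp: sm[of _ m]\<close>)
 then have iB: "minv Q *\<^sub>v (B *\<^sub>v x) = - (k / \<gamma>) \<cdot>\<^sub>v y" using spd_minv_apply(2)[OF Q] s(1-3) by simp
 have "C *\<^sub>v x = W *\<^sub>v (- (k / \<delta>) \<cdot>\<^sub>v z)"
  by (rule form_eq_imp_eq[of _ l]) (use s(1-3) Cx in \<open>auto simp: sm[of _ l]\<close>)
 then have iC: "minv W *\<^sub>v (C *\<^sub>v x) = - (k / \<delta>) \<cdot>\<^sub>v z" using spd_minv_apply(2)[OF W] s(1-3) by simp
 have pB: "\<gamma> * scalar_prod (B *\<^sub>v w) (minv Q *\<^sub>v (B *\<^sub>v x)) = - k * scalar_prod (B *\<^sub>v w) y"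
  if "w \<in> carrier_vec n" for w
  unfolding iB using that s(1-3) \<gamma> by (subst scalar_prod_smult_distrib[of _ m]) auto
 have pC: "\<delta> * scalar_prod (C *\<^sub>v w) (minv W *\<^sub>v (C *\<^sub>v x)) = - k * scalar_prod (C *\<^sub>v w) z"
  if "w \<in> carrier_vec n" for w
  unfolding iC using that s(1-3) \<delta> by (subst scalar_prod_smult_distrib[of _ l]) auto
 have Aw: "scalar_prod w (A *\<^sub>v x) = (k - 1) * (scalar_prod (B *\<^sub>v w) y + scalar_prod (C *\<^sub>v w) z)"
  if "w \<in> carrier_vec n" for w
  using AA_form[OF that s(1)] R[OF that] pB[OF that] pC[OF that] by (simp add: algebra_simps)
 have x0: "x ~= 0\<^sub>v n"
 proof
  assume x0: "x = 0\<^sub>v n"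
  have "B *\<^sub>v x = 0\<^sub>v m" "C *\<^sub>v x = 0\<^sub>v l" using B C x0 by auto
  then have "scalar_prod y (Q *\<^sub>v y) = 0" "scalar_prod z (W *\<^sub>v z) = 0"
   using Bx[OF s(2)] Cx[OF s(3)] k \<gamma> \<delta> s(1-3) by auto
  then have "y = 0\<^sub>v m" "z = 0\<^sub>v l" using spd_eq_0[OF Q s(2)] spd_eq_0[OF W s(3)] by auto
  moreover have "0\<^sub>v n @\<^sub>v (0\<^sub>v m @\<^sub>v 0\<^sub>v l) = (0\<^sub>v (n + (m + l)) :: real Matrix.vec)"
   by (auto intro!: eq_vecI)
  ultimately show False using v(2) s(4) x0 by simp
 qed
 have qB: "quad_form (aug \<gamma> B Q) x = - k * scalar_prod (B *\<^sub>v x) y"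
  unfolding quad_form_def aug_form(1)[OF B Q s(1,1)] by (rule pB[OF s(1)])
 have qC: "quad_form (aug \<delta> C W) x = - k * scalar_prod (C *\<^sub>v x) z"
  unfolding quad_form_def aug_form(1)[OF C W s(1,1)] by (rule pC[OF s(1)])
 have qAA: "quad_form AA x = - (scalar_prod (B *\<^sub>v x) y + scalar_prod (C *\<^sub>v x) z)"
  unfolding quad_form_def by (rule R[OF s(1)])
 have q1: "quad_form (aug \<gamma> B Q) x + quad_form (aug \<delta> C W) x = k * quad_form AA x"
  unfolding qB qC qAA by (simp add: algebra_simps)
 have AApos: "0 < quad_form AA x" using spd_AA s(1) x0 by (auto simp: spd_def)
 have qA: "quad_form A x = (1 - k) * quad_form AA x"
  unfolding qAA quad_form_def[of A] Aw[OF s(1)] by (simp add: algebra_simps)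
 have "0 < quad_form A x" using A s(1) x0 by (auto simp: spd_def)
 \<comment> \<open>The forms of \<open>A\<close> and \<open>AA\<close> are both positive at
   \<open>x\<close> and differ by the factor \<open>1 - k\<close>.\<close>
 with AApos qA have k1: "k < 1" by (simp add: zero_less_mult_iff)
 show ?thesis
 proof (rule that[of x "(k - 1) \<cdot>\<^sub>v y" "(k - 1) \<cdot>\<^sub>v z"])
  show "quad_form AA x = quad_form A x + quad_form (aug \<gamma> B Q) x + quad_form (aug \<delta> C W) x"
   using qA q1 by (simp add: algebra_simps)
  fix w :: "real Matrix.vec" assume w: "w \<in> carrier_vec n"
  show "scalar_prod w (A *\<^sub>v x) = scalar_prod (B *\<^sub>v w) ((k - 1) \<cdot>\<^sub>v y) + scalar_prod (C *\<^sub>v w) ((k - 1) \<cdot>\<^sub>v z)"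
   using Aw[OF w] w s(1-3)
   by (subst scalar_prod_smult_distrib[of _ m], simp, simp, subst scalar_prod_smult_distrib[of _ l])
    (auto simp: algebra_simps)
 next
  fix q :: "real Matrix.vec" assume q: "q \<in> carrier_vec m"
  show "scalar_prod q (Q *\<^sub>v ((k - 1) \<cdot>\<^sub>v y)) = (1 - k) / k * \<gamma> * scalar_prod q (B *\<^sub>v x)"
   using Bx[OF q] q s(1-3) k \<gamma> by (simp add: sm[of _ m] field_simps)
 next
  fix q :: "real Matrix.vec" assume q: "q \<in> carrier_vec l"
  show "scalar_prod q (W *\<^sub>v ((k - 1) \<cdot>\<^sub>v z)) = (1 - k) / k * \<delta> * scalar_prod q (C *\<^sub>v x)"
   using Cx[OF q] q s(1-3) k \<delta> by (simp add: sm[of _ l] field_simps)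
 qed (fact s x0 kpos k1 q1 AApos | use s(2,3) in simp)+
qed

lemma min_or_one_props:
 assumes "finite S" "!!r. r \<in> S ==> c <= r \<and> r <= 1" "c <= 1"
 shows "c <= min_or_one S" "min_or_one S <= 1" "r \<in> S ==> min_or_one S <= r"
proof -
 have "S ~= {} ==> c <= Min S \<and> Min S <= 1"
  using assms(2)[OF Min_in[OF assms(1)]] by blast
 then show "c <= min_or_one S" "min_or_one S <= 1"
  using assms(3) by (simp_all add: min_or_one_def)
 show "r \<in> S ==> min_or_one S <= r"
  using Min_le[OF assms(1)] by (auto simp: min_or_one_def)
qed

text \<open>An eigenvalue is \<open>1 / (1 + s)\<close> for the parameter \<open>s\<close> of its
  reduced problem, so an upper bound for all admissible \<open>s\<close> is a lower bound for the
  eigenvalues. The hypothesis \<open>bound\<close> is the only door through which the discretization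
  enters.\<close>

theorem spectral_bound:
 assumes S: "0 < S"
  and bound: "!!x y z s. \<lbrakk>x \<in> carrier_vec n; x ~= 0\<^sub>v n; y \<in> carrier_vec m; z \<in> carrier_vec l; 0 < s;
   !!w. w \<in> carrier_vec n ==>
    scalar_prod w (A *\<^sub>v x) = scalar_prod (B *\<^sub>v w) y + scalar_prod (C *\<^sub>v w) z;
   !!q. q \<in> carrier_vec m ==> scalar_prod q (Q *\<^sub>v y) = s * \<gamma> * scalar_prod q (B *\<^sub>v x);
   !!\<mu>. \<mu> \<in> carrier_vec l ==> scalar_prod \<mu> (W *\<^sub>v z) = s * \<delta> * scalar_prod \<mu> (C *\<^sub>v x)\<rbrakk> \<Longrightarrow> s <= S"
 defines "b \<equiv> lower_bound \<gamma> \<delta> A B C Q W"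
 shows "1 / (1 + S) <= b"
  and "spectrum (map_mat complex_of_real MM) - {0} \<subseteq> complex_of_real ` {b..1}"
proof -
 let ?c = "1 / (1 + S)"
 have c1: "?c <= 1" using S by simp
 have ev: "?c <= k" if e: "eigenvector MM v k" "k ~= 0" "k ~= 1" for v k
 proof -
  obtain x y z where *: "x \<in> carrier_vec n" "x ~= 0\<^sub>v n" "0 < k" "k < 1"
   "y \<in> carrier_vec m" "z \<in> carrier_vec l"
   "!!w. w \<in> carrier_vec n ==>
    scalar_prod w (A *\<^sub>v x) = scalar_prod (B *\<^sub>v w) y + scalar_prod (C *\<^sub>v w) z"
   "!!q. q \<in> carrier_vec m ==>
    scalar_prod q (Q *\<^sub>v y) = (1 - k) / k * \<gamma> * scalar_prod q (B *\<^sub>v x)"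
   "!!\<mu>. \<mu> \<in> carrier_vec l ==>
    scalar_prod \<mu> (W *\<^sub>v z) = (1 - k) / k * \<delta> * scalar_prod \<mu> (C *\<^sub>v x)"
   by (rule real_eigenvector[OF e]) blast
  have "(1 - k) / k <= S"
   by (rule bound[OF *(1,2,5,6) _ *(7,8,9)]) (use *(3,4) in auto)
  then have "1 <= k * (1 + S)" using *(3) by (simp add: field_simps)
  then show ?thesis using S by (simp add: field_simps)
 qed
 \<comment> \<open>\<open>Min\<close> is meaningful for finite sets only; the quotients will turn
   out to be eigenvalues, of which there are finitely many.\<close>
 have fin: "finite {k. eigenvalue MM k}"
  using card_finite_spectrum(1)[OF MM_carrier] by (simp add: spectrum_def)
 have ker0: "quad_form (aug s M R) x = 0"
  if "M \<in> carrier_mat p n" "spd p R" "x \<in> mat_kernel M" for s M R x p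
 proof -
  have x: "x \<in> carrier_vec n" "M *\<^sub>v x = 0\<^sub>v p" using that by (auto simp: mat_kernel_def)
  show ?thesis unfolding quad_form_def aug_form(1)[OF that(1,2) x(1) x(1)] x(2)
   using mult_mat_vec_carrier[OF spd_carrier[OF spd_minv(3)[OF that(2)]] zero_carrier_vec] by simp
 qed
 have sum_form: "quad_form (M + N) x = quad_form M x + quad_form N x"
  if "M \<in> carrier_mat n n" "N \<in> carrier_mat n n" "x \<in> carrier_vec n" for M N x
  using that mult_mat_vec_carrier[OF that(1,3)] mult_mat_vec_carrier[OF that(2,3)]
  by (simp add: quad_form_def add_mult_distrib_mat_vec[of _ n n] scalar_prod_add_distrib[of _ n])
 \<comment> \<open>On the kernel of \<open>C\<close> or of \<open>B\<close> one augmentation term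
   drops out of the Rayleigh quotient, so each quotient that applies to an eigenvector equals its
   eigenvalue. The last conjunct, true because \<open>k\<close> is not 0, ensures that the three
   index sets together miss no eigenvector.\<close>
 have quot: "(x \<in> mat_kernel C --> quad_form (aug \<gamma> B Q) x / quad_form (A + aug \<gamma> B Q) x = k) \<and>
   (x \<in> mat_kernel B --> quad_form (aug \<delta> C W) x / quad_form (A + aug \<delta> C W) x = k) \<and>
   quad_form (aug \<gamma> B Q + aug \<delta> C W) x / quad_form AA x = k \<and> ?c <= k \<and> k <= 1 \<and> x \<in> carrier_vec n
   \<and> \<not> (x \<in> mat_kernel B \<and> x \<in> mat_kernel C)"
  if e: "eigenvector MM v k" "k ~= 0" "k ~= 1" and xv: "x = vec_first v n" for x v k
 proof -
  obtain x' y z where x': "x' = vec_first v n" "x' \<in> carrier_vec n" "0 < k" "k < 1"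
   "quad_form (aug \<gamma> B Q) x' + quad_form (aug \<delta> C W) x' = k * quad_form AA x'" "0 < quad_form AA x'"
   "quad_form AA x' = quad_form A x' + quad_form (aug \<gamma> B Q) x' + quad_form (aug \<delta> C W) x'"
   by (rule real_eigenvector[OF e]) blast
  then have xx: "x' = x" using xv by simp
  note x = x'[unfolded xx]
  have "quad_form (aug \<gamma> B Q) x / quad_form (A + aug \<gamma> B Q) x = k" if "x \<in> mat_kernel C"
   using ker0[OF C W that, of \<delta>] x by (simp add: sum_form)
  moreover have "quad_form (aug \<delta> C W) x / quad_form (A + aug \<delta> C W) x = k" if "x \<in> mat_kernel B"
   using ker0[OF B Q that, of \<gamma>] x by (simp add: sum_form)
  moreover have "quad_form (aug \<gamma> B Q + aug \<delta> C W) x / quad_form AA x = k"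
   using x by (simp add: sum_form)
  moreover have "\<not> (x \<in> mat_kernel B \<and> x \<in> mat_kernel C)"
   using ker0[OF C W, of x \<delta>] ker0[OF B Q, of x \<gamma>] x by auto
  ultimately show ?thesis using ev[OF e] x by auto
 qed
 define E where "E = eig_comps \<gamma> \<delta> A B C Q W"
 have E: "\<exists>v k. eigenvector MM v k \<and> k ~= 0 \<and> k ~= 1 \<and> x = vec_first v n" if "x \<in> E" for x
  using that by (auto simp: E_def eig_comps_def)
 define S1 where "S1 = (\<lambda>x. quad_form (aug \<gamma> B Q) x / quad_form (A + aug \<gamma> B Q) x) `
   (E \<inter> (mat_kernel C - mat_kernel B))"
 define S2 where "S2 = (\<lambda>x. quad_form (aug \<delta> C W) x / quad_form (A + aug \<delta> C W) x) `
   (E \<inter> (mat_kernel B - mat_kernel C))"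
 define S3 where "S3 = (\<lambda>x. quad_form (aug \<gamma> B Q + aug \<delta> C W) x / quad_form AA x) `
   (E - (mat_kernel B \<union> mat_kernel C))"
 have sub: "r \<in> {k. eigenvalue MM k} \<and> ?c <= r \<and> r <= 1" if "r \<in> S1 \<union> S2 \<union> S3" for r
 proof -
  obtain x where x: "x \<in> E" "(x \<in> mat_kernel C \<and> r = quad_form (aug \<gamma> B Q) x / quad_form (A + aug \<gamma> B Q) x) \<or>
   (x \<in> mat_kernel B \<and> r = quad_form (aug \<delta> C W) x / quad_form (A + aug \<delta> C W) x) \<or>
   r = quad_form (aug \<gamma> B Q + aug \<delta> C W) x / quad_form AA x"
   using \<open>r \<in> S1 \<union> S2 \<union> S3\<close> unfolding S1_def S2_def S3_def by (elim UnE imageE) auto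
  obtain v k where vk: "eigenvector MM v k" "k ~= 0" "k ~= 1" "x = vec_first v n" using E[OF x(1)] by blast
  have "r = k" using quot[OF vk] x(2) by auto
  then show ?thesis using quot[OF vk] vk(1) by (auto simp: eigenvalue_def)
 qed
 have f: "finite S1" "finite S2" "finite S3"
  using sub by (auto intro!: finite_subset[OF _ fin])
 have bdef: "b = Min {min_or_one S1, min_or_one S2, min_or_one S3}"
  by (simp add: b_def lower_bound_def eta_def epsilon_def theta_def S1_def S2_def S3_def E_def)
 have m1: "?c <= min_or_one S1" "min_or_one S1 <= 1" "!!r. r \<in> S1 ==> min_or_one S1 <= r"
  using sub by (intro min_or_one_props[OF f(1) _ c1]; blast)+
 have m2: "?c <= min_or_one S2" "min_or_one S2 <= 1" "!!r. r \<in> S2 ==> min_or_one S2 <= r"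
  using sub by (intro min_or_one_props[OF f(2) _ c1]; blast)+
 have m3: "?c <= min_or_one S3" "min_or_one S3 <= 1" "!!r. r \<in> S3 ==> min_or_one S3 <= r"
  using sub by (intro min_or_one_props[OF f(3) _ c1]; blast)+
 show "?c <= b" using m1 m2 m3 by (simp add: bdef)
 have b1: "b <= 1" using m1 by (simp add: bdef)
 have bk: "b <= k \<and> k <= 1" if e: "eigenvector MM v k" "k ~= 0" "k ~= 1" for v k
 proof -
  define x where "x = vec_first v n"
  note q = quot[OF e x_def]
  have "x \<in> E" using e by (auto simp: E_def eig_comps_def x_def)
  then have "k \<in> S1 \<or> k \<in> S2 \<or> k \<in> S3"
   using q unfolding S1_def S2_def S3_def by (cases "x \<in> mat_kernel C"; cases "x \<in> mat_kernel B") (auto simp: image_iff)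
  then show ?thesis using m1(3) m2(3) m3(3) q by (auto simp: bdef min_le_iff_disj)
 qed
 show "spectrum (map_mat complex_of_real MM) - {0} \<subseteq> complex_of_real ` {b..1}"
 proof
  fix kap assume "kap \<in> spectrum (map_mat complex_of_real MM) - {0}"
  then obtain v where v: "v \<in> carrier_vec (n + (m + l))" "v ~= 0\<^sub>v (n + (m + l))"
   "map_mat complex_of_real MM *\<^sub>v v = kap \<cdot>\<^sub>v v" and kap0: "kap ~= 0"
   using MM_carrier by (auto simp: spectrum_def eigenvalue_def eigenvector_def)
  have dMM: "dim_row MM = n + (m + l)" "dim_col MM = n + (m + l)" using MM_carrier unfolding carrier_mat_def by blast+
  \<comment> \<open>A complex eigenvector of a real matrix splits into the pair expected by
    \<open>eigen_pair\<close>. Once the eigenvalue is known to be real, whichever part is nonzero is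
    a real eigenvector.\<close>
  define v1 where "v1 = map_vec Re v"
  define v2 where "v2 = map_vec Im v"
  have c12: "v1 \<in> carrier_vec (n + (m + l))" "v2 \<in> carrier_vec (n + (m + l))"
   using v by (auto simp: v1_def v2_def)
  have Mi: "vec_index (MM *\<^sub>v v1) i = Re (vec_index (map_mat complex_of_real MM *\<^sub>v v) i)"
   "vec_index (MM *\<^sub>v v2) i = Im (vec_index (map_mat complex_of_real MM *\<^sub>v v) i)"
   if "i < n + (m + l)" for i
   using that v(1) by (auto simp: dMM v1_def v2_def scalar_prod_def)
  have e1: "MM *\<^sub>v v1 = Re kap \<cdot>\<^sub>v v1 + (- Im kap) \<cdot>\<^sub>v v2"
   by (rule eq_vecI) (use Mi v(1) in \<open>auto simp: v(3) dMM v1_def v2_def\<close>)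
  have e2: "MM *\<^sub>v v2 = Im kap \<cdot>\<^sub>v v1 + Re kap \<cdot>\<^sub>v v2"
   by (rule eq_vecI) (use Mi v(1) in \<open>auto simp: v(3) dMM v1_def v2_def\<close>)
  have ne: "v1 ~= 0\<^sub>v (n + (m + l)) \<or> v2 ~= 0\<^sub>v (n + (m + l))"
  proof (rule ccontr)
   assume "\<not> ?thesis"
   then have z: "v1 = 0\<^sub>v (n + (m + l))" "v2 = 0\<^sub>v (n + (m + l))" by auto
   have "v = 0\<^sub>v (n + (m + l))"
   proof (rule eq_vecI)
    fix i assume i: "i < dim_vec (0\<^sub>v (n + (m + l)))"
    have "vec_index v1 i = 0" "vec_index v2 i = 0" using z i by auto
    then show "vec_index v i = vec_index (0\<^sub>v (n + (m + l))) i"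
     using i v(1) by (auto simp: v1_def v2_def complex_eq_iff)
   qed (use v in auto)
   then show False using v(2) by simp
  qed
  show "kap \<in> complex_of_real ` {b..1}"
  proof (cases "kap = 1")
   case True
   then show ?thesis using b1 by (auto intro!: image_eqI[of _ _ 1])
  next
   case False
   have i0: "Im kap = 0"
    by (rule eigen_pair(1)[OF c12 ne e1 e2]) (use False kap0 in \<open>auto simp: complex_eq_iff\<close>)
   then have kap: "kap = complex_of_real (Re kap)" by (simp add: complex_eq_iff)
   then have re: "Re kap ~= 0" "Re kap ~= 1" using False kap0 by auto
   have "MM *\<^sub>v v1 = Re kap \<cdot>\<^sub>v v1" "MM *\<^sub>v v2 = Re kap \<cdot>\<^sub>v v2"
    using e1 e2 c12 i0 by auto
   then have "eigenvector MM v1 (Re kap) \<or> eigenvector MM v2 (Re kap)"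
    using ne c12 by (auto simp: eigenvector_def dMM)
   then show ?thesis using bk re kap by (metis atLeastAtMost_iff imageI)
  qed
 qed
qed

end

section \<open>Arc length measure\<close>

text \<open>The line integral, with values in \<open>ennreal\<close> and the parameter running over
  the whole line under an indicator: sums, suprema and affine substitutions then need no
  integrability.\<close>

definition segint :: "real^2 => real^2 => (real^2 => ennreal) => ennreal" where
 "segint a b f = ennreal (dist a b) * (\<integral>\<^sup>+t. f (linepath a b t) * indicator {0..1} t \<partial>lborel)"

lemma linepath_measurable [measurable]: "linepath a b \<in> borel_measurable borel"
 by (intro borel_measurable_continuous_onI continuous_on_linepath)

lemma closed_segment_borel [measurable]: "closed_segment a b \<in> sets (borel :: (real^2) measure)"
 by (intro borel_closed closed_segment)

lemma segint_indicator:
 assumes [measurable]: "S \<in> sets borel"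
 shows "segint a b (indicator S) = ennreal (dist a b) * emeasure lborel {t\<in>{0..1}. linepath a b t \<in> S}"
proof -
 have "(\<integral>\<^sup>+t. indicator S (linepath a b t) * indicator {0..1} t \<partial>lborel) =
   (\<integral>\<^sup>+t. indicator {t\<in>{0..1}. linepath a b t \<in> S} t \<partial>lborel)"
  by (intro nn_integral_cong) (auto simp: indicator_def)
 also have "\<dots> = emeasure lborel {t\<in>{0..1}. linepath a b t \<in> S}"
  by (subst nn_integral_indicator) auto
 finally show ?thesis by (simp add: segint_def)
qed

lemma segint_cong:
 assumes "!!t. t \<in> {0..1} ==> f (linepath a b t) = g (linepath a b t)"
 shows "segint a b f = segint a b g"
proof -
 have "(\<integral>\<^sup>+t. f (linepath a b t) * indicator {0..1} t \<partial>lborel) =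
   (\<integral>\<^sup>+t. g (linepath a b t) * indicator {0..1} t \<partial>lborel)"
  using assms by (intro nn_integral_cong) (auto simp: indicator_def)
 then show ?thesis by (simp add: segint_def)
qed

lemma segint_mono:
 assumes "!!t. t \<in> {0..1} ==> f (linepath a b t) <= g (linepath a b t)"
 shows "segint a b f <= segint a b g"
 unfolding segint_def using assms
 by (intro mult_left_mono nn_integral_mono) (auto simp: indicator_def)

lemma segint_add:
 assumes [measurable]: "f \<in> borel_measurable borel" "g \<in> borel_measurable borel"
 shows "segint a b (\<lambda>x. f x + g x) = segint a b f + segint a b g"
 unfolding segint_def by (simp add: distrib_right nn_integral_add distrib_left)

lemma segint_cmult:
 assumes [measurable]: "f \<in> borel_measurable borel"
 shows "segint a b (\<lambda>x. c * f x) = c * segint a b f"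
 unfolding segint_def by (simp add: mult.assoc nn_integral_cmult mult.left_commute)

lemma segint_sum:
 assumes "!!i. i \<in> I ==> f i \<in> borel_measurable borel"
 shows "segint a b (\<lambda>x. \<Sum>i\<in>I. f i x) = (\<Sum>i\<in>I. segint a b (f i))"
 using assms
proof (induction I rule: infinite_finite_induct)
 case (insert x F)
 then show ?case by (simp add: segint_add)
qed (simp_all add: segint_def)

lemma space_arc [simp]: "space (arc_measure T) = UNIV"
 unfolding arc_measure_def by (subst space_measure_of) auto

lemma sets_arc [simp, measurable_cong]: "sets (arc_measure T) = sets borel"
 unfolding arc_measure_def
 by (subst sets_measure_of) (auto simp: sets.sigma_sets_eq[of borel, simplified])

text \<open>\<open>arc_measure\<close> comes from \<open>measure_of\<close>, which yields the
  intended set function only once its countable additivity has been verified.\<close>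

lemma emeasure_arc:
 assumes S: "S \<in> sets borel" and T: "finite T"
 shows "emeasure (arc_measure T) S = (\<Sum>(a, b)\<in>T. segint a b (indicator S))"
proof -
 let ?f = "\<lambda>S. \<Sum>(a, b)\<in>T. ennreal (dist a b) * emeasure lborel {t\<in>{0..1}. linepath a b t \<in> S}"
 have "emeasure (arc_measure T) S = ?f S"
 proof (rule emeasure_measure_of[OF arc_measure_def])
  show "positive (sets (arc_measure T)) ?f" by (auto simp: positive_def)
  show "countably_additive (sets (arc_measure T)) ?f"
   unfolding countably_additive_def sets_arc
  proof safe
   fix A :: "nat => (real^2) set"
   assume A: "range A \<subseteq> sets borel" "disjoint_family A"
   have [measurable]: "A i \<in> sets borel" for i using A(1) by auto
   have "(\<Sum>i. ?f (A i)) =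
    (\<Sum>p\<in>T. \<Sum>i. (case p of (a, b) => ennreal (dist a b) * emeasure lborel {t\<in>{0..1}. linepath a b t \<in> A i}))"
    by (subst suminf_sum) auto
   also have "\<dots> = ?f (\<Union> (range A))"
   proof (rule sum.cong[OF refl])
    fix p assume "p \<in> T"
    obtain a b where p: "p = (a, b)" by (cases p)
    have "(\<Sum>i. emeasure lborel {t\<in>{0..1}. linepath a b t \<in> A i}) =
     emeasure lborel (\<Union>i. {t\<in>{0..1}. linepath a b t \<in> A i})"
     using A(2) by (intro suminf_emeasure) (auto simp: disjoint_family_on_def)
    also have "(\<Union>i. {t\<in>{0..1}. linepath a b t \<in> A i}) = {t\<in>{0..1}. linepath a b t \<in> \<Union> (range A)}"
     by auto
    finally show "(\<Sum>i. case p of (a, b) => ennreal (dist a b) * emeasure lborel {t\<in>{0..1}. linepath a b t \<in> A i}) =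
     (case p of (a, b) => ennreal (dist a b) * emeasure lborel {t\<in>{0..1}. linepath a b t \<in> \<Union> (range A)})"
     by (simp add: p)
   qed
   finally show "(\<Sum>i. ?f (A i)) = ?f (\<Union> (range A))" .
  qed
 qed (use S in auto)
 also have "\<dots> = (\<Sum>(a, b)\<in>T. segint a b (indicator S))"
  using S by (simp add: segint_indicator case_prod_beta)
 finally show ?thesis .
qed

lemma nn_integral_arc:
 assumes f: "f \<in> borel_measurable borel" and T: "finite T"
 shows "(\<integral>\<^sup>+x. f x \<partial>arc_measure T) = (\<Sum>(a, b)\<in>T. segint a b f)"
 using f
proof (induction f rule: borel_measurable_induct)
 case (cong f g)
 then show ?case by (simp cong: nn_integral_cong add: segint_def)
next
 case (set A)
 then show ?case using emeasure_arc[OF _ T] by simp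
next
 case (mult u c)
 then have [measurable]: "u \<in> borel_measurable borel" by simp
 have "(\<Sum>(a, b)\<in>T. segint a b (\<lambda>x. c * u x)) = c * (\<Sum>(a, b)\<in>T. segint a b u)"
  by (simp add: segint_cmult sum_distrib_left case_prod_beta)
 then show ?case using mult by (simp add: nn_integral_cmult)
next
 case (add u v)
 then have [measurable]: "u \<in> borel_measurable borel" "v \<in> borel_measurable borel" by simp_all
 have "(\<Sum>(a, b)\<in>T. segint a b (\<lambda>x. v x + u x)) = (\<Sum>(a, b)\<in>T. segint a b v) + (\<Sum>(a, b)\<in>T. segint a b u)"
  by (simp add: segint_add sum.distrib case_prod_beta)
 then show ?case using add by (simp add: nn_integral_add)
next
 case (seq U)
 then have [measurable]: "U i \<in> borel_measurable borel" for i by simp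
 have inc: "incseq U" by fact
 have pt: "Sup (range U) x = (SUP i. U i x)" for x by (simp add: image_comp)
 have L: "(\<integral>\<^sup>+x. Sup (range U) x \<partial>arc_measure T) = (SUP i. \<integral>\<^sup>+x. U i x \<partial>arc_measure T)"
  unfolding pt by (rule nn_integral_monotone_convergence_SUP[OF inc]) simp
 have R: "segint a b (Sup (range U)) = (SUP i. segint a b (U i))" for a b
 proof -
  have "(\<integral>\<^sup>+t. Sup (range U) (linepath a b t) * indicator {0..1} t \<partial>lborel) =
   (\<integral>\<^sup>+t. (SUP i. U i (linepath a b t) * indicator {0..1} t) \<partial>lborel)"
   unfolding pt by (intro nn_integral_cong) (auto simp: indicator_def)
  also have "\<dots> = (SUP i. \<integral>\<^sup>+t. U i (linepath a b t) * indicator {0..1} t \<partial>lborel)"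
   using inc by (intro nn_integral_monotone_convergence_SUP)
    (auto simp: incseq_def le_fun_def intro!: mult_right_mono)
  finally show ?thesis by (simp add: segint_def SUP_mult_left_ennreal)
 qed
 have mono: "incseq (\<lambda>i. segint a b (U i))" for a b
  using inc by (auto simp: incseq_def le_fun_def intro!: segint_mono)
 have "(\<Sum>p\<in>T. (SUP i. segint (fst p) (snd p) (U i))) = (SUP i. \<Sum>p\<in>T. segint (fst p) (snd p) (U i))"
  by (rule ennreal_SUP_sum[symmetric]) (use mono in auto)
 moreover have "(\<Sum>(a, b)\<in>T. segint a b (Sup (range U))) = (\<Sum>p\<in>T. (SUP i. segint (fst p) (snd p) (U i)))"
  by (simp only: R split_def)
 moreover have "(\<integral>\<^sup>+x. U i x \<partial>arc_measure T) = (\<Sum>p\<in>T. segint (fst p) (snd p) (U i))" for i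
  using seq by (simp add: case_prod_beta)
 ultimately show ?case using L by (simp only:)
qed

section \<open>Independence of the arc length measure from the mesh\<close>

lemma linepath_affine: "linepath a b t = a + t *\<^sub>R (b - a)"
 by (simp add: linepath_def algebra_simps)

lemma linepath_eq_iff: "a ~= b ==> linepath a b s = linepath a b t \<longleftrightarrow> s = t"
 by (auto simp: linepath_affine)

lemma linepath_in_segment_iff: "a ~= b ==> linepath a b t \<in> closed_segment a b \<longleftrightarrow> t \<in> {0..1}"
 using linepath_eq_iff[of a b] by (auto simp: linepath_image_01[symmetric])

lemma AE_linepath_avoids:
 assumes "a ~= b" "finite F"
 shows "AE t in lborel. linepath a b t \<notin> F"
proof -
 have "finite {t. linepath a b t \<in> F}"
  using finite_vimageI[OF assms(2), of "linepath a b"] linepath_eq_iff[OF assms(1)]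
  by (auto simp: vimage_def inj_def)
 then show ?thesis
  by (intro AE_I'[of "{t. linepath a b t \<in> F}"] finite_imp_null_set_lborel) auto
qed

lemma segint_point_0:
 assumes "a ~= b" "finite F" "S \<subseteq> F"
 shows "segint a b (indicator S) = 0"
proof -
 have "(\<integral>\<^sup>+t. indicator S (linepath a b t) * indicator {0..1} t \<partial>lborel) = (\<integral>\<^sup>+t. 0 \<partial>(lborel::real measure))"
  using AE_linepath_avoids[OF assms(1,2)] assms(3)
  by (intro nn_integral_cong_AE) (auto elim!: eventually_mono simp: indicator_def)
 then show ?thesis by (simp add: segint_def)
qed

text \<open>The length of the common part of two segments is the same measured along either of them.
  With at most one common point both sides are 0; two common points make the segments collinear, and
  the parametrizations differ by an affine map.\<close>

lemma segint_swap:
 assumes ab: "a ~= b" and cd: "c ~= d" and [measurable]: "S \<in> sets borel"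
 shows "segint a b (indicator (S \<inter> closed_segment c d)) = segint c d (indicator (S \<inter> closed_segment a b))"
proof (cases "\<exists>p q. p ~= q \<and> p \<in> closed_segment a b \<inter> closed_segment c d \<and> q \<in> closed_segment a b \<inter> closed_segment c d")
 case False
 have "\<exists>p. closed_segment a b \<inter> closed_segment c d \<subseteq> {p}" using False by blast
 then obtain p where p: "closed_segment a b \<inter> closed_segment c d \<subseteq> {p}" ..
 have "segint a b (indicator (S \<inter> closed_segment c d)) = segint a b (indicator (S \<inter> closed_segment c d \<inter> {p}))"
  using p linepath_in_segment_iff[OF ab] by (intro segint_cong) (auto simp: indicator_def)
 moreover have "segint c d (indicator (S \<inter> closed_segment a b)) = segint c d (indicator (S \<inter> closed_segment a b \<inter> {p}))"
  using p linepath_in_segment_iff[OF cd] by (intro segint_cong) (auto simp: indicator_def)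
 ultimately show ?thesis
  using segint_point_0[OF ab, of "{p}"] segint_point_0[OF cd, of "{p}"] by simp
next
 case True
 then obtain p q where pq: "p ~= q" "p \<in> closed_segment a b" "q \<in> closed_segment a b"
  "p \<in> closed_segment c d" "q \<in> closed_segment c d" by blast
 have "\<exists>s. x = a' + s *\<^sub>R (b' - a')" if "x \<in> closed_segment a' b'" for x a' b' :: "real^2"
  using that by (auto simp: linepath_image_01[symmetric] linepath_affine)
 with pq obtain s t s' t' where st: "p = a + s *\<^sub>R (b - a)" "q = a + t *\<^sub>R (b - a)"
  "p = c + s' *\<^sub>R (d - c)" "q = c + t' *\<^sub>R (d - c)"
  by metis
 have ne: "s' ~= t'" using pq st by auto
 \<comment> \<open>\<open>kap\<close> is the signed ratio of the two lengths, and
   \<open>\<alpha>\<close> is the parameter of \<open>c\<close> on the line through \<open>a\<close>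
   and \<open>b\<close>.\<close>
 define kap where "kap = (t - s) / (t' - s')"
 define \<alpha> where "\<alpha> = s - s' * kap"
 have "(t' - s') *\<^sub>R (d - c) = (t - s) *\<^sub>R (b - a)"
  using arg_cong2[OF st(1,2), of "\<lambda>x y. y - x"] arg_cong2[OF st(3,4), of "\<lambda>x y. y - x"]
  by (simp add: scaleR_left_diff_distrib)
 then have "(1 / (t' - s')) *\<^sub>R ((t' - s') *\<^sub>R (d - c)) = kap *\<^sub>R (b - a)"
  by (simp add: kap_def)
 then have dc: "d - c = kap *\<^sub>R (b - a)" using ne by simp
 have "c = a + s *\<^sub>R (b - a) - s' *\<^sub>R (d - c)" using st(1,3) by (simp add: algebra_simps)
 then have c: "c = a + \<alpha> *\<^sub>R (b - a)" unfolding dc by (simp add: \<alpha>_def algebra_simps)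
 have L: "linepath c d t = linepath a b (\<alpha> + kap * t)" for t
  unfolding linepath_affine dc by (subst c) (simp add: algebra_simps)
 have kap0: "kap ~= 0" using dc cd by auto
 have dist: "dist c d = \<bar>kap\<bar> * dist a b"
  using arg_cong[OF dc, of norm] by (simp add: dist_norm norm_minus_commute)
 let ?g = "\<lambda>t. indicator (S \<inter> closed_segment c d) (linepath a b t) * indicator {0..1} t :: ennreal"
 have "(\<integral>\<^sup>+t. ?g t \<partial>lborel) = ennreal \<bar>kap\<bar> * (\<integral>\<^sup>+t. ?g (\<alpha> + kap * t) \<partial>lborel)"
  by (rule nn_integral_real_affine[OF _ kap0]) simp
 also have "(\<integral>\<^sup>+t. ?g (\<alpha> + kap * t) \<partial>lborel) =
  (\<integral>\<^sup>+t. indicator (S \<inter> closed_segment a b) (linepath c d t) * indicator {0..1} t \<partial>lborel)"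
  unfolding L[symmetric] using linepath_in_segment_iff[OF ab] linepath_in_segment_iff[OF cd]
  by (intro nn_integral_cong) (auto simp: indicator_def L)
 finally show ?thesis
  by (simp add: segint_def dist ennreal_mult' mult_ac)
qed

text \<open>Refinement by both meshes: as \<open>T'\<close> covers the set, a segment of
  \<open>T\<close> is at most the sum of its parts along \<open>T'\<close>. The parts are swapped,
  and as segments of \<open>T\<close> overlap in nodes only, the parts along one segment of
  \<open>T'\<close> add up to at most that segment. By symmetry one inequality is enough. This is
  what frees the geometric constants from the mesh at hand.\<close>

lemma arc_measure_mesh_le:
 assumes T: "segment_mesh \<Gamma> T" and T': "segment_mesh \<Gamma> T'" and S [measurable]: "S \<in> sets borel"
 shows "emeasure (arc_measure T) S <= emeasure (arc_measure T') S"
proof -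
 have fin: "finite T" "finite T'" using T T' by (auto simp: segment_mesh_def)
 have ne: "(a, b) \<in> T ==> a ~= b" "(a, b) \<in> T' ==> a ~= b" for a b
  using T T' by (auto simp: segment_mesh_def)
 have cov: "(\<Union>(a, b)\<in>T. closed_segment a b) = \<Gamma>" "(\<Union>(a, b)\<in>T'. closed_segment a b) = \<Gamma>"
  using T T' by (auto simp: segment_mesh_def)
 have "(\<Sum>(a, b)\<in>T. segint a b (indicator S)) <=
  (\<Sum>(a, b)\<in>T. \<Sum>(c, d)\<in>T'. segint a b (indicator (S \<inter> closed_segment c d)))"
 proof (intro sum_mono, clarify)
  fix a b assume ab: "(a, b) \<in> T"
  have "segint a b (indicator S) <= segint a b (\<lambda>x. \<Sum>q\<in>T'. indicator (S \<inter> closed_segment (fst q) (snd q)) x)"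
  proof (rule segint_mono)
   fix t :: real assume t: "t \<in> {0..1}"
   then have "linepath a b t \<in> closed_segment a b" using ne(1)[OF ab] by (simp add: linepath_in_segment_iff)
   then have "linepath a b t \<in> (\<Union>(a, b)\<in>T'. closed_segment a b)" unfolding cov(2) cov(1)[symmetric] using ab by auto
   then obtain q where q: "q \<in> T'" "linepath a b t \<in> closed_segment (fst q) (snd q)" by auto
   have "indicator S (linepath a b t) <= (indicator (S \<inter> closed_segment (fst q) (snd q)) (linepath a b t) :: ennreal)"
    using q by (auto simp: indicator_def)
   also have "\<dots> <= (\<Sum>q\<in>T'. indicator (S \<inter> closed_segment (fst q) (snd q)) (linepath a b t))"
    using q fin by (intro member_le_sum) auto
   finally show "indicator S (linepath a b t) <= (\<Sum>q\<in>T'. indicator (S \<inter> closed_segment (fst q) (snd q)) (linepath a b t) :: ennreal)" .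
  qed
  also have "\<dots> = (\<Sum>(c, d)\<in>T'. segint a b (indicator (S \<inter> closed_segment c d)))"
   by (subst segint_sum) (auto simp: case_prod_beta)
  finally show "segint a b (indicator S) <= (\<Sum>(c, d)\<in>T'. segint a b (indicator (S \<inter> closed_segment c d)))" .
 qed
 also have "\<dots> = (\<Sum>(a, b)\<in>T. \<Sum>(c, d)\<in>T'. segint c d (indicator (S \<inter> closed_segment a b)))"
  using ne by (intro sum.cong refl) (auto intro!: sum.cong segint_swap)
 also have "\<dots> = (\<Sum>(c, d)\<in>T'. \<Sum>(a, b)\<in>T. segint c d (indicator (S \<inter> closed_segment a b)))"
  unfolding case_prod_beta by (rule sum.swap)
 also have "\<dots> <= (\<Sum>(c, d)\<in>T'. segint c d (indicator S))"
 proof (intro sum_mono, clarify)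
  fix c d assume cd: "(c, d) \<in> T'"
  \<comment> \<open>The finitely many nodes of \<open>T\<close> are the only points that lie on two
    of its segments, and they carry no length.\<close>
  define F where "F = fst ` T \<union> snd ` T"
  have F: "finite F" using fin by (simp add: F_def)
  have "(\<Sum>(a, b)\<in>T. segint c d (indicator (S \<inter> closed_segment a b))) =
   segint c d (\<lambda>x. \<Sum>p\<in>T. indicator (S \<inter> closed_segment (fst p) (snd p)) x)"
   by (subst segint_sum) (auto simp: case_prod_beta)
  also have "\<dots> <= segint c d (indicator S)"
   unfolding segint_def
  proof (intro mult_left_mono nn_integral_mono_AE)
   show "AE t in lborel. (\<Sum>p\<in>T. indicator (S \<inter> closed_segment (fst p) (snd p)) (linepath c d t)) * indicator {0..1} t
     <= (indicator S (linepath c d t) * indicator {0..1} t :: ennreal)"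
    using AE_linepath_avoids[OF ne(2)[OF cd] F]
   proof (rule eventually_mono)
    fix t assume nF: "linepath c d t \<notin> F"
    let ?x = "linepath c d t"
    have "(\<Sum>p\<in>T. indicator (S \<inter> closed_segment (fst p) (snd p)) ?x) <= (indicator S ?x :: ennreal)"
    proof (cases "\<exists>p\<in>T. ?x \<in> closed_segment (fst p) (snd p)")
     case True
     then obtain p where p: "p \<in> T" "?x \<in> closed_segment (fst p) (snd p)" by auto
     have u: "?x \<notin> closed_segment (fst q) (snd q)" if q: "q \<in> T" "q ~= p" for q
     proof
      assume "?x \<in> closed_segment (fst q) (snd q)"
      then have "?x \<in> {fst p, snd p}"
       using T p q unfolding segment_mesh_def by (cases p; cases q) fastforce
      then show False using nF p(1) by (auto simp: F_def)
     qed
     have "(\<Sum>q\<in>T. indicator (S \<inter> closed_segment (fst q) (snd q)) ?x) =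
      (\<Sum>q\<in>{p}. indicator (S \<inter> closed_segment (fst q) (snd q)) ?x :: ennreal)"
      using fin p u by (intro sum.mono_neutral_right) (auto simp: indicator_def)
     also have "\<dots> = indicator (S \<inter> closed_segment (fst p) (snd p)) ?x" by simp
     also have "\<dots> <= indicator S ?x" by (auto simp: indicator_def)
     finally show ?thesis .
    next
     case False
     then have "(\<Sum>q\<in>T. indicator (S \<inter> closed_segment (fst q) (snd q)) ?x) = (0 :: ennreal)"
      by (intro sum.neutral) (auto simp: indicator_def)
     then show ?thesis by simp
    qed
    then show "(\<Sum>p\<in>T. indicator (S \<inter> closed_segment (fst p) (snd p)) ?x) * indicator {0..1} t
     <= (indicator S ?x * indicator {0..1} t :: ennreal)"
     by (intro mult_right_mono) auto
   qed
  qed simp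
  finally show "(\<Sum>(a, b)\<in>T. segint c d (indicator (S \<inter> closed_segment a b))) <= segint c d (indicator S)" .
 qed
 finally show ?thesis using emeasure_arc[OF S] fin by simp
qed

lemma arc_measure_mesh_eq:
 assumes "segment_mesh \<Gamma> T" "segment_mesh \<Gamma> T'"
 shows "arc_measure T = arc_measure T'"
 by (rule measure_eqI) (use assms in \<open>auto intro!: antisym arc_measure_mesh_le\<close>)

lemma finite_measure_arc:
 assumes "finite T"
 shows "finite_measure (arc_measure T)"
proof
 have "segint a b (indicator UNIV) = ennreal (dist a b)" for a b
  by (simp add: segint_def)
 then show "emeasure (arc_measure T) (space (arc_measure T)) ~= \<infinity>"
  using assms by (simp add: emeasure_arc case_prod_beta)
qed

section \<open>Integrals over the plane\<close>

lemma cross2_simps: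
 "cross2 (x + y) z = cross2 x z + cross2 y z" "cross2 z (x + y) = cross2 z x + cross2 z y"
 "cross2 (x - y) z = cross2 x z - cross2 y z" "cross2 z (x - y) = cross2 z x - cross2 z y"
 "cross2 (s *\<^sub>R x) z = s * cross2 x z" "cross2 z (s *\<^sub>R x) = s * cross2 z x"
 "cross2 (- x) z = - cross2 x z" "cross2 z (- x) = - cross2 z x"
 "cross2 x x = 0" "cross2 0 x = 0" "cross2 x 0 = 0"
 by (auto simp: cross2_def algebra_simps)

lemma cross2_commute: "cross2 x y = - cross2 y x"
 by (simp add: cross2_def)

lemma abs_cross2_le: "\<bar>cross2 x y\<bar> <= norm x * norm y"
proof (rule power2_le_imp_le)
 have "(norm x * norm y)\<^sup>2 - (cross2 x y)\<^sup>2 = (x \<bullet> y)\<^sup>2"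
  unfolding power_mult_distrib power2_norm_eq_inner cross2_def
  by (simp add: inner_vec_def sum_2 power2_eq_square algebra_simps)
 then have "(cross2 x y)\<^sup>2 <= (norm x * norm y)\<^sup>2"
  using zero_le_power2[of "x \<bullet> y"] by linarith
 then show "\<bar>cross2 x y\<bar>\<^sup>2 <= (norm x * norm y)\<^sup>2" by simp
qed simp

definition perp :: "real^2 => real^2" where
 "perp u = vector [- u $ 2, u $ 1]"

lemma norm_perp [simp]: "norm (perp u) = norm u"
 by (simp add: perp_def norm_eq_sqrt_inner inner_vec_def sum_2)

lemma cross2_perp: "cross2 u (perp u) = (norm u)\<^sup>2"
 by (simp add: perp_def cross2_def power2_norm_eq_inner inner_vec_def sum_2)

lemma Basis_real2: "(Basis :: (real^2) set) = {axis 1 1, axis 2 1}"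
 unfolding Basis_vec_def UNIV_2 by auto

lemma measurable_lborel_pair: "measurable (lborel \<Otimes>\<^sub>M lborel) N = measurable (borel \<Otimes>\<^sub>M borel) N"
 by (intro measurable_cong_sets sets_pair_measure_cong) auto

lemma vector_2_measurable [measurable]:
 "(\<lambda>(s, t). vector [s, t] :: real^2) \<in> borel_measurable (borel \<Otimes>\<^sub>M borel)"
proof -
 have "continuous_on UNIV (\<lambda>p. vector [fst p, snd p] :: real^2)"
  by (subst continuous_on_componentwise)
   (auto simp: Basis_real2 inner_axis intro!: continuous_intros)
 then have "(\<lambda>p. vector [fst p, snd p] :: real^2) \<in> borel_measurable borel"
  by (rule borel_measurable_continuous_onI)
 then show ?thesis by (simp add: borel_prod split_def)
qed

text \<open>Makes Fubini available on \<open>real^2\<close>; the two measures need to be compared on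
  boxes only.\<close>

lemma lborel_real2: "lborel = distr (lborel \<Otimes>\<^sub>M lborel) borel (\<lambda>(s, t). vector [s, t] :: real^2)"
proof (rule lborel_eqI)
 fix l u :: "real^2" assume le: "!!b. b \<in> Basis ==> l \<bullet> b <= u \<bullet> b"
 then have le': "l $ 1 <= u $ 1" "l $ 2 <= u $ 2"
  using le[of "axis 1 1"] le[of "axis 2 1"] by (auto simp: Basis_real2 inner_axis)
 have pre: "(\<lambda>(s, t). vector [s, t]) -` box l u \<inter> space (lborel \<Otimes>\<^sub>M lborel) =
   {l $ 1 <..< u $ 1} \<times> {l $ 2 <..< u $ 2}"
  by (auto simp: box_def Basis_real2 inner_axis space_pair_measure)
 have ne: "axis (1::2) (1::real) ~= axis 2 1" by (simp add: axis_eq_axis)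
 have "emeasure (distr (lborel \<Otimes>\<^sub>M lborel) borel (\<lambda>(s, t). vector [s, t])) (box l u) =
  emeasure (lborel \<Otimes>\<^sub>M lborel) ({l $ 1 <..< u $ 1} \<times> {l $ 2 <..< u $ 2})"
  using vector_2_measurable by (subst emeasure_distr) (auto simp: pre)
 also have "\<dots> = ennreal (u $ 1 - l $ 1) * ennreal (u $ 2 - l $ 2)"
  using le' by (subst lborel.emeasure_pair_measure_Times) auto
 also have "\<dots> = ennreal (\<Prod>b\<in>Basis. (u - l) \<bullet> b)"
  using le' ne by (simp add: Basis_real2 inner_axis ennreal_mult)
 finally show "emeasure (distr (lborel \<Otimes>\<^sub>M lborel) borel (\<lambda>(s, t). vector [s, t])) (box l u) =
  ennreal (\<Prod>b\<in>Basis. (u - l) \<bullet> b)" .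
qed simp

lemma nn_integral_plane:
 fixes f :: "real^2 => ennreal"
 assumes [measurable]: "f \<in> borel_measurable borel"
 shows "(\<integral>\<^sup>+x. f x \<partial>lborel) = (\<integral>\<^sup>+s. \<integral>\<^sup>+t. f (vector [s, t]) \<partial>lborel \<partial>lborel)"
proof -
 have m: "(\<lambda>p. case p of (s, t) => f (vector [s, t])) \<in> borel_measurable (lborel \<Otimes>\<^sub>M lborel)"
  using measurable_compose[OF vector_2_measurable assms] by (simp add: split_def)
 have "(\<integral>\<^sup>+x. f x \<partial>lborel) = (\<integral>\<^sup>+p. f (case p of (s, t) => vector [s, t]) \<partial>(lborel \<Otimes>\<^sub>M lborel))"
  by (subst lborel_real2, subst nn_integral_distr) auto
 also have "\<dots> = (\<integral>\<^sup>+s. \<integral>\<^sup>+t. f (vector [s, t]) \<partial>lborel \<partial>lborel)"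
  using lborel.nn_integral_fst[OF m] by (simp add: split_def)
 finally show ?thesis .
qed

text \<open>Change of variables to oblique coordinates by two one-dimensional affine substitutions,
  first for the abscissa, then for the ordinate. This needs \<open>u $ 1 ~= 0\<close>; otherwise
  \<open>u\<close> and \<open>n\<close> exchange their roles.\<close>

lemma nn_integral_skew:
 fixes f :: "real^2 => ennreal"
 assumes f [measurable]: "f \<in> borel_measurable borel" and c: "cross2 u n ~= 0"
 shows "(\<integral>\<^sup>+s. \<integral>\<^sup>+r. f (p + s *\<^sub>R u + r *\<^sub>R n) \<partial>lborel \<partial>lborel) =
  ennreal (1 / \<bar>cross2 u n\<bar>) * (\<integral>\<^sup>+x. f x \<partial>lborel)"
proof -
 have swap: "(\<integral>\<^sup>+s. \<integral>\<^sup>+r. f (p + s *\<^sub>R u + r *\<^sub>R n) \<partial>lborel \<partial>lborel) =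
  (\<integral>\<^sup>+r. \<integral>\<^sup>+s. f (p + s *\<^sub>R u + r *\<^sub>R n) \<partial>lborel \<partial>lborel)" for u n
  by (rule lborel_pair.Fubini') (simp add: borel_prod[symmetric] split_def, measurable)
 have main: "(\<integral>\<^sup>+r. \<integral>\<^sup>+s. f (p + s *\<^sub>R u + r *\<^sub>R n) \<partial>lborel \<partial>lborel) =
  ennreal (1 / \<bar>cross2 u n\<bar>) * (\<integral>\<^sup>+x. f x \<partial>lborel)"
  if c: "cross2 u n ~= 0" and u1: "u $ 1 ~= 0" for u n
 proof -
  define D where "D = cross2 u n"
  have D0: "D ~= 0" using c by (simp add: D_def)
  define k where "k = u $ 2 / u $ 1"
  \<comment> \<open>The ordinate of the point with abscissa \<open>\<sigma>\<close> on the line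
    through \<open>p + r *\<^sub>R n\<close> in direction \<open>u\<close>.\<close>
  define y where "y \<sigma> r = p $ 2 + (\<sigma> - p $ 1) * k + r * (D / u $ 1)" for \<sigma> r
  have vm [measurable]: "(\<lambda>p. vector [fst p, y (fst p) (snd p)] :: real^2) \<in> borel_measurable (borel \<Otimes>\<^sub>M borel)"
   using measurable_compose[OF _ vector_2_measurable, of "\<lambda>p. (fst p, y (fst p) (snd p))" "borel \<Otimes>\<^sub>M borel"]
   by (simp add: y_def)
  have eqv: "p + s *\<^sub>R u + r *\<^sub>R n = vector [p $ 1 + r * n $ 1 + u $ 1 * s, y (p $ 1 + r * n $ 1 + u $ 1 * s) r]" for s r
   unfolding cart_eq_iff forall_2 using u1 by (simp add: y_def k_def D_def cross2_def field_simps)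
  have m1: "(\<lambda>\<sigma>. f (vector [\<sigma>, y \<sigma> r])) \<in> borel_measurable borel" for r
   using measurable_compose[OF _ measurable_compose[OF vm f], of "\<lambda>\<sigma>. (\<sigma>, r)" borel] by simp
  have m2: "(\<lambda>\<sigma>. f (vector [c, \<sigma>])) \<in> borel_measurable borel" for c
   using measurable_compose[OF _ measurable_compose[OF vector_2_measurable f], of "\<lambda>\<sigma>. (c, \<sigma>)" borel] by simp
  have inner: "(\<integral>\<^sup>+s. f (p + s *\<^sub>R u + r *\<^sub>R n) \<partial>lborel) =
   ennreal (1 / \<bar>u $ 1\<bar>) * (\<integral>\<^sup>+\<sigma>. f (vector [\<sigma>, y \<sigma> r]) \<partial>lborel)" for r
  proof -
   have "(\<integral>\<^sup>+\<sigma>. f (vector [\<sigma>, y \<sigma> r]) \<partial>lborel) = ennreal \<bar>u $ 1\<bar> * (\<integral>\<^sup>+s. f (p + s *\<^sub>R u + r *\<^sub>R n) \<partial>lborel)"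
    unfolding eqv by (rule nn_integral_real_affine[OF m1 u1])
   then show ?thesis using u1 by (simp add: mult.assoc[symmetric] ennreal_mult[symmetric])
  qed
  have e1: "(\<integral>\<^sup>+r. \<integral>\<^sup>+s. f (p + s *\<^sub>R u + r *\<^sub>R n) \<partial>lborel \<partial>lborel) =
   ennreal (1 / \<bar>u $ 1\<bar>) * (\<integral>\<^sup>+r. \<integral>\<^sup>+\<sigma>. f (vector [\<sigma>, y \<sigma> r]) \<partial>lborel \<partial>lborel)"
   unfolding inner
  proof (rule nn_integral_cmult)
   have "(\<lambda>p. f (vector [snd p, y (snd p) (fst p)])) \<in> borel_measurable (borel \<Otimes>\<^sub>M borel)"
    using measurable_compose[OF measurable_Pair[OF measurable_snd measurable_fst] measurable_compose[OF vm f]]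
    by (simp only: fst_conv snd_conv)
   then show "(\<lambda>r. \<integral>\<^sup>+\<sigma>. f (vector [\<sigma>, y \<sigma> r]) \<partial>lborel) \<in> borel_measurable lborel"
    by (intro lborel.borel_measurable_nn_integral) (simp only: split_def measurable_lborel_pair measurable_lborel1)
  qed
  have e2: "(\<integral>\<^sup>+r. \<integral>\<^sup>+\<sigma>. f (vector [\<sigma>, y \<sigma> r]) \<partial>lborel \<partial>lborel) =
   (\<integral>\<^sup>+\<sigma>. \<integral>\<^sup>+r. f (vector [\<sigma>, y \<sigma> r]) \<partial>lborel \<partial>lborel)"
   using measurable_compose[OF vm f]
   by (intro lborel_pair.Fubini') (simp only: split_def measurable_lborel_pair)
  have e3: "(\<lambda>\<sigma>. \<integral>\<^sup>+r. f (vector [\<sigma>, y \<sigma> r]) \<partial>lborel) =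
   (\<lambda>\<sigma>. ennreal \<bar>u $ 1 / D\<bar> * (\<integral>\<^sup>+t. f (vector [\<sigma>, t]) \<partial>lborel))"
  proof
   fix \<sigma>
   have d: "D / u $ 1 ~= 0" using D0 u1 by simp
   have "(\<integral>\<^sup>+t. f (vector [\<sigma>, t]) \<partial>lborel) = ennreal \<bar>D / u $ 1\<bar> *
    (\<integral>\<^sup>+r. f (vector [\<sigma>, (p $ 2 + (\<sigma> - p $ 1) * k) + (D / u $ 1) * r]) \<partial>lborel)"
    by (rule nn_integral_real_affine[OF m2 d])
   then show "(\<integral>\<^sup>+r. f (vector [\<sigma>, y \<sigma> r]) \<partial>lborel) = ennreal \<bar>u $ 1 / D\<bar> * (\<integral>\<^sup>+t. f (vector [\<sigma>, t]) \<partial>lborel)"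
    using D0 u1 by (simp add: y_def mult.commute mult.assoc[symmetric] ennreal_mult[symmetric])
  qed
  have e4: "(\<integral>\<^sup>+\<sigma>. ennreal \<bar>u $ 1 / D\<bar> * (\<integral>\<^sup>+t. f (vector [\<sigma>, t]) \<partial>lborel) \<partial>lborel) =
   ennreal \<bar>u $ 1 / D\<bar> * (\<integral>\<^sup>+x. f x \<partial>lborel)"
   unfolding nn_integral_plane[OF f]
  proof (rule nn_integral_cmult)
   show "(\<lambda>\<sigma>. \<integral>\<^sup>+t. f (vector [\<sigma>, t]) \<partial>lborel) \<in> borel_measurable lborel"
    using measurable_compose[OF vector_2_measurable f]
    by (intro lborel.borel_measurable_nn_integral) (simp add: split_def)
  qed
  show ?thesis unfolding e1 e2 e3 e4 using u1 D0
   by (simp add: D_def[symmetric] mult.assoc[symmetric] ennreal_mult[symmetric])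
 qed
 show ?thesis
 proof (cases "u $ 1 = 0")
  case False
  then show ?thesis using swap[of u n] main[OF c] by simp
 next
  case True
  then have n1: "n $ 1 ~= 0" using c by (auto simp: cross2_def)
  have c': "cross2 n u ~= 0" using c by (simp add: cross2_commute[of n])
  have "(\<integral>\<^sup>+s. \<integral>\<^sup>+r. f (p + s *\<^sub>R u + r *\<^sub>R n) \<partial>lborel \<partial>lborel) =
   (\<integral>\<^sup>+s. \<integral>\<^sup>+r. f (p + r *\<^sub>R n + s *\<^sub>R u) \<partial>lborel \<partial>lborel)"
   by (simp add: add_ac)
  then show ?thesis using main[OF c' n1] by (simp add: cross2_commute[of n])
 qed
qed

lemma nn_integral_sqrt_inverse:
 "(\<integral>\<^sup>+th. ennreal (th powr (-1/2)) * indicator {0..1} th \<partial>lborel) = 2"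
proof -
 have "((\<lambda>x. x powr (-1/2)) has_integral 1 powr (- 1/2 + 1) / (-1/2 + 1)) {0..1::real}"
  by (rule has_integral_powr_from_0) auto
 then have "((\<lambda>x. x powr (-1/2)) has_integral 2) {0..1::real}" by simp
 then have "((\<lambda>x. indicator {0..1} x * x powr (-1/2)) has_integral 2) (UNIV :: real set)"
  by (subst (asm) has_integral_restrict_UNIV[symmetric])
   (auto elim!: has_integral_eq[rotated] simp: indicator_def)
 then have "(\<integral>\<^sup>+x. ennreal (indicator {0..1} x * x powr (-1/2)) \<partial>lborel) = ennreal 2"
  by (intro nn_integral_has_integral_lborel) auto
 then show ?thesis by (simp add: ennreal_mult' ennreal_indicator mult.commute)
qed

text \<open>The weight \<open>th\<^sup>1\<^sup>/\<^sup>2\<close> absorbs the factor \<open>th\<^sup>-\<^sup>1\<close> of a dilation by \<open>th\<close>.\<close>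

lemma weighted_Cauchy_Schwarz:
 assumes [measurable]: "G \<in> borel_measurable borel"
 shows "(\<integral>\<^sup>+th. G th * indicator {0..1} th \<partial>lborel)\<^sup>2 <=
  2 * (\<integral>\<^sup>+th. (G th)\<^sup>2 * (ennreal (th powr (1/2)) * indicator {0..1} th) \<partial>lborel)"
proof -
 have sq: "(ennreal (th powr (-1/4)))\<^sup>2 = ennreal (th powr (-1/2))"
  "(ennreal (th powr (1/4)))\<^sup>2 = ennreal (th powr (1/2))" for th :: real
  unfolding ennreal_power[OF powr_ge_zero] by (simp_all add: power2_eq_square flip: powr_add)
 have ind2: "(indicator S th)\<^sup>2 = (indicator S th :: ennreal)" for S and th :: real
  by (simp add: indicator_def)
 have one: "ennreal (th powr (1/4)) * ennreal (th powr (-1/4)) = 1" if "th ~= 0" for th :: real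
 proof -
  have "th powr (1/4) * th powr (-1/4) = 1"
   using that unfolding powr_add[symmetric] by simp
  then show ?thesis by (simp only: ennreal_mult[symmetric, OF powr_ge_zero powr_ge_zero] ennreal_1)
 qed
 \<comment> \<open>Cauchy--Schwarz is prepared with the weight \<open>th powr (1/4)\<close> on one
   factor and its inverse on the other. They cancel except at \<open>th = 0\<close>, a null
   set.\<close>
 have eq: "(\<integral>\<^sup>+th. G th * indicator {0..1} th \<partial>lborel) =
  (\<integral>\<^sup>+th. (G th * (ennreal (th powr (1/4)) * indicator {0..1} th)) * (ennreal (th powr (-1/4)) * indicator {0..1} th) \<partial>lborel)"
 proof (rule nn_integral_cong_AE)
  show "AE th in lborel. G th * indicator {0..1} th =
   (G th * (ennreal (th powr (1/4)) * indicator {0..1} th)) * (ennreal (th powr (-1/4)) * indicator {0..1} th)"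
   using AE_lborel_singleton[of "0::real"]
  proof (rule eventually_mono)
   fix th :: real assume "th ~= 0"
   then show "G th * indicator {0..1} th =
   (G th * (ennreal (th powr (1/4)) * indicator {0..1} th)) * (ennreal (th powr (-1/4)) * indicator {0..1} th)"
    using one[of th] by (simp add: indicator_def mult.assoc)
  qed
 qed
 have cs: "(\<integral>\<^sup>+th. G th * indicator {0..1} th \<partial>lborel)\<^sup>2 <= (\<integral>\<^sup>+th. (G th * (ennreal (th powr (1/4)) * indicator {0..1} th))\<^sup>2 \<partial>lborel) *
   (\<integral>\<^sup>+th. (ennreal (th powr (-1/4)) * indicator {0..1} th)\<^sup>2 \<partial>lborel)"
  unfolding eq by (rule Cauchy_Schwarz_nn_integral) measurable
 have two: "(\<integral>\<^sup>+th. (ennreal (th powr (-1/4)) * indicator {0..1} th)\<^sup>2 \<partial>lborel) = 2"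
 proof -
  have "(\<integral>\<^sup>+th. (ennreal (th powr (-1/4)) * indicator {0..1} th)\<^sup>2 \<partial>lborel) =
   (\<integral>\<^sup>+th. ennreal (th powr (-1/2)) * indicator {0..1} th \<partial>lborel)"
   by (intro nn_integral_cong) (simp only: power_mult_distrib sq ind2)
  then show ?thesis by (simp only: nn_integral_sqrt_inverse)
 qed
 have wt: "(\<integral>\<^sup>+th. (G th * (ennreal (th powr (1/4)) * indicator {0..1} th))\<^sup>2 \<partial>lborel) =
  (\<integral>\<^sup>+th. (G th)\<^sup>2 * (ennreal (th powr (1/2)) * indicator {0..1} th) \<partial>lborel)"
  by (intro nn_integral_cong) (simp only: power_mult_distrib sq ind2)
 show ?thesis using cs unfolding two wt by (simp add: mult.commute)
qed

section \<open>Trace inequality\<close>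

definition skel :: "edge set => (real^2) set" where
 "skel E = (\<Union>(a, b)\<in>E. closed_segment a b)"

text \<open>Functions extended by zero, so that estimates can run along full lines and over the
  whole plane. \<open>E\<close> will be the set of sides of the quadrilateral mesh, off which the
  gradient is classical. The bound on the gradient serves to make integrals finite; no constant
  depends on it or on \<open>E\<close>.\<close>

definition pw_smooth :: "(real^2) set => edge set => (real^2 => real^2) => bool" where
 "pw_smooth \<Omega> E v \<longleftrightarrow> finite E \<and> continuous_on UNIV v \<and>
  (\<forall>x. x \<notin> skel E --> v differentiable (at x)) \<and> continuous_on (- skel E) (grad v) \<and>
  (\<exists>M. \<forall>x. x \<notin> skel E --> norm (grad v x) <= M) \<and>
  (\<forall>x. x \<notin> \<Omega> --> v x = 0) \<and> (\<forall>x. x \<notin> skel E --> x \<notin> \<Omega> --> grad v x = 0)"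

text \<open>The gradient with its junk values on the skeleton replaced by \<open>0\<close>.\<close>

definition bgrad :: "edge set => (real^2 => real^2) => real^2 => real^2^2" where
 "bgrad E v x = (if x \<in> skel E then 0 else grad v x)"

lemma closed_skel: "finite E ==> closed (skel E)"
 unfolding skel_def by (intro closed_UN) auto

lemma bgrad_measurable:
 assumes "pw_smooth \<Omega> E v"
 shows "bgrad E v \<in> borel_measurable borel"
proof -
 have "(\<lambda>x. indicator (- skel E) x *\<^sub>R grad v x) \<in> borel_measurable borel"
  using assms closed_skel[of E] unfolding pw_smooth_def
  by (intro borel_measurable_continuous_on_indicator) (auto intro: borel_open)
 moreover have "(\<lambda>x. indicator (- skel E) x *\<^sub>R grad v x) = bgrad E v"
  by (auto simp: bgrad_def indicator_def)
 ultimately show ?thesis by simp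
qed

lemma pw_smooth_measurable: "pw_smooth \<Omega> E v ==> v \<in> borel_measurable borel"
 unfolding pw_smooth_def by (intro borel_measurable_continuous_onI) auto

lemma bgrad_bounded: "pw_smooth \<Omega> E v ==> \<exists>M\<ge>0. \<forall>x. norm (bgrad E v x) <= M"
proof -
 assume "pw_smooth \<Omega> E v"
 then obtain M where M: "!!x. x \<notin> skel E ==> norm (grad v x) <= M" by (auto simp: pw_smooth_def)
 show ?thesis
  by (rule exI[of _ "max M 0"]) (use M in \<open>auto simp: bgrad_def intro: le_max_iff_disj[THEN iffD2]\<close>)
qed

lemma norm_matrix_vector_mult_le: "norm (A *v x) <= norm A * norm (x :: real^2)" for A :: "real^2^2"
proof -
 have "norm ((A *v x) $ i) <= norm (A $ i) * norm x" for i
  using Cauchy_Schwarz_ineq2[of "A $ i" x] by (simp add: matrix_vector_mul_component)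
 then have "L2_set (\<lambda>i. norm ((A *v x) $ i)) UNIV <= L2_set (\<lambda>i. norm (A $ i) * norm x) UNIV"
  by (intro L2_set_mono) auto
 also have "\<dots> = norm A * norm x"
  unfolding norm_vec_def[of A] by (simp add: L2_set_left_distrib)
 finally show ?thesis by (simp only: norm_vec_def)
qed

lemma has_derivative_grad:
 assumes "v differentiable (at x)"
 shows "(v has_derivative (\<lambda>h. grad v x *v h)) (at x)"
proof -
 have d: "(v has_derivative frechet_derivative v (at x)) (at x)"
  using assms by (simp add: frechet_derivative_works)
 moreover have "frechet_derivative v (at x) = (\<lambda>h. grad v x *v h)"
  using has_derivative_linear[OF d] by (auto simp: grad_def matrix_works)
 ultimately show ?thesis by simp
qed

text \<open>A line in direction \<open>n\<close> meets a segment in infinitely many points only if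
  the segment lies on that line, so each edge excludes at most one value of
  \<open>s\<close>.\<close>

lemma almost_all_lines:
 assumes E: "finite E" and c: "cross2 u n ~= 0"
 shows "finite {s. infinite {ta. p + s *\<^sub>R u + ta *\<^sub>R n \<in> skel E}}"
proof -
 have n0: "n ~= 0" using c by (auto simp: cross2_simps)
 \<comment> \<open>The value of \<open>s\<close> for the line through the first end point of
   \<open>e\<close>, found by taking cross products with \<open>n\<close>.\<close>
 define \<Phi> where "\<Phi> e = (cross2 (fst e) n - cross2 p n) / cross2 u n" for e :: edge
 have "{s. infinite {ta. p + s *\<^sub>R u + ta *\<^sub>R n \<in> skel E}} \<subseteq> \<Phi> ` E"
 proof
  fix s assume "s \<in> {s. infinite {ta. p + s *\<^sub>R u + ta *\<^sub>R n \<in> skel E}}"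
  moreover have "{ta. p + s *\<^sub>R u + ta *\<^sub>R n \<in> skel E} =
   (\<Union>e\<in>E. {ta. p + s *\<^sub>R u + ta *\<^sub>R n \<in> closed_segment (fst e) (snd e)})"
   by (auto simp: skel_def)
  ultimately obtain e where e: "e \<in> E"
   and inf: "infinite {ta. p + s *\<^sub>R u + ta *\<^sub>R n \<in> closed_segment (fst e) (snd e)}" (is "infinite ?S")
   using E by auto
  obtain ta1 where t1: "ta1 \<in> ?S" using inf infinite_imp_nonempty by blast
  obtain ta2 where t2: "ta2 \<in> ?S" "ta2 ~= ta1"
   using inf by (metis finite.emptyI finite_insert finite_subset insertCI subsetI)
  obtain q1 where q1: "p + s *\<^sub>R u + ta1 *\<^sub>R n = fst e + q1 *\<^sub>R (snd e - fst e)"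
   using t1 by (auto simp: closed_segment_image_interval algebra_simps)
  obtain q2 where q2: "p + s *\<^sub>R u + ta2 *\<^sub>R n = fst e + q2 *\<^sub>R (snd e - fst e)"
   using t2 by (auto simp: closed_segment_image_interval algebra_simps)
  have c1: "cross2 p n + s * cross2 u n = cross2 (fst e) n + q1 * cross2 (snd e - fst e) n"
   using arg_cong[OF q1, of "\<lambda>z. cross2 z n"] by (simp add: cross2_simps)
  have c2: "cross2 p n + s * cross2 u n = cross2 (fst e) n + q2 * cross2 (snd e - fst e) n"
   using arg_cong[OF q2, of "\<lambda>z. cross2 z n"] by (simp add: cross2_simps)
  have "q1 ~= q2"
  proof
   assume "q1 = q2"
   then have "ta1 *\<^sub>R n = ta2 *\<^sub>R n" using q1 q2 by (metis add_left_cancel)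
   then show False using n0 t2(2) by simp
  qed
  moreover have "q1 * cross2 (snd e - fst e) n = q2 * cross2 (snd e - fst e) n" using c1 c2 by linarith
  ultimately have "cross2 (snd e - fst e) n = 0" by simp
  then have "s = \<Phi> e" using c1 c by (simp add: \<Phi>_def field_simps)
  then show "s \<in> \<Phi> ` E" using e by simp
 qed
 then show ?thesis using E finite_subset by blast
qed

lemma line_has_integral:
 assumes v: "pw_smooth \<Omega> E v" and fin: "finite {ta. p + ta *\<^sub>R w \<in> skel E}" and ab: "a <= b"
 shows "((\<lambda>th. bgrad E v (p + th *\<^sub>R w) *v w) has_integral v (p + b *\<^sub>R w) - v (p + a *\<^sub>R w)) {a..b}"
proof (rule fundamental_theorem_of_calculus_interior_strong[OF fin ab])
 fix th assume "th \<in> {a<..<b} - {ta. p + ta *\<^sub>R w \<in> skel E}"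
 then have x: "p + th *\<^sub>R w \<notin> skel E" by simp
 have "v differentiable (at (p + th *\<^sub>R w))" using v x by (auto simp: pw_smooth_def)
 note d = has_derivative_grad[OF this]
 have l: "((\<lambda>th. p + th *\<^sub>R w) has_derivative (\<lambda>h. h *\<^sub>R w)) (at th)"
  by (auto intro!: derivative_eq_intros)
 have "((\<lambda>th. v (p + th *\<^sub>R w)) has_derivative (\<lambda>h. grad v (p + th *\<^sub>R w) *v (h *\<^sub>R w))) (at th)"
  using has_derivative_compose[OF l d] .
 then show "((\<lambda>th. v (p + th *\<^sub>R w)) has_vector_derivative bgrad E v (p + th *\<^sub>R w) *v w) (at th)"
  using x by (simp add: has_vector_derivative_def bgrad_def matrix_vector_mult_scaleR)
next
 have "continuous_on UNIV v" using v by (simp add: pw_smooth_def)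
 then show "continuous_on {a..b} (\<lambda>th. v (p + th *\<^sub>R w))"
  by (rule continuous_on_compose2) (auto intro!: continuous_intros)
qed

text \<open>The path parameter is normalized to the unit interval, so that its range does not depend
  on \<open>r\<close>; this allows the integrals over \<open>r\<close> and \<open>th\<close> to be
  exchanged later.\<close>

lemma line_estimate:
 assumes v: "pw_smooth \<Omega> E v" and fin: "finite {ta. p + ta *\<^sub>R n \<in> skel E}"
 shows "ennreal (norm (v (p + r *\<^sub>R n) - v p)) <=
  ennreal (\<bar>r\<bar> * norm n) * (\<integral>\<^sup>+th. ennreal (norm (bgrad E v (p + (th * r) *\<^sub>R n))) * indicator {0..1} th \<partial>lborel)"
proof (cases "r = 0")
 case False
 let ?w = "r *\<^sub>R n"
 note [measurable] = bgrad_measurable[OF v]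
 define h where "h th = norm (bgrad E v (p + th *\<^sub>R ?w)) * norm ?w" for th
 have hm [measurable]: "h \<in> borel_measurable borel" unfolding h_def by measurable
 obtain M where M: "0 <= M" "!!x. norm (bgrad E v x) <= M" using bgrad_bounded[OF v] by blast
 have h0: "0 <= h th" for th by (simp add: h_def)
 have hb: "h th <= M * norm ?w" for th unfolding h_def by (intro mult_right_mono M) simp
 have si: "set_integrable lborel {0..1} h"
  unfolding set_integrable_def
 proof (rule Bochner_Integration.integrable_bound)
  show "integrable lborel (\<lambda>th. indicator {0..1::real} th * (M * norm ?w))"
   by (intro integrable_mult_left integrable_real_indicator) auto
  show "AE th in lborel. norm (indicator {0..1} th *\<^sub>R h th) <= norm (indicator {0..1} th * (M * norm ?w))"
   using hb h0 M(1) by (auto simp: indicator_def)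
 qed measurable
 have io: "h integrable_on {0..1}" and ie: "(LINT th:{0..1}|lborel. h th) = integral {0..1} h"
  using set_borel_integral_eq_integral[OF si] by auto
 have "finite ((\<lambda>ta. ta / r) ` {ta. p + ta *\<^sub>R n \<in> skel E})" using fin by simp
 moreover have "{ta. p + ta *\<^sub>R ?w \<in> skel E} \<subseteq> (\<lambda>ta. ta / r) ` {ta. p + ta *\<^sub>R n \<in> skel E}"
 proof
  fix ta assume "ta \<in> {ta. p + ta *\<^sub>R ?w \<in> skel E}"
  then show "ta \<in> (\<lambda>ta. ta / r) ` {ta. p + ta *\<^sub>R n \<in> skel E}"
   using False by (intro image_eqI[of _ _ "ta * r"]) auto
 qed
 ultimately have fin': "finite {ta. p + ta *\<^sub>R ?w \<in> skel E}" using finite_subset by blast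
 have hi: "((\<lambda>th. bgrad E v (p + th *\<^sub>R ?w) *v ?w) has_integral v (p + 1 *\<^sub>R ?w) - v (p + 0 *\<^sub>R ?w)) {0..1}"
  by (rule line_has_integral[OF v fin']) simp
 have "norm (integral {0..1} (\<lambda>th. bgrad E v (p + th *\<^sub>R ?w) *v ?w)) <= integral {0..1} h"
  using hi norm_matrix_vector_mult_le[of _ "r *\<^sub>R n"]
  by (intro integral_norm_bound_integral[OF _ io]) (auto simp: h_def)
 then have "norm (v (p + ?w) - v p) <= integral {0..1} h"
  using integral_unique[OF hi] by simp
 then have "ennreal (norm (v (p + ?w) - v p)) <= ennreal (LINT th:{0..1}|lborel. h th)"
  unfolding ie by (rule ennreal_leI)
 also have "ennreal (LINT th:{0..1}|lborel. h th) = (\<integral>\<^sup>+th. ennreal (indicator {0..1} th *\<^sub>R h th) \<partial>lborel)"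
  unfolding set_lebesgue_integral_def using si h0
  by (intro nn_integral_eq_integral[symmetric]) (auto simp: set_integrable_def)
 also have "\<dots> = (\<integral>\<^sup>+th. ennreal (\<bar>r\<bar> * norm n) * (ennreal (norm (bgrad E v (p + (th * r) *\<^sub>R n))) * indicator {0..1} th) \<partial>lborel)"
  by (intro nn_integral_cong) (auto simp: indicator_def h_def mult.commute simp flip: ennreal_mult')
 also have "\<dots> = ennreal (\<bar>r\<bar> * norm n) * (\<integral>\<^sup>+th. ennreal (norm (bgrad E v (p + (th * r) *\<^sub>R n))) * indicator {0..1} th \<partial>lborel)"
  by (rule nn_integral_cmult) measurable
 finally show ?thesis .
qed simp

definition denergy :: "edge set => (real^2 => real^2) => ennreal" where
 "denergy E v = (\<integral>\<^sup>+x. ennreal ((norm (bgrad E v x))\<^sup>2) \<partial>lborel)"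

lemma ennreal_norm_sq: "(ennreal (norm x))\<^sup>2 = ennreal ((norm x)\<^sup>2)"
 by (simp add: ennreal_power)

text \<open>Writing the increment as \<open>r \<integral>\<^sub>0\<^sup>1\<close> of a directional derivative, this is the two-dimensional
 form of Hardy's inequality.\<close>

lemma difference_quotient_estimate:
 assumes v: "pw_smooth \<Omega> E v" and c: "cross2 u n ~= 0"
 shows "(\<integral>\<^sup>+s. \<integral>\<^sup>+r. ennreal ((norm (v (p + s *\<^sub>R u + r *\<^sub>R n) - v (p + s *\<^sub>R u)))\<^sup>2 / r\<^sup>2) \<partial>lborel \<partial>lborel) <=
  ennreal (4 * (norm n)\<^sup>2 / \<bar>cross2 u n\<bar>) * denergy E v"
proof -
 note [measurable] = bgrad_measurable[OF v] pw_smooth_measurable[OF v]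
 have fE: "finite E" using v by (simp add: pw_smooth_def)
 define g where "g x = ennreal ((norm (bgrad E v x))\<^sup>2)" for x
 have gm [measurable]: "g \<in> borel_measurable borel" unfolding g_def by measurable
 have dg: "denergy E v = (\<integral>\<^sup>+x. g x \<partial>lborel)" by (simp add: denergy_def g_def)
 define wt where "wt th = ennreal (th powr (1/2)) * indicator {0..1} th" for th :: real
 have wm [measurable]: "wt \<in> borel_measurable borel" unfolding wt_def by measurable
 let ?N = "ennreal ((norm n)\<^sup>2)"
 let ?F = "\<lambda>s r th. g (p + s *\<^sub>R u + (th * r) *\<^sub>R n) * wt th"
 have pt: "ennreal ((norm (v (p + s *\<^sub>R u + r *\<^sub>R n) - v (p + s *\<^sub>R u)))\<^sup>2 / r\<^sup>2) <= 2 * ?N * (\<integral>\<^sup>+th. ?F s r th \<partial>lborel)"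
  if fin: "finite {ta. p + s *\<^sub>R u + ta *\<^sub>R n \<in> skel E}" for s r
 proof (cases "r = 0")
  case False
  define G where "G th = ennreal (norm (bgrad E v (p + s *\<^sub>R u + (th * r) *\<^sub>R n)))" for th
  have Gm: "G \<in> borel_measurable borel" unfolding G_def by measurable
  let ?I = "\<integral>\<^sup>+th. G th * indicator {0..1} th \<partial>lborel"
  have "ennreal (norm (v (p + s *\<^sub>R u + r *\<^sub>R n) - v (p + s *\<^sub>R u))) <= ennreal (\<bar>r\<bar> * norm n) * ?I"
   using line_estimate[OF v fin] by (simp add: G_def)
  then have "(ennreal (norm (v (p + s *\<^sub>R u + r *\<^sub>R n) - v (p + s *\<^sub>R u))))\<^sup>2 <= (ennreal (\<bar>r\<bar> * norm n) * ?I)\<^sup>2"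
   by (rule power_mono) simp
  then have "ennreal ((norm (v (p + s *\<^sub>R u + r *\<^sub>R n) - v (p + s *\<^sub>R u)))\<^sup>2) <= ennreal (r\<^sup>2 * (norm n)\<^sup>2) * ?I\<^sup>2"
   by (simp add: ennreal_power power_mult_distrib)
  then have "ennreal (1 / r\<^sup>2) * ennreal ((norm (v (p + s *\<^sub>R u + r *\<^sub>R n) - v (p + s *\<^sub>R u)))\<^sup>2) <=
    ennreal (1 / r\<^sup>2) * (ennreal (r\<^sup>2 * (norm n)\<^sup>2) * ?I\<^sup>2)"
   by (rule mult_left_mono) simp
  then have A: "ennreal ((norm (v (p + s *\<^sub>R u + r *\<^sub>R n) - v (p + s *\<^sub>R u)))\<^sup>2 / r\<^sup>2) <= ?N * ?I\<^sup>2"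
   using False by (simp add: mult.assoc[symmetric] ennreal_mult[symmetric])
  have "?I\<^sup>2 <= 2 * (\<integral>\<^sup>+th. ?F s r th \<partial>lborel)"
   using weighted_Cauchy_Schwarz[OF Gm] by (simp add: G_def g_def wt_def ennreal_norm_sq)
  then have "?N * ?I\<^sup>2 <= ?N * (2 * (\<integral>\<^sup>+th. ?F s r th \<partial>lborel))"
   by (rule mult_left_mono) simp
  from order_trans[OF A this] show ?thesis by (simp only: mult_ac)
 qed simp
 have "finite {s. infinite {ta. p + s *\<^sub>R u + ta *\<^sub>R n \<in> skel E}}" by (rule almost_all_lines[OF fE c])
 then have ae: "AE s in lborel. finite {ta. p + s *\<^sub>R u + ta *\<^sub>R n \<in> skel E}"
  by (intro AE_I'[of "{s. infinite {ta. p + s *\<^sub>R u + ta *\<^sub>R n \<in> skel E}}"] finite_imp_null_set_lborel) auto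
 have 1: "(\<integral>\<^sup>+s. \<integral>\<^sup>+r. ennreal ((norm (v (p + s *\<^sub>R u + r *\<^sub>R n) - v (p + s *\<^sub>R u)))\<^sup>2 / r\<^sup>2) \<partial>lborel \<partial>lborel) <=
  (\<integral>\<^sup>+s. \<integral>\<^sup>+r. 2 * ?N * (\<integral>\<^sup>+th. ?F s r th \<partial>lborel) \<partial>lborel \<partial>lborel)"
  using ae by (intro nn_integral_mono_AE) (auto elim!: eventually_mono intro!: nn_integral_mono pt)
 have 2: "(\<integral>\<^sup>+s. \<integral>\<^sup>+r. 2 * ?N * (\<integral>\<^sup>+th. ?F s r th \<partial>lborel) \<partial>lborel \<partial>lborel) =
  2 * ?N * (\<integral>\<^sup>+s. \<integral>\<^sup>+r. \<integral>\<^sup>+th. ?F s r th \<partial>lborel \<partial>lborel \<partial>lborel)"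
  by (subst nn_integral_cmult, measurable, subst nn_integral_cmult, measurable)
 have 3: "(\<integral>\<^sup>+r. \<integral>\<^sup>+th. ?F s r th \<partial>lborel \<partial>lborel) = (\<integral>\<^sup>+th. \<integral>\<^sup>+r. ?F s r th \<partial>lborel \<partial>lborel)" for s
  by (rule lborel_pair.Fubini') measurable
 have 4: "(\<integral>\<^sup>+s. \<integral>\<^sup>+th. \<integral>\<^sup>+r. ?F s r th \<partial>lborel \<partial>lborel \<partial>lborel) = (\<integral>\<^sup>+th. \<integral>\<^sup>+s. \<integral>\<^sup>+r. ?F s r th \<partial>lborel \<partial>lborel \<partial>lborel)"
  by (rule lborel_pair.Fubini') measurable
 \<comment> \<open>For fixed \<open>th\<close> the map from \<open>(s, r)\<close> to the plane has
   Jacobian \<open>th\<close> times \<open>cross2 u n\<close>. The resulting \<open>1 / th\<close>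
   and the weight \<open>th powr (1/2)\<close> leave \<open>th powr (-1/2)\<close>, whose integral
   is 2; with the 2 of \<open>weighted_Cauchy_Schwarz\<close> this makes the constant 4.\<close>
 have 5: "(\<integral>\<^sup>+s. \<integral>\<^sup>+r. ?F s r th \<partial>lborel \<partial>lborel) =
  ennreal (1 / \<bar>cross2 u n\<bar>) * denergy E v * (ennreal (th powr (-1/2)) * indicator {0..1} th)" if "th ~= 0" for th
 proof (cases "th \<in> {0..1}")
  case True
  then have th: "0 < th" using that by simp
  have c': "cross2 u (th *\<^sub>R n) ~= 0" using c th by (simp add: cross2_simps)
  have "(\<integral>\<^sup>+s. \<integral>\<^sup>+r. ?F s r th \<partial>lborel \<partial>lborel) = (\<integral>\<^sup>+s. \<integral>\<^sup>+r. g (p + s *\<^sub>R u + r *\<^sub>R (th *\<^sub>R n)) \<partial>lborel \<partial>lborel) * wt th"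
   by (subst nn_integral_multc, measurable, subst nn_integral_multc, measurable) (simp add: mult.commute)
  then have "(\<integral>\<^sup>+s. \<integral>\<^sup>+r. ?F s r th \<partial>lborel \<partial>lborel) = ennreal (1 / \<bar>cross2 u (th *\<^sub>R n)\<bar>) * denergy E v * wt th"
   unfolding nn_integral_skew[OF gm c'] dg .
  then have X: "(\<integral>\<^sup>+s. \<integral>\<^sup>+r. ?F s r th \<partial>lborel \<partial>lborel) = denergy E v * (ennreal (1 / \<bar>cross2 u (th *\<^sub>R n)\<bar>) * wt th)"
   by (simp only: mult_ac)
  have Y: "ennreal (1 / \<bar>cross2 u (th *\<^sub>R n)\<bar>) * wt th = ennreal (1 / \<bar>cross2 u n\<bar>) * ennreal (th powr (-1/2))"
  proof -
   have "th powr (1/2) = th * th powr (-1/2)"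
    using th powr_add[of th 1 "-1/2"] by simp
   then have "1 / \<bar>cross2 u (th *\<^sub>R n)\<bar> * th powr (1/2) = 1 / \<bar>cross2 u n\<bar> * th powr (-1/2)"
    using th c by (simp add: cross2_simps abs_mult)
   then show ?thesis using True by (simp add: wt_def ennreal_mult[symmetric])
  qed
  show ?thesis unfolding X Y using True by (simp add: mult_ac)
 qed (simp add: wt_def)
 have "(\<integral>\<^sup>+th. \<integral>\<^sup>+s. \<integral>\<^sup>+r. ?F s r th \<partial>lborel \<partial>lborel \<partial>lborel) =
  (\<integral>\<^sup>+th. ennreal (1 / \<bar>cross2 u n\<bar>) * denergy E v * (ennreal (th powr (-1/2)) * indicator {0..1} th) \<partial>lborel)"
  by (intro nn_integral_cong_AE, rule eventually_mono[OF AE_lborel_singleton[of "0::real"]], rule 5)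
 then have 6: "(\<integral>\<^sup>+th. \<integral>\<^sup>+s. \<integral>\<^sup>+r. ?F s r th \<partial>lborel \<partial>lborel \<partial>lborel) = ennreal (1 / \<bar>cross2 u n\<bar>) * denergy E v * 2"
  by (simp only:) (subst nn_integral_cmult, measurable, simp only: nn_integral_sqrt_inverse)
 have "2 * ?N * (ennreal (1 / \<bar>cross2 u n\<bar>) * denergy E v * 2) = ennreal (4 * (norm n)\<^sup>2 / \<bar>cross2 u n\<bar>) * denergy E v"
 proof -
  have "ennreal 2 * ?N * (ennreal (1 / \<bar>cross2 u n\<bar>) * ennreal 2) = ennreal (4 * (norm n)\<^sup>2 / \<bar>cross2 u n\<bar>)"
   by (simp add: ennreal_mult[symmetric] del: ennreal_numeral)
  then show ?thesis by (simp add: mult_ac)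
 qed
 then show ?thesis using 1 unfolding 2 3 4 6 by simp
qed

section \<open>The Slobodeckij seminorm over pairs of lines\<close>

definition slob :: "(real^2 => real^2) => real^2 => real^2 => ennreal" where
 "slob v x y = ennreal ((norm (v x - v y))\<^sup>2 / (dist x y)\<^sup>2)"

lemma norm_diff_sq_le: "(norm (A - B))\<^sup>2 <= 2 * (norm A)\<^sup>2 + 2 * (norm (B :: 'a::real_normed_vector))\<^sup>2"
proof -
 have "(norm (A - B))\<^sup>2 <= (norm A + norm B)\<^sup>2" by (intro power_mono norm_triangle_ineq4) auto
 also have "\<dots> <= 2 * (norm A)\<^sup>2 + 2 * (norm B)\<^sup>2"
  using zero_le_power2[of "norm A - norm B"] by (simp add: power2_eq_square algebra_simps)
 finally show ?thesis .
qed

text \<open>An increment is split into two legs whose steps \<open>t\<close> and \<open>s\<close>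
  are at most multiples of \<open>D\<close>. A quotient with denominator 0 is 0, so a leg of step 0
  has to be assumed to have increment 0.\<close>

lemma quotient_split:
 fixes A B :: "real^2"
 assumes a: "0 < \<alpha>" "0 < \<beta>" and D: "\<alpha>\<^sup>2 * t\<^sup>2 <= D\<^sup>2" "\<beta>\<^sup>2 * s\<^sup>2 <= D\<^sup>2"
  and z: "t = 0 ==> A = 0" "s = 0 ==> B = 0"
 shows "(norm (A - B))\<^sup>2 / D\<^sup>2 <= 2 / \<alpha>\<^sup>2 * ((norm A)\<^sup>2 / t\<^sup>2) + 2 / \<beta>\<^sup>2 * ((norm B)\<^sup>2 / s\<^sup>2)"
proof -
 have *: "(norm X)\<^sup>2 / D\<^sup>2 <= 1 / c\<^sup>2 * ((norm X)\<^sup>2 / r\<^sup>2)"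
  if "0 < c" "c\<^sup>2 * r\<^sup>2 <= D\<^sup>2" "r = 0 ==> X = 0" for X :: "real^2" and c r
 proof (cases "r = 0")
  case False
  then have pos: "0 < c\<^sup>2 * r\<^sup>2" using that(1) by simp
  then have "0 < D\<^sup>2" using that(2) by linarith
  then have "(norm X)\<^sup>2 / D\<^sup>2 <= (norm X)\<^sup>2 / (c\<^sup>2 * r\<^sup>2)"
   by (intro divide_left_mono that(2) mult_pos_pos pos) simp
  then show ?thesis by (simp add: mult.commute)
 qed (use that in simp)
 have "(norm (A - B))\<^sup>2 / D\<^sup>2 <= (2 * (norm A)\<^sup>2 + 2 * (norm B)\<^sup>2) / D\<^sup>2"
  by (intro divide_right_mono norm_diff_sq_le) simp
 also have "\<dots> = 2 * ((norm A)\<^sup>2 / D\<^sup>2) + 2 * ((norm B)\<^sup>2 / D\<^sup>2)" by (simp add: add_divide_distrib)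
 finally show ?thesis using *[OF a(1) D(1) z(1)] *[OF a(2) D(2) z(2)] by simp
qed

text \<open>Enlarges both segments to full lines, where integrals over two parameters become
  integrals over the plane.\<close>

lemma segint2_le:
 assumes f: "(\<lambda>(x, y). f x y) \<in> borel_measurable (borel \<Otimes>\<^sub>M borel)"
 shows "segint a b (\<lambda>x. segint c d (f x)) <= ennreal (dist a b * dist c d) *
  (\<integral>\<^sup>+s. \<integral>\<^sup>+t. f (a + s *\<^sub>R (b - a)) (c + t *\<^sub>R (d - c)) \<partial>lborel \<partial>lborel)"
proof -
 have fm: "(\<lambda>z. f (g z) (h z)) \<in> borel_measurable M" if "g \<in> borel_measurable M" "h \<in> borel_measurable M" for g h M
  using measurable_compose[OF measurable_Pair[OF that] f] by simp
 have in_le: "segint c d (f x) <= ennreal (dist c d) * (\<integral>\<^sup>+t. f x (c + t *\<^sub>R (d - c)) \<partial>lborel)" for x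
  unfolding segint_def linepath_affine
  by (intro mult_left_mono nn_integral_mono) (auto simp: indicator_def)
 have "segint a b (\<lambda>x. segint c d (f x)) <=
  ennreal (dist a b) * (\<integral>\<^sup>+s. ennreal (dist c d) * (\<integral>\<^sup>+t. f (a + s *\<^sub>R (b - a)) (c + t *\<^sub>R (d - c)) \<partial>lborel) \<partial>lborel)"
  unfolding segint_def[of a b] linepath_affine[of a b]
 proof (intro mult_left_mono nn_integral_mono)
  fix s :: real
  show "segint c d (f (a + s *\<^sub>R (b - a))) * indicator {0..1} s <=
   ennreal (dist c d) * (\<integral>\<^sup>+t. f (a + s *\<^sub>R (b - a)) (c + t *\<^sub>R (d - c)) \<partial>lborel)"
   using in_le[of "a + s *\<^sub>R (b - a)"] by (auto simp: indicator_def)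
 qed simp
 also have "(\<integral>\<^sup>+s. ennreal (dist c d) * (\<integral>\<^sup>+t. f (a + s *\<^sub>R (b - a)) (c + t *\<^sub>R (d - c)) \<partial>lborel) \<partial>lborel) =
  ennreal (dist c d) * (\<integral>\<^sup>+s. \<integral>\<^sup>+t. f (a + s *\<^sub>R (b - a)) (c + t *\<^sub>R (d - c)) \<partial>lborel \<partial>lborel)"
  by (intro nn_integral_cmult lborel.borel_measurable_nn_integral) (simp only: split_def, intro fm, measurable)
 finally show ?thesis by (simp add: ennreal_mult mult.assoc)
qed

lemma slob_measurable:
 assumes [measurable]: "v \<in> borel_measurable borel"
 shows "(\<lambda>(x, y). slob v x y) \<in> borel_measurable (borel \<Otimes>\<^sub>M borel)"
 unfolding slob_def by measurable

definition dq :: "(real^2 => real^2) => real^2 => real^2 => real^2 => real => real => ennreal" where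
 "dq v p u n s r = ennreal ((norm (v (p + s *\<^sub>R u + r *\<^sub>R n) - v (p + s *\<^sub>R u)))\<^sup>2 / r\<^sup>2)"

lemma dq_measurable:
 assumes [measurable]: "v \<in> borel_measurable borel"
  and [measurable]: "f \<in> borel_measurable M" "g \<in> borel_measurable M"
 shows "(\<lambda>z. dq v p u n (f z) (g z)) \<in> borel_measurable M"
 unfolding dq_def by measurable

lemma nn_integral2_add:
 assumes f: "(\<lambda>(s, t). f s t) \<in> borel_measurable (lborel \<Otimes>\<^sub>M lborel)"
  and g: "(\<lambda>(s, t). g s t) \<in> borel_measurable (lborel \<Otimes>\<^sub>M lborel)"
 shows "(\<integral>\<^sup>+s. \<integral>\<^sup>+t. ennreal c * f s t + ennreal d * g s t \<partial>(lborel::real measure) \<partial>(lborel::real measure)) =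
  ennreal c * (\<integral>\<^sup>+s. \<integral>\<^sup>+t. f s t \<partial>lborel \<partial>lborel) + ennreal d * (\<integral>\<^sup>+s. \<integral>\<^sup>+t. g s t \<partial>lborel \<partial>lborel)"
proof -
 have [measurable]: "f s \<in> borel_measurable lborel" "g s \<in> borel_measurable lborel" for s
  using measurable_Pair2[OF f, of s] measurable_Pair2[OF g, of s] by simp_all
 have [measurable]: "(\<lambda>s. \<integral>\<^sup>+t. f s t \<partial>lborel) \<in> borel_measurable lborel" "(\<lambda>s. \<integral>\<^sup>+t. g s t \<partial>lborel) \<in> borel_measurable lborel"
  using lborel.borel_measurable_nn_integral[OF f] lborel.borel_measurable_nn_integral[OF g] by simp_all
 show ?thesis by (simp add: nn_integral_add nn_integral_cmult)
qed

lemma nn_integral_shift: "f \<in> borel_measurable borel ==> (\<integral>\<^sup>+x. f (c + x) \<partial>lborel) = (\<integral>\<^sup>+x. f x \<partial>(lborel :: real measure))"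
 using nn_integral_real_affine[of f 1 c] by simp

text \<open>The two points are joined via the fourth corner
  \<open>p + s *\<^sub>R u + t *\<^sub>R w\<close> of a parallelogram at the intersection
  \<open>p\<close>. As the lines cross at an angle, both legs are at most a multiple of the distance
  of the points, and each leg is covered by \<open>difference_quotient_estimate\<close>.\<close>

lemma crossing_lines:
 assumes v: "pw_smooth \<Omega> E v" and X: "cross2 u w ~= 0"
 shows "(\<integral>\<^sup>+s. \<integral>\<^sup>+t. slob v (a + s *\<^sub>R u) (c + t *\<^sub>R w) \<partial>lborel \<partial>lborel) <=
  ennreal (16 * (norm u)\<^sup>2 * (norm w)\<^sup>2 / \<bar>cross2 u w\<bar> ^ 3) * denergy E v"
proof -
 note vm = pw_smooth_measurable[OF v]
 note [measurable] = vm
 define X where "X = cross2 u w"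
 have X0: "X ~= 0" using assms by (simp add: X_def)
 \<comment> \<open>Cramer's rule for the intersection of the two lines.\<close>
 define s0 where "s0 = cross2 (c - a) w / X"
 define t0 where "t0 = cross2 (c - a) u / X"
 define p where "p = a + s0 *\<^sub>R u"
 have p: "p = c + t0 *\<^sub>R w"
 proof -
  have "(a + s0 *\<^sub>R u) $ i = (c + t0 *\<^sub>R w) $ i" for i
   using X0 exhaust_2[of i] unfolding s0_def t0_def
   by (auto simp: X_def cross2_def field_simps)
  then show ?thesis by (simp add: p_def cart_eq_iff)
 qed
 have u0: "0 < norm u" "0 < norm w" using X by (auto simp: cross2_simps)
 have e1: "a + (s0 + s) *\<^sub>R u = p + s *\<^sub>R u" "c + (t0 + s) *\<^sub>R w = p + s *\<^sub>R w" for s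
  by (simp add: p_def algebra_simps) (simp add: p algebra_simps)
 have sm: "(\<lambda>z. slob v (f z) (g z)) \<in> borel_measurable M" if "f \<in> borel_measurable M" "g \<in> borel_measurable M" for f g M
  using measurable_compose[OF measurable_Pair[OF that] slob_measurable[OF vm]] by simp
 have in1: "(\<integral>\<^sup>+t. slob v x (c + t *\<^sub>R w) \<partial>lborel) = (\<integral>\<^sup>+t. slob v x (p + t *\<^sub>R w) \<partial>lborel)" for x
  unfolding e1(2)[symmetric]
  by (rule nn_integral_shift[symmetric]) (intro sm, measurable)
 have sh1: "(\<integral>\<^sup>+s. \<integral>\<^sup>+t. slob v (a + s *\<^sub>R u) (p + t *\<^sub>R w) \<partial>lborel \<partial>lborel) = (\<integral>\<^sup>+s. \<integral>\<^sup>+t. slob v (p + s *\<^sub>R u) (p + t *\<^sub>R w) \<partial>lborel \<partial>lborel)"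
  unfolding e1(1)[symmetric]
  by (rule nn_integral_shift[symmetric], rule lborel.borel_measurable_nn_integral)
   (simp only: split_def, intro sm, measurable)
 have shift: "(\<integral>\<^sup>+s. \<integral>\<^sup>+t. slob v (a + s *\<^sub>R u) (c + t *\<^sub>R w) \<partial>lborel \<partial>lborel) =
  (\<integral>\<^sup>+s. \<integral>\<^sup>+t. slob v (p + s *\<^sub>R u) (p + t *\<^sub>R w) \<partial>lborel \<partial>lborel)"
  unfolding in1 sh1 ..
 let ?c = "2 * (norm u)\<^sup>2 / X\<^sup>2" and ?d = "2 * (norm w)\<^sup>2 / X\<^sup>2"
 have pt: "slob v (p + s *\<^sub>R u) (p + t *\<^sub>R w) <= ennreal ?c * dq v p u w s t + ennreal ?d * dq v p w u t s" for s t
 proof -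
  let ?A = "v (p + s *\<^sub>R u + t *\<^sub>R w) - v (p + s *\<^sub>R u)"
  let ?B = "v (p + t *\<^sub>R w + s *\<^sub>R u) - v (p + t *\<^sub>R w)"
  let ?D = "dist (p + s *\<^sub>R u) (p + t *\<^sub>R w)"
  have sc: "(\<bar>X\<bar> / N)\<^sup>2 * r\<^sup>2 <= ?D\<^sup>2" if N: "0 < N" and le: "\<bar>r * X\<bar> <= N * ?D" for N r
  proof -
   have "(\<bar>X\<bar> / N)\<^sup>2 * r\<^sup>2 = \<bar>r * X\<bar>\<^sup>2 / N\<^sup>2" by (simp add: power_divide power_mult_distrib)
   also have "\<dots> <= (N * ?D)\<^sup>2 / N\<^sup>2" by (intro divide_right_mono power_mono le) auto
   also have "\<dots> = ?D\<^sup>2" using N by (simp add: power_mult_distrib)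
   finally show ?thesis .
  qed
  have "\<bar>t * X\<bar> <= norm u * ?D"
   using abs_cross2_le[of u "s *\<^sub>R u - t *\<^sub>R w"] by (simp add: dist_norm cross2_simps X_def abs_mult)
  then have d1: "(\<bar>X\<bar> / norm u)\<^sup>2 * t\<^sup>2 <= ?D\<^sup>2" by (rule sc[OF u0(1)])
  have "\<bar>s * X\<bar> <= norm w * ?D"
   using abs_cross2_le[of "s *\<^sub>R u - t *\<^sub>R w" w] by (simp add: dist_norm cross2_simps X_def abs_mult mult.commute)
  then have d2: "(\<bar>X\<bar> / norm w)\<^sup>2 * s\<^sup>2 <= ?D\<^sup>2" by (rule sc[OF u0(2)])
  have "(norm (?A - ?B))\<^sup>2 / ?D\<^sup>2 <= 2 / (\<bar>X\<bar> / norm u)\<^sup>2 * ((norm ?A)\<^sup>2 / t\<^sup>2) + 2 / (\<bar>X\<bar> / norm w)\<^sup>2 * ((norm ?B)\<^sup>2 / s\<^sup>2)"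
   by (rule quotient_split[OF _ _ d1 d2]) (use X0 u0 in auto)
  moreover have "norm (?A - ?B) = norm (v (p + s *\<^sub>R u) - v (p + t *\<^sub>R w))"
   by (simp add: add_ac norm_minus_commute)
  ultimately have "(norm (v (p + s *\<^sub>R u) - v (p + t *\<^sub>R w)))\<^sup>2 / ?D\<^sup>2 <=
   ?c * ((norm ?A)\<^sup>2 / t\<^sup>2) + ?d * ((norm ?B)\<^sup>2 / s\<^sup>2)"
   by (simp add: power_divide)
  then have "slob v (p + s *\<^sub>R u) (p + t *\<^sub>R w) <= ennreal (?c * ((norm ?A)\<^sup>2 / t\<^sup>2) + ?d * ((norm ?B)\<^sup>2 / s\<^sup>2))"
   unfolding slob_def by (rule ennreal_leI)
  also have "\<dots> = ennreal ?c * dq v p u w s t + ennreal ?d * dq v p w u t s"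
   unfolding dq_def by (subst ennreal_plus) (simp_all add: ennreal_mult[symmetric])
  finally show ?thesis .
 qed
 have b1: "(\<integral>\<^sup>+s. \<integral>\<^sup>+t. slob v (p + s *\<^sub>R u) (p + t *\<^sub>R w) \<partial>lborel \<partial>lborel) <=
  (\<integral>\<^sup>+s. \<integral>\<^sup>+t. ennreal ?c * dq v p u w s t + ennreal ?d * dq v p w u t s \<partial>lborel \<partial>lborel)"
  by (intro nn_integral_mono pt)
 have b2: "(\<integral>\<^sup>+s. \<integral>\<^sup>+t. ennreal ?c * dq v p u w s t + ennreal ?d * dq v p w u t s \<partial>lborel \<partial>lborel) =
   ennreal ?c * (\<integral>\<^sup>+s. \<integral>\<^sup>+t. dq v p u w s t \<partial>lborel \<partial>lborel) +
   ennreal ?d * (\<integral>\<^sup>+s. \<integral>\<^sup>+t. dq v p w u t s \<partial>lborel \<partial>lborel)"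
  by (rule nn_integral2_add) (simp_all only: split_def, (intro dq_measurable vm; measurable)+)
 have b3: "(\<integral>\<^sup>+s. \<integral>\<^sup>+t. dq v p w u t s \<partial>lborel \<partial>lborel) = (\<integral>\<^sup>+t. \<integral>\<^sup>+s. dq v p w u t s \<partial>lborel \<partial>lborel)"
  by (rule lborel_pair.Fubini') (simp only: split_def, intro dq_measurable vm; measurable)
 have b4: "(\<integral>\<^sup>+s. \<integral>\<^sup>+t. dq v p u w s t \<partial>lborel \<partial>lborel) <= ennreal (4 * (norm w)\<^sup>2 / \<bar>X\<bar>) * denergy E v"
  unfolding dq_def X_def by (rule difference_quotient_estimate[OF v X])
 have b5: "(\<integral>\<^sup>+t. \<integral>\<^sup>+s. dq v p w u t s \<partial>lborel \<partial>lborel) <= ennreal (4 * (norm u)\<^sup>2 / \<bar>X\<bar>) * denergy E v"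
  using difference_quotient_estimate[OF v, of w u p] X
  unfolding dq_def X_def by (simp add: cross2_commute[of w u])
 have b6: "ennreal ?c * (ennreal (4 * (norm w)\<^sup>2 / \<bar>X\<bar>) * denergy E v) + ennreal ?d * (ennreal (4 * (norm u)\<^sup>2 / \<bar>X\<bar>) * denergy E v)
  = ennreal (?c * (4 * (norm w)\<^sup>2 / \<bar>X\<bar>) + ?d * (4 * (norm u)\<^sup>2 / \<bar>X\<bar>)) * denergy E v"
  by (subst ennreal_plus) (simp_all add: ennreal_mult[symmetric] distrib_right mult.assoc[symmetric])
 have b7: "?c * (4 * (norm w)\<^sup>2 / \<bar>X\<bar>) + ?d * (4 * (norm u)\<^sup>2 / \<bar>X\<bar>) = 16 * (norm u)\<^sup>2 * (norm w)\<^sup>2 / \<bar>X\<bar> ^ 3"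
  using X0 by (simp add: power2_eq_square power3_eq_cube divide_simps)
 have "(\<integral>\<^sup>+s. \<integral>\<^sup>+t. slob v (p + s *\<^sub>R u) (p + t *\<^sub>R w) \<partial>lborel \<partial>lborel) <=
  ennreal (16 * (norm u)\<^sup>2 * (norm w)\<^sup>2 / \<bar>X\<bar> ^ 3) * denergy E v"
  unfolding b7[symmetric] b6[symmetric]
  by (rule order_trans[OF b1], unfold b2 b3, rule add_mono[OF mult_left_mono[OF b4] mult_left_mono[OF b5]]) simp_all
 then show ?thesis unfolding shift X_def .
qed

text \<open>On a single line the detour has to leave it: it passes the third corner
  \<open>a + s *\<^sub>R u + r *\<^sub>R n\<close> of an isosceles right triangle, along the
  directions \<open>n\<close> and \<open>m = n - u\<close>. The two legs contribute the constants 4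
  and 8, because the squared norm of \<open>m\<close> is twice that of \<open>u\<close>, and
  \<open>2 * (4 + 8) = 24\<close>.\<close>

lemma same_line:
 assumes v: "pw_smooth \<Omega> E v" and u: "u ~= 0"
 shows "(\<integral>\<^sup>+s. \<integral>\<^sup>+t. slob v (a + s *\<^sub>R u) (a + t *\<^sub>R u) \<partial>lborel \<partial>lborel) <=
  ennreal (24 / (norm u)\<^sup>2) * denergy E v"
proof -
 note vm = pw_smooth_measurable[OF v]
 note [measurable] = vm
 have sm: "(\<lambda>z. slob v (f z) (g z)) \<in> borel_measurable M" if "f \<in> borel_measurable M" "g \<in> borel_measurable M" for f g M
  using measurable_compose[OF measurable_Pair[OF that] slob_measurable[OF vm]] by simp
 define n where "n = perp u"
 define m where "m = n - u"
 have u0: "0 < norm u" using u by simp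
 have Xn: "cross2 u n = (norm u)\<^sup>2" by (simp add: n_def cross2_perp)
 have Xm: "cross2 u m = (norm u)\<^sup>2" by (simp add: m_def cross2_simps Xn)
 have nn: "(norm n)\<^sup>2 = (norm u)\<^sup>2" by (simp add: n_def)
 have nm: "(norm m)\<^sup>2 = 2 * (norm u)\<^sup>2"
  by (simp add: m_def n_def perp_def power2_norm_eq_inner inner_vec_def sum_2 algebra_simps)
 have s1: "(\<integral>\<^sup>+t. slob v x (a + t *\<^sub>R u) \<partial>lborel) = (\<integral>\<^sup>+r. slob v x (a + (s + r) *\<^sub>R u) \<partial>lborel)" for x s
  by (rule nn_integral_shift[symmetric]) (intro sm, measurable)
 let ?c = "2 / (norm u)\<^sup>2"
 have pt: "slob v (a + s *\<^sub>R u) (a + (s + r) *\<^sub>R u) <= ennreal ?c * dq v a u n s r + ennreal ?c * dq v a u m (s + r) r" for s r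
 proof -
  let ?A = "v (a + s *\<^sub>R u + r *\<^sub>R n) - v (a + s *\<^sub>R u)"
  let ?B = "v (a + (s + r) *\<^sub>R u + r *\<^sub>R m) - v (a + (s + r) *\<^sub>R u)"
  let ?D = "dist (a + s *\<^sub>R u) (a + (s + r) *\<^sub>R u)"
  have "a + s *\<^sub>R u - (a + (s + r) *\<^sub>R u) = - (r *\<^sub>R u)" by (simp add: algebra_simps)
  then have "?D = norm u * \<bar>r\<bar>" by (simp add: dist_norm)
  then have D: "(norm u)\<^sup>2 * r\<^sup>2 <= ?D\<^sup>2" by (simp add: power_mult_distrib)
  have "(norm (?A - ?B))\<^sup>2 / ?D\<^sup>2 <= ?c * ((norm ?A)\<^sup>2 / r\<^sup>2) + ?c * ((norm ?B)\<^sup>2 / r\<^sup>2)"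
   by (rule quotient_split[OF u0 u0 D D]) auto
  moreover have "a + (s + r) *\<^sub>R u + r *\<^sub>R m = a + s *\<^sub>R u + r *\<^sub>R n" by (simp add: m_def algebra_simps)
  then have "?A - ?B = - (v (a + s *\<^sub>R u) - v (a + (s + r) *\<^sub>R u))" by (simp only:) simp
  then have "norm (?A - ?B) = norm (v (a + s *\<^sub>R u) - v (a + (s + r) *\<^sub>R u))"
   by (simp only: norm_minus_cancel)
  ultimately have "(norm (v (a + s *\<^sub>R u) - v (a + (s + r) *\<^sub>R u)))\<^sup>2 / ?D\<^sup>2 <=
   ?c * ((norm ?A)\<^sup>2 / r\<^sup>2) + ?c * ((norm ?B)\<^sup>2 / r\<^sup>2)" by (simp only:)
  then have "slob v (a + s *\<^sub>R u) (a + (s + r) *\<^sub>R u) <= ennreal (?c * ((norm ?A)\<^sup>2 / r\<^sup>2) + ?c * ((norm ?B)\<^sup>2 / r\<^sup>2))"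
   unfolding slob_def by (rule ennreal_leI)
  also have "\<dots> = ennreal ?c * dq v a u n s r + ennreal ?c * dq v a u m (s + r) r"
   unfolding dq_def by (subst ennreal_plus) (simp_all add: ennreal_mult[symmetric])
  finally show ?thesis .
 qed
 \<comment> \<open>The second leg starts at parameter \<open>s + r\<close>; for fixed
   \<open>r\<close> this is a translation in \<open>s\<close>.\<close>
 have s2: "(\<integral>\<^sup>+s. \<integral>\<^sup>+r. dq v a u m (s + r) r \<partial>lborel \<partial>lborel) = (\<integral>\<^sup>+s. \<integral>\<^sup>+r. dq v a u m s r \<partial>lborel \<partial>lborel)"
 proof -
  have f1: "(\<integral>\<^sup>+s. \<integral>\<^sup>+r. dq v a u m (s + r) r \<partial>lborel \<partial>lborel) = (\<integral>\<^sup>+r. \<integral>\<^sup>+s. dq v a u m (s + r) r \<partial>lborel \<partial>lborel)"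
   by (rule lborel_pair.Fubini') (simp only: split_def, intro dq_measurable vm; measurable)
  have f2: "(\<integral>\<^sup>+s. dq v a u m (s + r) r \<partial>lborel) = (\<integral>\<^sup>+s. dq v a u m s r \<partial>lborel)" for r
   unfolding add.commute[of _ r]
   by (rule nn_integral_shift) (intro dq_measurable vm; measurable)
  have f3: "(\<integral>\<^sup>+s. \<integral>\<^sup>+r. dq v a u m s r \<partial>lborel \<partial>lborel) = (\<integral>\<^sup>+r. \<integral>\<^sup>+s. dq v a u m s r \<partial>lborel \<partial>lborel)"
   by (rule lborel_pair.Fubini') (simp only: split_def, intro dq_measurable vm; measurable)
  show ?thesis unfolding f1 f2 f3 ..
 qed
 have b1: "(\<integral>\<^sup>+s. \<integral>\<^sup>+t. slob v (a + s *\<^sub>R u) (a + t *\<^sub>R u) \<partial>lborel \<partial>lborel) <=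
  (\<integral>\<^sup>+s. \<integral>\<^sup>+r. ennreal ?c * dq v a u n s r + ennreal ?c * dq v a u m (s + r) r \<partial>lborel \<partial>lborel)"
 proof (rule nn_integral_mono)
  fix s :: real
  show "(\<integral>\<^sup>+t. slob v (a + s *\<^sub>R u) (a + t *\<^sub>R u) \<partial>lborel) <=
   (\<integral>\<^sup>+r. ennreal ?c * dq v a u n s r + ennreal ?c * dq v a u m (s + r) r \<partial>lborel)"
   unfolding s1[of _ s] by (intro nn_integral_mono pt)
 qed
 have b2: "(\<integral>\<^sup>+s. \<integral>\<^sup>+r. ennreal ?c * dq v a u n s r + ennreal ?c * dq v a u m (s + r) r \<partial>lborel \<partial>lborel) =
   ennreal ?c * (\<integral>\<^sup>+s. \<integral>\<^sup>+r. dq v a u n s r \<partial>lborel \<partial>lborel) +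
   ennreal ?c * (\<integral>\<^sup>+s. \<integral>\<^sup>+r. dq v a u m (s + r) r \<partial>lborel \<partial>lborel)"
  by (rule nn_integral2_add) (simp_all only: split_def, (intro dq_measurable vm; measurable)+)
 have b4: "(\<integral>\<^sup>+s. \<integral>\<^sup>+r. dq v a u n s r \<partial>lborel \<partial>lborel) <= ennreal 4 * denergy E v"
  using difference_quotient_estimate[OF v, of u n a] u unfolding dq_def by (simp add: Xn nn)
 have b5: "(\<integral>\<^sup>+s. \<integral>\<^sup>+r. dq v a u m s r \<partial>lborel \<partial>lborel) <= ennreal 8 * denergy E v"
  using difference_quotient_estimate[OF v, of u m a] u unfolding dq_def by (simp add: Xm nm)
 have b6: "ennreal ?c * (ennreal 4 * denergy E v) + ennreal ?c * (ennreal 8 * denergy E v) =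
  ennreal (?c * 4 + ?c * 8) * denergy E v"
  by (subst ennreal_plus) (simp_all add: ennreal_mult[symmetric] distrib_right mult.assoc[symmetric] del: ennreal_numeral)
 have b7: "?c * 4 + ?c * 8 = 24 / (norm u)\<^sup>2" by simp
 show ?thesis
  unfolding b7[symmetric] b6[symmetric]
  by (rule order_trans[OF b1], unfold b2 s2, rule add_mono[OF mult_left_mono[OF b4] mult_left_mono[OF b5]]) simp_all
qed

text \<open>Far along the normal \<open>v\<close> vanishes, so the value on the segment is itself an
  increment, with step between \<open>r0\<close> and \<open>r0 + 1\<close>. The difference quotient
  estimate then bounds it by the gradient alone.\<close>

lemma L2_trace:
 assumes ab: "a ~= b" and \<Omega>: "bounded \<Omega>"
 shows "\<exists>K\<ge>0. \<forall>E v. pw_smooth \<Omega> E v --> segint a b (\<lambda>x. ennreal ((norm (v x))\<^sup>2)) <= ennreal K * denergy E v"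
proof -
 obtain R where R: "0 < R" "!!x. x \<in> \<Omega> ==> norm x <= R" using \<Omega> by (auto simp: bounded_pos)
 define u where "u = b - a"
 define n where "n = perp u"
 have u0: "0 < norm u" using ab by (simp add: u_def)
 \<comment> \<open>Chosen so that all points at least \<open>r0\<close> steps along the normal from
   the segment have norm greater than \<open>R\<close>.\<close>
 define r0 where "r0 = (norm a + norm u + R + 1) / norm u"
 have r0: "0 < r0" using u0 R(1) unfolding r0_def by (intro divide_pos_pos add_nonneg_pos) auto
 have Xn: "cross2 u n = (norm u)\<^sup>2" by (simp add: n_def cross2_perp)
 have far: "a + s *\<^sub>R u + r *\<^sub>R n \<notin> \<Omega>" if "s \<in> {0..1}" "r0 <= r" for s r
 proof
  assume "a + s *\<^sub>R u + r *\<^sub>R n \<in> \<Omega>"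
  then have "norm (a + s *\<^sub>R u + r *\<^sub>R n) <= R" by (rule R)
  moreover have "norm (r *\<^sub>R n) <= norm (a + s *\<^sub>R u + r *\<^sub>R n) + norm (a + s *\<^sub>R u)"
   using norm_triangle_ineq4[of "a + s *\<^sub>R u + r *\<^sub>R n" "a + s *\<^sub>R u"] by simp
  moreover have "norm (a + s *\<^sub>R u) <= norm a + norm u"
  proof -
   have "\<bar>s\<bar> * norm u <= 1 * norm u" using that by (intro mult_right_mono) auto
   then show ?thesis using norm_triangle_ineq[of a "s *\<^sub>R u"] by simp
  qed
  moreover have "norm a + norm u + R + 1 <= norm (r *\<^sub>R n)"
  proof -
   have "r0 * norm u <= r * norm u" using that u0 by simp
   then show ?thesis using u0 r0 that by (simp add: r0_def n_def)
  qed
  ultimately show False by linarith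
 qed
 define K where "K = norm u * ((r0 + 1)\<^sup>2 * 4)"
 show ?thesis
 proof (intro exI[of _ K] conjI allI impI)
  show "0 <= K" by (simp add: K_def)
  fix E v assume v: "pw_smooth \<Omega> E v"
  note vm = pw_smooth_measurable[OF v]
  note [measurable] = vm
  have v0: "v x = 0" if "x \<notin> \<Omega>" for x using v that by (simp add: pw_smooth_def)
  let ?q = "\<lambda>s. ennreal ((norm (v (a + s *\<^sub>R u)))\<^sup>2)"
  have lo: "?q s * indicator {0..1} s <= ennreal ((r0 + 1)\<^sup>2) * (\<integral>\<^sup>+r. dq v a u n s r \<partial>lborel)" for s
  proof (cases "s \<in> {0..1}")
   case True
   have "?q s = (\<integral>\<^sup>+r. ?q s * indicator {r0..r0+1} r \<partial>lborel)"
    by (subst nn_integral_cmult_indicator) auto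
   also have "\<dots> <= (\<integral>\<^sup>+r. ennreal ((r0 + 1)\<^sup>2) * dq v a u n s r \<partial>lborel)"
   proof (rule nn_integral_mono)
    fix r :: real
    show "?q s * indicator {r0..r0+1} r <= ennreal ((r0 + 1)\<^sup>2) * dq v a u n s r"
    proof (cases "r \<in> {r0..r0+1}")
     case r: True
     have "1 <= (r0 + 1)\<^sup>2 / r\<^sup>2" using r r0 by (simp add: power_mono)
     then have "(norm (v (a + s *\<^sub>R u)))\<^sup>2 * 1 <= (norm (v (a + s *\<^sub>R u)))\<^sup>2 * ((r0 + 1)\<^sup>2 / r\<^sup>2)"
      by (rule mult_left_mono) simp
     then have "ennreal ((norm (v (a + s *\<^sub>R u)))\<^sup>2) <= ennreal ((r0 + 1)\<^sup>2 * ((norm (v (a + s *\<^sub>R u)))\<^sup>2 / r\<^sup>2))"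
      by (intro ennreal_leI) (simp add: mult.commute)
     then have "ennreal ((norm (v (a + s *\<^sub>R u)))\<^sup>2) <= ennreal ((r0 + 1)\<^sup>2) * ennreal ((norm (v (a + s *\<^sub>R u)))\<^sup>2 / r\<^sup>2)"
      by (subst ennreal_mult[symmetric]) simp_all
     moreover have "v (a + s *\<^sub>R u + r *\<^sub>R n) = 0" using r by (intro v0 far[OF True]) simp
     ultimately show ?thesis using r by (simp add: dq_def)
    qed simp
   qed
   also have "\<dots> = ennreal ((r0 + 1)\<^sup>2) * (\<integral>\<^sup>+r. dq v a u n s r \<partial>lborel)"
    by (rule nn_integral_cmult) (intro dq_measurable vm; measurable)
   finally show ?thesis using True by simp
  qed simp
  have m: "(\<lambda>s. \<integral>\<^sup>+r. dq v a u n s r \<partial>lborel) \<in> borel_measurable lborel"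
   by (rule lborel.borel_measurable_nn_integral) (simp only: split_def, intro dq_measurable vm; measurable)
  have i1: "(\<integral>\<^sup>+s. ?q s * indicator {0..1} s \<partial>lborel) <=
   (\<integral>\<^sup>+s. ennreal ((r0 + 1)\<^sup>2) * (\<integral>\<^sup>+r. dq v a u n s r \<partial>lborel) \<partial>lborel)"
   by (intro nn_integral_mono lo)
  have i2: "(\<integral>\<^sup>+s. ennreal ((r0 + 1)\<^sup>2) * (\<integral>\<^sup>+r. dq v a u n s r \<partial>lborel) \<partial>lborel) =
   ennreal ((r0 + 1)\<^sup>2) * (\<integral>\<^sup>+s. \<integral>\<^sup>+r. dq v a u n s r \<partial>lborel \<partial>lborel)"
   by (rule nn_integral_cmult[OF m])
  have i3: "(\<integral>\<^sup>+s. \<integral>\<^sup>+r. dq v a u n s r \<partial>lborel \<partial>lborel) <= ennreal 4 * denergy E v"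
   using difference_quotient_estimate[OF v, of u n a] u0 unfolding dq_def by (simp add: Xn) (simp add: n_def)
  have d: "dist a b = norm u" by (simp add: u_def dist_norm norm_minus_commute)
  have "segint a b (\<lambda>x. ennreal ((norm (v x))\<^sup>2)) <= ennreal (norm u) * (ennreal ((r0 + 1)\<^sup>2) * (ennreal 4 * denergy E v))"
   unfolding segint_def d linepath_affine u_def[symmetric]
   by (rule mult_left_mono[OF order_trans[OF i1]], unfold i2, rule mult_left_mono[OF i3]) simp_all
  also have "\<dots> = ennreal K * denergy E v"
   unfolding K_def by (simp add: ennreal_mult mult.assoc del: ennreal_numeral)
  finally show "segint a b (\<lambda>x. ennreal ((norm (v x))\<^sup>2)) <= ennreal K * denergy E v" .
 qed
qed

lemma inv_le: "0 < C ==> 0 < D ==> C <= N * D ==> 1 / D <= N / (C::real)"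
 by (simp add: field_simps)

lemma segint_const: "segint a b (\<lambda>x. c) = ennreal (dist a b) * c"
 unfolding segint_def by (simp add: nn_integral_cmult_indicator)

text \<open>The carrying lines may cross, coincide, or be parallel and distinct. In the last case
  the distance of the points is bounded below, so the kernel is bounded and \<open>L2_trace\<close>
  suffices.\<close>

lemma pair_trace:
 assumes ab: "a ~= b" and cd: "c ~= d" and \<Omega>: "bounded \<Omega>"
 shows "\<exists>K\<ge>0. \<forall>E v. pw_smooth \<Omega> E v --> segint a b (\<lambda>x. segint c d (slob v x)) <= ennreal K * denergy E v"
proof -
 define u where "u = b - a"
 define w where "w = d - c"
 have u0: "u ~= 0" "w ~= 0" using ab cd by (auto simp: u_def w_def)
 let ?L = "dist a b * dist c d"
 have gen: "\<exists>K\<ge>0. \<forall>E v. pw_smooth \<Omega> E v --> segint a b (\<lambda>x. segint c d (slob v x)) <= ennreal K * denergy E v"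
  if K0: "0 <= K0" and bound: "!!E v. pw_smooth \<Omega> E v ==>
   (\<integral>\<^sup>+s. \<integral>\<^sup>+t. slob v (a + s *\<^sub>R u) (c + t *\<^sub>R w) \<partial>lborel \<partial>lborel) <= ennreal K0 * denergy E v" for K0
 proof (intro exI[of _ "?L * K0"] conjI allI impI)
  fix E v assume v: "pw_smooth \<Omega> E v"
  show "segint a b (\<lambda>x. segint c d (slob v x)) <= ennreal (?L * K0) * denergy E v"
   using order_trans[OF segint2_le[OF slob_measurable[OF pw_smooth_measurable[OF v]], of a b c d]
    mult_left_mono[OF bound[OF v, unfolded u_def w_def], of "ennreal ?L"]] K0
   by (simp add: ennreal_mult mult.assoc)
 qed (use K0 in simp)
 consider (cross) "cross2 u w ~= 0" | (same) "cross2 u w = 0" "cross2 u (c - a) = 0"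
  | (par) "cross2 u w = 0" "cross2 u (c - a) ~= 0" by blast
 then show ?thesis
 proof cases
  case cross
  show ?thesis by (rule gen[OF _ crossing_lines[OF _ cross]]) simp_all
 next
  case same
  have parallel: "\<exists>k. x = k *\<^sub>R u" if "cross2 u x = 0" for x
  proof -
   have "x = ((x \<bullet> u) / (u \<bullet> u)) *\<^sub>R u"
   proof -
    have "(u \<bullet> u) * x $ i = (x \<bullet> u) * u $ i" for i
     using exhaust_2[of i] that by (auto simp: cross2_def inner_vec_def sum_2 algebra_simps)
    then show ?thesis using u0(1) by (simp add: cart_eq_iff field_simps)
   qed
   then show ?thesis by blast
  qed
  obtain kap where kap: "w = kap *\<^sub>R u" using parallel[OF same(1)] by blast
  obtain \<sigma> where \<sigma>: "c - a = \<sigma> *\<^sub>R u" using parallel[OF same(2)] by blast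
  have kap0: "kap ~= 0" using kap u0 by auto
  have c: "c + t *\<^sub>R w = a + (\<sigma> + kap * t) *\<^sub>R u" for t
   using \<sigma> kap by (simp add: algebra_simps)
  show ?thesis
  proof (rule gen[of "1 / \<bar>kap\<bar> * (24 / (norm u)\<^sup>2)"])
   fix E v assume v: "pw_smooth \<Omega> E v"
   note [measurable] = pw_smooth_measurable[OF v]
   have sm: "(\<lambda>z. slob v (f z) (g z)) \<in> borel_measurable M" if "f \<in> borel_measurable M" "g \<in> borel_measurable M" for f g M
    using measurable_compose[OF measurable_Pair[OF that] slob_measurable[OF pw_smooth_measurable[OF v]]] by simp
   have i: "(\<integral>\<^sup>+t. slob v x (a + (\<sigma> + kap * t) *\<^sub>R u) \<partial>lborel) = ennreal (1 / \<bar>kap\<bar>) * (\<integral>\<^sup>+t. slob v x (a + t *\<^sub>R u) \<partial>lborel)" for x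
   proof -
    have "(\<integral>\<^sup>+t. slob v x (a + t *\<^sub>R u) \<partial>lborel) = ennreal \<bar>kap\<bar> * (\<integral>\<^sup>+t. slob v x (a + (\<sigma> + kap * t) *\<^sub>R u) \<partial>lborel)"
     by (rule nn_integral_real_affine[OF _ kap0]) (intro sm, measurable)
    then show ?thesis using kap0 by (simp add: mult.assoc[symmetric] ennreal_mult[symmetric])
   qed
   have "(\<integral>\<^sup>+s. \<integral>\<^sup>+t. slob v (a + s *\<^sub>R u) (c + t *\<^sub>R w) \<partial>lborel \<partial>lborel) =
    ennreal (1 / \<bar>kap\<bar>) * (\<integral>\<^sup>+s. \<integral>\<^sup>+t. slob v (a + s *\<^sub>R u) (a + t *\<^sub>R u) \<partial>lborel \<partial>lborel)"
    unfolding c i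
    by (intro nn_integral_cmult lborel.borel_measurable_nn_integral) (simp only: split_def, intro sm, measurable)
   then show "(\<integral>\<^sup>+s. \<integral>\<^sup>+t. slob v (a + s *\<^sub>R u) (c + t *\<^sub>R w) \<partial>lborel \<partial>lborel) <=
    ennreal (1 / \<bar>kap\<bar> * (24 / (norm u)\<^sup>2)) * denergy E v"
    using mult_left_mono[OF same_line[OF v u0(1), of a], of "ennreal (1 / \<bar>kap\<bar>)"]
    by (subst ennreal_mult) (simp_all add: mult.assoc)
  qed simp
 next
  case par
  define k where "k = 2 * ((norm u)\<^sup>2 / (cross2 u (c - a))\<^sup>2)"
  have k0: "0 <= k" by (simp add: k_def)
  have pt: "slob v (a + s *\<^sub>R u) (c + t *\<^sub>R w) <= ennreal k * (ennreal ((norm (v (a + s *\<^sub>R u)))\<^sup>2) + ennreal ((norm (v (c + t *\<^sub>R w)))\<^sup>2))" for v s t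
  proof -
   let ?x = "a + s *\<^sub>R u" and ?y = "c + t *\<^sub>R w"
   \<comment> \<open>For parallel lines the cross product of \<open>u\<close> with the difference of
     the points is constant, which bounds the distance from below.\<close>
   have "cross2 u (?y - ?x) = cross2 u (c - a)" using par(1) by (simp add: cross2_simps)
   then have "\<bar>cross2 u (c - a)\<bar> <= norm u * dist ?x ?y"
    using abs_cross2_le[of u "?y - ?x"] by (simp add: dist_norm norm_minus_commute)
   then have "\<bar>cross2 u (c - a)\<bar>\<^sup>2 <= (norm u * dist ?x ?y)\<^sup>2" by (rule power_mono) simp
   then have le: "(cross2 u (c - a))\<^sup>2 <= (norm u)\<^sup>2 * (dist ?x ?y)\<^sup>2" by (simp add: power_mult_distrib)
   have c0: "0 < (cross2 u (c - a))\<^sup>2" using par(2) by simp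
   then have D: "0 < (dist ?x ?y)\<^sup>2" using le by (cases "dist ?x ?y = 0") auto
   have inv: "1 / (dist ?x ?y)\<^sup>2 <= (norm u)\<^sup>2 / (cross2 u (c - a))\<^sup>2"
    by (rule inv_le[OF c0 D le])
   have "(norm (v ?x - v ?y))\<^sup>2 / (dist ?x ?y)\<^sup>2 = (norm (v ?x - v ?y))\<^sup>2 * (1 / (dist ?x ?y)\<^sup>2)" by simp
   also have "\<dots> <= (2 * (norm (v ?x))\<^sup>2 + 2 * (norm (v ?y))\<^sup>2) * ((norm u)\<^sup>2 / (cross2 u (c - a))\<^sup>2)"
    by (intro mult_mono norm_diff_sq_le inv) auto
   also have "\<dots> = k * ((norm (v ?x))\<^sup>2 + (norm (v ?y))\<^sup>2)" by (simp add: k_def algebra_simps)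
   finally have "slob v ?x ?y <= ennreal (k * ((norm (v ?x))\<^sup>2 + (norm (v ?y))\<^sup>2))"
    unfolding slob_def by (rule ennreal_leI)
   then show ?thesis using k0 by (simp add: ennreal_mult)
  qed
  from L2_trace[OF ab \<Omega>] obtain K1 where K1': "0 <= K1" "\<forall>E v. pw_smooth \<Omega> E v --> segint a b (\<lambda>x. ennreal ((norm (v x))\<^sup>2)) <= ennreal K1 * denergy E v"
   by (elim exE conjE)
  note K1 = K1'(1) K1'(2)[rule_format]
  from L2_trace[OF cd \<Omega>] obtain K2 where K2': "0 <= K2" "\<forall>E v. pw_smooth \<Omega> E v --> segint c d (\<lambda>x. ennreal ((norm (v x))\<^sup>2)) <= ennreal K2 * denergy E v"
   by (elim exE conjE)
  note K2 = K2'(1) K2'(2)[rule_format]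
  define K where "K = k * (dist c d * K1 + dist a b * K2)"
  show ?thesis
  proof (intro exI[of _ K] conjI allI impI)
   show "0 <= K" using k0 K1 K2 by (simp add: K_def)
   fix E v assume v: "pw_smooth \<Omega> E v"
   note [measurable] = pw_smooth_measurable[OF v]
   let ?q = "\<lambda>x. ennreal ((norm (v x))\<^sup>2)"
   have q [measurable]: "?q \<in> borel_measurable borel" by measurable
   have "segint a b (\<lambda>x. segint c d (slob v x)) <= segint a b (\<lambda>x. segint c d (\<lambda>y. ennreal k * (?q x + ?q y)))"
    by (intro segint_mono) (simp add: linepath_affine u_def[symmetric] w_def[symmetric] pt)
   also have "\<dots> = segint a b (\<lambda>x. ennreal k * (ennreal (dist c d) * ?q x + segint c d ?q))"
   proof (rule segint_cong)
    fix t
    show "segint c d (\<lambda>y. ennreal k * (?q (linepath a b t) + ?q y)) =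
     ennreal k * (ennreal (dist c d) * ?q (linepath a b t) + segint c d ?q)"
     by (subst segint_cmult, measurable, subst segint_add) (simp_all add: segint_const)
   qed
   also have "\<dots> = ennreal k * (ennreal (dist c d) * segint a b ?q + ennreal (dist a b) * segint c d ?q)"
    by (subst segint_cmult, measurable, subst segint_add) (simp_all add: segint_const segint_cmult)
   also have "\<dots> <= ennreal k * (ennreal (dist c d) * (ennreal K1 * denergy E v) + ennreal (dist a b) * (ennreal K2 * denergy E v))"
    by (intro mult_left_mono add_mono K1(2)[OF v] K2(2)[OF v]) simp_all
   also have "\<dots> = ennreal K * denergy E v"
    unfolding K_def using k0 K1 K2 by (simp add: ennreal_mult distrib_left distrib_right mult_ac)
   finally show "segint a b (\<lambda>x. segint c d (slob v x)) <= ennreal K * denergy E v" .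
  qed
 qed
qed

lemma segint_measurable:
 assumes f: "(\<lambda>(x, y). f x y) \<in> borel_measurable (borel \<Otimes>\<^sub>M borel)"
 shows "(\<lambda>x. segint a b (f x)) \<in> borel_measurable borel"
proof -
 have fm: "(\<lambda>z. f (g z) (h z)) \<in> borel_measurable M" if "g \<in> borel_measurable M" "h \<in> borel_measurable M" for g h M
  using measurable_compose[OF measurable_Pair[OF that] f] by simp
 have [measurable]: "(\<lambda>z. f (fst z) (linepath a b (snd z))) \<in> borel_measurable (borel \<Otimes>\<^sub>M lborel)"
  by (intro fm; measurable)
 have "(\<lambda>x. \<integral>\<^sup>+t. f x (linepath a b t) * indicator {0..1} t \<partial>lborel) \<in> borel_measurable borel"
  by (rule lborel.borel_measurable_nn_integral) (simp only: split_def, measurable)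
 then show ?thesis unfolding segint_def by measurable
qed

text \<open>\<open>K\<close> is fixed before \<open>E\<close> and \<open>v\<close>, which makes it
  independent of the quadrilateral mesh, though not of the segments in \<open>T\<close>. Only the
  gradient appears on the right because \<open>L2_trace\<close> already contains a Poincare
  argument.\<close>

theorem trace_inequality:
 assumes T: "finite T" and ne: "!!a b. (a, b) \<in> T ==> a ~= b" and \<Omega>: "bounded \<Omega>"
 shows "\<exists>K\<ge>0. \<forall>E v. pw_smooth \<Omega> E v --> Hhalf_sq T v <= ennreal K * denergy E v"
proof -
 have "\<forall>e\<in>T. \<exists>K. 0 <= K \<and> (\<forall>E v. pw_smooth \<Omega> E v --> segint (fst e) (snd e) (\<lambda>x. ennreal ((norm (v x))\<^sup>2)) <= ennreal K * denergy E v)"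
 proof
  fix e assume "e \<in> T"
  then have "fst e ~= snd e" using ne[of "fst e" "snd e"] by simp
  then show "\<exists>K. 0 <= K \<and> (\<forall>E v. pw_smooth \<Omega> E v --> segint (fst e) (snd e) (\<lambda>x. ennreal ((norm (v x))\<^sup>2)) <= ennreal K * denergy E v)"
   by (rule L2_trace[OF _ \<Omega>])
 qed
 from bchoice[OF this] obtain K1 where K1': "\<forall>e\<in>T. 0 <= K1 e \<and> (\<forall>E v. pw_smooth \<Omega> E v -->
  segint (fst e) (snd e) (\<lambda>x. ennreal ((norm (v x))\<^sup>2)) <= ennreal (K1 e) * denergy E v)" ..
 then have K1: "!!e. e \<in> T ==> 0 <= K1 e"
  "!!e E v. e \<in> T ==> pw_smooth \<Omega> E v ==> segint (fst e) (snd e) (\<lambda>x. ennreal ((norm (v x))\<^sup>2)) <= ennreal (K1 e) * denergy E v"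
  by blast+
 have "\<forall>p\<in>T \<times> T. \<exists>K. 0 <= K \<and> (\<forall>E v. pw_smooth \<Omega> E v -->
   segint (fst (fst p)) (snd (fst p)) (\<lambda>x. segint (fst (snd p)) (snd (snd p)) (slob v x)) <= ennreal K * denergy E v)"
 proof
  fix p assume p: "p \<in> T \<times> T"
  then have 1: "fst (fst p) ~= snd (fst p)" using ne[of "fst (fst p)" "snd (fst p)"] by auto
  from p have 2: "fst (snd p) ~= snd (snd p)" using ne[of "fst (snd p)" "snd (snd p)"] by auto
  show "\<exists>K. 0 <= K \<and> (\<forall>E v. pw_smooth \<Omega> E v -->
   segint (fst (fst p)) (snd (fst p)) (\<lambda>x. segint (fst (snd p)) (snd (snd p)) (slob v x)) <= ennreal K * denergy E v)"
   by (rule pair_trace[OF 1 2 \<Omega>])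
 qed
 from bchoice[OF this] obtain K' where K': "\<forall>p\<in>T \<times> T. 0 <= K' p \<and> (\<forall>E v. pw_smooth \<Omega> E v -->
   segint (fst (fst p)) (snd (fst p)) (\<lambda>x. segint (fst (snd p)) (snd (snd p)) (slob v x)) <= ennreal (K' p) * denergy E v)" ..
 define K2 where "K2 e f = K' (e, f)" for e f
 have K2: "0 <= K2 e f" "pw_smooth \<Omega> E v ==>
   segint (fst e) (snd e) (\<lambda>x. segint (fst f) (snd f) (slob v x)) <= ennreal (K2 e f) * denergy E v"
  if "e \<in> T" "f \<in> T" for e f E v
  using bspec[OF K', of "(e, f)"] that by (auto simp: K2_def)
 define K where "K = (\<Sum>e\<in>T. K1 e) + (\<Sum>e\<in>T. \<Sum>f\<in>T. K2 e f)"
 have pos: "0 <= (\<Sum>e\<in>T. K1 e)" "0 <= (\<Sum>e\<in>T. \<Sum>f\<in>T. K2 e f)"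
  using K1 K2 by (auto intro!: sum_nonneg)
 show ?thesis
 proof (intro exI[of _ K] conjI allI impI)
  show "0 <= K" using pos by (simp add: K_def)
  fix E v assume v: "pw_smooth \<Omega> E v"
  note vm [measurable] = pw_smooth_measurable[OF v]
  have m1: "(\<lambda>x. ennreal ((norm (v x))\<^sup>2)) \<in> borel_measurable borel" by measurable
  have ms: "slob v x \<in> borel_measurable borel" for x unfolding slob_def by measurable
  have a1: "(\<integral>\<^sup>+x. ennreal ((norm (v x))\<^sup>2) \<partial>arc_measure T) <= (\<Sum>e\<in>T. ennreal (K1 e) * denergy E v)"
   unfolding nn_integral_arc[OF m1 T] case_prod_beta by (intro sum_mono K1(2) v)
  have in2: "(\<integral>\<^sup>+y. ennreal ((norm (v x - v y))\<^sup>2 / (dist x y)\<^sup>2) \<partial>arc_measure T) = (\<Sum>f\<in>T. segint (fst f) (snd f) (slob v x))" for x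
   using nn_integral_arc[OF ms T] by (simp only: slob_def split_def)
  have m2: "(\<lambda>x. segint (fst f) (snd f) (slob v x)) \<in> borel_measurable borel" for f
   by (rule segint_measurable[OF slob_measurable[OF vm]])
  have m3: "(\<lambda>x. \<Sum>f\<in>T. segint (fst f) (snd f) (slob v x)) \<in> borel_measurable borel"
   using m2 by (rule borel_measurable_sum)
  have a2: "(\<integral>\<^sup>+x. (\<integral>\<^sup>+y. ennreal ((norm (v x - v y))\<^sup>2 / (dist x y)\<^sup>2) \<partial>arc_measure T) \<partial>arc_measure T) <=
   (\<Sum>e\<in>T. \<Sum>f\<in>T. ennreal (K2 e f) * denergy E v)"
   unfolding in2 nn_integral_arc[OF m3 T] case_prod_beta segint_sum[OF m2]
   by (intro sum_mono K2(2) v)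
  have "Hhalf_sq T v <= (\<Sum>e\<in>T. ennreal (K1 e) * denergy E v) + (\<Sum>e\<in>T. \<Sum>f\<in>T. ennreal (K2 e f) * denergy E v)"
   unfolding Hhalf_sq_def by (rule add_mono[OF a1 a2])
  also have "\<dots> = ennreal K * denergy E v"
  proof -
   have "(\<Sum>e\<in>T. ennreal (K1 e) * denergy E v) = ennreal (\<Sum>e\<in>T. K1 e) * denergy E v"
    using K1(1) by (simp add: sum_distrib_right[symmetric] sum_ennreal)
   moreover have "(\<Sum>e\<in>T. \<Sum>f\<in>T. ennreal (K2 e f) * denergy E v) = ennreal (\<Sum>e\<in>T. \<Sum>f\<in>T. K2 e f) * denergy E v"
    using K2(1) by (simp add: sum_distrib_right[symmetric] sum_ennreal sum_nonneg)
   ultimately show ?thesis using pos by (simp add: K_def distrib_right)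
  qed
  finally show "Hhalf_sq T v <= ennreal K * denergy E v" .
 qed
qed

section \<open>Mean value of the divergence\<close>

lemma matrix_vector_mult_axis: "((A :: real^2^2) *v axis i 1) $ j = A $ j $ i"
 by (simp add: matrix_vector_mul_component inner_axis)

lemma bgrad_nth_measurable:
 assumes "pw_smooth \<Omega> E v"
 shows "(\<lambda>x. bgrad E v x $ i $ j) \<in> borel_measurable borel"
proof -
 have "continuous_on UNIV (\<lambda>A :: real^2^2. A $ i $ j)" by (intro continuous_intros)
 from borel_measurable_continuous_on[OF this bgrad_measurable[OF assms]] show ?thesis .
qed

text \<open>Both ends of a long piece of the line lie outside \<Omega>, so the fundamental theorem
  yields a difference of two zeros.\<close>

lemma integral_line_bgrad:
 assumes v: "pw_smooth \<Omega> E v" and \<Omega>: "bounded \<Omega>"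
  and fin: "finite {ta. p + ta *\<^sub>R axis i 1 \<in> skel E}"
 shows "(\<integral>ta. bgrad E v (p + ta *\<^sub>R axis i 1) $ i $ i \<partial>lborel) = 0"
proof -
 note [measurable] = bgrad_measurable[OF v] bgrad_nth_measurable[OF v]
 obtain R where R: "0 < R" "!!x. x \<in> \<Omega> ==> norm x <= R" using \<Omega> by (auto simp: bounded_pos)
 define b where "b = R + norm p + 1"
 have out: "p + ta *\<^sub>R axis i 1 \<notin> \<Omega>" if "b <= \<bar>ta\<bar>" for ta
 proof
  assume "p + ta *\<^sub>R axis i 1 \<in> \<Omega>"
  then have "norm (p + ta *\<^sub>R axis i 1) <= R" by (rule R)
  moreover have "norm (ta *\<^sub>R axis i (1::real)) <= norm (p + ta *\<^sub>R axis i 1) + norm p"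
   using norm_triangle_ineq4[of "p + ta *\<^sub>R axis i 1" p] by simp
  ultimately show False using that by (simp add: b_def)
 qed
 have b0: "0 < b" using R(1) by (simp add: b_def add_pos_nonneg)
 have v0: "v x = 0" "bgrad E v x = 0" if "x \<notin> \<Omega>" for x
  using v that by (auto simp: pw_smooth_def bgrad_def)
 let ?h = "\<lambda>ta. bgrad E v (p + ta *\<^sub>R axis i 1) $ i $ i"
 have "((\<lambda>ta. bgrad E v (p + ta *\<^sub>R axis i 1) *v axis i 1) has_integral
   v (p + b *\<^sub>R axis i 1) - v (p + (- b) *\<^sub>R axis i 1)) {-b..b}"
  by (rule line_has_integral[OF v fin]) (use b0 in simp)
 then have z: "((\<lambda>ta. bgrad E v (p + ta *\<^sub>R axis i 1) *v axis i 1) has_integral 0) {-b..b}"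
  using v0(1)[OF out[of b]] v0(1)[OF out[of "-b"]] b0 by simp
 have "((\<lambda>ta. (bgrad E v (p + ta *\<^sub>R axis i 1) *v axis i 1) $ i) has_integral 0) {-b..b}"
  using has_integral_linear[OF z bounded_linear_vec_nth[of i]] by (simp only: o_def zero_index)
 then have hi: "(?h has_integral 0) {-b..b}" by (simp add: matrix_vector_mult_axis)
 obtain M where M: "0 <= M" "!!x. norm (bgrad E v x) <= M" using bgrad_bounded[OF v] by blast
 have hM: "\<bar>?h ta\<bar> <= M" for ta
  using component_le_norm_cart[of "bgrad E v (p + ta *\<^sub>R axis i 1) $ i" i]
   Finite_Cartesian_Product.norm_nth_le[of "bgrad E v (p + ta *\<^sub>R axis i 1)" i] M(2)[of "p + ta *\<^sub>R axis i 1"]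
  by linarith
 have si: "set_integrable lborel {-b..b} ?h"
  unfolding set_integrable_def
 proof (rule Bochner_Integration.integrable_bound)
  show "integrable lborel (\<lambda>th. indicator {-b..b} th * M)"
   using b0 by (intro integrable_mult_left integrable_real_indicator) auto
  show "AE th in lborel. norm (indicator {-b..b} th *\<^sub>R ?h th) <= norm (indicator {-b..b} th * M)"
   using hM M(1) by (auto simp: indicator_def)
 qed measurable
 have "(\<integral>ta. ?h ta \<partial>lborel) = (LINT ta:{-b..b}|lborel. ?h ta)"
  unfolding set_lebesgue_integral_def
 proof (rule Bochner_Integration.integral_cong[OF refl])
  fix ta :: real
  show "?h ta = indicator {-b..b} ta *\<^sub>R ?h ta"
   using v0(2)[OF out[of ta]] by (cases "ta \<in> {-b..b}") (auto simp: abs_le_iff not_le)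
 qed
 also have "\<dots> = integral {-b..b} ?h" using set_borel_integral_eq_integral[OF si] by simp
 also have "\<dots> = 0" using integral_unique[OF hi] .
 finally show ?thesis .
qed

lemma integrable_bounded_support:
 fixes f :: "real^2 => 'b::{banach, second_countable_topology}"
 assumes f: "f \<in> borel_measurable borel" and M: "!!x. norm (f x) <= M"
  and 0: "!!x. x \<notin> \<Omega> ==> f x = 0" and \<Omega>: "bounded \<Omega>"
 shows "integrable lborel f"
proof -
 obtain R where R: "\<Omega> \<subseteq> cball 0 R" using \<Omega> by (auto simp: bounded_iff subset_iff)
 show ?thesis
 proof (rule Bochner_Integration.integrable_bound)
  show "integrable lborel (\<lambda>x. indicator (cball (0::real^2) R) x * M)"
   using emeasure_lborel_cball_finite[of "0::real^2" R]
   by (intro integrable_mult_left integrable_real_indicator) auto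
  show "f \<in> borel_measurable lborel" using f by simp
  show "AE x in lborel. norm (f x) <= norm (indicator (cball 0 R) x * M)"
  proof (rule AE_I2)
   fix x
   show "norm (f x) <= norm (indicator (cball 0 R) x * M)"
   proof (cases "x \<in> cball 0 R")
    case True
    then show ?thesis using order_trans[OF M[of x] abs_ge_self] by simp
   next
    case False
    then show ?thesis using 0[of x] subsetD[OF R, of x] by auto
   qed
  qed
 qed
qed

text \<open>The divergence theorem for functions vanishing at the boundary, by Fubini: the inner
  integral runs along the \<open>i\<close>-th axis and vanishes on almost every line.\<close>

lemma integral_bgrad_diag:
 assumes v: "pw_smooth \<Omega> E v" and \<Omega>: "bounded \<Omega>"
 shows "(\<integral>x. bgrad E v x $ i $ i \<partial>lborel) = 0" "integrable lborel (\<lambda>x. bgrad E v x $ i $ i)"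
proof -
 note [measurable] = bgrad_measurable[OF v] bgrad_nth_measurable[OF v]
 have fE: "finite E" using v by (simp add: pw_smooth_def)
 define f where "f x = bgrad E v x $ i $ i" for x
 have fm [measurable]: "f \<in> borel_measurable borel" unfolding f_def by measurable
 obtain M where M: "0 <= M" "!!x. norm (bgrad E v x) <= M" using bgrad_bounded[OF v] by blast
 have "\<bar>f x\<bar> <= M" for x
  using component_le_norm_cart[of "bgrad E v x $ i" i]
   Finite_Cartesian_Product.norm_nth_le[of "bgrad E v x" i] M(2)[of x]
  unfolding f_def by linarith
 moreover have "bgrad E v x = 0" if "x \<notin> \<Omega>" for x
  using v that by (auto simp: pw_smooth_def bgrad_def)
 ultimately have fi: "integrable lborel f"
  by (intro integrable_bounded_support[OF fm _ _ \<Omega>, of M]) (auto simp: f_def)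
 then show "integrable lborel (\<lambda>x. bgrad E v x $ i $ i)" unfolding f_def .
 let ?V = "\<lambda>(s, t). vector [s, t] :: real^2"
 have Vm: "?V \<in> measurable (lborel \<Otimes>\<^sub>M lborel) borel"
  unfolding measurable_lborel_pair by (rule vector_2_measurable)
 have gi: "integrable (lborel \<Otimes>\<^sub>M lborel) (\<lambda>p. f (?V p))"
  using fi unfolding lborel_real2 by (subst (asm) integrable_distr_eq[OF Vm]) auto
 have "(\<integral>x. f x \<partial>lborel) = (\<integral>p. f (?V p) \<partial>(lborel \<Otimes>\<^sub>M lborel))"
  unfolding lborel_real2 by (rule integral_distr[OF Vm]) simp
 then have eq: "(\<integral>x. f x \<partial>lborel) = (\<integral>(s, t). f (vector [s, t]) \<partial>(lborel \<Otimes>\<^sub>M lborel))"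
  by (simp add: split_def)
 have gi': "integrable (lborel \<Otimes>\<^sub>M lborel) (\<lambda>(s, t). f (vector [s, t]))"
  using gi by (simp add: split_def)
 have V: "vector [s, t] = 0 + s *\<^sub>R axis 1 1 + t *\<^sub>R (axis 2 1 :: real^2)" for s t
  by (simp add: cart_eq_iff forall_2 axis_def)
 have X: "cross2 (axis 1 1) (axis 2 1) ~= 0" "cross2 (axis 2 1) (axis 1 1) ~= 0"
  by (simp_all add: cross2_def axis_def)
 have ae: "AE s in lborel. finite {ta. 0 + s *\<^sub>R u + ta *\<^sub>R n \<in> skel E}" if "cross2 u n ~= 0" for u n
  using almost_all_lines[OF fE that, of 0]
  by (intro AE_I'[of "{s. infinite {ta. 0 + s *\<^sub>R u + ta *\<^sub>R n \<in> skel E}}"] finite_imp_null_set_lborel) auto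
 have "(\<integral>x. f x \<partial>lborel) = 0"
 proof (cases "i = 2")
  case True
  have z: "AE s in lborel. (\<integral>t. f (vector [s, t]) \<partial>lborel) = 0"
   using ae[OF X(1)] unfolding V f_def True by (rule eventually_mono) (rule integral_line_bgrad[OF v \<Omega>])
  have "(\<integral>x. f x \<partial>lborel) = (\<integral>s. (\<integral>t. f (vector [s, t]) \<partial>lborel) \<partial>lborel)"
   unfolding eq by (rule lborel_pair.integral_fst'[OF gi', symmetric, unfolded split_conv])
  then show ?thesis using integral_eq_zero_AE[OF z] by simp
 next
  case False
  then have i: "i = 1" using exhaust_2[of i] by auto
  have V': "vector [s, t] = 0 + t *\<^sub>R axis 2 1 + s *\<^sub>R (axis 1 1 :: real^2)" for s t
   unfolding V by (simp add: add_ac)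
  have z: "AE t in lborel. (\<integral>s. f (vector [s, t]) \<partial>lborel) = 0"
   using ae[OF X(2)] unfolding V' f_def i by (rule eventually_mono) (rule integral_line_bgrad[OF v \<Omega>])
  have "(\<integral>x. f x \<partial>lborel) = (\<integral>t. (\<integral>s. f (vector [s, t]) \<partial>lborel) \<partial>lborel)"
   unfolding eq by (rule lborel_pair.integral_snd[OF gi', symmetric])
  then show ?thesis using integral_eq_zero_AE[OF z] by simp
 qed
 then show "(\<integral>x. bgrad E v x $ i $ i \<partial>lborel) = 0" unfolding f_def .
qed

lemma negligible_skel:
 assumes "finite E"
 shows "negligible (skel E)"
proof -
 have "negligible (closed_segment a b)" for a b :: "real^2"
 proof -
  have "interior (closed_segment a b) = {}" by (rule interior_closed_segment_ge2) simp
  then have "frontier (closed_segment a b) = closed_segment a b"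
   by (simp add: frontier_def)
  then show ?thesis using negligible_convex_frontier[OF convex_closed_segment, of a b] by simp
 qed
 then show ?thesis unfolding skel_def using assms by (auto intro!: negligible_Union)
qed

lemma AE_not_skel:
 assumes "finite E"
 shows "AE x in lebesgue. x \<notin> skel E" "AE x in lborel. x \<notin> skel E"
proof -
 have n: "skel E \<in> null_sets lebesgue" using negligible_skel[OF assms] by (simp add: negligible_iff_null_sets)
 show "AE x in lebesgue. x \<notin> skel E" by (rule AE_not_in[OF n])
 have "skel E \<in> null_sets lborel"
  using n closed_skel[OF assms] null_sets_completion_iff[of "skel E" lborel] by (simp add: borel_closed)
 then show "AE x in lborel. x \<notin> skel E" by (rule AE_not_in)
qed

text \<open>Integrals of the definitions, over \<open>\<Omega>\<close> and for the Lebesgue measure, in terms of a Borel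
 function on the plane which agrees with the integrand off the skeleton.\<close>

lemma set_integral_off_skel:
 fixes f g :: "real^2 => real"
 assumes E: "finite E" and g: "g \<in> borel_measurable borel"
  and eq: "!!x. x \<in> \<Omega> ==> x \<notin> skel E ==> f x = g x"
  and 0: "!!x. x \<notin> \<Omega> ==> x \<notin> skel E ==> g x = 0"
 shows "(LINT x:\<Omega>|lebesgue. f x) = (\<integral>x. g x \<partial>lborel)"
proof -
 have ae: "AE x in lebesgue. indicator \<Omega> x *\<^sub>R f x = g x"
  using AE_not_skel(1)[OF E] by (rule eventually_mono) (use eq 0 in \<open>auto simp: indicator_def\<close>)
 have gm: "g \<in> borel_measurable lborel" using g by simp
 have gL: "g \<in> borel_measurable lebesgue" using measurable_completion[OF gm] .
 \<comment> \<open>On the skeleton \<open>f\<close> takes junk values, so its measurability rests on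
   completeness: all subsets of a null set are Lebesgue measurable.\<close>
 have fL: "(\<lambda>x. indicator \<Omega> x *\<^sub>R f x) \<in> borel_measurable lebesgue"
 proof (rule borel_measurableI)
  let ?F = "\<lambda>x. indicator \<Omega> x *\<^sub>R f x"
  fix S :: "real set" assume S: "open S"
  have n: "skel E \<in> null_sets lebesgue" using negligible_skel[OF E] by (simp add: negligible_iff_null_sets)
  have Feq: "?F x = g x" if "x \<notin> skel E" for x
   using eq[of x] 0[of x] that by (cases "x \<in> \<Omega>") auto
  have N: "?F -` S \<inter> skel E \<in> null_sets lebesgue" by (rule null_sets_completion_subset[OF _ n]) auto
  have G: "g -` S - skel E \<in> sets lebesgue"
   using measurable_sets[OF gL borel_open[OF S]] n by (auto simp: null_sets_def)
  have U: "?F -` S = (g -` S - skel E) \<union> (?F -` S \<inter> skel E)"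
   using Feq by auto
  have "?F -` S \<in> sets lebesgue" by (subst U) (rule sets.Un[OF G null_setsD2[OF N]])
  then show "?F -` S \<inter> space lebesgue \<in> sets lebesgue" by simp
 qed
 have "(LINT x:\<Omega>|lebesgue. f x) = (\<integral>x. g x \<partial>lebesgue)"
  unfolding set_lebesgue_integral_def by (rule integral_cong_AE[OF fL gL ae])
 also have "\<dots> = (\<integral>x. g x \<partial>lborel)" by (rule integral_completion[OF gm])
 finally show ?thesis .
qed

section \<open>Separation of mesh segments\<close>

lemma collinear_segment_subset:
 "closed_segment (p + \<sigma> *\<^sub>R u) (p + ta *\<^sub>R u) \<subseteq>
  closed_segment (p + \<sigma> *\<^sub>R u) p \<union> closed_segment p (p + ta *\<^sub>R (u :: real^2))"
proof -
 have img: "closed_segment (p + s *\<^sub>R u) (p + t *\<^sub>R u) = (\<lambda>r. p + r *\<^sub>R u) ` closed_segment s t" for s t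
 proof -
  have "(\<lambda>r. p + r *\<^sub>R u) ` closed_segment s t = (+) p ` ((\<lambda>r. r *\<^sub>R u) ` closed_segment s t)"
   by (simp add: image_image)
  also have "(\<lambda>r. r *\<^sub>R u) ` closed_segment s t = closed_segment (s *\<^sub>R u) (t *\<^sub>R u)"
   by (rule closed_segment_linear_image[symmetric]) (simp add: linear_scaleR_left)
  finally show ?thesis by (simp add: closed_segment_translation)
 qed
 have "closed_segment \<sigma> ta \<subseteq> closed_segment \<sigma> 0 \<union> closed_segment 0 ta"
  by (auto simp: closed_segment_eq_real_ivl split: if_splits)
 then have "(\<lambda>r. p + r *\<^sub>R u) ` closed_segment \<sigma> ta \<subseteq>
  (\<lambda>r. p + r *\<^sub>R u) ` closed_segment \<sigma> 0 \<union> (\<lambda>r. p + r *\<^sub>R u) ` closed_segment 0 ta"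
  by (metis image_Un image_mono)
 then show ?thesis using img[of \<sigma> ta] img[of \<sigma> 0] img[of 0 ta] by simp
qed

lemma segment_param: "(x :: real^2) \<in> closed_segment a b ==> \<exists>s\<in>{0..1}. x = linepath a b s"
 by (auto simp: linepath_image_01[symmetric])

lemma segment_point_dir:
 assumes "(p :: real^2) \<in> closed_segment a b" "x \<in> closed_segment a b"
 shows "\<exists>\<sigma>. x = p + \<sigma> *\<^sub>R (b - a)"
proof -
 obtain s where s: "p = a + s *\<^sub>R (b - a)" using segment_param[OF assms(1)] by (auto simp: linepath_affine)
 obtain t where t: "x = a + t *\<^sub>R (b - a)" using segment_param[OF assms(2)] by (auto simp: linepath_affine)
 have "x = p + (t - s) *\<^sub>R (b - a)" unfolding s t scaleR_left_diff_distrib by simp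
 then show ?thesis ..
qed

lemma parallel_dir:
 assumes "cross2 u w = 0" "u ~= 0"
 shows "\<exists>k. w = k *\<^sub>R u"
proof -
 have "(u \<bullet> u) * w $ i = (w \<bullet> u) * u $ i" for i
  using exhaust_2[of i] assms(1) by (auto simp: cross2_def inner_vec_def sum_2 algebra_simps)
 then have "w = ((w \<bullet> u) / (u \<bullet> u)) *\<^sub>R u"
  using assms(2) by (simp add: cart_eq_iff field_simps)
 then show ?thesis by blast
qed

text \<open>A quantitative local connectedness of the kind called bounded turning: close points are
  joined in \<open>S\<close> by a connected set that stays within a multiple of their distance. The
  first alternative takes care of distinct components.\<close>

definition near_or_joined :: "real => (real^2) set => real^2 => real^2 => bool" where
 "near_or_joined kap S x y \<longleftrightarrow> kap <= dist x y \<or>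
  (\<exists>P. connected P \<and> x \<in> P \<and> y \<in> P \<and> P \<subseteq> S \<and> (\<forall>q\<in>P. kap * dist x q <= dist x y))"

lemma near_or_joined_mono:
 assumes "near_or_joined kap S x y" "kap' <= kap" "S \<subseteq> S'"
 shows "near_or_joined kap' S' x y"
 using assms(1) unfolding near_or_joined_def
proof (elim disjE exE conjE)
 fix P assume P: "connected P" "x \<in> P" "y \<in> P" "P \<subseteq> S" "\<forall>q\<in>P. kap * dist x q <= dist x y"
 have "kap' * dist x q <= dist x y" if "q \<in> P" for q
  using P(5) that assms(2) mult_right_mono[OF assms(2), of "dist x q"] by fastforce
 then show "kap' <= dist x y \<or> (\<exists>P. connected P \<and> x \<in> P \<and> y \<in> P \<and> P \<subseteq> S' \<and> (\<forall>q\<in>P. kap' * dist x q <= dist x y))"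
  using P assms(3) by (intro disjI2 exI[of _ P]) auto
qed (use assms in linarith)

text \<open>Disjoint segments have positive distance. Segments that meet are joined through a common
  point: on one line nothing is lost, and at an angle the law of sines bounds both legs.\<close>

lemma two_segments_chord_arc:
 assumes ab: "a ~= b" and cd: "c ~= d"
 shows "\<exists>kap>0. \<forall>x\<in>closed_segment a b. \<forall>y\<in>closed_segment c d.
  near_or_joined kap (closed_segment a b \<union> closed_segment c d) x y"
proof (cases "closed_segment a b \<inter> closed_segment c d = {}")
 case True
 obtain kap where "0 < kap" "\<forall>x\<in>closed_segment a b. \<forall>y\<in>closed_segment c d. kap <= dist x y"
  using separate_compact_closed[OF compact_segment closed_segment True] by auto
 then show ?thesis unfolding near_or_joined_def by auto
next
 case False
 then obtain p where p: "p \<in> closed_segment a b" "p \<in> closed_segment c d" by auto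
 define u where "u = b - a"
 define w where "w = d - c"
 have u0: "0 < norm u" "0 < norm w" using ab cd by (auto simp: u_def w_def)
 have sub: "closed_segment x p \<subseteq> closed_segment a b" "closed_segment p y \<subseteq> closed_segment c d"
  if "x \<in> closed_segment a b" "y \<in> closed_segment c d" for x y
  using that p by (auto simp: closed_segment_subset)
 show ?thesis
 proof (cases "cross2 u w = 0")
  case True
  obtain k where k: "w = k *\<^sub>R u" using parallel_dir[OF True] u0 by auto
  have "near_or_joined 1 (closed_segment a b \<union> closed_segment c d) x y"
   if xy: "x \<in> closed_segment a b" "y \<in> closed_segment c d" for x y
  proof -
   obtain \<sigma> where \<sigma>: "x = p + \<sigma> *\<^sub>R u" using segment_point_dir[OF p(1) xy(1)] by (auto simp: u_def)
   obtain ta where ta: "y = p + ta *\<^sub>R w" using segment_point_dir[OF p(2) xy(2)] by (auto simp: w_def)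
   have "closed_segment x y \<subseteq> closed_segment x p \<union> closed_segment p y"
    using collinear_segment_subset[of p \<sigma> u "ta * k"] by (simp add: \<sigma> ta k)
   then have "closed_segment x y \<subseteq> closed_segment a b \<union> closed_segment c d" using sub[OF xy] by blast
   then show ?thesis
    unfolding near_or_joined_def
    by (intro disjI2 exI[of _ "closed_segment x y"])
     (auto simp: dist_commute[of x] dest: dist_in_closed_segment(1))
  qed
  then show ?thesis by (intro exI[of _ 1]) auto
 next
  case False
  \<comment> \<open>Half the sine of the angle; the half pays for adding the two legs.\<close>
  define kap where "kap = \<bar>cross2 u w\<bar> / (2 * (norm u * norm w))"
  have kap0: "0 < kap" using False u0 by (simp add: kap_def)
  have "near_or_joined kap (closed_segment a b \<union> closed_segment c d) x y"
   if xy: "x \<in> closed_segment a b" "y \<in> closed_segment c d" for x y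
  proof -
   obtain \<sigma> where \<sigma>: "x = p + \<sigma> *\<^sub>R u" using segment_point_dir[OF p(1) xy(1)] by (auto simp: u_def)
   obtain ta where ta: "y = p + ta *\<^sub>R w" using segment_point_dir[OF p(2) xy(2)] by (auto simp: w_def)
   have xmy: "x - y = \<sigma> *\<^sub>R u - ta *\<^sub>R w" by (simp add: \<sigma> ta)
   have "\<bar>\<sigma>\<bar> * \<bar>cross2 u w\<bar> <= dist x y * norm w"
    using abs_cross2_le[of "x - y" w] by (simp add: xmy cross2_simps abs_mult dist_norm)
   then have s: "dist x p * \<bar>cross2 u w\<bar> <= norm u * norm w * dist x y"
    using mult_left_mono[of "\<bar>\<sigma>\<bar> * \<bar>cross2 u w\<bar>" "dist x y * norm w" "norm u"]
    by (simp add: \<sigma> dist_norm mult_ac)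
   have "\<bar>ta\<bar> * \<bar>cross2 u w\<bar> <= norm u * dist x y"
    using abs_cross2_le[of u "x - y"] by (simp add: xmy cross2_simps abs_mult dist_norm)
   then have t: "dist p y * \<bar>cross2 u w\<bar> <= norm u * norm w * dist x y"
    using mult_left_mono[of "\<bar>ta\<bar> * \<bar>cross2 u w\<bar>" "norm u * dist x y" "norm w"]
    by (simp add: ta dist_norm mult_ac)
   have sum: "kap * (dist x p + dist p y) <= dist x y"
    using s t u0 by (simp add: kap_def field_simps)
   let ?P = "closed_segment x p \<union> closed_segment p y"
   have q: "dist x q <= dist x p + dist p y" if "q \<in> ?P" for q
   proof -
    have "q \<in> closed_segment x p ==> dist x q <= dist x p"
     using dist_in_closed_segment(1)[of q x p] by (simp add: dist_commute)
    moreover have "q \<in> closed_segment p y ==> dist p q <= dist p y"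
     using dist_in_closed_segment(1)[of q p y] by (simp add: dist_commute)
    ultimately show ?thesis
     using that dist_triangle[of x q p] by (auto intro: order_trans)
   qed
   have "kap * dist x q <= dist x y" if "q \<in> ?P" for q
    using order_trans[OF mult_left_mono[OF q[OF that], of kap] sum] kap0 by simp
   moreover have "connected ?P" by (intro connected_Un) auto
   ultimately show ?thesis
    unfolding near_or_joined_def using sub[OF xy] by (intro disjI2 exI[of _ ?P]) auto
  qed
  then show ?thesis using kap0 by auto
 qed
qed

lemma mesh_chord_arc:
 assumes T: "segment_mesh \<Gamma> T"
 shows "\<exists>kap>0. \<forall>x\<in>\<Gamma>. \<forall>y\<in>\<Gamma>. near_or_joined kap \<Gamma> x y"
proof -
 let ?s = "\<lambda>e :: edge. closed_segment (fst e) (snd e)"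
 have fin: "finite T" and cov: "(\<Union>e\<in>T. ?s e) = \<Gamma>" and ne: "!!e. e \<in> T ==> fst e ~= snd e"
  using T by (auto simp: segment_mesh_def)
 have "\<forall>p\<in>T \<times> T. \<exists>kap>0. \<forall>x\<in>?s (fst p). \<forall>y\<in>?s (snd p). near_or_joined kap (?s (fst p) \<union> ?s (snd p)) x y"
  using two_segments_chord_arc ne by auto
 from bchoice[OF this] obtain f where f: "\<forall>p\<in>T \<times> T. 0 < f p \<and>
  (\<forall>x\<in>?s (fst p). \<forall>y\<in>?s (snd p). near_or_joined (f p) (?s (fst p) \<union> ?s (snd p)) x y)" by auto
 define kap where "kap = Min (insert 1 (f ` (T \<times> T)))"
 have kap: "0 < kap" "!!p. p \<in> T \<times> T ==> kap <= f p"
  using fin f by (auto simp: kap_def)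
 show ?thesis
 proof (intro exI[of _ kap] conjI ballI)
  fix x y assume "x \<in> \<Gamma>" "y \<in> \<Gamma>"
  then obtain e e' where e: "e \<in> T" "x \<in> ?s e" "e' \<in> T" "y \<in> ?s e'" using cov by auto
  then have "near_or_joined (f (e, e')) (?s e \<union> ?s e') x y" using f by auto
  then show "near_or_joined kap \<Gamma> x y"
   by (rule near_or_joined_mono) (use kap(2)[of "(e, e')"] e cov in auto)
 qed (rule kap(1))
qed

lemma mesh_segments_meet:
 assumes "segment_mesh \<Gamma> T" "(a, b) \<in> T" "(c, d) \<in> T" "(a, b) ~= (c, d)"
 shows "closed_segment a b \<inter> closed_segment c d \<subseteq> {a, b} \<inter> {c, d}"
 using assms unfolding segment_mesh_def by fast

text \<open>The remaining segments form a closed set that meets this one in end points only. A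
  connected set leaving the open segment without passing \<open>a\<close> or \<open>b\<close> would
  be disconnected by the two closed sets.\<close>

lemma connected_leaves_segment:
 assumes T: "segment_mesh \<Gamma> T" and K: "(a, b) \<in> T" and P: "connected P" "P \<subseteq> \<Gamma>"
  and x: "x \<in> P" "x \<in> open_segment a b" and y: "y \<in> P" "y \<notin> open_segment a b"
 shows "a \<in> P \<or> b \<in> P"
proof (rule ccontr)
 assume n: "\<not> ?thesis"
 let ?R = "\<Union>(c, d)\<in>T - {(a, b)}. closed_segment c d"
 have cl: "closed (closed_segment a b)" "closed ?R"
  using T by (auto intro!: closed_UN simp: segment_mesh_def)
 have cov: "P \<subseteq> closed_segment a b \<union> ?R" using P(2) T by (auto simp: segment_mesh_def)
 have "closed_segment a b \<inter> ?R \<subseteq> {a, b}" using mesh_segments_meet[OF T K] by fastforce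
 then have "closed_segment a b \<inter> ?R \<inter> P = {}" using n by blast
 moreover have "closed_segment a b \<inter> P ~= {}" using x by (auto simp: open_segment_def)
 moreover have "?R \<inter> P ~= {}"
  using y cov n by (auto simp: open_segment_def)
 ultimately show False using P(1) cl cov unfolding connected_closed by blast
qed

text \<open>The constant comes from \<open>T0\<close>, hence from the interface, and yet serves
  every mesh: a connected set in the interface from \<open>x\<close> to \<open>y\<close> has to pass
  \<open>a\<close> or \<open>b\<close>. The quantity \<open>dist x a * dist x b / dist a b\<close>
  is at most the distance to either end point; it is also the value of the bubble at
  \<open>x\<close> times the length of the segment, which is how it will be used.\<close>

lemma mesh_separation:
 assumes T0: "segment_mesh \<Gamma> T0"
 shows "\<exists>kap>0. \<forall>T a b x y. segment_mesh \<Gamma> T --> (a, b) \<in> T --> x \<in> open_segment a b --> y \<in> \<Gamma> -->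
  y \<notin> open_segment a b --> kap * (dist x a * dist x b / dist a b) <= dist x y"
proof -
 obtain kap where kap: "0 < kap" "\<forall>x\<in>\<Gamma>. \<forall>y\<in>\<Gamma>. near_or_joined kap \<Gamma> x y" using mesh_chord_arc[OF T0] by auto
 have "compact \<Gamma>" using T0 unfolding segment_mesh_def
  by (auto intro!: compact_UN simp: case_prod_beta)
 then have bd: "bounded \<Gamma>" by (rule compact_imp_bounded)
 then obtain D where D: "!!x y. x \<in> \<Gamma> ==> y \<in> \<Gamma> ==> dist x y <= D"
  using diameter_bounded_bound[OF bd] by blast
 \<comment> \<open>The division covers points at distance at least \<open>kap\<close>, for which the
   left-hand side is only known to be at most the diameter bound \<open>D\<close>.\<close>
 define kap' where "kap' = kap / max 1 D"
 have kap': "0 < kap'" "kap' <= kap" "kap' * D <= kap"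
 proof -
  show "0 < kap'" using kap(1) by (simp add: kap'_def)
  show "kap' <= kap" using kap(1) by (simp add: kap'_def divide_le_eq)
  have "kap * D <= kap * max 1 D" using kap(1) by (intro mult_left_mono) auto
  then show "kap' * D <= kap" by (simp add: kap'_def divide_le_eq)
 qed
 show ?thesis
 proof (intro exI[of _ kap'] conjI allI impI)
  fix T a b x y
  assume T: "segment_mesh \<Gamma> T" and K: "(a, b) \<in> T" and x: "x \<in> open_segment a b"
   and y: "y \<in> \<Gamma>" "y \<notin> open_segment a b"
  have ab: "a ~= b" and sub: "closed_segment a b \<subseteq> \<Gamma>" using T K by (auto simp: segment_mesh_def)
  have xc: "x \<in> closed_segment a b" using x by (simp add: open_segment_def)
  have xG: "x \<in> \<Gamma>" "a \<in> \<Gamma>" "b \<in> \<Gamma>" using xc sub by auto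
  have d: "0 < dist a b" "dist x a <= dist a b" "dist x b <= dist a b"
   using ab dist_in_closed_segment[OF xc] by auto
  have m: "dist x a * dist x b / dist a b <= dist x a" "dist x a * dist x b / dist a b <= dist x b"
  proof -
   have "dist x a * dist x b <= dist x a * dist a b" using d by (intro mult_left_mono) auto
   then show "dist x a * dist x b / dist a b <= dist x a" using d(1) by (simp add: divide_le_eq)
   have "dist x a * dist x b <= dist a b * dist x b" using d by (intro mult_right_mono) auto
   then show "dist x a * dist x b / dist a b <= dist x b" using d(1) by (simp add: divide_le_eq mult.commute)
  qed
  let ?m = "dist x a * dist x b / dist a b"
  from kap(2) xG(1) y(1) have "near_or_joined kap \<Gamma> x y" by blast
  then consider "kap <= dist x y" | P where "connected P" "x \<in> P" "y \<in> P" "P \<subseteq> \<Gamma>" "\<forall>q\<in>P. kap * dist x q <= dist x y"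
   unfolding near_or_joined_def by blast
  then show "kap' * ?m <= dist x y"
  proof cases
   case 1
   have "?m <= D" using m(1) D[OF xG(1,2)] by linarith
   then have "kap' * ?m <= kap' * D" using kap'(1) by (intro mult_left_mono) auto
   then show ?thesis using kap'(3) 1 by linarith
  next
   case 2
   have "a \<in> P \<or> b \<in> P" by (rule connected_leaves_segment[OF T K 2(1,4,2) x 2(3) y(2)])
   then obtain q where q: "q \<in> P" "?m <= dist x q" using m by auto
   have "kap' * ?m <= kap * dist x q" using kap'(1,2) kap(1) q(2) by (intro mult_mono) auto
   then show ?thesis using 2(5) q(1) by fastforce
  qed
 qed (rule kap'(1))
qed

section \<open>The inverse square kernel away from its singularity\<close>

lemma nn_integral_Cauchy_kernel: "(\<integral>\<^sup>+x. ennreal (1 / (1 + x\<^sup>2)) \<partial>lborel) <= ennreal pi"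
proof -
 have half: "(\<integral>\<^sup>+x. ennreal (1 / (1 + x\<^sup>2)) * indicator {0..} x \<partial>lborel) = ennreal (pi / 2)"
 proof -
  have "(\<integral>\<^sup>+x. ennreal (1 / (1 + x\<^sup>2)) * indicator {0..} x \<partial>lborel) = ennreal (pi / 2 - arctan 0)"
   by (rule nn_integral_FTC_atLeast)
    (auto intro!: derivative_eq_intros tendsto_arctan_at_top simp: field_simps)
  then show ?thesis by simp
 qed
 have refl: "(\<integral>\<^sup>+x. ennreal (1 / (1 + x\<^sup>2)) * indicator {..0} x \<partial>lborel) = ennreal (pi / 2)"
 proof -
  have "(\<integral>\<^sup>+x. ennreal (1 / (1 + x\<^sup>2)) * indicator {..0} x \<partial>lborel) =
   ennreal \<bar>-1\<bar> * (\<integral>\<^sup>+x. ennreal (1 / (1 + (0 + (-1) * x)\<^sup>2)) * indicator {..0} (0 + (-1) * x :: real) \<partial>lborel)"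
   by (rule nn_integral_real_affine) auto
  also have "(\<integral>\<^sup>+x. ennreal (1 / (1 + (0 + (-1) * x)\<^sup>2)) * indicator {..0} (0 + (-1) * x :: real) \<partial>lborel) = ennreal (pi / 2)"
   unfolding half[symmetric] by (intro nn_integral_cong) (simp add: indicator_def)
  finally show ?thesis by simp
 qed
 have "(\<integral>\<^sup>+x. ennreal (1 / (1 + x\<^sup>2)) \<partial>lborel) <=
  (\<integral>\<^sup>+x. ennreal (1 / (1 + x\<^sup>2)) * indicator {0..} x + ennreal (1 / (1 + x\<^sup>2)) * indicator {..0} x \<partial>(lborel :: real measure))"
  by (intro nn_integral_mono) (auto simp: indicator_def)
 moreover have "\<dots> = ennreal (pi / 2) + ennreal (pi / 2)"
  by (subst nn_integral_add) (simp_all add: half refl)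
 moreover have "\<dots> = ennreal pi" by (simp add: ennreal_plus[symmetric] del: ennreal_plus)
 ultimately show ?thesis by simp
qed

definition far_kernel :: "real => real^2 => real^2 => ennreal" where
 "far_kernel rh x y = (if rh <= dist x y then ennreal (1 / (dist x y)\<^sup>2) else 0)"

lemma far_kernel_measurable [measurable]: "far_kernel rh x \<in> borel_measurable borel"
 unfolding far_kernel_def by measurable

text \<open>The distance to a point of the segment is at least its distance along the line from the
  foot of the perpendicular, and also at least \<open>rh\<close> where the kernel is nonzero.
  Averaging the two squares produces the Cauchy density, hence the factor \<open>pi\<close>. The
  bound depends neither on the segment nor on \<open>x\<close>.\<close>

lemma segint_far_kernel:
 assumes ab: "a ~= b" and rh: "0 < rh"
 shows "segint a b (far_kernel rh x) <= ennreal (2 * pi / rh)"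
proof -
 define L where "L = dist a b"
 have L: "0 < L" using ab by (simp add: L_def)
 \<comment> \<open>The parameter of the foot of the perpendicular from \<open>x\<close>.\<close>
 define ta where "ta = ((x - a) \<bullet> (b - a)) / L\<^sup>2"
 let ?h = "\<lambda>t. ennreal (1 / (1 + t\<^sup>2))"
 have nL: "norm (b - a) = L" by (simp add: L_def dist_norm norm_minus_commute)
 then have LL: "(b - a) \<bullet> (b - a) = L\<^sup>2" by (simp only: power2_norm_eq_inner[symmetric])
 have tl: "(x - a) \<bullet> (b - a) = ta * L\<^sup>2" using L by (simp add: ta_def)
 have pt: "far_kernel rh x (linepath a b t) <= ennreal (2 / rh\<^sup>2) * ?h (- ta * L / rh + (L / rh) * t)" for t
 proof (cases "rh <= dist x (linepath a b t)")
  case True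
  let ?d = "dist x (linepath a b t)"
  have "(x - linepath a b t) \<bullet> (b - a) = (ta - t) * L\<^sup>2"
  proof -
   have e: "x - linepath a b t = (x - a) - t *\<^sub>R (b - a)" by (simp add: linepath_affine)
   show ?thesis unfolding e inner_diff_left[of "x - a" "t *\<^sub>R (b - a)"] inner_scaleR_left LL tl
    by (simp add: left_diff_distrib)
  qed
  then have "\<bar>ta - t\<bar> * L\<^sup>2 <= ?d * L"
   using Cauchy_Schwarz_ineq2[of "x - linepath a b t" "b - a"]
   by (simp add: abs_mult dist_norm nL)
  then have "\<bar>ta - t\<bar> * L <= ?d" using L by (simp add: power2_eq_square)
  then have "(\<bar>ta - t\<bar> * L)\<^sup>2 <= ?d\<^sup>2" using L by (intro power_mono) auto
  moreover have "rh\<^sup>2 <= ?d\<^sup>2" using True rh by (intro power_mono) auto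
  ultimately have le: "rh\<^sup>2 + ((t - ta) * L)\<^sup>2 <= 2 * ?d\<^sup>2"
   by (simp add: power_mult_distrib power2_commute)
  have pos: "0 < rh\<^sup>2 + ((t - ta) * L)\<^sup>2" using rh by (simp add: add_pos_nonneg)
  have "0 < ?d" using True rh by linarith
  then have d0: "0 < ?d\<^sup>2" by (rule zero_less_power)
  have "1 / ?d\<^sup>2 <= 2 / (rh\<^sup>2 + ((t - ta) * L)\<^sup>2)"
   using frac_le[of 2 2 "rh\<^sup>2 + ((t - ta) * L)\<^sup>2" "2 * ?d\<^sup>2"] le pos by simp
  also have "rh\<^sup>2 + ((t - ta) * L)\<^sup>2 = rh\<^sup>2 * (1 + (- ta * L / rh + (L / rh) * t)\<^sup>2)"
  proof -
   have "- ta * L / rh + (L / rh) * t = (t - ta) * L / rh" using rh by (simp add: field_simps)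
   then show ?thesis using rh by (simp add: power_divide distrib_left)
  qed
  also have "2 / (rh\<^sup>2 * (1 + (- ta * L / rh + (L / rh) * t)\<^sup>2)) = 2 / rh\<^sup>2 * (1 / (1 + (- ta * L / rh + (L / rh) * t)\<^sup>2))"
   by simp
  finally have "ennreal (1 / ?d\<^sup>2) <= ennreal (2 / rh\<^sup>2 * (1 / (1 + (- ta * L / rh + (L / rh) * t)\<^sup>2)))"
   by (rule ennreal_leI)
  then show ?thesis using True unfolding far_kernel_def
   by (subst ennreal_mult[symmetric]) (simp_all add: add_nonneg_nonneg)
 qed (simp add: far_kernel_def)
 have c0: "L / rh ~= 0" using L rh by simp
 have i1: "(\<integral>\<^sup>+t. far_kernel rh x (linepath a b t) * indicator {0..1} t \<partial>lborel) <=
  (\<integral>\<^sup>+t. ennreal (2 / rh\<^sup>2) * ?h (- ta * L / rh + (L / rh) * t) \<partial>lborel)"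
  using pt by (intro nn_integral_mono) (auto simp: indicator_def)
 have i2: "(\<integral>\<^sup>+t. ennreal (2 / rh\<^sup>2) * ?h (- ta * L / rh + (L / rh) * t) \<partial>lborel) =
  ennreal (2 / rh\<^sup>2) * (\<integral>\<^sup>+t. ?h (- ta * L / rh + (L / rh) * t) \<partial>lborel)"
  by (rule nn_integral_cmult) measurable
 have i3: "ennreal (L / rh) * (\<integral>\<^sup>+t. ?h (- ta * L / rh + (L / rh) * t) \<partial>lborel) <= ennreal pi"
 proof -
  have m: "?h \<in> borel_measurable borel" by measurable
  show ?thesis
   using nn_integral_real_affine[OF m c0, of "- ta * L / rh"] nn_integral_Cauchy_kernel L rh by simp
 qed
 have "ennreal L * (ennreal (2 / rh\<^sup>2) * X) = ennreal (2 / rh) * (ennreal (L / rh) * X)" for X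
 proof -
  have "L * (2 / rh\<^sup>2) = 2 / rh * (L / rh)" by (simp add: power2_eq_square)
  then have "ennreal L * ennreal (2 / rh\<^sup>2) = ennreal (2 / rh) * ennreal (L / rh)"
   using L rh by (simp only: ennreal_mult[symmetric] less_imp_le divide_nonneg_nonneg zero_le_power2 zero_le_numeral)
  then show ?thesis by (simp only: mult.assoc[symmetric])
 qed
 then have "segint a b (far_kernel rh x) <= ennreal (2 / rh) * (ennreal (L / rh) * (\<integral>\<^sup>+t. ?h (- ta * L / rh + (L / rh) * t) \<partial>lborel))"
  using mult_left_mono[OF i1, of "ennreal L"] unfolding segint_def L_def[symmetric] i2 by simp
 also have "\<dots> <= ennreal (2 / rh) * ennreal pi" by (rule mult_left_mono[OF i3]) simp
 also have "\<dots> = ennreal (2 * pi / rh)" using rh by (simp add: ennreal_mult[symmetric])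
 finally show ?thesis .
qed

section \<open>Inverse inequality\<close>

text \<open>\<open>U\<close> and \<open>V\<close> are the end point values of \<open>\<nu>\<close> on each segment.\<close>

definition segval :: "edge set => (edge => real^2) => (edge => real^2) => (real^2 => real^2) => bool" where
 "segval T U V \<nu> \<longleftrightarrow> (\<forall>(a, b)\<in>T. \<forall>t\<in>{0<..<1}. \<nu> (linepath a b t) = (1 - t) *\<^sub>R U (a, b) + t *\<^sub>R V (a, b)) \<and>
  (\<forall>x. x \<notin> (\<Union>(a, b)\<in>T. open_segment a b) --> \<nu> x = 0)"

lemma segval_Lambda_space: "segval T U V \<nu> ==> \<nu> \<in> Lambda_space T"
 unfolding segval_def Lambda_space_def by fast

lemma open_segment_param:
 assumes "(x :: real^2) \<in> open_segment a b"
 obtains t where "t \<in> {0<..<1}" "x = linepath a b t"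
 using assms by (auto simp: open_segment_image_interval linepath_def split: if_splits)

lemma linepath_open_segment: "a ~= b ==> t \<in> {0<..<1} ==> linepath a b t \<in> open_segment a (b :: real^2)"
 by (auto simp: open_segment_image_interval linepath_def)

lemma open_segment_borel [measurable]: "open_segment a b \<in> sets (borel :: (real^2) measure)"
proof -
 have "open_segment a b = closed_segment a b - {a, b}" by (simp add: open_segment_def)
 then show ?thesis using closed_segment_borel by simp
qed

lemma dist_linepath: "dist (linepath a b s) (linepath a b t) = \<bar>s - t\<bar> * dist a (b :: real^2)"
proof -
 have "linepath a b s - linepath a b t = (s - t) *\<^sub>R (b - a)"
  unfolding linepath_affine scaleR_left_diff_distrib by simp
 then show ?thesis by (simp add: dist_norm norm_minus_commute)
qed

lemma dist_linepath_ends: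
 assumes "t \<in> {0..1}"
 shows "dist (linepath a b t) a = t * dist a (b :: real^2)" "dist (linepath a b t) b = (1 - t) * dist a b"
 using dist_linepath[of a b t 0] dist_linepath[of a b t 1] assms
 by (auto simp: linepath_def)

text \<open>Up to constants, the mean square over the segment of the affine function with these end
  point values; no power of the length is involved.\<close>

definition endsq :: "(edge => real^2) => (edge => real^2) => edge => real" where
 "endsq U V e = (norm (U e))\<^sup>2 + (norm (V e))\<^sup>2"

lemma endsq_nonneg [simp]: "0 <= endsq U V e" by (simp add: endsq_def)

locale seg_mesh =
 fixes \<Gamma> T
 assumes mesh: "segment_mesh \<Gamma> T"
begin

lemma fin: "finite T" using mesh by (simp add: segment_mesh_def)

lemma ne: "(a, b) \<in> T ==> a ~= b" using mesh by (auto simp: segment_mesh_def)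

lemma open_disjoint:
 assumes "(a, b) \<in> T" "(c, d) \<in> T" "x \<in> open_segment a b" "x \<in> open_segment c d"
 shows "(a, b) = (c, d)"
 using mesh_segments_meet[OF mesh assms(1,2)] assms(3,4) by (auto simp: open_segment_def)

lemma segval_norm_le:
 assumes "segval T U V \<nu>" "(a, b) \<in> T" "t \<in> {0<..<1}"
 shows "(norm (\<nu> (linepath a b t)))\<^sup>2 <= (norm (U (a, b)))\<^sup>2 + (norm (V (a, b)))\<^sup>2"
proof -
 let ?U = "U (a, b)" and ?V = "V (a, b)"
 have e: "\<nu> (linepath a b t) = (1 - t) *\<^sub>R ?U + t *\<^sub>R ?V" using assms unfolding segval_def by fast
 have "norm (\<nu> (linepath a b t)) <= (1 - t) * norm ?U + t * norm ?V"
  unfolding e using norm_triangle_ineq[of "(1 - t) *\<^sub>R ?U" "t *\<^sub>R ?V"] assms(3) by simp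
 also have "\<dots> <= (1 - t) * max (norm ?U) (norm ?V) + t * max (norm ?U) (norm ?V)"
  using assms(3) by (intro add_mono mult_left_mono) auto
 also have "\<dots> = max (norm ?U) (norm ?V)" by (simp add: algebra_simps)
 finally have "(norm (\<nu> (linepath a b t)))\<^sup>2 <= (max (norm ?U) (norm ?V))\<^sup>2" by (rule power_mono) simp
 moreover have "(max (norm ?U) (norm ?V))\<^sup>2 <= (norm ?U)\<^sup>2 + (norm ?V)\<^sup>2" by (simp add: max_def)
 ultimately show ?thesis by (rule order_trans)
qed

lemma segval_bounded:
 assumes "segval T U V \<nu>"
 shows "(norm (\<nu> x))\<^sup>2 <= (\<Sum>e\<in>T. endsq U V e)"
proof (cases "\<exists>(a, b)\<in>T. x \<in> open_segment a b")
 case True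
 then obtain a b where ab: "(a, b) \<in> T" "x \<in> open_segment a b" by auto
 obtain t where t: "t \<in> {0<..<1}" "x = linepath a b t" by (rule open_segment_param[OF ab(2)])
 have "(norm (\<nu> x))\<^sup>2 <= endsq U V (a, b)" using segval_norm_le[OF assms ab(1) t(1)] by (simp add: t(2) endsq_def)
 also have "\<dots> <= (\<Sum>e\<in>T. endsq U V e)" using ab(1) fin by (intro member_le_sum) auto
 finally show ?thesis .
next
 case False
 then have "\<nu> x = 0" using assms unfolding segval_def by fast
 then show ?thesis by (simp add: sum_nonneg)
qed

lemma segval_measurable:
 assumes "segval T U V \<nu>"
 shows "\<nu> \<in> borel_measurable borel"
proof -
 \<comment> \<open>Affine interpolation written with distances to the end points, which makes it a
   Borel function on the plane.\<close>
 define F where "F e x = indicator (open_segment (fst e) (snd e)) x *\<^sub>R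
  ((dist x (snd e) / dist (fst e) (snd e)) *\<^sub>R U e + (dist x (fst e) / dist (fst e) (snd e)) *\<^sub>R V e)" for e :: edge and x
 have "(\<lambda>x. \<Sum>e\<in>T. F e x) \<in> borel_measurable borel" unfolding F_def by measurable
 moreover have "(\<Sum>e\<in>T. F e x) = \<nu> x" for x
 proof (cases "\<exists>(a, b)\<in>T. x \<in> open_segment a b")
  case True
  then obtain a b where ab: "(a, b) \<in> T" "x \<in> open_segment a b" by auto
  obtain t where t: "t \<in> {0<..<1}" "x = linepath a b t" by (rule open_segment_param[OF ab(2)])
  have "(\<Sum>e\<in>T. F e x) = (\<Sum>e\<in>{(a, b)}. F e x)"
  proof (rule sum.mono_neutral_right)
   show "\<forall>e\<in>T - {(a, b)}. F e x = 0"
   proof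
    fix e assume e: "e \<in> T - {(a, b)}"
    then have "x \<notin> open_segment (fst e) (snd e)"
     using open_disjoint[OF ab(1) _ ab(2), of "fst e" "snd e"] by auto
    then show "F e x = 0" by (simp add: F_def)
   qed
  qed (use fin ab in auto)
  also have "\<dots> = (1 - t) *\<^sub>R U (a, b) + t *\<^sub>R V (a, b)"
   using ab ne[OF ab(1)] t(1) dist_linepath_ends[of t a b] by (simp add: F_def t(2))
  also have "\<dots> = \<nu> x" using assms ab(1) t unfolding segval_def by fastforce
  finally show ?thesis .
 next
  case False
  then have "\<nu> x = 0" using assms unfolding segval_def by fast
  moreover have "F e x = 0" if "e \<in> T" for e using False that by (cases e) (auto simp: F_def indicator_def)
  ultimately show ?thesis by simp
 qed
 ultimately show ?thesis by simp
qed

lemma segint_le_const: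
 assumes "a ~= b" "!!t. t \<in> {0<..<1} ==> f (linepath a b t) <= c"
 shows "segint a b f <= ennreal (dist a b) * c"
proof -
 have "(\<integral>\<^sup>+t. f (linepath a b t) * indicator {0..1} t \<partial>lborel) <= (\<integral>\<^sup>+t. c * indicator {0..1::real} t \<partial>lborel)"
 proof (rule nn_integral_mono_AE)
  have "AE t in lborel. t ~= (0::real)" "AE t in lborel. t ~= (1::real)" by (rule AE_lborel_singleton)+
  then show "AE t in lborel. f (linepath a b t) * indicator {0..1} t <= c * indicator {0..1} t"
  proof eventually_elim
   case (elim t)
   then show ?case using assms(2)[of t] by (auto simp: indicator_def)
  qed
 qed
 then show ?thesis unfolding segint_def by (intro mult_left_mono) (simp_all add: nn_integral_cmult_indicator)
qed

lemma arc_bounded_integrable: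
 fixes f :: "real^2 => real"
 assumes "f \<in> borel_measurable borel" "!!x. \<bar>f x\<bar> <= M"
 shows "integrable (arc_measure T) f"
proof -
 interpret finite_measure "arc_measure T" by (rule finite_measure_arc[OF fin])
 have m: "f \<in> borel_measurable (arc_measure T)"
  using assms(1) by (simp cong: measurable_cong_sets)
 show ?thesis by (rule integrable_const_bound[of _ M, OF _ m]) (use assms(2) in auto)
qed

lemma emeasure_open_segment_le:
 assumes "(a, b) \<in> T"
 shows "emeasure (arc_measure T) (open_segment a b) <= ennreal (dist a b)"
proof -
 have "(\<Sum>e\<in>T. segint (fst e) (snd e) (indicator (open_segment a b))) =
  (\<Sum>e\<in>{(a, b)}. segint (fst e) (snd e) (indicator (open_segment a b)))"
 proof (rule sum.mono_neutral_right)
  show "\<forall>e\<in>T - {(a, b)}. segint (fst e) (snd e) (indicator (open_segment a b)) = 0"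
  proof
   fix e assume "e \<in> T - {(a, b)}"
   then obtain c d where e: "e = (c, d)" "(c, d) \<in> T" "(c, d) ~= (a, b)" by (cases e) auto
   have "segint c d (indicator (open_segment a b)) <= ennreal (dist c d) * 0"
   proof (rule segint_le_const[OF ne[OF e(2)]])
    fix t :: real assume "t \<in> {0<..<1}"
    then have "linepath c d t \<in> open_segment c d" using ne[OF e(2)] by (rule linepath_open_segment[rotated])
    then have "linepath c d t \<notin> open_segment a b" using open_disjoint[OF e(2) assms] e(3) by blast
    then show "indicator (open_segment a b) (linepath c d t) <= (0::ennreal)" by simp
   qed
   then show "segint (fst e) (snd e) (indicator (open_segment a b)) = 0" by (simp add: e(1))
  qed
 qed (use fin assms in auto)
 moreover have "segint a b (indicator (open_segment a b)) <= ennreal (dist a b) * 1"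
  by (rule segint_le_const[OF ne[OF assms]]) (simp add: indicator_def)
 ultimately show ?thesis using emeasure_arc[OF open_segment_borel fin] by (simp add: case_prod_beta)
qed

end

text \<open>Duality; the representation of the supremum is only meaningful because the pairings with the
 unit ball are bounded.\<close>

lemma pairing_le_dual_norm:
 assumes T: "segment_mesh \<Gamma> T" and sv: "segval T U V \<nu>" and w: "w \<in> borel_measurable borel"
  and S: "0 < S" and le: "Hhalf_sq T w <= ennreal (S\<^sup>2)"
 shows "pairing T \<nu> w <= S * Hminushalf_norm T \<nu>"
proof -
 interpret seg_mesh \<Gamma> T by standard (rule T)
 interpret \<mu>: finite_measure "arc_measure T" by (rule finite_measure_arc[OF fin])
 define M where "M = sqrt (\<Sum>e\<in>T. endsq U V e)"
 have M: "norm (\<nu> x) <= M" for x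
  using segval_bounded[OF sv, of x] unfolding M_def by (rule real_le_rsqrt)
 have M0: "0 <= M" using M[of 0] norm_ge_zero[of "\<nu> 0"] by linarith
 let ?B = "{w\<in>Hhalf T. Hhalf_norm T w <= 1}"
 have bdd: "bdd_above (pairing T \<nu> ` ?B)"
 proof (rule bdd_aboveI2)
  fix z assume z: "z \<in> ?B"
  then have zm [measurable]: "z \<in> borel_measurable borel" and zf: "Hhalf_sq T z < \<infinity>" and z1: "Hhalf_norm T z <= 1"
   by (auto simp: Hhalf_def)
  have "enn2real (Hhalf_sq T z) <= 1" using z1 by (simp add: Hhalf_norm_def)
  then have "Hhalf_sq T z <= 1" using zf by (cases "Hhalf_sq T z") auto
  then have L2: "(\<integral>\<^sup>+x. ennreal ((norm (z x))\<^sup>2) \<partial>arc_measure T) <= 1"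
   unfolding Hhalf_sq_def by (rule order_trans[rotated]) simp
  define c where "c = M * (1 + measure (arc_measure T) UNIV)"
  show "pairing T \<nu> z <= c"
  proof (cases "integrable (arc_measure T) (\<lambda>x. \<nu> x \<bullet> z x)")
   case True
   have "ennreal (norm (pairing T \<nu> z)) <= (\<integral>\<^sup>+x. ennreal (norm (\<nu> x \<bullet> z x)) \<partial>arc_measure T)"
    unfolding pairing_def by (rule integral_norm_bound_ennreal[OF True])
   also have "\<dots> <= (\<integral>\<^sup>+x. ennreal M * (1 + ennreal ((norm (z x))\<^sup>2)) \<partial>arc_measure T)"
   proof (rule nn_integral_mono)
    fix x
    \<comment> \<open>A crude bound is enough, since only finiteness of the supremum is at stake;
      the constant \<open>c\<close> does not enter any estimate.\<close>
    have "norm (z x) <= 1 + (norm (z x))\<^sup>2"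
     using zero_le_power2[of "norm (z x) - 1"] by (simp add: power2_eq_square algebra_simps) (smt (verit) norm_ge_zero)
    then have "norm (\<nu> x) * norm (z x) <= M * (1 + (norm (z x))\<^sup>2)"
     using M[of x] M0 by (intro mult_mono) auto
    then have "\<bar>\<nu> x \<bullet> z x\<bar> <= M * (1 + (norm (z x))\<^sup>2)"
     using Cauchy_Schwarz_ineq2[of "\<nu> x" "z x"] by linarith
    then show "ennreal (norm (\<nu> x \<bullet> z x)) <= ennreal M * (1 + ennreal ((norm (z x))\<^sup>2))"
     using M0 by (simp add: ennreal_mult[symmetric] ennreal_plus[symmetric] ennreal_1[symmetric] del: ennreal_1 ennreal_plus)
   qed
   also have "\<dots> = ennreal M * (emeasure (arc_measure T) UNIV + (\<integral>\<^sup>+x. ennreal ((norm (z x))\<^sup>2) \<partial>arc_measure T))"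
   proof -
    have m: "(\<lambda>x. ennreal ((norm (z x))\<^sup>2)) \<in> borel_measurable (arc_measure T)"
     using zm by (simp cong: measurable_cong_sets)
    show ?thesis using m by (simp add: nn_integral_cmult nn_integral_add)
   qed
   also have "\<dots> <= ennreal M * (emeasure (arc_measure T) UNIV + 1)"
    by (intro mult_left_mono add_mono L2) auto
   also have "\<dots> = ennreal c"
    using M0 by (simp add: c_def \<mu>.emeasure_eq_measure ennreal_mult ennreal_plus[symmetric] ennreal_1[symmetric] add.commute
     del: ennreal_1 ennreal_plus)
   finally show ?thesis using M0 by (simp add: c_def)
  next
   case False
   then show ?thesis using M0 by (simp add: pairing_def not_integrable_integral_eq c_def)
  qed
 qed
 define z where "z x = (1 / S) *\<^sub>R w x" for x
 have zm: "z \<in> borel_measurable borel" unfolding z_def using w by measurable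
 have sc: "Hhalf_sq T z = ennreal (1 / S\<^sup>2) * Hhalf_sq T w"
 proof -
  have p1: "ennreal ((norm (z x))\<^sup>2) = ennreal (1 / S\<^sup>2) * ennreal ((norm (w x))\<^sup>2)" for x
   using S by (simp add: z_def power_divide power_mult_distrib ennreal_mult[symmetric])
  have p2: "ennreal ((norm (z x - z y))\<^sup>2 / (dist x y)\<^sup>2) = ennreal (1 / S\<^sup>2) * ennreal ((norm (w x - w y))\<^sup>2 / (dist x y)\<^sup>2)" for x y
  proof -
   have "norm (z x - z y) = norm (w x - w y) / S"
    using S by (simp add: z_def scaleR_right_diff_distrib[symmetric])
   then show ?thesis by (simp add: power_divide ennreal_mult[symmetric])
  qed
  have m: "(\<lambda>x. ennreal ((norm (w x))\<^sup>2)) \<in> borel_measurable (arc_measure T)"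
   "!!x. (\<lambda>y. ennreal ((norm (w x - w y))\<^sup>2 / (dist x y)\<^sup>2)) \<in> borel_measurable (arc_measure T)"
   using w by (simp_all cong: measurable_cong_sets)
  have m2: "(\<lambda>x. \<integral>\<^sup>+y. ennreal ((norm (w x - w y))\<^sup>2 / (dist x y)\<^sup>2) \<partial>arc_measure T) \<in> borel_measurable (arc_measure T)"
   using w by (intro \<mu>.borel_measurable_nn_integral) (simp cong: measurable_cong_sets sets_pair_measure_cong)
  show ?thesis unfolding Hhalf_sq_def p1 p2
   by (simp only: nn_integral_cmult[OF m(1)] nn_integral_cmult[OF m(2)] nn_integral_cmult[OF m2] distrib_left)
 qed
 have "Hhalf_sq T z <= ennreal (1 / S\<^sup>2) * ennreal (S\<^sup>2)" unfolding sc by (rule mult_left_mono[OF le]) simp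
 also have "\<dots> = 1" using S by (simp add: ennreal_mult[symmetric])
 finally have z1: "Hhalf_sq T z <= 1" .
 then have "enn2real (Hhalf_sq T z) <= 1" using enn2real_mono[of "Hhalf_sq T z" 1] by simp
 then have "Hhalf_norm T z <= 1" by (simp add: Hhalf_norm_def)
 moreover have "Hhalf_sq T z < \<infinity>" using z1 by (rule order_le_less_trans) simp
 ultimately have "z \<in> ?B" using zm by (simp add: Hhalf_def)
 then have "pairing T \<nu> z <= Hminushalf_norm T \<nu>"
  unfolding Hminushalf_norm_def by (rule cSUP_upper[OF _ bdd])
 moreover have "pairing T \<nu> z = pairing T \<nu> w / S" by (simp add: pairing_def z_def)
 ultimately show ?thesis using S by (simp add: divide_le_eq mult.commute)
qed

text \<open>The two cubics are the bubble \<open>t * (1 - t)\<close> times the affine shape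
  functions of a segment, that is, the coefficients of the end point values in the test
  function.\<close>

lemma cubic_bubble_lipschitz:
 assumes "s \<in> {0..1}" "t \<in> {0..1::real}"
 shows "\<bar>s * (1 - s)\<^sup>2 - t * (1 - t)\<^sup>2\<bar> <= \<bar>s - t\<bar>" "\<bar>s\<^sup>2 * (1 - s) - t\<^sup>2 * (1 - t)\<bar> <= \<bar>s - t\<bar>"
proof -
 have *: "\<bar>s * (1 - s)\<^sup>2 - t * (1 - t)\<^sup>2\<bar> <= \<bar>s - t\<bar>" if st: "s \<in> {0..1}" "t \<in> {0..1::real}" for s t
 proof -
  let ?q = "1 - 2 * (s + t) + (s * s + s * t + t * t)"
  have e: "s * (1 - s)\<^sup>2 - t * (1 - t)\<^sup>2 = (s - t) * ?q" by (simp add: power2_eq_square algebra_simps)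
  have "s * s <= s * 1" "t * t <= t * 1" "s * t <= t * 1" "0 <= s * t"
   using st mult_left_mono[of s 1 s] mult_left_mono[of t 1 t] mult_right_mono[of s 1 t] by auto
  then have "?q <= 1" using st by auto
  moreover have "0 <= (1 - s) * (1 - s) + (1 - t) * (1 - t) + s * t" using st by (intro add_nonneg_nonneg) auto
  then have "-1 <= ?q" by (simp add: algebra_simps)
  ultimately have "\<bar>?q\<bar> <= 1" by linarith
  then show ?thesis unfolding e abs_mult using mult_left_mono[of "\<bar>?q\<bar>" 1 "\<bar>s - t\<bar>"] by simp
 qed
 show "\<bar>s * (1 - s)\<^sup>2 - t * (1 - t)\<^sup>2\<bar> <= \<bar>s - t\<bar>" by (rule *[OF assms])
 show "\<bar>s\<^sup>2 * (1 - s) - t\<^sup>2 * (1 - t)\<bar> <= \<bar>s - t\<bar>"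
  using *[of "1 - s" "1 - t"] assms by (simp add: mult.commute abs_minus_commute)
qed

lemma ennreal_two_sum: "0 <= p ==> 0 <= q ==> ennreal (2 * p + 2 * q) = 2 * ennreal p + 2 * ennreal q"
 by (simp add: ennreal_mult)

lemma nn_integral_add_twice:
 assumes "f \<in> borel_measurable M" "g \<in> borel_measurable M" "h \<in> borel_measurable M"
 shows "(\<integral>\<^sup>+x. f x + (2 * g x + 2 * h x) \<partial>M) = (\<integral>\<^sup>+x. f x \<partial>M) + (2 * (\<integral>\<^sup>+x. g x \<partial>M) + 2 * (\<integral>\<^sup>+x. h x \<partial>M))"
 using assms by (simp add: nn_integral_add nn_integral_cmult)

lemma segint_ge:
 assumes "0 <= p" "p <= q" "q <= 1" "0 <= c" and f: "!!t. t \<in> {p..q} ==> ennreal c <= f (linepath a b t)"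
 shows "ennreal (dist a b * (c * (q - p))) <= segint a b f"
proof -
 have "(\<integral>\<^sup>+t. ennreal c * indicator {p..q} t \<partial>lborel) <= (\<integral>\<^sup>+t. f (linepath a b t) * indicator {0..1} t \<partial>lborel)"
  using f assms(1-3) by (intro nn_integral_mono) (auto simp: indicator_def)
 moreover have "(\<integral>\<^sup>+t. ennreal c * indicator {p..q} t \<partial>lborel) = ennreal (c * (q - p))"
  using assms by (subst nn_integral_cmult_indicator) (simp_all add: ennreal_mult)
 ultimately have "ennreal (dist a b) * ennreal (c * (q - p)) <= segint a b f"
  unfolding segint_def by (intro mult_left_mono) auto
 then show ?thesis using assms by (simp add: ennreal_mult)
qed

context seg_mesh
begin

lemma arc_mono:
 assumes "f \<in> borel_measurable borel" "g \<in> borel_measurable borel" "!!y. y \<in> \<Gamma> ==> f y <= g y"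
 shows "(\<integral>\<^sup>+y. f y \<partial>arc_measure T) <= (\<integral>\<^sup>+y. g y \<partial>arc_measure T)"
 unfolding nn_integral_arc[OF assms(1) fin] nn_integral_arc[OF assms(2) fin] case_prod_beta
proof (intro sum_mono segint_mono assms(3))
 fix e t assume e: "e \<in> T" and t: "t \<in> {0..1::real}"
 then have "linepath (fst e) (snd e) t \<in> closed_segment (fst e) (snd e)"
  by (auto simp: linepath_image_01[symmetric])
 then show "linepath (fst e) (snd e) t \<in> \<Gamma>" using e mesh unfolding segment_mesh_def by (auto simp: case_prod_beta)
qed

text \<open>The quadratic bubble \<open>t * (1 - t)\<close> on each segment, written with distances
  so that it is a Borel function on the plane.\<close>

definition bub :: "real^2 => real" where
 "bub x = (\<Sum>e\<in>T. indicator (open_segment (fst e) (snd e)) x *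
  (dist x (fst e) * dist x (snd e) / (dist (fst e) (snd e))\<^sup>2))"

lemma bub_measurable [measurable]: "bub \<in> borel_measurable borel"
 unfolding bub_def by measurable

lemma bub_eq:
 assumes e: "(a, b) \<in> T" and t: "t \<in> {0<..<1}"
 shows "bub (linepath a b t) = t * (1 - t)"
proof -
 let ?x = "linepath a b t"
 have x: "?x \<in> open_segment a b" by (rule linepath_open_segment[OF ne[OF e] t])
 have "bub ?x = (\<Sum>e\<in>{(a, b)}. indicator (open_segment (fst e) (snd e)) ?x *
  (dist ?x (fst e) * dist ?x (snd e) / (dist (fst e) (snd e))\<^sup>2))"
  unfolding bub_def
 proof (rule sum.mono_neutral_right)
  show "\<forall>i\<in>T - {(a, b)}. indicator (open_segment (fst i) (snd i)) ?x *
   (dist ?x (fst i) * dist ?x (snd i) / (dist (fst i) (snd i))\<^sup>2) = 0"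
  proof
   fix i assume i: "i \<in> T - {(a, b)}"
   then have "?x \<notin> open_segment (fst i) (snd i)"
    using open_disjoint[OF e _ x, of "fst i" "snd i"] by auto
   then show "indicator (open_segment (fst i) (snd i)) ?x *
   (dist ?x (fst i) * dist ?x (snd i) / (dist (fst i) (snd i))\<^sup>2) = 0" by simp
  qed
 qed (use fin e in auto)
 also have "\<dots> = t * (1 - t)"
  using x t dist_linepath_ends[of t a b] ne[OF e] by (simp add: power2_eq_square)
 finally show ?thesis .
qed

text \<open>No inverse power of the mesh size may appear. For pairs on one segment the Lipschitz
  bound costs the inverse square of the length, which the double integral restores. For pairs on
  different segments the difference is split into its two values; the kernel beyond distance
  \<open>rh\<close> integrates to at most \<open>Ck / rh\<close>, where \<open>rh\<close> is
  proportional to the bubble at \<open>x\<close>, and the squared bubble in \<open>A x\<close>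
  compensates this. Without the bubble the integral would diverge logarithmically at the end
  points.\<close>

lemma test_function_estimate:
 assumes sv: "segval T U V \<nu>" and kap: "0 < kap"
  and sep: "!!a b x y. (a, b) \<in> T ==> x \<in> open_segment a b ==> y \<in> \<Gamma> ==> y \<notin> open_segment a b ==>
   kap * (dist x a * dist x b / dist a b) <= dist x y"
  and ker: "!!x rh. 0 < rh ==> (\<integral>\<^sup>+y. far_kernel rh x y \<partial>arc_measure T) <= ennreal (Ck / rh)" and Ck: "0 <= Ck"
  and D: "!!a b. (a, b) \<in> T ==> dist a b <= D"
 shows "Hhalf_sq T (\<lambda>x. bub x *\<^sub>R \<nu> x) <= ennreal ((\<bar>D\<bar> + 2 + 4 * Ck / kap) * (\<Sum>e\<in>T. endsq U V e))"
proof -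
 interpret \<mu>: finite_measure "arc_measure T" by (rule finite_measure_arc[OF fin])
 interpret P: pair_sigma_finite "arc_measure T" "arc_measure T" ..
 note [measurable] = segval_measurable[OF sv]
 let ?N = "endsq U V"
 define w where "w x = bub x *\<^sub>R \<nu> x" for x
 have wm [measurable]: "w \<in> borel_measurable borel" unfolding w_def by measurable
 define A where "A x = (norm (w x))\<^sup>2" for x
 have Am [measurable]: "A \<in> borel_measurable borel" unfolding A_def by measurable
 have A0: "0 <= A x" for x by (simp add: A_def)
 have bc: "borel_measurable (arc_measure T) = (borel_measurable borel :: (real^2 => ennreal) set)"
  by (rule measurable_cong_sets) auto
 have w0: "w x = 0" if "\<not> (\<exists>(a, b)\<in>T. x \<in> open_segment a b)" for x
  using sv that unfolding segval_def w_def by fastforce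
 have wt: "w (linepath a b t) = (t * (1 - t)\<^sup>2) *\<^sub>R U (a, b) + (t\<^sup>2 * (1 - t)) *\<^sub>R V (a, b)"
  if "(a, b) \<in> T" "t \<in> {0<..<1}" for a b t
 proof -
  have "\<nu> (linepath a b t) = (1 - t) *\<^sub>R U (a, b) + t *\<^sub>R V (a, b)" using sv that unfolding segval_def by fast
  then show ?thesis using bub_eq[OF that] by (simp add: w_def scaleR_add_right power2_eq_square mult_ac)
 qed
 have At: "A (linepath a b t) <= (t * (1 - t))\<^sup>2 * ?N (a, b)" if "(a, b) \<in> T" "t \<in> {0<..<1}" for a b t
 proof -
  have "A (linepath a b t) = (t * (1 - t))\<^sup>2 * (norm (\<nu> (linepath a b t)))\<^sup>2"
   using bub_eq[OF that] that(2) by (simp add: A_def w_def power_mult_distrib)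
  also have "\<dots> <= (t * (1 - t))\<^sup>2 * ?N (a, b)"
   using segval_norm_le[OF sv that] by (intro mult_left_mono) (auto simp: endsq_def)
  finally show ?thesis .
 qed
 have t14: "t * (1 - t) <= 1" "0 < t * (1 - t)" if "t \<in> {0<..<1}" for t :: real
  using that mult_le_one[of t "1 - t"] by auto
 have AN: "A (linepath a b t) <= ?N (a, b)" if "(a, b) \<in> T" "t \<in> {0<..<1}" for a b t
 proof -
  have "(t * (1 - t))\<^sup>2 * ?N (a, b) <= 1 * ?N (a, b)"
   using t14[OF that(2)] by (intro mult_right_mono power_le_one) auto
  then show ?thesis using At[OF that] by simp
 qed
 have lip: "slob w (linepath a b s) (linepath a b t) <= ennreal (2 * ?N (a, b) / (dist a b)\<^sup>2)"
  if e: "(a, b) \<in> T" and st: "s \<in> {0<..<1}" "t \<in> {0<..<1}" for a b s t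
 proof (cases "s = t")
  case False
  have L: "0 < dist a b" using ne[OF e] by simp
  let ?p = "s * (1 - s)\<^sup>2 - t * (1 - t)\<^sup>2" and ?q = "s\<^sup>2 * (1 - s) - t\<^sup>2 * (1 - t)"
  let ?U = "norm (U (a, b))" and ?V = "norm (V (a, b))"
  have "w (linepath a b s) - w (linepath a b t) = ?p *\<^sub>R U (a, b) + ?q *\<^sub>R V (a, b)"
   unfolding wt[OF e st(1)] wt[OF e st(2)] by (simp add: scaleR_left_diff_distrib)
  then have "norm (w (linepath a b s) - w (linepath a b t)) <= \<bar>?p\<bar> * ?U + \<bar>?q\<bar> * ?V"
   using norm_triangle_ineq[of "?p *\<^sub>R U (a, b)" "?q *\<^sub>R V (a, b)"] by simp
  also have "\<dots> <= \<bar>s - t\<bar> * ?U + \<bar>s - t\<bar> * ?V"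
   using cubic_bubble_lipschitz[of s t] st by (intro add_mono mult_right_mono) auto
  finally have "norm (w (linepath a b s) - w (linepath a b t)) <= \<bar>s - t\<bar> * (?U + ?V)" by (simp add: distrib_left)
  then have "(norm (w (linepath a b s) - w (linepath a b t)))\<^sup>2 <= (\<bar>s - t\<bar> * (?U + ?V))\<^sup>2"
   by (rule power_mono) simp
  also have "\<dots> = (s - t)\<^sup>2 * (?U + ?V)\<^sup>2" by (simp add: power_mult_distrib)
  also have "\<dots> <= (s - t)\<^sup>2 * (2 * ?N (a, b))"
  proof (rule mult_left_mono)
   show "(?U + ?V)\<^sup>2 <= 2 * ?N (a, b)"
    using zero_le_power2[of "?U - ?V"] unfolding endsq_def by (simp add: power2_eq_square algebra_simps)
  qed simp
  finally have le: "(norm (w (linepath a b s) - w (linepath a b t)))\<^sup>2 <= (s - t)\<^sup>2 * (2 * ?N (a, b))" .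
  have d: "(dist (linepath a b s) (linepath a b t))\<^sup>2 = (s - t)\<^sup>2 * (dist a b)\<^sup>2"
   by (simp add: dist_linepath power_mult_distrib)
  have "(norm (w (linepath a b s) - w (linepath a b t)))\<^sup>2 / (dist (linepath a b s) (linepath a b t))\<^sup>2
   <= (s - t)\<^sup>2 * (2 * ?N (a, b)) / ((s - t)\<^sup>2 * (dist a b)\<^sup>2)"
   unfolding d by (intro divide_right_mono le) simp
  also have "\<dots> = 2 * ?N (a, b) / (dist a b)\<^sup>2" using False by simp
  finally show ?thesis unfolding slob_def by (rule ennreal_leI)
 qed (simp add: slob_def)
 define same where "same x y \<longleftrightarrow> (\<exists>e\<in>T. x \<in> open_segment (fst e) (snd e) \<and> y \<in> open_segment (fst e) (snd e))" for x y
 define k where "k x y = (if same x y then 0 else ennreal (A x / (dist x y)\<^sup>2))" for x y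
 have same_m: "{p. same (fst p) (snd p)} \<in> sets (borel \<Otimes>\<^sub>M borel)"
 proof -
  have "{p. same (fst p) (snd p)} = (\<Union>e\<in>T. open_segment (fst e) (snd e) \<times> open_segment (fst e) (snd e))"
   unfolding same_def by force
  then show ?thesis using fin by (auto intro!: sets.finite_UN pair_measureI)
 qed
 have km: "(\<lambda>p. k (fst p) (snd p)) \<in> borel_measurable (borel \<Otimes>\<^sub>M borel)"
  unfolding k_def
 proof (rule measurable_If)
  show "{p \<in> space (borel \<Otimes>\<^sub>M borel). same (fst p) (snd p)} \<in> sets (borel \<Otimes>\<^sub>M borel)"
   using same_m by (simp add: space_pair_measure)
 qed measurable
 have km2: "(\<lambda>z. k (f z) (g z)) \<in> borel_measurable M" if "f \<in> borel_measurable M" "g \<in> borel_measurable M" for f g M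
  using measurable_compose[OF measurable_Pair[OF that] km] by simp
 define S where "S e x y = indicator (open_segment (fst e) (snd e)) x * indicator (open_segment (fst e) (snd e)) y *
  ennreal (2 * ?N e / (dist (fst e) (snd e))\<^sup>2)" for e :: edge and x y :: "real^2"
 have pt: "slob w x y <= (\<Sum>e\<in>T. S e x y) + (2 * k x y + 2 * k y x)" for x y
 proof (cases "same x y")
  case True
  then obtain a b where e: "(a, b) \<in> T" "x \<in> open_segment a b" "y \<in> open_segment a b" by (auto simp: same_def)
  obtain s where s: "s \<in> {0<..<1}" "x = linepath a b s" by (rule open_segment_param[OF e(2)])
  obtain t where t: "t \<in> {0<..<1}" "y = linepath a b t" by (rule open_segment_param[OF e(3)])
  have "slob w x y <= S (a, b) x y" using lip[OF e(1) s(1) t(1)] e s t by (simp add: S_def)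
  also have "\<dots> <= (\<Sum>e\<in>T. S e x y)" using e(1) fin by (intro member_le_sum) auto
  finally show ?thesis by (rule order_trans) simp
 next
  case False
  then have F': "\<not> same y x" by (auto simp: same_def)
  have "(norm (w x - w y))\<^sup>2 / (dist x y)\<^sup>2 <= (2 * A x + 2 * A y) / (dist x y)\<^sup>2"
   unfolding A_def by (intro divide_right_mono norm_diff_sq_le) simp
  then have "slob w x y <= ennreal (2 * (A x / (dist x y)\<^sup>2) + 2 * (A y / (dist y x)\<^sup>2))"
   unfolding slob_def by (intro ennreal_leI) (simp add: add_divide_distrib dist_commute)
  also have "\<dots> = 2 * k x y + 2 * k y x"
   using False F' A0 by (subst ennreal_two_sum) (auto simp: k_def)
  finally show ?thesis by (rule order_trans) simp
 qed
 have inner: "(\<integral>\<^sup>+y. k (linepath a b t) y \<partial>arc_measure T) <= ennreal (?N (a, b) * Ck / (kap * dist a b))"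
  if e: "(a, b) \<in> T" and t: "t \<in> {0<..<1}" for a b t
 proof -
  let ?x = "linepath a b t"
  \<comment> \<open>The lower bound that \<open>sep\<close> gives for the distance from this point
    to the interface outside its own segment.\<close>
  define rh where "rh = kap * (dist a b * (t * (1 - t)))"
  have L: "0 < dist a b" using ne[OF e] by simp
  have rh: "0 < rh" unfolding rh_def by (rule mult_pos_pos[OF kap mult_pos_pos[OF L t14(2)[OF t]]])
  have xo: "?x \<in> open_segment a b" by (rule linepath_open_segment[OF ne[OF e] t])
  have rh_eq: "kap * (dist ?x a * dist ?x b / dist a b) = rh"
   using dist_linepath_ends[of t a b] t L by (simp add: rh_def)
  have i1: "(\<integral>\<^sup>+y. k ?x y \<partial>arc_measure T) <= (\<integral>\<^sup>+y. ennreal (A ?x) * far_kernel rh ?x y \<partial>arc_measure T)"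
  proof (rule arc_mono)
   have pm: "(\<lambda>y. (?x, y)) \<in> borel \<rightarrow>\<^sub>M borel \<Otimes>\<^sub>M borel" by measurable
   show "k ?x \<in> borel_measurable borel" using measurable_compose[OF pm km] unfolding fst_conv snd_conv .
   show "(\<lambda>y. ennreal (A ?x) * far_kernel rh ?x y) \<in> borel_measurable borel" by measurable
   fix y assume y: "y \<in> \<Gamma>"
   show "k ?x y <= ennreal (A ?x) * far_kernel rh ?x y"
   proof (cases "same ?x y")
    case False
    then have "y \<notin> open_segment a b" using e xo by (auto simp: same_def)
    from sep[OF e xo y this] have "rh <= dist ?x y" unfolding rh_eq .
    then show ?thesis using False A0[of ?x] by (simp add: k_def far_kernel_def ennreal_mult[symmetric])
   qed (simp add: k_def)
  qed
  have i2: "(\<integral>\<^sup>+y. ennreal (A ?x) * far_kernel rh ?x y \<partial>arc_measure T) =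
   ennreal (A ?x) * (\<integral>\<^sup>+y. far_kernel rh ?x y \<partial>arc_measure T)"
   by (rule nn_integral_cmult) (simp add: bc)
  have i3: "ennreal (A ?x) * (\<integral>\<^sup>+y. far_kernel rh ?x y \<partial>arc_measure T) <= ennreal (A ?x) * ennreal (Ck / rh)"
   by (rule mult_left_mono[OF ker[OF rh]]) simp
  have i4: "ennreal (A ?x) * ennreal (Ck / rh) = ennreal (A ?x * (Ck / rh))"
   using A0[of ?x] Ck rh by (subst ennreal_mult) auto
  have i5: "ennreal (A ?x * (Ck / rh)) <= ennreal (?N (a, b) * Ck / (kap * dist a b))"
  proof (rule ennreal_leI)
   have "A ?x * (Ck / rh) <= (t * (1 - t))\<^sup>2 * ?N (a, b) * (Ck / rh)"
    using Ck rh by (intro mult_right_mono At[OF e t]) auto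
   \<comment> \<open>One of the two bubble factors cancels against \<open>rh\<close>; the other is
     at most 1.\<close>
   also have "\<dots> = (t * (1 - t)) * (?N (a, b) * Ck / (kap * dist a b))"
   proof -
    define r where "r = t * (1 - t)"
    have "r ~= 0" using t14(2)[OF t] unfolding r_def by (rule less_imp_neq[symmetric])
    then have "r\<^sup>2 * ?N (a, b) * (Ck / (kap * (dist a b * r))) = r * (?N (a, b) * Ck / (kap * dist a b))"
     using L kap by (simp add: power2_eq_square)
    then show ?thesis unfolding rh_def r_def .
   qed
   also have "\<dots> <= 1 * (?N (a, b) * Ck / (kap * dist a b))"
    using t14[OF t] Ck kap by (intro mult_right_mono) auto
   finally show "A ?x * (Ck / rh) <= ?N (a, b) * Ck / (kap * dist a b)" by simp
  qed
  have "(\<integral>\<^sup>+y. k ?x y \<partial>arc_measure T) <= ennreal (A ?x * (Ck / rh))"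
   using order_trans[OF i1[unfolded i2] i3] unfolding i4 .
  then show ?thesis by (rule order_trans[OF _ i5])
 qed
 have mk: "(\<lambda>x. \<integral>\<^sup>+y. k x y \<partial>arc_measure T) \<in> borel_measurable borel"
  unfolding bc[symmetric]
  by (rule \<mu>.borel_measurable_nn_integral) (simp add: split_def, intro km2; measurable)
 have K1: "(\<integral>\<^sup>+x. \<integral>\<^sup>+y. k x y \<partial>arc_measure T \<partial>arc_measure T) <= ennreal (Ck / kap * (\<Sum>e\<in>T. ?N e))"
 proof -
  have "(\<integral>\<^sup>+x. \<integral>\<^sup>+y. k x y \<partial>arc_measure T \<partial>arc_measure T) <= (\<Sum>e\<in>T. ennreal (Ck / kap * ?N e))"
   unfolding nn_integral_arc[OF mk fin]
  proof (intro sum_mono, clarify)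
   fix a b assume e: "(a, b) \<in> T"
   have "segint a b (\<lambda>x. \<integral>\<^sup>+y. k x y \<partial>arc_measure T) <= ennreal (dist a b) * ennreal (?N (a, b) * Ck / (kap * dist a b))"
    by (rule segint_le_const[OF ne[OF e]]) (rule inner[OF e])
   also have "\<dots> = ennreal (Ck / kap * ?N (a, b))"
    using ne[OF e] kap Ck by (simp add: ennreal_mult[symmetric] mult.commute)
   finally show "segint a b (\<lambda>x. \<integral>\<^sup>+y. k x y \<partial>arc_measure T) <= ennreal (Ck / kap * ?N (a, b))" .
  qed
  also have "\<dots> = ennreal (Ck / kap * (\<Sum>e\<in>T. ?N e))"
   using Ck kap by (simp add: sum_ennreal sum_distrib_left)
  finally show ?thesis .
 qed
 \<comment> \<open>By Tonelli \<open>k y x\<close> contributes no more than \<open>k x y\<close>;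
   each enters with the factor 2, which explains \<open>4 * Ck / kap\<close>.\<close>
 have K2: "(\<integral>\<^sup>+x. \<integral>\<^sup>+y. k y x \<partial>arc_measure T \<partial>arc_measure T) <= ennreal (Ck / kap * (\<Sum>e\<in>T. ?N e))"
 proof -
  have "(\<integral>\<^sup>+x. \<integral>\<^sup>+y. k y x \<partial>arc_measure T \<partial>arc_measure T) = (\<integral>\<^sup>+y. \<integral>\<^sup>+x. k y x \<partial>arc_measure T \<partial>arc_measure T)"
   by (rule P.Fubini') (simp add: split_def, intro km2; measurable)
  then show ?thesis using K1 by simp
 qed
 have Sm: "(\<lambda>p. S e (fst p) (snd p)) \<in> borel_measurable (arc_measure T \<Otimes>\<^sub>M arc_measure T)" for e
  unfolding S_def by measurable
 have S1: "(\<integral>\<^sup>+x. \<integral>\<^sup>+y. S e x y \<partial>arc_measure T \<partial>arc_measure T) <= ennreal (2 * ?N e)" if e: "e \<in> T" for e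
 proof -
  obtain a b where ab: "e = (a, b)" "(a, b) \<in> T" using e by (cases e) auto
  let ?c = "2 * ?N e / (dist a b)\<^sup>2" and ?O = "open_segment a b"
  have O: "?O \<in> sets (arc_measure T)" by simp
  have i: "(\<integral>\<^sup>+y. S e x y \<partial>arc_measure T) = indicator ?O x * (emeasure (arc_measure T) ?O * ennreal ?c)" for x
  proof -
   have "(\<integral>\<^sup>+y. S e x y \<partial>arc_measure T) = (\<integral>\<^sup>+y. (indicator ?O x * ennreal ?c) * indicator ?O y \<partial>arc_measure T)"
    by (intro nn_integral_cong) (simp add: S_def ab mult_ac)
   then show ?thesis unfolding nn_integral_cmult_indicator[OF O] by (simp only: mult_ac)
  qed
  have "(\<integral>\<^sup>+x. \<integral>\<^sup>+y. S e x y \<partial>arc_measure T \<partial>arc_measure T) =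
   emeasure (arc_measure T) ?O * ennreal ?c * emeasure (arc_measure T) ?O"
   unfolding i mult.commute[of "indicator ?O _ :: ennreal"] nn_integral_cmult_indicator[OF O] ..
  also have "\<dots> <= ennreal (dist a b) * ennreal ?c * ennreal (dist a b)"
   by (intro mult_mono emeasure_open_segment_le ab) auto
  also have "\<dots> = ennreal (2 * ?N e)"
   using ne[OF ab(2)] by (simp add: ennreal_mult[symmetric] power2_eq_square)
  finally show ?thesis .
 qed
 have Sint: "(\<integral>\<^sup>+x. \<integral>\<^sup>+y. (\<Sum>e\<in>T. S e x y) \<partial>arc_measure T \<partial>arc_measure T) <= ennreal (2 * (\<Sum>e\<in>T. ?N e))"
 proof -
  have m1: "S e x \<in> borel_measurable (arc_measure T)" for e x unfolding S_def by measurable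
  have m2: "(\<lambda>x. \<integral>\<^sup>+y. S e x y \<partial>arc_measure T) \<in> borel_measurable (arc_measure T)" for e
   by (rule \<mu>.borel_measurable_nn_integral) (simp add: split_def Sm)
  have "(\<integral>\<^sup>+x. \<integral>\<^sup>+y. (\<Sum>e\<in>T. S e x y) \<partial>arc_measure T \<partial>arc_measure T) =
   (\<Sum>e\<in>T. \<integral>\<^sup>+x. \<integral>\<^sup>+y. S e x y \<partial>arc_measure T \<partial>arc_measure T)"
   by (simp add: nn_integral_sum m1 m2)
  also have "\<dots> <= (\<Sum>e\<in>T. ennreal (2 * ?N e))" by (intro sum_mono S1)
  also have "\<dots> = ennreal (2 * (\<Sum>e\<in>T. ?N e))" by (simp add: sum_ennreal sum_distrib_left)
  finally show ?thesis .
 qed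
 have L2: "(\<integral>\<^sup>+x. ennreal ((norm (w x))\<^sup>2) \<partial>arc_measure T) <= ennreal (\<bar>D\<bar> * (\<Sum>e\<in>T. ?N e))"
 proof -
  have m: "(\<lambda>x. ennreal ((norm (w x))\<^sup>2)) \<in> borel_measurable borel" by measurable
  have "(\<integral>\<^sup>+x. ennreal ((norm (w x))\<^sup>2) \<partial>arc_measure T) <= (\<Sum>e\<in>T. ennreal (\<bar>D\<bar> * ?N e))"
   unfolding nn_integral_arc[OF m fin]
  proof (intro sum_mono, clarify)
   fix a b assume e: "(a, b) \<in> T"
   have "segint a b (\<lambda>x. ennreal ((norm (w x))\<^sup>2)) <= ennreal (dist a b) * ennreal (?N (a, b))"
    by (rule segint_le_const[OF ne[OF e]]) (use AN[OF e] in \<open>auto simp: A_def intro: ennreal_leI\<close>)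
   also have "\<dots> <= ennreal \<bar>D\<bar> * ennreal (?N (a, b))"
    using D[OF e] by (intro mult_right_mono ennreal_leI) auto
   finally show "segint a b (\<lambda>x. ennreal ((norm (w x))\<^sup>2)) <= ennreal (\<bar>D\<bar> * ?N (a, b))" by (simp add: ennreal_mult)
  qed
  then show ?thesis by (simp add: sum_ennreal sum_distrib_left)
 qed
 let ?T = "\<Sum>e\<in>T. ?N e"
 have T0: "0 <= ?T" by (simp add: sum_nonneg)
 have "(\<integral>\<^sup>+x. \<integral>\<^sup>+y. slob w x y \<partial>arc_measure T \<partial>arc_measure T) <=
  (\<integral>\<^sup>+x. \<integral>\<^sup>+y. (\<Sum>e\<in>T. S e x y) + (2 * k x y + 2 * k y x) \<partial>arc_measure T \<partial>arc_measure T)"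
  by (intro nn_integral_mono pt)
 moreover have "(\<integral>\<^sup>+x. \<integral>\<^sup>+y. (\<Sum>e\<in>T. S e x y) + (2 * k x y + 2 * k y x) \<partial>arc_measure T \<partial>arc_measure T) =
  (\<integral>\<^sup>+x. \<integral>\<^sup>+y. (\<Sum>e\<in>T. S e x y) \<partial>arc_measure T \<partial>arc_measure T) +
  (2 * (\<integral>\<^sup>+x. \<integral>\<^sup>+y. k x y \<partial>arc_measure T \<partial>arc_measure T) + 2 * (\<integral>\<^sup>+x. \<integral>\<^sup>+y. k y x \<partial>arc_measure T \<partial>arc_measure T))"
 proof -
  have m1: "S e x \<in> borel_measurable (arc_measure T)" for e x unfolding S_def by measurable
  have m1': "(\<lambda>y. \<Sum>e\<in>T. S e x y) \<in> borel_measurable (arc_measure T)" for x by (intro borel_measurable_sum m1)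
  have m2: "(\<lambda>x. \<integral>\<^sup>+y. (\<Sum>e\<in>T. S e x y) \<partial>arc_measure T) \<in> borel_measurable (arc_measure T)"
   by (rule \<mu>.borel_measurable_nn_integral) (simp add: split_def, intro borel_measurable_sum Sm)
  have m3: "(\<lambda>y. k x y) \<in> borel_measurable (arc_measure T)" "(\<lambda>y. k y x) \<in> borel_measurable (arc_measure T)" for x
   unfolding bc by (intro km2; measurable)+
  have m4: "(\<lambda>x. \<integral>\<^sup>+y. k x y \<partial>arc_measure T) \<in> borel_measurable (arc_measure T)" using mk by (simp add: bc)
  have m5: "(\<lambda>x. \<integral>\<^sup>+y. k y x \<partial>arc_measure T) \<in> borel_measurable (arc_measure T)"
   by (rule \<mu>.borel_measurable_nn_integral) (simp add: split_def, intro km2; measurable)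
  have "(\<integral>\<^sup>+y. (\<Sum>e\<in>T. S e x y) + (2 * k x y + 2 * k y x) \<partial>arc_measure T) =
   (\<integral>\<^sup>+y. (\<Sum>e\<in>T. S e x y) \<partial>arc_measure T) + (2 * (\<integral>\<^sup>+y. k x y \<partial>arc_measure T) + 2 * (\<integral>\<^sup>+y. k y x \<partial>arc_measure T))" for x
   by (rule nn_integral_add_twice[OF m1' m3])
  then show ?thesis
   by (simp only: nn_integral_add_twice[OF m2 m4 m5])
 qed
 moreover have "\<dots> <= ennreal (2 * ?T) + (2 * ennreal (Ck / kap * ?T) + 2 * ennreal (Ck / kap * ?T))"
  by (intro add_mono mult_left_mono Sint K1 K2) simp_all
 moreover have "ennreal (2 * ?T) + (2 * ennreal (Ck / kap * ?T) + 2 * ennreal (Ck / kap * ?T)) = ennreal ((2 + 4 * Ck / kap) * ?T)"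
 proof -
  define r where "r = Ck / kap * ?T"
  have "0 <= r" using Ck kap T0 by (simp add: r_def)
  then have "ennreal (2 * ?T) + (2 * ennreal r + 2 * ennreal r) = ennreal (2 * ?T + (2 * r + 2 * r))"
   using T0 ennreal_two_sum[of r r] by (subst ennreal_plus) auto
  then show ?thesis by (simp add: r_def algebra_simps)
 qed
 ultimately have J: "(\<integral>\<^sup>+x. \<integral>\<^sup>+y. slob w x y \<partial>arc_measure T \<partial>arc_measure T) <= ennreal ((2 + 4 * Ck / kap) * ?T)"
  by simp
 have "Hhalf_sq T w <= ennreal (\<bar>D\<bar> * ?T) + ennreal ((2 + 4 * Ck / kap) * ?T)"
  using add_mono[OF L2 J] unfolding Hhalf_sq_def slob_def .
 also have "\<dots> = ennreal ((\<bar>D\<bar> + 2 + 4 * Ck / kap) * ?T)"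
  using T0 Ck kap by (subst ennreal_plus[symmetric]) (auto simp: algebra_simps)
 finally show ?thesis by (simp add: w_def[abs_def])
qed

end


text \<open>The pairing with the test function is at least of order \<open>mesh_size T\<close> times
  the sum of \<open>endsq\<close>, while the test function has norm of the order of the square root
  of that sum, uniformly in the mesh. As \<open>endsq\<close> is a mean square, this is the usual
  bound of \<open>h powr (1/2)\<close> times the mean square norm by the dual norm of order 1/2.
  Quasi-uniformity replaces the single lengths by the mesh size.\<close>

theorem inverse_inequality:
 assumes \<sigma>: "0 < \<sigma>"
 shows "\<exists>C>0. \<forall>T U V \<nu>. segment_mesh \<Gamma> T --> quasi_uniform \<sigma> T --> segval T U V \<nu> -->
  (mesh_size T)\<^sup>2 * (\<Sum>e\<in>T. endsq U V e) <= C * (Hminushalf_norm T \<nu>)\<^sup>2"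
proof (cases "\<exists>T0. segment_mesh \<Gamma> T0")
 case False
 then show ?thesis by (intro exI[of _ 1]) auto
next
 case True
 then obtain T0 where T0: "segment_mesh \<Gamma> T0" by (elim exE)
 interpret Z: seg_mesh \<Gamma> T0 by standard (rule T0)
 obtain kap where kap: "0 < kap" and sep: "!!T a b x y. segment_mesh \<Gamma> T ==> (a, b) \<in> T ==> x \<in> open_segment a b ==> y \<in> \<Gamma> ==>
   y \<notin> open_segment a b ==> kap * (dist x a * dist x b / dist a b) <= dist x y"
  using mesh_separation[OF T0] by (elim exE conjE) (rule that, assumption, simp)
 \<comment> \<open>Counts the segments of the reference mesh; the number of segments of
   \<open>T\<close> would not be bounded.\<close>
 define Ck where "Ck = real (card T0) * (2 * pi)"
 have Ck: "0 <= Ck" by (simp add: Ck_def)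
 have ker: "(\<integral>\<^sup>+y. far_kernel rh x y \<partial>arc_measure T) <= ennreal (Ck / rh)" if "segment_mesh \<Gamma> T" "0 < rh" for T rh x
 proof -
  have "(\<integral>\<^sup>+y. far_kernel rh x y \<partial>arc_measure T) = (\<integral>\<^sup>+y. far_kernel rh x y \<partial>arc_measure T0)"
   unfolding arc_measure_mesh_eq[OF that(1) T0] ..
  moreover have "(\<integral>\<^sup>+y. far_kernel rh x y \<partial>arc_measure T0) <= (\<Sum>e\<in>T0. ennreal (2 * pi / rh))"
   unfolding nn_integral_arc[OF far_kernel_measurable Z.fin] case_prod_beta
   by (intro sum_mono segint_far_kernel Z.ne that(2)) auto
  moreover have "(\<Sum>e\<in>T0. ennreal (2 * pi / rh)) = ennreal (Ck / rh)"
   by (subst sum_ennreal) (use that(2) in \<open>simp_all add: Ck_def\<close>)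
  ultimately show ?thesis by simp
 qed
 define D where "D = diameter \<Gamma>"
 have bd: "bounded \<Gamma>"
 proof -
  have "(\<Union>e\<in>T0. closed_segment (fst e) (snd e)) = \<Gamma>" using T0 by (simp add: segment_mesh_def case_prod_beta)
  moreover have "bounded (\<Union>e\<in>T0. closed_segment (fst e) (snd e))"
   using Z.fin by (intro bounded_UN ballI bounded_closed_segment)
  ultimately show ?thesis by simp
 qed
 have D: "dist a b <= D" if "segment_mesh \<Gamma> T" "(a, b) \<in> T" for T a b
 proof -
  have "closed_segment a b \<subseteq> (\<Union>e\<in>T. closed_segment (fst e) (snd e))"
   using UN_upper[OF that(2), of "\<lambda>e. closed_segment (fst e) (snd e)"] by simp
  also have "\<dots> = \<Gamma>" using that(1) by (simp add: segment_mesh_def case_prod_beta)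
  finally have "a \<in> \<Gamma>" "b \<in> \<Gamma>" by auto
  then show ?thesis unfolding D_def by (rule diameter_bounded_bound[OF bd])
 qed
 define C1 where "C1 = \<bar>D\<bar> + 2 + 4 * Ck / kap"
 have C1: "0 < C1" using Ck kap by (simp add: C1_def add_pos_nonneg)
 define C where "C = (1024 / \<sigma>)\<^sup>2 * C1"
 have main: "(mesh_size T)\<^sup>2 * (\<Sum>e\<in>T. endsq U V e) <= C * (Hminushalf_norm T \<nu>)\<^sup>2"
  if T: "segment_mesh \<Gamma> T" and qu: "quasi_uniform \<sigma> T" and sv: "segval T U V \<nu>" for T U V \<nu>
 proof (cases "0 < (\<Sum>e\<in>T. endsq U V e)")
  case False
  moreover have "0 <= (\<Sum>e\<in>T. endsq U V e)" by (simp add: sum_nonneg endsq_def)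
  ultimately have "(\<Sum>e\<in>T. endsq U V e) = 0" by linarith
  then show ?thesis using C1 by (simp add: C_def)
 next
  case pos: True
  interpret seg_mesh \<Gamma> T by standard (rule T)
  interpret \<mu>: finite_measure "arc_measure T" by (rule finite_measure_arc[OF fin])
  let ?N = "\<Sum>e\<in>T. endsq U V e" and ?h = "mesh_size T"
  define w where "w x = bub x *\<^sub>R \<nu> x" for x
  note vm [measurable] = segval_measurable[OF sv]
  have wm: "w \<in> borel_measurable borel" unfolding w_def by measurable
  have H: "Hhalf_sq T w <= ennreal (C1 * ?N)"
   unfolding w_def C1_def
   by (rule test_function_estimate[OF sv kap sep[OF T] ker[OF T] Ck D[OF T]])
  define P where "P x = bub x * (norm (\<nu> x))\<^sup>2" for x
  have Pm: "P \<in> borel_measurable borel" unfolding P_def by measurable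
  have b0: "0 <= bub x" for x unfolding bub_def by (intro sum_nonneg) auto
  have P0: "0 <= P x" for x using b0 by (simp add: P_def)
  have pe: "pairing T \<nu> w = (\<integral>x. P x \<partial>arc_measure T)"
   unfolding pairing_def w_def P_def by (simp add: power2_norm_eq_inner)
  have bub1: "bub x <= real (card T)" if "x \<in> \<Gamma>" for x
  proof -
   have "bub x <= (\<Sum>e\<in>T. 1)"
    unfolding bub_def
   proof (rule sum_mono)
    fix e assume e: "e \<in> T"
    show "indicator (open_segment (fst e) (snd e)) x * (dist x (fst e) * dist x (snd e) / (dist (fst e) (snd e))\<^sup>2) <= (1::real)"
    proof (cases "x \<in> open_segment (fst e) (snd e)")
     case True
     have n: "fst e ~= snd e" using e by (intro ne) simp
     have "dist x (fst e) <= dist (fst e) (snd e)" "dist x (snd e) <= dist (fst e) (snd e)"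
      using dist_in_closed_segment[of x "fst e" "snd e"] True unfolding open_segment_def by (auto simp: dist_commute)
     then have "dist x (fst e) * dist x (snd e) <= dist (fst e) (snd e) * dist (fst e) (snd e)"
      by (intro mult_mono) auto
     then show ?thesis using True n by (simp add: power2_eq_square divide_le_eq)
    qed simp
   qed
   then show ?thesis by simp
  qed
  \<comment> \<open>On an eighth of the segment, near the end point with the larger value, the
    bubble is at least \<open>1 / 16\<close> and the norm of \<open>\<nu>\<close> at least half the
    larger value \<open>M\<close>, since \<open>3 / 4 - 1 / 4 = 1 / 2\<close>. As
    \<open>M\<^sup>2\<close> is at least half of \<open>endsq\<close>, this gives
    \<open>128 = 16 * 8\<close>; the length \<open>1 / 8\<close> leads to the 1024 below.\<close>
  have P_ge: "ennreal (dist a b * (endsq U V (a, b) / 128 * (1 / 8))) <= segint a b (\<lambda>x. ennreal (P x))" if e: "(a, b) \<in> T" for a b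
  proof -
   have key: "ennreal (endsq U V (a, b) / 128) <= ennreal (P (linepath a b t))"
    if t: "t \<in> {0<..<1}" and s: "1 / 16 <= t * (1 - t)" and n: "endsq U V (a, b) / 8 <= (norm (\<nu> (linepath a b t)))\<^sup>2" for t
   proof (rule ennreal_leI)
    have "1 / 16 * (endsq U V (a, b) / 8) <= (t * (1 - t)) * (norm (\<nu> (linepath a b t)))\<^sup>2"
     by (rule mult_mono[OF s n]) (use t in \<open>auto simp: endsq_def\<close>)
    then show "endsq U V (a, b) / 128 <= P (linepath a b t)" by (simp add: P_def bub_eq[OF e t])
   qed
   have nu: "\<nu> (linepath a b t) = (1 - t) *\<^sub>R U (a, b) + t *\<^sub>R V (a, b)" if "t \<in> {0<..<1}" for t
    using sv e that unfolding segval_def by fast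
   have half: "endsq U V (a, b) / 8 <= r\<^sup>2" if "norm (U (a, b)) <= M" "norm (V (a, b)) <= M" "M / 2 <= r" for M r
   proof -
    have M: "0 <= M" by (rule order_trans[OF norm_ge_zero that(1)])
    have "(norm (U (a, b)))\<^sup>2 <= M\<^sup>2" "(norm (V (a, b)))\<^sup>2 <= M\<^sup>2" "(M / 2)\<^sup>2 <= r\<^sup>2"
     using that M by (intro power_mono; simp)+
    then show ?thesis unfolding endsq_def power_divide by (simp add: field_simps)
   qed
   show ?thesis
   proof (cases "norm (V (a, b)) <= norm (U (a, b))")
    case True
    have "ennreal (dist a b * (endsq U V (a, b) / 128 * (1 / 4 - 1 / 8))) <= segint a b (\<lambda>x. ennreal (P x))"
    proof (rule segint_ge)
     fix t assume t: "t \<in> {1 / 8..1 / 4 :: real}"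
     have s: "1 / 16 <= t * (1 - t)" using mult_mono[of "1/8" t "3/4" "1 - t"] t by auto
     have "norm ((1 - t) *\<^sub>R U (a, b)) - norm (t *\<^sub>R V (a, b)) <= norm ((1 - t) *\<^sub>R U (a, b) + t *\<^sub>R V (a, b))"
      using norm_triangle_ineq2[of "(1 - t) *\<^sub>R U (a, b)" "- t *\<^sub>R V (a, b)"] by simp
     moreover have "t * norm (V (a, b)) <= 1 / 4 * norm (U (a, b))" "3 / 4 * norm (U (a, b)) <= (1 - t) * norm (U (a, b))"
      using t True by (intro mult_mono mult_right_mono; simp)+
     ultimately have "norm (U (a, b)) / 2 <= norm (\<nu> (linepath a b t))" using t by (simp add: nu)
     then show "ennreal (endsq U V (a, b) / 128) <= ennreal (P (linepath a b t))"
      using t True by (intro key s half) auto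
    qed (auto simp: endsq_def)
    then show ?thesis by simp
   next
    case False
    have "ennreal (dist a b * (endsq U V (a, b) / 128 * (7 / 8 - 3 / 4))) <= segint a b (\<lambda>x. ennreal (P x))"
    proof (rule segint_ge)
     fix t assume t: "t \<in> {3 / 4..7 / 8 :: real}"
     have s: "1 / 16 <= t * (1 - t)" using mult_mono[of "3/4" t "1/8" "1 - t"] t by auto
     have "norm (t *\<^sub>R V (a, b)) - norm ((1 - t) *\<^sub>R U (a, b)) <= norm ((1 - t) *\<^sub>R U (a, b) + t *\<^sub>R V (a, b))"
      using norm_triangle_ineq2[of "t *\<^sub>R V (a, b)" "- ((1 - t) *\<^sub>R U (a, b))"]
      by (simp only: norm_minus_cancel diff_minus_eq_add add.commute)
     moreover have "(1 - t) * norm (U (a, b)) <= 1 / 4 * norm (V (a, b))" "3 / 4 * norm (V (a, b)) <= t * norm (V (a, b))"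
      using t False by (intro mult_mono mult_right_mono; simp)+
     ultimately have "norm (V (a, b)) / 2 <= norm (\<nu> (linepath a b t))" using t by (simp add: nu)
     then show "ennreal (endsq U V (a, b) / 128) <= ennreal (P (linepath a b t))"
      using t False by (intro key s half) auto
    qed (auto simp: endsq_def)
    then show ?thesis by simp
   qed
  qed
  have fin_P: "(\<integral>\<^sup>+x. ennreal (P x) \<partial>arc_measure T) < \<infinity>"
  proof -
   have "(\<integral>\<^sup>+x. ennreal (P x) \<partial>arc_measure T) <= (\<integral>\<^sup>+x. ennreal (real (card T) * ?N) \<partial>arc_measure T)"
   proof (rule arc_mono)
    fix y assume "y \<in> \<Gamma>"
    then have "P y <= real (card T) * ?N"
     unfolding P_def using bub1 segval_bounded[OF sv, of y] by (intro mult_mono) auto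
    then show "ennreal (P y) <= ennreal (real (card T) * ?N)" by (rule ennreal_leI)
   qed (use Pm in measurable)
   also have "\<dots> < \<infinity>" by (simp add: \<mu>.emeasure_eq_measure ennreal_mult[symmetric] ennreal_mult_less_top)
   finally show ?thesis .
  qed
  have pen: "ennreal (pairing T \<nu> w) = (\<integral>\<^sup>+x. ennreal (P x) \<partial>arc_measure T)"
  proof -
   have Pm': "P \<in> borel_measurable (arc_measure T)" using Pm by (simp cong: measurable_cong_sets)
   have "integrable (arc_measure T) P"
    using fin_P P0 Pm' by (intro integrableI_bounded) auto
   then show ?thesis unfolding pe using nn_integral_eq_integral[of "arc_measure T" P] P0 by simp
  qed
  have h0: "0 <= ?h"
  proof -
   obtain e where "e \<in> T" using pos by (cases "T = {}") auto
   then have "dist (fst e) (snd e) <= ?h" using bspec[OF qu[unfolded quasi_uniform_def]] by (auto simp: case_prod_beta)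
   then show ?thesis by (rule order_trans[OF zero_le_dist])
  qed
  have "ennreal (\<sigma> * ?h * ?N / 1024) <= (\<Sum>e\<in>T. segint (fst e) (snd e) (\<lambda>x. ennreal (P x)))"
  proof -
   have "\<sigma> * ?h * ?N / 1024 = (\<Sum>e\<in>T. \<sigma> * ?h * (endsq U V e / 128 * (1 / 8)))"
    by (simp add: sum_distrib_left sum_divide_distrib)
   then have "ennreal (\<sigma> * ?h * ?N / 1024) = (\<Sum>e\<in>T. ennreal (\<sigma> * ?h * (endsq U V e / 128 * (1 / 8))))"
    using \<sigma> h0 by (subst sum_ennreal) (auto simp: endsq_def)
   also have "\<dots> <= (\<Sum>e\<in>T. segint (fst e) (snd e) (\<lambda>x. ennreal (P x)))"
   proof (rule sum_mono)
    fix e assume e: "e \<in> T"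
    have "\<sigma> * ?h <= dist (fst e) (snd e)" using bspec[OF qu[unfolded quasi_uniform_def] e] by (simp add: case_prod_beta)
    then have "\<sigma> * ?h * (endsq U V e / 128 * (1 / 8)) <= dist (fst e) (snd e) * (endsq U V e / 128 * (1 / 8))"
     by (rule mult_right_mono) (simp add: endsq_def)
    moreover have "ennreal (dist (fst e) (snd e) * (endsq U V e / 128 * (1 / 8))) <= segint (fst e) (snd e) (\<lambda>x. ennreal (P x))"
     using P_ge[of "fst e" "snd e"] e by simp
    ultimately show "ennreal (\<sigma> * ?h * (endsq U V e / 128 * (1 / 8))) <= segint (fst e) (snd e) (\<lambda>x. ennreal (P x))"
     by (rule order_trans[OF ennreal_leI])
   qed
   finally show ?thesis .
  qed
  moreover have "(\<integral>\<^sup>+x. ennreal (P x) \<partial>arc_measure T) = (\<Sum>e\<in>T. segint (fst e) (snd e) (\<lambda>x. ennreal (P x)))"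
  proof -
   have "(\<lambda>x. ennreal (P x)) \<in> borel_measurable borel" using Pm by measurable
   from nn_integral_arc[OF this fin] show ?thesis unfolding case_prod_beta .
  qed
  ultimately have "ennreal (\<sigma> * ?h * ?N / 1024) <= ennreal (pairing T \<nu> w)" unfolding pen by simp
  moreover have "0 <= pairing T \<nu> w" unfolding pe using P0 by simp
  ultimately have lower: "\<sigma> * ?h * ?N / 1024 <= pairing T \<nu> w" by simp
  define S where "S = sqrt (C1 * ?N)"
  have S: "0 < S" "S\<^sup>2 = C1 * ?N" using pos C1 by (simp_all add: S_def)
  have "pairing T \<nu> w <= S * Hminushalf_norm T \<nu>"
   using H by (intro pairing_le_dual_norm[OF T sv wm S(1)]) (simp add: S(2))
  with lower have "\<sigma> * ?h * ?N / 1024 <= S * Hminushalf_norm T \<nu>" by linarith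
  then have "(\<sigma> * ?h * ?N / 1024)\<^sup>2 <= (S * Hminushalf_norm T \<nu>)\<^sup>2"
   using \<sigma> h0 pos by (intro power_mono) auto
  \<comment> \<open>The sum \<open>?N\<close> enters the lower bound linearly and the upper bound as
    a square root; after squaring one factor cancels.\<close>
  then have "(\<sigma> / 1024)\<^sup>2 * ?h\<^sup>2 * ?N * ?N <= C1 * (Hminushalf_norm T \<nu>)\<^sup>2 * ?N"
   unfolding power_mult_distrib S(2) by (simp add: power_divide power_mult_distrib power2_eq_square mult_ac)
  then have "(\<sigma> / 1024)\<^sup>2 * ?h\<^sup>2 * ?N <= C1 * (Hminushalf_norm T \<nu>)\<^sup>2" using pos by simp
  then have "(1024 / \<sigma>)\<^sup>2 * ((\<sigma> / 1024)\<^sup>2 * (?h\<^sup>2 * ?N)) <= (1024 / \<sigma>)\<^sup>2 * (C1 * (Hminushalf_norm T \<nu>)\<^sup>2)"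
   by (intro mult_left_mono) (simp_all add: mult_ac)
  moreover have "(1024 / \<sigma>)\<^sup>2 * ((\<sigma> / 1024)\<^sup>2 * (?h\<^sup>2 * ?N)) = ?h\<^sup>2 * ?N" using \<sigma> by (simp add: power_divide)
  ultimately show ?thesis unfolding C_def by (simp only: mult.assoc)
 qed
 show ?thesis using \<sigma> C1 main by (intro exI[of _ C]) (auto simp: C_def)
qed

section \<open>Convex quadrilaterals\<close>

text \<open>\<open>dF1\<close> and \<open>dF2\<close> are the partial derivatives of
  \<open>bilinear_map\<close>; each is a function of the other coordinate alone.\<close>

fun dF1 :: "quad => real => real^2" where
 "dF1 (a, b, c, d) t = (1 - t) *\<^sub>R (b - a) + t *\<^sub>R (c - d)"

fun dF2 :: "quad => real => real^2" where
 "dF2 (a, b, c, d) s = (1 - s) *\<^sub>R (d - a) + s *\<^sub>R (c - b)"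

definition jac :: "quad => real^2 => real" where
 "jac K xi = cross2 (dF1 K (xi $ 2)) (dF2 K (xi $ 1))"

fun sides :: "quad => edge set" where
 "sides (a, b, c, d) = {(a, b), (b, c), (c, d), (d, a)}"

lemma finite_sides: "finite (sides K)"
 by (cases K) simp

lemma quad_edges_sides: "quad_edges K = (\<lambda>(a, b). closed_segment a b) ` sides K"
 by (cases K) simp

lemma cbox_unit: "xi \<in> cbox 0 (1 :: real^2) \<longleftrightarrow> 0 <= xi $ 1 \<and> xi $ 1 <= 1 \<and> 0 <= xi $ 2 \<and> xi $ 2 <= 1"
 by (auto simp: mem_box_cart forall_2)

lemma box_unit: "xi \<in> box 0 (1 :: real^2) \<longleftrightarrow> 0 < xi $ 1 \<and> xi $ 1 < 1 \<and> 0 < xi $ 2 \<and> xi $ 2 < 1"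
 by (auto simp: mem_box_cart forall_2)

lemma convex_comb_pos:
 assumes "0 <= r" "r <= 1" "0 < x" "0 < (y :: real)"
 shows "0 < (1 - r) * x + r * y"
proof (cases "r = 0")
 case False
 then have "0 < r * y" using assms by simp
 moreover have "0 <= (1 - r) * x" using assms by simp
 ultimately show ?thesis by linarith
qed (use assms in simp)

text \<open>The Jacobian of a bilinear map interpolates its four corner values, and these are the
  cross products that strict convexity makes positive.\<close>

lemma jac_midpoint_pos:
 assumes "strictly_convex_quad K" "0 <= s" "s <= 1" "0 <= t" "t <= 1"
 shows "0 < cross2 (dF1 K t) (dF2 K s)"
proof (cases K)
 case (fields a b c d)
 let ?Ja = "cross2 (b - a) (d - a)" and ?Jb = "cross2 (c - b) (a - b)"
  and ?Jc = "cross2 (d - c) (b - c)" and ?Jd = "cross2 (a - d) (c - d)"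
 have "cross2 (dF1 K t) (dF2 K s) = (1 - s) * ((1 - t) * ?Ja + t * ?Jd) + s * ((1 - t) * ?Jb + t * ?Jc)"
  unfolding fields by (simp add: cross2_def algebra_simps)
 then show ?thesis using assms fields by (auto intro!: convex_comb_pos)
qed

lemma jac_pos: "strictly_convex_quad K ==> xi \<in> cbox 0 1 ==> 0 < jac K xi"
 unfolding jac_def cbox_unit by (intro jac_midpoint_pos) auto

text \<open>A mean value formula without remainder, exact because the map is bilinear. With
  derivatives at midpoints, injectivity reduces to the independence of two vectors.\<close>

lemma bilinear_map_diff:
 "bilinear_map K xi - bilinear_map K \<eta> =
  (xi $ 1 - \<eta> $ 1) *\<^sub>R dF1 K ((xi $ 2 + \<eta> $ 2) / 2) + (xi $ 2 - \<eta> $ 2) *\<^sub>R dF2 K ((xi $ 1 + \<eta> $ 1) / 2)"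
 by (cases K) (simp add: cart_eq_iff field_simps)

lemma bilinear_map_inj:
 assumes "strictly_convex_quad K"
 shows "inj_on (bilinear_map K) (cbox 0 1)"
proof (rule inj_onI)
 fix xi \<eta> :: "real^2" assume xi: "xi \<in> cbox 0 1" and \<eta>: "\<eta> \<in> cbox 0 1" and e: "bilinear_map K xi = bilinear_map K \<eta>"
 let ?u = "dF1 K ((xi $ 2 + \<eta> $ 2) / 2)" and ?v = "dF2 K ((xi $ 1 + \<eta> $ 1) / 2)"
 define p where "p = xi $ 1 - \<eta> $ 1"
 define q where "q = xi $ 2 - \<eta> $ 2"
 have J: "0 < cross2 ?u ?v" using xi \<eta> by (intro jac_midpoint_pos assms) (auto simp: cbox_unit)
 have z: "p *\<^sub>R ?u + q *\<^sub>R ?v = 0" using bilinear_map_diff[of K xi \<eta>] e by (simp add: p_def q_def)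
 have "p * cross2 ?u ?v = cross2 (p *\<^sub>R ?u + q *\<^sub>R ?v) ?v" by (simp add: cross2_def algebra_simps)
 then have "p = 0" using J z by (simp add: cross2_def)
 moreover have "q * cross2 ?u ?v = cross2 ?u (p *\<^sub>R ?u + q *\<^sub>R ?v)" by (simp add: cross2_def algebra_simps)
 then have "q = 0" using J z by (simp add: cross2_def)
 ultimately show "xi = \<eta>" by (simp add: p_def q_def cart_eq_iff forall_2)
qed

lemma continuous_bilinear_map: "continuous_on S (bilinear_map K)"
 by (cases K) (auto intro!: continuous_intros)

lemma bilinear_map_has_derivative:
 "(bilinear_map K has_derivative (\<lambda>h. h $ 1 *\<^sub>R dF1 K (xi $ 2) + h $ 2 *\<^sub>R dF2 K (xi $ 1))) (at xi)"
proof (cases K)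
 case (fields a b c d)
 have n: "((\<lambda>x::real^2. x $ i) has_derivative (\<lambda>h. h $ i)) (at xi)" for i
  by (rule bounded_linear_imp_has_derivative[OF bounded_linear_vec_nth])
 show ?thesis
  unfolding fields bilinear_map.simps
  by (rule has_derivative_eq_rhs, (rule derivative_intros n)+)
   (simp add: fun_eq_iff cart_eq_iff algebra_simps)
qed

lemma compact_quad_elem: "compact (quad_elem K)"
 unfolding quad_elem_def by (intro compact_continuous_image continuous_bilinear_map compact_cbox)

lemma open_quad_interior:
 assumes "strictly_convex_quad K"
 shows "open (bilinear_map K ` box 0 1)"
 using bilinear_map_inj[OF assms] box_subset_cbox[of "0 :: real^2" 1]
 by (intro invariance_of_domain continuous_bilinear_map open_box) (auto intro: inj_on_subset)

text \<open>A quarter turn of the reference square brings any side to the front, so that statements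
  about sides are proved for the first side only.\<close>

fun rot :: "quad => quad" where "rot (a, b, c, d) = (b, c, d, a)"

lemma bilinear_map_rot: "bilinear_map (rot K) xi = bilinear_map K (vector [1 - xi $ 2, xi $ 1])"
 by (cases K) (simp add: cart_eq_iff algebra_simps)

lemma strictly_convex_rot: "strictly_convex_quad (rot K) = strictly_convex_quad K"
 by (cases K) auto

lemma sides_rot: "sides (rot K) = sides K"
 by (cases K) auto

lemma quad_vertices_rot: "quad_vertices (rot K) = quad_vertices K"
 by (cases K) auto

lemma quad_elem_rot: "quad_elem (rot K) = quad_elem K"
proof -
 have le: "quad_elem (rot K) \<subseteq> quad_elem K" for K
 proof
  fix x assume "x \<in> quad_elem (rot K)"
  then obtain xi where "xi \<in> cbox 0 1" "x = bilinear_map (rot K) xi"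
   unfolding quad_elem_def by (elim imageE) (rule that)
  then show "x \<in> quad_elem K" unfolding quad_elem_def bilinear_map_rot
   by (intro image_eqI[of _ _ "vector [1 - xi $ 2, xi $ 1]"]) (auto simp: cbox_unit)
 qed
 have "rot (rot (rot (rot K))) = K" by (cases K) simp
 then have "quad_elem K \<subseteq> quad_elem (rot K)" using le[of "rot K"] le[of "rot (rot K)"] le[of "rot (rot (rot K))"] by auto
 then show ?thesis using le by blast
qed

lemma side_first:
 assumes "(a, b) \<in> sides K" "strictly_convex_quad K"
 obtains c d where "strictly_convex_quad (a, b, c, d)" "sides (a, b, c, d) = sides K"
  "quad_elem (a, b, c, d) = quad_elem K" "quad_vertices (a, b, c, d) = quad_vertices K"
proof -
 note I = strictly_convex_rot sides_rot quad_vertices_rot quad_elem_rot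
 obtain p q r s where K: "K = (p, q, r, s)" by (cases K)
 have "\<exists>n. \<exists>c d. (rot ^^ n) K = (a, b, c, d)"
 proof -
  consider "(a, b) = (p, q)" | "(a, b) = (q, r)" | "(a, b) = (r, s)" | "(a, b) = (s, p)"
   using assms(1) K by auto
  then show ?thesis
  proof cases
   case 1 then show ?thesis by (intro exI[of _ "0 :: nat"] exI[of _ r] exI[of _ s]) (simp add: K)
  next
   case 2 then show ?thesis by (intro exI[of _ "1 :: nat"] exI[of _ s] exI[of _ p]) (simp add: K)
  next
   case 3 then show ?thesis by (intro exI[of _ "2 :: nat"] exI[of _ p] exI[of _ q]) (simp add: K numeral_eq_Suc)
  next
   case 4 then show ?thesis by (intro exI[of _ "3 :: nat"] exI[of _ q] exI[of _ r]) (simp add: K numeral_eq_Suc)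
  qed
 qed
 then obtain n c d where n: "(rot ^^ n) K = (a, b, c, d)" by (elim exE)
 have "strictly_convex_quad ((rot ^^ n) K) = strictly_convex_quad K" "sides ((rot ^^ n) K) = sides K"
  "quad_elem ((rot ^^ n) K) = quad_elem K" "quad_vertices ((rot ^^ n) K) = quad_vertices K"
  by (induction n) (simp_all add: I)
 then show ?thesis using assms(2) by (intro that[of c d]) (simp_all only: n)
qed

text \<open>The height over the first side is \<open>xi $ 2\<close> times a convex combination of
  positive corner cross products, so its sign and its zeros can be read off the second reference
  coordinate.\<close>

lemma cross2_side:
 "cross2 (b - a) (bilinear_map (a, b, c, d) xi - a) =
  xi $ 2 * ((1 - xi $ 1) * cross2 (b - a) (d - a) + xi $ 1 * cross2 (c - b) (a - b))"
 by (simp add: cross2_def algebra_simps)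

lemma quad_elem_side_nonneg:
 assumes K: "strictly_convex_quad K" "(a, b) \<in> sides K" and x: "x \<in> quad_elem K"
 shows "0 <= cross2 (b - a) (x - a)" "cross2 (b - a) (x - a) = 0 \<longleftrightarrow> x \<in> closed_segment a b"
proof -
 obtain c d where cd: "strictly_convex_quad (a, b, c, d)" "quad_elem (a, b, c, d) = quad_elem K"
  by (rule side_first[OF K(2,1)])
 obtain xi where xi: "xi \<in> cbox 0 1" "x = bilinear_map (a, b, c, d) xi"
  using x[folded cd(2)] unfolding quad_elem_def by (elim imageE) (rule that)
 define J where "J = (1 - xi $ 1) * cross2 (b - a) (d - a) + xi $ 1 * cross2 (c - b) (a - b)"
 have J: "0 < J" unfolding J_def using xi(1) cd(1) by (intro convex_comb_pos) (auto simp: cbox_unit)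
 have e: "cross2 (b - a) (x - a) = xi $ 2 * J" unfolding xi(2) cross2_side J_def ..
 show "0 <= cross2 (b - a) (x - a)" using J xi(1) unfolding e by (simp add: cbox_unit)
 show "cross2 (b - a) (x - a) = 0 \<longleftrightarrow> x \<in> closed_segment a b"
 proof
  assume "cross2 (b - a) (x - a) = 0"
  then have "xi $ 2 = 0" using J unfolding e by simp
  then have "x = linepath a b (xi $ 1)" unfolding xi(2) by (simp add: linepath_def)
  then show "x \<in> closed_segment a b" using xi(1) by (simp add: cbox_unit linepath_in_path)
 next
  assume "x \<in> closed_segment a b"
  then obtain u where u: "x = (1 - u) *\<^sub>R a + u *\<^sub>R b" unfolding closed_segment_def by blast
  show "cross2 (b - a) (x - a) = 0" unfolding u by (simp add: cross2_def algebra_simps)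
 qed
qed

lemma open_side_pos:
 assumes K: "strictly_convex_quad K" "(a, b) \<in> sides K" and x: "x \<in> open_segment a b"
  and pq: "(p, q) \<in> sides K" "(p, q) ~= (a, b)"
 shows "0 < cross2 (q - p) (x - p)"
proof -
 obtain c d where cd: "strictly_convex_quad (a, b, c, d)" "sides (a, b, c, d) = sides K"
  by (rule side_first[OF K(2,1)])
 let ?Ja = "cross2 (b - a) (d - a)" and ?Jb = "cross2 (c - b) (a - b)"
  and ?Jc = "cross2 (d - c) (b - c)" and ?Jd = "cross2 (a - d) (c - d)"
 have J: "0 < ?Ja" "0 < ?Jb" "0 < ?Jc" "0 < ?Jd" using cd(1) by auto
 obtain u where u: "0 < u" "u < 1" "x = (1 - u) *\<^sub>R a + u *\<^sub>R b" using x unfolding in_segment by blast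
 have "cross2 (c - b) (x - b) = (1 - u) * ?Jb" "cross2 (a - d) (x - d) = u * ?Ja"
  "cross2 (d - c) (x - c) = (1 - u) * ?Jd + u * ?Jc"
  unfolding u(3) by (simp_all add: cross2_def algebra_simps)
 moreover have "(p, q) \<in> {(b, c), (c, d), (d, a)}" using pq cd(2)[symmetric] by auto
 ultimately show ?thesis using u J convex_comb_pos[of u ?Jd ?Jc] by auto
qed

lemma quad_interior_pos:
 assumes K: "strictly_convex_quad K" and xi: "xi \<in> box 0 1" and ab: "(a, b) \<in> sides K"
 shows "0 < cross2 (b - a) (bilinear_map K xi - a)"
proof -
 obtain p q r s where fields: "K = (p, q, r, s)" by (cases K)
 let ?Jp = "cross2 (q - p) (s - p)" and ?Jq = "cross2 (r - q) (p - q)"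
  and ?Jr = "cross2 (s - r) (q - r)" and ?Js = "cross2 (p - s) (r - s)"
 have J: "0 < ?Jp" "0 < ?Jq" "0 < ?Jr" "0 < ?Js" using K fields by auto
 let ?x = "bilinear_map K xi"
 have "cross2 (q - p) (?x - p) = xi $ 2 * ((1 - xi $ 1) * ?Jp + xi $ 1 * ?Jq)"
  "cross2 (r - q) (?x - q) = (1 - xi $ 1) * ((1 - xi $ 2) * ?Jq + xi $ 2 * ?Jr)"
  "cross2 (s - r) (?x - r) = (1 - xi $ 2) * ((1 - xi $ 1) * ?Js + xi $ 1 * ?Jr)"
  "cross2 (p - s) (?x - s) = xi $ 1 * ((1 - xi $ 2) * ?Jp + xi $ 2 * ?Js)"
  unfolding fields by (simp_all add: cross2_def algebra_simps)
 moreover have "(a, b) \<in> {(p, q), (q, r), (r, s), (s, p)}" using ab fields by simp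
 ultimately show ?thesis using xi J unfolding box_unit
  by (auto intro!: mult_pos_pos convex_comb_pos)
qed

lemma quad_elem_decomp:
 assumes K: "strictly_convex_quad K" and x: "x \<in> quad_elem K"
 shows "x \<in> bilinear_map K ` box 0 1 \<or> (\<exists>(a, b)\<in>sides K. x \<in> closed_segment a b)"
proof -
 obtain p q r s where fields: "K = (p, q, r, s)" by (cases K)
 obtain xi where xi: "xi \<in> cbox 0 1" "x = bilinear_map K xi"
  using x unfolding quad_elem_def by (elim imageE) (rule that)
 have l: "(1 - xi $ i) *\<^sub>R y + xi $ i *\<^sub>R z \<in> closed_segment y z" for i and y z :: "real^2"
  using xi(1) unfolding in_segment by (intro exI[of _ "xi $ i"]) (auto simp: mem_box_cart)
 consider "xi \<in> box 0 1" | "xi $ 2 = 0" | "xi $ 1 = 1" | "xi $ 2 = 1" | "xi $ 1 = 0"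
  using xi(1) unfolding box_unit cbox_unit by linarith
 then show ?thesis
 proof cases
  case 1 then show ?thesis using xi(2) by blast
 next
  case 2 then show ?thesis using l[of 1 p q] xi(2) by (simp add: fields)
 next
  case 3 then show ?thesis using l[of 2 q r] xi(2) by (simp add: fields)
 next
  case 4 then show ?thesis using l[of 1 s r] xi(2) by (simp add: fields closed_segment_commute[of r s] add.commute)
 next
  case 5 then show ?thesis using l[of 2 p s] xi(2) by (simp add: fields closed_segment_commute[of s p])
 qed
qed

text \<open>The image of the open square is open, and closed relative to the open polygon cut out by the
 sides, because its closure adds only points on the sides.\<close>

lemma quad_interior_eq:
 assumes K: "strictly_convex_quad K"
 shows "bilinear_map K ` box 0 1 = {x. \<forall>(a, b)\<in>sides K. 0 < cross2 (b - a) (x - a)}" (is "?I = ?P")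
proof -
 have cont: "continuous_on UNIV (\<lambda>x. cross2 (b - a) (x - a))" for a b
  unfolding cross2_def by (intro continuous_intros)
 have sub: "?I \<subseteq> ?P" by (auto intro: quad_interior_pos[OF K])
 have "convex ?P"
 proof (rule convexI)
  fix x y u v assume xy: "x \<in> ?P" "y \<in> ?P" and uv: "0 <= u" "0 <= v" "u + v = (1::real)"
  show "u *\<^sub>R x + v *\<^sub>R y \<in> ?P"
  proof (clarify)
   fix a b assume ab: "(a, b) \<in> sides K"
   have v: "u = 1 - v" using uv by simp
   have "cross2 (b - a) (u *\<^sub>R x + v *\<^sub>R y - a) = (1 - v) * cross2 (b - a) (x - a) + v * cross2 (b - a) (y - a)"
    unfolding v by (simp add: cross2_def algebra_simps)
   then show "0 < cross2 (b - a) (u *\<^sub>R x + v *\<^sub>R y - a)"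
    using xy ab uv by (auto intro!: convex_comb_pos)
  qed
 qed
 then have con: "connected ?P" by (rule convex_connected)
 have eq: "?I = quad_elem K \<inter> ?P"
 proof
  show "?I \<subseteq> quad_elem K \<inter> ?P" using sub box_subset_cbox[of "0::real^2" 1] unfolding quad_elem_def by blast
  show "quad_elem K \<inter> ?P \<subseteq> ?I"
  proof
   fix x assume x: "x \<in> quad_elem K \<inter> ?P"
   have "x \<notin> closed_segment a b" if "(a, b) \<in> sides K" for a b
   proof -
    have "0 < cross2 (b - a) (x - a)" using x that by auto
    then show ?thesis using quad_elem_side_nonneg(2)[OF K that, of x] x by auto
   qed
   then show "x \<in> ?I" using quad_elem_decomp[OF K, of x] x by auto
  qed
 qed
 have "openin (top_of_set ?P) ?I" using open_quad_interior[OF K] sub by (simp add: open_subset)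
 moreover have "closedin (top_of_set ?P) ?I"
  unfolding eq Int_commute[of "quad_elem K"]
  by (rule closedin_closed_Int[OF compact_imp_closed[OF compact_quad_elem]])
 moreover have "bilinear_map K (vector [1/2, 1/2]) \<in> ?I" by (rule imageI) (simp add: box_unit)
 then have "?I ~= {}" by (rule ex_in_conv[THEN iffD1, OF exI])
 ultimately show ?thesis using con[unfolded connected_clopen, rule_format, of ?I] by simp
qed

lemma quad_elem_eq:
 assumes K: "strictly_convex_quad K"
 shows "quad_elem K = {x. \<forall>(a, b)\<in>sides K. 0 <= cross2 (b - a) (x - a)}" (is "_ = ?P")
proof
 show "quad_elem K \<subseteq> ?P" by (auto intro: quad_elem_side_nonneg(1)[OF K])
 show "?P \<subseteq> quad_elem K"
 proof
  fix x assume x: "x \<in> ?P"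
  \<comment> \<open>A point of the closed polygon is approached along the segment to the image
    \<open>z\<close> of the centre, where all side inequalities are strict.\<close>
  define z where "z = bilinear_map K (vector [1/2, 1/2])"
  have z: "0 < cross2 (b - a) (z - a)" if "(a, b) \<in> sides K" for a b
   unfolding z_def by (rule quad_interior_pos[OF K _ that]) (simp add: box_unit)
  define y where "y n = x + (1 / real (Suc n)) *\<^sub>R (z - x)" for n
  have "y n \<in> quad_elem K" for n
  proof -
   have "y n \<in> {x. \<forall>(a, b)\<in>sides K. 0 < cross2 (b - a) (x - a)}"
   proof clarify
    fix a b assume ab: "(a, b) \<in> sides K"
    define r where "r = 1 / real (Suc n)"
    have r: "0 < r" "r <= 1" by (auto simp: r_def)
    have "cross2 (b - a) (y n - a) = (1 - r) * cross2 (b - a) (x - a) + r * cross2 (b - a) (z - a)"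
     unfolding y_def r_def[symmetric] by (simp add: cross2_def algebra_simps)
    moreover have "0 <= (1 - r) * cross2 (b - a) (x - a)" using x ab r by auto
    ultimately show "0 < cross2 (b - a) (y n - a)" using mult_pos_pos[OF r(1) z[OF ab]] by linarith
   qed
   then show ?thesis unfolding quad_interior_eq[OF K, symmetric] quad_elem_def
    using box_subset_cbox[of "0::real^2" 1] by blast
  qed
  moreover have "y \<longlonglongrightarrow> x + 0 *\<^sub>R (z - x)"
   unfolding y_def by (intro tendsto_intros lim_1_over_n[THEN LIMSEQ_Suc, unfolded o_def])
  ultimately show "x \<in> quad_elem K"
   using closed_sequentially[OF compact_imp_closed[OF compact_quad_elem], of y] by simp
 qed
qed

text \<open>The inequalities of the other sides are strict at \<open>x\<close> and persist nearby,
  so only the side through \<open>x\<close> cuts a small disc. This is the local picture of a mesh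
  along a side.\<close>

lemma half_disc_subset:
 assumes K: "strictly_convex_quad K" "(a, b) \<in> sides K" and x: "x \<in> open_segment a b"
 shows "\<exists>r>0. \<forall>y\<in>ball x r. 0 <= cross2 (b - a) (y - a) --> y \<in> quad_elem K"
proof -
 have "\<forall>\<^sub>F y in nhds x. \<forall>e\<in>sides K - {(a, b)}. 0 < cross2 (snd e - fst e) (y - fst e)"
 proof (rule eventually_ball_finite)
  show "\<forall>e\<in>sides K - {(a, b)}. \<forall>\<^sub>F y in nhds x. 0 < cross2 (snd e - fst e) (y - fst e)"
  proof
   fix e assume e: "e \<in> sides K - {(a, b)}"
   have "open {y. 0 < cross2 (snd e - fst e) (y - fst e)}"
    unfolding cross2_def by (intro open_Collect_less continuous_intros)
   moreover have "0 < cross2 (snd e - fst e) (x - fst e)"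
    using e by (intro open_side_pos[OF K x]) auto
   ultimately show "\<forall>\<^sub>F y in nhds x. 0 < cross2 (snd e - fst e) (y - fst e)"
    using eventually_nhds_in_open[of "{y. 0 < cross2 (snd e - fst e) (y - fst e)}" x] by simp
  qed
 qed (simp add: finite_sides)
 then obtain r where r0: "0 < r"
   and r1: "\<forall>y. dist y x < r --> (\<forall>e\<in>sides K - {(a, b)}. 0 < cross2 (snd e - fst e) (y - fst e))"
  unfolding eventually_nhds_metric by (elim exE conjE)
 have "y \<in> quad_elem K" if y: "y \<in> ball x r" "0 <= cross2 (b - a) (y - a)" for y
  unfolding quad_elem_eq[OF K(1)]
 proof (clarify)
  fix p q assume pq: "(p, q) \<in> sides K"
  show "0 <= cross2 (q - p) (y - p)"
  proof (cases "(p, q) = (a, b)")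
   case False
   have "dist y x < r" using y(1) by (simp add: dist_commute)
   with r1 have "\<forall>e\<in>sides K - {(a, b)}. 0 < cross2 (snd e - fst e) (y - fst e)" by simp
   from bspec[OF this, of "(p, q)"] show ?thesis using pq False by simp
  qed (use y in simp)
 qed
 then show ?thesis using r0 by (intro exI[of _ r]) auto
qed

section \<open>Polynomials on the reference element\<close>

lemma real2_eta: "vector [xi $ 1, xi $ 2] = (xi :: real^2)"
 by (simp add: cart_eq_iff forall_2)

lemma Q_poly_add: "p \<in> Q_poly k ==> q \<in> Q_poly k ==> (\<lambda>xi. p xi + q xi) \<in> Q_poly k"
 unfolding Q_poly_def
proof clarify
 fix c d
 show "\<exists>e. (\<lambda>xi::real^2. (\<Sum>i\<le>k. \<Sum>j\<le>k. c i j * xi $ 1 ^ i * xi $ 2 ^ j) + (\<Sum>i\<le>k. \<Sum>j\<le>k. d i j * xi $ 1 ^ i * xi $ 2 ^ j)) =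
  (\<lambda>xi. \<Sum>i\<le>k. \<Sum>j\<le>k. e i j * xi $ 1 ^ i * xi $ 2 ^ j)"
  by (rule exI[of _ "\<lambda>i j. c i j + d i j"]) (simp add: sum.distrib distrib_right)
qed

lemma Q_poly_scale: "p \<in> Q_poly k ==> (\<lambda>xi. r * p xi) \<in> Q_poly k"
 unfolding Q_poly_def
proof clarify
 fix c
 show "\<exists>e. (\<lambda>xi::real^2. r * (\<Sum>i\<le>k. \<Sum>j\<le>k. c i j * xi $ 1 ^ i * xi $ 2 ^ j)) =
  (\<lambda>xi. \<Sum>i\<le>k. \<Sum>j\<le>k. e i j * xi $ 1 ^ i * xi $ 2 ^ j)"
  by (rule exI[of _ "\<lambda>i j. r * c i j"]) (simp add: sum_distrib_left mult.assoc)
qed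

lemma Q_poly_zero: "(\<lambda>_. 0) \<in> Q_poly k"
 unfolding Q_poly_def by (auto intro!: exI[of _ "\<lambda>_ _. 0"])

lemma Q_poly_sum: "finite A ==> (!!a. a \<in> A ==> f a \<in> Q_poly k) ==> (\<lambda>xi. \<Sum>a\<in>A. f a xi) \<in> Q_poly k"
 by (induction A rule: finite_induct) (auto intro: Q_poly_zero Q_poly_add)

lemma Q_poly_prod: "(\<lambda>xi. (\<Sum>i\<le>k. u i * (xi $ 1) ^ i) * (\<Sum>j\<le>k. w j * (xi $ 2) ^ j)) \<in> Q_poly k"
 unfolding Q_poly_def
 by (auto intro!: exI[of _ "\<lambda>i j. u i * w j"] simp: sum_product mult_ac)

lemma continuous_Q_poly: "p \<in> Q_poly k ==> continuous_on S p"
 unfolding Q_poly_def by (auto intro!: continuous_intros)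

lemma Q_poly_derivative:
 assumes "p \<in> Q_poly k"
 shows "\<exists>p1 p2. continuous_on UNIV p1 \<and> continuous_on UNIV p2 \<and>
  (\<forall>xi. (p has_derivative (\<lambda>h. p1 xi * h $ 1 + p2 xi * h $ 2)) (at xi))"
proof -
 obtain c where p: "p = (\<lambda>xi. \<Sum>i\<le>k. \<Sum>j\<le>k. c i j * (xi $ 1) ^ i * (xi $ 2) ^ j)" using assms unfolding Q_poly_def by auto
 define p1 where "p1 xi = (\<Sum>i\<le>k. \<Sum>j\<le>k. c i j * (real i * (xi $ 1) ^ (i - 1)) * (xi $ 2) ^ j)" for xi :: "real^2"
 define p2 where "p2 xi = (\<Sum>i\<le>k. \<Sum>j\<le>k. c i j * (xi $ 1) ^ i * (real j * (xi $ 2) ^ (j - 1)))" for xi :: "real^2"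
 have n: "((\<lambda>x::real^2. x $ i) has_derivative (\<lambda>h. h $ i)) (at xi)" for i xi
  by (rule bounded_linear_imp_has_derivative[OF bounded_linear_vec_nth])
 have pw: "((\<lambda>x::real^2. (x $ i) ^ m) has_derivative (\<lambda>h. real m * (xi $ i) ^ (m - 1) * h $ i)) (at xi)" for i m xi
  by (rule has_derivative_eq_rhs[OF has_derivative_power[OF n]]) (auto simp: mult_ac)
 have D: "(p has_derivative (\<lambda>h. \<Sum>i\<le>k. \<Sum>j\<le>k. c i j * ((xi $ 1) ^ i * (real j * (xi $ 2) ^ (j - 1) * h $ 2) +
   (real i * (xi $ 1) ^ (i - 1) * h $ 1) * (xi $ 2) ^ j))) (at xi)" for xi
  unfolding p mult.assoc[of "c _ _"]
  by (intro has_derivative_sum has_derivative_mult_right) (rule has_derivative_mult[OF pw pw])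
 have E: "(\<Sum>i\<le>k. \<Sum>j\<le>k. c i j * ((xi $ 1) ^ i * (real j * (xi $ 2) ^ (j - 1) * h $ 2) +
   (real i * (xi $ 1) ^ (i - 1) * h $ 1) * (xi $ 2) ^ j)) = p1 xi * h $ 1 + p2 xi * h $ 2" for xi h
  unfolding p1_def p2_def sum_distrib_right sum.distrib[symmetric] by (intro sum.cong refl) (simp add: algebra_simps)
 have "(p has_derivative (\<lambda>h. p1 xi * h $ 1 + p2 xi * h $ 2)) (at xi)" for xi
  by (rule has_derivative_eq_rhs[OF D]) (rule ext, rule E)
 moreover have "continuous_on UNIV p1" "continuous_on UNIV p2"
  unfolding p1_def p2_def by (intro continuous_intros)+
 ultimately show ?thesis by - (rule exI[of _ p1], rule exI[of _ p2], simp)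
qed

definition poly1 :: "nat => (real => real) => bool" where
 "poly1 k f \<longleftrightarrow> (\<exists>c. \<forall>r. f r = (\<Sum>i\<le>k. c i * r ^ i))"

text \<open>With degree at most \<open>k\<close> and agreement at \<open>k + 1\<close> points, a
  nonzero difference would have too many roots.\<close>

lemma poly1_eqI:
 assumes f: "poly1 k f" and g: "poly1 k g" and k: "1 <= k" and e: "!!i. i <= k ==> f (real i / real k) = g (real i / real k)"
 shows "f r = g r"
proof -
 obtain c d where c: "!!r. f r = (\<Sum>i\<le>k. c i * r ^ i)" and d: "!!r. g r = (\<Sum>i\<le>k. d i * r ^ i)"
  using f g unfolding poly1_def by auto
 define Z where "Z = {z. (\<Sum>i\<le>k. (c i - d i) * z ^ i) = 0}"
 have fg: "f r - g r = (\<Sum>i\<le>k. (c i - d i) * r ^ i)" for r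
  unfolding c d by (simp add: left_diff_distrib sum_subtractf)
 have sub: "(\<lambda>i. real i / real k) ` {..k} \<subseteq> Z"   proof (rule image_subsetI)
  fix i assume "i \<in> {..k}"
  then have "f (real i / real k) - g (real i / real k) = 0" using e by simp
  then show "real i / real k \<in> Z" unfolding fg Z_def by simp
 qed
 have card: "card ((\<lambda>i. real i / real k) ` {..k}) = Suc k"
  using k by (subst card_image) (auto simp: inj_on_def)
 have "\<forall>i\<le>k. c i - d i = 0"
 proof (rule ccontr)
  assume "\<not> ?thesis"
  then obtain i where "i <= k" "c i - d i ~= 0" by blast
  then have "finite Z \<and> card Z <= k" unfolding Z_def by (rule Transcendental.polyfun_rootbound[of "\<lambda>i. c i - d i" i k, rotated])
  then show False using card_mono[OF _ sub] card by simp
 qed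
 then have "f r - g r = 0" unfolding fg by simp
 then show ?thesis by simp
qed

lemma poly1_zero: "poly1 k (\<lambda>_. 0)"
 unfolding poly1_def by (rule exI[of _ "\<lambda>_. 0"]) simp

lemma atMost_2: "{..2::nat} = {0, 1, 2}"
 by auto

lemma poly1_reflect:
 assumes k: "k = 1 \<or> k = 2" and f: "poly1 k f"
 shows "poly1 k (\<lambda>r. f (1 - r))"
proof -
 obtain c where c: "!!r. f r = (\<Sum>i\<le>k. c i * r ^ i)" using f unfolding poly1_def by auto
 show ?thesis
 proof (cases "k = 1")
  case True
  show ?thesis unfolding poly1_def c True
   by (rule exI[of _ "\<lambda>i. if i = 0 then c 0 + c 1 else - c 1"]) (simp add: algebra_simps)
 next
  case False
  then have k: "k = 2" using k by simp
  show ?thesis unfolding poly1_def c k atMost_2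
   by (rule exI[of _ "\<lambda>i. if i = 0 then c 0 + c 1 + c 2 else if i = 1 then - c 1 - 2 * c 2 else c 2"])
    (simp add: algebra_simps power2_eq_square)
 qed
qed

lemma poly1_fst: "p \<in> Q_poly k ==> poly1 k (\<lambda>r. p (vector [r, t]))"
 unfolding Q_poly_def poly1_def
proof clarify
 fix c
 show "\<exists>d. \<forall>r. (\<Sum>i\<le>k. \<Sum>j\<le>k. c i j * (vector [r, t] :: real^2) $ 1 ^ i * (vector [r, t] :: real^2) $ 2 ^ j) = (\<Sum>i\<le>k. d i * r ^ i)"
  by (rule exI[of _ "\<lambda>i. \<Sum>j\<le>k. c i j * t ^ j"]) (simp add: sum_distrib_right sum_distrib_left mult_ac)
qed

lemma poly1_snd: "p \<in> Q_poly k ==> poly1 k (\<lambda>r. p (vector [t, r]))"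
 unfolding Q_poly_def poly1_def
proof clarify
 fix c
 have "(\<Sum>i\<le>k. \<Sum>j\<le>k. c i j * t ^ i * r ^ j) = (\<Sum>j\<le>k. (\<Sum>i\<le>k. c i j * t ^ i) * r ^ j)" for r
  by (subst sum.swap) (simp add: sum_distrib_right)
 then show "\<exists>d. \<forall>r. (\<Sum>i\<le>k. \<Sum>j\<le>k. c i j * (vector [t, r] :: real^2) $ 1 ^ i * (vector [t, r] :: real^2) $ 2 ^ j) = (\<Sum>i\<le>k. d i * r ^ i)"
  by (intro exI[of _ "\<lambda>j. \<Sum>i\<le>k. c i j * t ^ i"]) simp
qed

text \<open>Unisolvence on the tensor grid: first along the horizontal lines through the nodes, then
  along every vertical line.\<close>

lemma Q_poly_eq_0:
 assumes p: "p \<in> Q_poly k" and k: "1 <= k"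
  and z: "!!i j. i <= k ==> j <= k ==> p (vector [real i / real k, real j / real k]) = 0"
 shows "p xi = 0"
proof -
 have 1: "p (vector [r, real j / real k]) = 0" if "j <= k" for j r
  using poly1_eqI[OF poly1_fst[OF p] poly1_zero k, of "real j / real k"] z that by simp
 have "p (vector [xi $ 1, t]) = 0" for t
  using poly1_eqI[OF poly1_snd[OF p] poly1_zero k, of "xi $ 1"] 1 by simp
 from this[of "xi $ 2"] show ?thesis unfolding real2_eta .
qed

text \<open>Row \<open>i\<close> holds the coefficients of the Lagrange polynomial for the node
  \<open>i / k\<close>, written out for the two degrees in use.\<close>

lemma lagrange_coeffs:
 assumes "k = 1 \<or> k = 2"
 shows "\<exists>L :: nat => nat => real. \<forall>i\<le>k. \<forall>j\<le>k. (\<Sum>a\<le>k. L i a * (real j / real k) ^ a) = (if i = j then 1 else 0)"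
proof (cases "k = 1")
 case True
 have le1: "n <= 1 \<longleftrightarrow> n = 0 \<or> n = 1" for n :: nat by auto
 show ?thesis unfolding True
  by (rule exI[of _ "\<lambda>i a. if i = 0 then (if a = 0 then 1 else -1) else (if a = 0 then 0 else 1)"])
   (auto simp: le1)
next
 case False
 then have k: "k = 2" using assms by simp
 have le2: "n <= 2 \<longleftrightarrow> n = 0 \<or> n = 1 \<or> n = 2" for n :: nat by auto
 show ?thesis unfolding k atMost_2
  by (rule exI[of _ "\<lambda>i a. if i = 0 then (if a = 0 then 1 else if a = 1 then -3 else 2)
    else if i = 1 then (if a = 0 then 0 else if a = 1 then 4 else -4)
    else (if a = 0 then 0 else if a = 1 then -1 else 2)"])
   (auto simp: le2 power2_eq_square)
qed

lemma Q_poly_interpolation: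
 assumes k: "k = 1 \<or> k = 2"
 shows "\<exists>p\<in>Q_poly k. \<forall>i\<le>k. \<forall>j\<le>k. p (vector [real i / real k, real j / real k]) = g i j"
proof -
 obtain L :: "nat => nat => real"
  where L: "\<forall>i\<le>k. \<forall>j\<le>k. (\<Sum>a\<le>k. L i a * (real j / real k) ^ a) = (if i = j then 1 else 0)"
  using lagrange_coeffs[OF k] by (elim exE)
 define p where "p xi = (\<Sum>i\<le>k. \<Sum>j\<le>k. g i j * ((\<Sum>a\<le>k. L i a * (xi $ 1) ^ a) * (\<Sum>b\<le>k. L j b * (xi $ 2) ^ b)))" for xi :: "real^2"
 have "p \<in> Q_poly k" unfolding p_def[abs_def] by (intro Q_poly_sum Q_poly_scale Q_poly_prod) auto
 moreover have "p (vector [real m / real k, real n / real k]) = g m n" if mn: "m <= k" "n <= k" for m n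
 proof -
  have "p (vector [real m / real k, real n / real k]) = (\<Sum>i\<le>k. \<Sum>j\<le>k. g i j * ((if i = m then 1 else 0) * (if j = n then 1 else 0)))"
   unfolding p_def vector_2 using L mn by (intro sum.cong refl) simp
  also have "\<dots> = (\<Sum>i\<le>k. if i = m then g i n else 0)"
  proof (rule sum.cong[OF refl])
   fix i
   have "(\<Sum>j\<le>k. g i j * ((if i = m then 1 else 0) * (if j = n then 1 else 0))) =
    (\<Sum>j\<le>k. if j = n then if i = m then g i j else 0 else 0)" by (intro sum.cong refl) simp
   then show "(\<Sum>j\<le>k. g i j * ((if i = m then 1 else 0) * (if j = n then 1 else 0))) = (if i = m then g i n else 0)"
    using mn by simp
  qed
  also have "\<dots> = g m n" using mn by simp
  finally show ?thesis .
 qed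
 ultimately show ?thesis by (intro bexI[of _ p]) auto
qed

lemma vertex_param:
 assumes "v \<in> quad_vertices K" "1 <= k"
 shows "\<exists>i\<le>k. \<exists>j\<le>k. v = bilinear_map K (vector [real i / real k, real j / real k])"
proof -
 obtain a b c d where K: "K = (a, b, c, d)" by (cases K)
 consider "v = a" | "v = b" | "v = c" | "v = d" using assms K by auto
 then show ?thesis
 proof cases
  case 1 then show ?thesis using assms by (intro exI[of _ 0] conjI) (auto simp: K)
 next
  case 2 then show ?thesis using assms by (intro exI[of _ k] conjI exI[of _ 0]) (auto simp: K)
 next
  case 3 then show ?thesis using assms by (intro exI[of _ k] conjI) (auto simp: K)
 next
  case 4 then show ?thesis using assms by (intro exI[of _ 0] conjI exI[of _ k]) (auto simp: K)
 qed
qed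

text \<open>Both orientations of an edge are covered, because two elements traverse their common edge in
 opposite directions.\<close>

lemma edge_param:
 assumes ab: "(a, b) \<in> sides K \<or> (b, a) \<in> sides K" and k: "k = 1 \<or> k = 2"
 obtains \<zeta> :: "real => real^2"
 where "!!r. r \<in> {0..1} ==> \<zeta> r \<in> cbox 0 1" "!!r. bilinear_map K (\<zeta> r) = linepath a b r"
  "!!p. p \<in> Q_poly k ==> poly1 k (\<lambda>r. p (\<zeta> r))"
  "!!i. i <= k ==> \<exists>i'\<le>k. \<exists>j'\<le>k. \<zeta> (real i / real k) = vector [real i' / real k, real j' / real k]"
proof -
 obtain p q r s where K: "K = (p, q, r, s)" by (cases K)
 have refl: "1 - real i / real k = real (k - i) / real k" if "i <= k" for i
  using that k by (auto simp: of_nat_diff diff_divide_distrib)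
 have k1: "1 <= k" using k by auto
 have one: "1 = real k / real k" using k by auto
 have zero: "0 = real 0 / real k" by simp
 note R = poly1_reflect[OF k poly1_fst] poly1_reflect[OF k poly1_snd] poly1_fst poly1_snd
 note I = exI[of _ "_ :: nat"]
 have ex1: "\<exists>i'\<le>k. \<exists>j'\<le>k. vector [real i / real k, 0] = (vector [real i' / real k, real j' / real k] :: real^2)"
  "\<exists>i'\<le>k. \<exists>j'\<le>k. vector [real i / real k, 1] = (vector [real i' / real k, real j' / real k] :: real^2)"
  "\<exists>i'\<le>k. \<exists>j'\<le>k. vector [0, real i / real k] = (vector [real i' / real k, real j' / real k] :: real^2)"
  "\<exists>i'\<le>k. \<exists>j'\<le>k. vector [1, real i / real k] = (vector [real i' / real k, real j' / real k] :: real^2)"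
  if "i <= k" for i
  subgoal by (rule exI[of _ i], intro conjI that, rule exI[of _ 0]) simp
  subgoal by (rule exI[of _ i], intro conjI that, rule exI[of _ k]) (use one in simp)
  subgoal by (rule exI[of _ 0], intro conjI, simp, rule exI[of _ i]) (use that in simp)
  subgoal by (rule exI[of _ k], intro conjI, simp, rule exI[of _ i]) (use that one in simp)
  done
 have ex2: "\<exists>i'\<le>k. \<exists>j'\<le>k. vector [1 - real i / real k, 0] = (vector [real i' / real k, real j' / real k] :: real^2)"
  "\<exists>i'\<le>k. \<exists>j'\<le>k. vector [1 - real i / real k, 1] = (vector [real i' / real k, real j' / real k] :: real^2)"
  "\<exists>i'\<le>k. \<exists>j'\<le>k. vector [0, 1 - real i / real k] = (vector [real i' / real k, real j' / real k] :: real^2)"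
  "\<exists>i'\<le>k. \<exists>j'\<le>k. vector [1, 1 - real i / real k] = (vector [real i' / real k, real j' / real k] :: real^2)"
  if "i <= k" for i
  unfolding refl[OF that] by (rule ex1; simp)+
 note D = linepath_def cart_eq_iff algebra_simps
 consider "(a, b) = (p, q)" | "(a, b) = (q, r)" | "(a, b) = (r, s)" | "(a, b) = (s, p)"
  | "(b, a) = (p, q)" | "(b, a) = (q, r)" | "(b, a) = (r, s)" | "(b, a) = (s, p)"
  using ab K by auto
 then show ?thesis
 proof cases
  case 1 then show ?thesis using ex1 ex2 by (intro that[of "\<lambda>t. vector [t, 0]"]) (auto simp: K cbox_unit intro: R simp: D)
 next
  case 2 then show ?thesis using ex1 ex2 by (intro that[of "\<lambda>t. vector [1, t]"]) (auto simp: K cbox_unit intro: R simp: D)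
 next
  case 3 then show ?thesis using ex1 ex2 by (intro that[of "\<lambda>t. vector [1 - t, 1]"]) (auto simp: K cbox_unit intro: R simp: D)
 next
  case 4 then show ?thesis using ex1 ex2 by (intro that[of "\<lambda>t. vector [0, 1 - t]"]) (auto simp: K cbox_unit intro: R simp: D)
 next
  case 5 then show ?thesis using ex1 ex2 by (intro that[of "\<lambda>t. vector [1 - t, 0]"]) (auto simp: K cbox_unit intro: R simp: D)
 next
  case 6 then show ?thesis using ex1 ex2 by (intro that[of "\<lambda>t. vector [1, 1 - t]"]) (auto simp: K cbox_unit intro: R simp: D)
 next
  case 7 then show ?thesis using ex1 ex2 by (intro that[of "\<lambda>t. vector [t, 1]"]) (auto simp: K cbox_unit intro: R simp: D)
 next
  case 8 then show ?thesis using ex1 ex2 by (intro that[of "\<lambda>t. vector [0, t]"]) (auto simp: K cbox_unit intro: R simp: D)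
 qed
qed

section \<open>Quadrilateral meshes\<close>

text \<open>Excludes slits. A mesh covers the closure and so sees \<Omega> only up to the interior
  of its closure. The local graph settles the difference: arbitrarily close below a boundary point,
  in direction \<open>e2\<close>, there are points outside the closure.\<close>

lemma lipschitz_interior_closure:
 assumes "open \<Omega>" "lipschitz_boundary \<Omega>"
 shows "interior (closure \<Omega>) \<subseteq> \<Omega>"
proof (rule subsetI, rule ccontr)
 fix x assume x: "x \<in> interior (closure \<Omega>)" "x \<notin> \<Omega>"
 then have "x \<in> frontier \<Omega>" using interior_subset interior_open[OF assms(1)] unfolding frontier_def by blast
 then obtain r e1 e2 g where r: "0 < r" "norm e2 = 1" "e1 \<bullet> e2 = 0"
  and int: "interior \<Omega> \<inter> ball x r = {y\<in>ball x r. g (y \<bullet> e1) < y \<bullet> e2}"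
  and cl: "closure \<Omega> \<inter> ball x r = {y\<in>ball x r. g (y \<bullet> e1) <= y \<bullet> e2}"
  using assms(2) unfolding lipschitz_boundary_def by (elim ballE[of _ _ x] exE conjE) auto
 obtain rh where rh: "0 < rh" "ball x rh \<subseteq> closure \<Omega>" using x(1) unfolding mem_interior by (elim exE conjE)
 define \<epsilon> where "\<epsilon> = min r rh / 2"
 have \<epsilon>: "0 < \<epsilon>" "\<epsilon> < r" "\<epsilon> < rh" using r(1) rh(1) by (auto simp: \<epsilon>_def)
 define y where "y = x - \<epsilon> *\<^sub>R e2"
 have "dist x y = \<epsilon>" using \<epsilon>(1) r(2) by (simp add: y_def dist_norm)
 then have "y \<in> closure \<Omega> \<inter> ball x r" using rh(2) \<epsilon> by auto
 then have "g (y \<bullet> e1) <= y \<bullet> e2" unfolding cl by simp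
 moreover have "y \<bullet> e1 = x \<bullet> e1" "y \<bullet> e2 = x \<bullet> e2 - \<epsilon>"
  using r(2,3) by (simp_all add: y_def inner_diff_left inner_commute[of e2] power2_norm_eq_inner[symmetric])
 moreover have "x \<notin> interior \<Omega> \<inter> ball x r" using x(2) interior_subset by blast
 then have "\<not> g (x \<bullet> e1) < x \<bullet> e2" unfolding int using r(1) by simp
 ultimately show False using \<epsilon>(1) by simp
qed

definition mesh_sides :: "quad set => edge set" where
 "mesh_sides T = (\<Union>K\<in>T. sides K)"

locale fe_mesh =
 fixes \<Omega> :: "(real^2) set" and T :: "quad set"
 assumes dom: "lipschitz_domain \<Omega>" and mesh: "quad_mesh \<Omega> T"
begin

lemma open_dom: "open \<Omega>" and bounded_dom: "bounded \<Omega>"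
 using dom by (auto simp: lipschitz_domain_def)

lemma interior_closure: "interior (closure \<Omega>) \<subseteq> \<Omega>"
 using dom by (intro lipschitz_interior_closure) (auto simp: lipschitz_domain_def)

lemma finT: "finite T" and cov: "(\<Union>K\<in>T. quad_elem K) = closure \<Omega>"
 and convex_T: "K \<in> T ==> strictly_convex_quad K"
 using mesh by (auto simp: quad_mesh_def)

lemma meet: "K \<in> T ==> L \<in> T ==> K ~= L ==> quad_elem K \<inter> quad_elem L = {} \<or>
  (\<exists>p\<in>quad_vertices K \<inter> quad_vertices L. quad_elem K \<inter> quad_elem L = {p}) \<or>
  (\<exists>e\<in>quad_edges K \<inter> quad_edges L. quad_elem K \<inter> quad_elem L = e)"
 using conjunct2[OF conjunct2[OF conjunct2[OF mesh[unfolded quad_mesh_def]]]] by simp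

lemma finite_mesh_sides: "finite (mesh_sides T)"
 unfolding mesh_sides_def using finT finite_sides by auto

lemma frontier_eq: "frontier \<Omega> = closure \<Omega> - \<Omega>"
 using open_dom by (simp add: frontier_def interior_open)

lemma elem_subset: "K \<in> T ==> quad_elem K \<subseteq> closure \<Omega>"
 using cov by blast

lemma elem_interior_subset: assumes "K \<in> T" shows "bilinear_map K ` box 0 1 \<subseteq> \<Omega>"
proof -
 have "bilinear_map K ` box 0 1 \<subseteq> quad_elem K"
  unfolding quad_elem_def by (rule image_mono[OF box_subset_cbox])
 then have "bilinear_map K ` box 0 1 \<subseteq> interior (closure \<Omega>)"
  using elem_subset[OF assms] by (intro interior_maximal open_quad_interior convex_T assms) auto
 then show ?thesis using interior_closure by simp
qed

lemma closure_cases: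
 assumes "x \<in> closure \<Omega>"
 obtains K where "K \<in> T" "x \<in> quad_elem K"
 using assms unfolding cov[symmetric] by auto

lemma off_skel:
 assumes "x \<in> closure \<Omega>" "x \<notin> skel (mesh_sides T)"
 shows "\<exists>K\<in>T. x \<in> bilinear_map K ` box 0 1"
proof -
 obtain K where K: "K \<in> T" "x \<in> quad_elem K" by (rule closure_cases[OF assms(1)])
 moreover have "\<not> (\<exists>(a, b)\<in>sides K. x \<in> closed_segment a b)"
  using assms(2) K(1) unfolding skel_def mesh_sides_def by auto
 ultimately show ?thesis using quad_elem_decomp[OF convex_T[OF K(1)] K(2)] by auto
qed

lemma side_ne:
 assumes "K \<in> T" "(a, b) \<in> sides K"
 shows "a ~= b"
proof -
 obtain c d where "strictly_convex_quad (a, b, c, d)" by (rule side_first[OF assms(2) convex_T[OF assms(1)]])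
 then show ?thesis by (auto simp: cross2_def)
qed

lemma open_side_not_vertex:
 assumes K: "K \<in> T" "(a, b) \<in> sides K" and x: "x \<in> open_segment a b"
 shows "x \<notin> quad_vertices K"
proof
 assume v: "x \<in> quad_vertices K"
 obtain c d where cd: "strictly_convex_quad (a, b, c, d)" "sides (a, b, c, d) = sides K"
  "quad_vertices (a, b, c, d) = quad_vertices K"
  by (rule side_first[OF K(2) convex_T[OF K(1)]])
 have ne: "a ~= b" "b ~= c" "d ~= a" using cd(1) by (auto simp: cross2_def)
 have "0 < cross2 (c - b) (x - b)" "0 < cross2 (a - d) (x - d)"
  using ne by (intro open_side_pos[OF convex_T[OF K(1)] K(2) x]; simp add: cd(2)[symmetric])+
 moreover have "x ~= a" "x ~= b" using x by (auto simp: open_segment_def)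
 moreover have "x = a \<or> x = b \<or> x = c \<or> x = d" using v unfolding cd(3)[symmetric] by auto
 ultimately show False by (auto simp: cross2_def)
qed

text \<open>An inner point of a side is not a vertex, so of the permitted intersections of two
  elements only a common edge remains, and the point tells which one it is.\<close>

lemma common_side:
 assumes K: "K \<in> T" "(a, b) \<in> sides K" and L: "L \<in> T" "L ~= K" and z: "z \<in> open_segment a b" "z \<in> quad_elem L"
 shows "quad_elem K \<inter> quad_elem L = closed_segment a b" "(a, b) \<in> sides L \<or> (b, a) \<in> sides L"
proof -
 have zK: "z \<in> quad_elem K"
  using quad_elem_eq[OF convex_T[OF K(1)]] z(1)
 proof -
  have "0 <= cross2 (q - p) (z - p)" if pq: "(p, q) \<in> sides K" for p q
  proof (cases "(p, q) = (a, b)")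
   case True
   obtain u where u: "z = (1 - u) *\<^sub>R a + u *\<^sub>R b" using z(1) unfolding in_segment by blast
   have "cross2 (b - a) (z - a) = 0" unfolding u by (simp add: cross2_def algebra_simps)
   then show ?thesis using True by simp
  next
   case False
   then show ?thesis using open_side_pos[OF convex_T[OF K(1)] K(2) z(1) pq] by simp
  qed
  then show ?thesis unfolding quad_elem_eq[OF convex_T[OF K(1)]] by auto
 qed
 have "quad_elem K \<inter> quad_elem L ~= {}" using zK z(2) by auto
 moreover have "quad_elem K \<inter> quad_elem L ~= {p}" if "p \<in> quad_vertices K" for p
  using open_side_not_vertex[OF K z(1)] zK z(2) that by auto
 ultimately obtain e where e: "e \<in> quad_edges K" "e \<in> quad_edges L" "quad_elem K \<inter> quad_elem L = e"
  using meet[OF K(1) L(1) L(2)[symmetric]] by auto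
 obtain p q where pq: "(p, q) \<in> sides K" "e = closed_segment p q" using e(1) unfolding quad_edges_sides by auto
 have zc: "z \<in> closed_segment p q" using zK z(2) e(3) pq(2) by auto
 have "(p, q) = (a, b)"
 proof (rule ccontr)
  assume "(p, q) ~= (a, b)"
  from open_side_pos[OF convex_T[OF K(1)] K(2) z(1) pq(1) this]
  show False using quad_elem_side_nonneg(2)[OF convex_T[OF K(1)] pq(1) zK] zc by simp
 qed
 then show eq: "quad_elem K \<inter> quad_elem L = closed_segment a b" using e(3) pq(2) by simp
 obtain r s where rs: "(r, s) \<in> sides L" "e = closed_segment r s" using e(2) unfolding quad_edges_sides by auto
 then have "{r, s} = {a, b}" using eq e(3) closed_segment_eq[of r s a b] by simp
 then show "(a, b) \<in> sides L \<or> (b, a) \<in> sides L" using rs(1) by (auto simp: doubleton_eq_iff)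
qed

text \<open>Elements on opposite sides of a common side contribute two half discs, which form a disc
  in the closure of \<Omega>.\<close>

lemma common_side_interior:
 assumes K: "K \<in> T" "(a, b) \<in> sides K" and L: "L \<in> T" "L ~= K" and z: "z \<in> open_segment a b" "z \<in> quad_elem L"
 shows "z \<in> \<Omega>"
proof -
 note cs = common_side[OF assms]
 obtain r where r: "0 < r" "\<forall>y\<in>ball z r. 0 <= cross2 (b - a) (y - a) --> y \<in> quad_elem K"
  using half_disc_subset[OF convex_T[OF K(1)] K(2) z(1)] by (elim exE conjE)
 have ne: "a ~= b" by (rule side_ne[OF K])
 obtain u where u: "z = (1 - u) *\<^sub>R a + u *\<^sub>R b" using z(1) unfolding in_segment by blast
 have za: "cross2 (b - a) (z - a) = 0" unfolding u by (simp add: cross2_def algebra_simps)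
 have zb: "cross2 (a - b) (y - b) = - cross2 (b - a) (y - a)" for y by (simp add: cross2_def algebra_simps)
 show ?thesis
 proof (cases "(a, b) \<in> sides L")
  \<comment> \<open>With equal orientation both elements would lie to the left of the side, and a
    point \<open>y\<close> slightly to the left would belong to both, although they meet in a
    segment only.\<close>
  case True
  obtain r' where r': "0 < r'" "\<forall>y\<in>ball z r'. 0 <= cross2 (b - a) (y - a) --> y \<in> quad_elem L"
   using half_disc_subset[OF convex_T[OF L(1)] True z(1)] by (elim exE conjE)
  define \<epsilon> where "\<epsilon> = min r r' / (2 * norm (b - a))"
  have n: "0 < norm (b - a)" using ne by simp
  have \<epsilon>: "0 < \<epsilon>" using r(1) r'(1) n by (simp add: \<epsilon>_def)
  define y where "y = z + \<epsilon> *\<^sub>R perp (b - a)"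
  have "dist z y = \<epsilon> * norm (b - a)" using \<epsilon> by (simp add: y_def dist_norm)
  also have "\<dots> = min r r' / 2" using n by (simp add: \<epsilon>_def)
  finally have "dist z y = min r r' / 2" .
  then have y: "y \<in> ball z r" "y \<in> ball z r'" using r(1) r'(1) by auto
  have "y - a = (z - a) + \<epsilon> *\<^sub>R perp (b - a)" by (simp add: y_def)
  then have cy: "cross2 (b - a) (y - a) = \<epsilon> * (norm (b - a))\<^sup>2"
   using za by (simp add: cross2_simps cross2_perp del: cross2_simps(3))
  then have pos: "0 < cross2 (b - a) (y - a)" using \<epsilon> n by simp
  then have "y \<in> quad_elem K \<inter> quad_elem L" using y r(2) r'(2) by auto
  then show ?thesis
   using cs(1) quad_elem_side_nonneg(2)[OF convex_T[OF K(1)] K(2), of y] pos by auto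
 next
  case False
  then have ba: "(b, a) \<in> sides L" using cs(2) by simp
  obtain r' where r': "0 < r'" "\<forall>y\<in>ball z r'. 0 <= cross2 (a - b) (y - b) --> y \<in> quad_elem L"
   using half_disc_subset[OF convex_T[OF L(1)] ba z(1)[unfolded open_segment_commute[of a b]]] by (elim exE conjE)
  have "ball z (min r r') \<subseteq> closure \<Omega>"
  proof
   fix y assume y: "y \<in> ball z (min r r')"
   show "y \<in> closure \<Omega>"
   proof (cases "0 <= cross2 (b - a) (y - a)")
    case True
    then have "y \<in> quad_elem K" using r(2) y by auto
    then show ?thesis using elem_subset[OF K(1)] by auto
   next
    case False
    then have "y \<in> quad_elem L" using r'(2) y zb[of y] by auto
    then show ?thesis using elem_subset[OF L(1)] by auto
   qed
  qed
  then have "z \<in> interior (closure \<Omega>)" using r(1) r'(1) by (intro interiorI[of "ball z (min r r')"]) auto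
  then show ?thesis using interior_closure by auto
 qed
qed

text \<open>At a boundary point no second element can be present, and then by
  \<open>common_side\<close> none is present anywhere inside the side. A point of \<Omega> on the
  side would have a disc covered by \<open>K\<close> alone, but \<open>K\<close> lies on one side of
  it. Boundary values are thereby reduced to boundary nodes.\<close>

lemma frontier_side:
 assumes K: "K \<in> T" "(a, b) \<in> sides K" and x: "x \<in> open_segment a b" "x \<in> frontier \<Omega>"
 shows "closed_segment a b \<subseteq> frontier \<Omega>"
proof -
 have ne: "a ~= b" by (rule side_ne[OF K])
 have sub: "open_segment a b \<subseteq> closure \<Omega>"
 proof
  fix z assume z: "z \<in> open_segment a b"
  have "0 <= cross2 (q - p) (z - p)" if pq: "(p, q) \<in> sides K" for p q
  proof (cases "(p, q) = (a, b)")
   case True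
   obtain u where u: "z = (1 - u) *\<^sub>R a + u *\<^sub>R b" using z unfolding in_segment by blast
   have "cross2 (b - a) (z - a) = 0" unfolding u by (simp add: cross2_def algebra_simps)
   then show ?thesis using True by simp
  next
   case False
   then show ?thesis using open_side_pos[OF convex_T[OF K(1)] K(2) z pq] by simp
  qed
  then have "z \<in> quad_elem K" unfolding quad_elem_eq[OF convex_T[OF K(1)]] by auto
  then show "z \<in> closure \<Omega>" using elem_subset[OF K(1)] by auto
 qed
 have no: "x \<notin> quad_elem L" if "L \<in> T" "L ~= K" for L
  using common_side_interior[OF K that x(1)] x(2) frontier_eq by auto
 have "open_segment a b \<subseteq> frontier \<Omega>"
 proof (rule subsetI, rule ccontr)
  fix y assume y: "y \<in> open_segment a b" "y \<notin> frontier \<Omega>"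
  then have yO: "y \<in> \<Omega>" using sub frontier_eq by auto
  have noy: "y \<notin> quad_elem L" if L: "L \<in> T" "L ~= K" for L
  proof
   assume "y \<in> quad_elem L"
   from common_side(1)[OF K L y(1) this] have "x \<in> quad_elem L" using x(1) by (auto simp: open_segment_def)
   then show False using no[OF L] by simp
  qed
  define N where "N = \<Omega> - (\<Union>L\<in>T - {K}. quad_elem L)"
  have "closed (\<Union>L\<in>T - {K}. quad_elem L)"
   using finT by (intro closed_UN) (auto intro: compact_imp_closed compact_quad_elem)
  then have "open N" unfolding N_def by (intro open_Diff open_dom)
  moreover have "y \<in> N" using yO noy by (auto simp: N_def)
  ultimately obtain r where r: "0 < r" "ball y r \<subseteq> N" by (rule openE)
  have rK: "ball y r \<subseteq> quad_elem K"
  proof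
   fix w assume "w \<in> ball y r"
   then have w: "w \<in> N" using r(2) by auto
   then have "w \<in> closure \<Omega>" using closure_subset by (auto simp: N_def)
   then obtain L where "L \<in> T" "w \<in> quad_elem L" by (rule closure_cases)
   then show "w \<in> quad_elem K" using w by (cases "L = K") (auto simp: N_def)
  qed
  define \<epsilon> where "\<epsilon> = r / (2 * norm (b - a))"
  have n: "0 < norm (b - a)" using ne by simp
  have \<epsilon>: "0 < \<epsilon>" using r(1) n by (simp add: \<epsilon>_def)
  define w where "w = y - \<epsilon> *\<^sub>R perp (b - a)"
  have "dist y w = \<epsilon> * norm (b - a)" using \<epsilon> by (simp add: w_def dist_norm)
  also have "\<dots> = r / 2" using n by (simp add: \<epsilon>_def)
  finally have "w \<in> ball y r" using r(1) by simp
  then have "w \<in> quad_elem K" using rK by auto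
  then have "0 <= cross2 (b - a) (w - a)" by (rule quad_elem_side_nonneg(1)[OF convex_T[OF K(1)] K(2)])
  moreover obtain u where u: "y = (1 - u) *\<^sub>R a + u *\<^sub>R b" using y(1) unfolding in_segment by blast
  have "cross2 (b - a) (w - a) = - \<epsilon> * cross2 (b - a) (perp (b - a))"
   unfolding w_def u by (simp add: cross2_def algebra_simps)
  moreover have "0 < \<epsilon> * cross2 (b - a) (perp (b - a))" using \<epsilon> n by (simp add: cross2_perp)
  ultimately show False by simp
 qed
 then have "closure (open_segment a b) \<subseteq> frontier \<Omega>" by (intro closure_minimal frontier_closed)
 then show ?thesis using ne by simp
qed

end

section \<open>Finite element spaces\<close>

lemma fe_space_add:
 assumes "f \<in> fe_space k \<Omega> T" "g \<in> fe_space k \<Omega> T"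
 shows "(\<lambda>x. f x + g x) \<in> fe_space k \<Omega> T"
proof -
 have "\<exists>p\<in>Q_poly k. \<forall>xi\<in>cbox 0 1. f (bilinear_map K xi) + g (bilinear_map K xi) = p xi" if K: "K \<in> T" for K
 proof -
  obtain p q where "p \<in> Q_poly k" "\<forall>xi\<in>cbox 0 1. f (bilinear_map K xi) = p xi"
   "q \<in> Q_poly k" "\<forall>xi\<in>cbox 0 1. g (bilinear_map K xi) = q xi"
   using assms K unfolding fe_space_def by fastforce
  then show ?thesis by (intro bexI[OF _ Q_poly_add[of p k q]]) auto
 qed
 then show ?thesis using assms unfolding fe_space_def by (auto intro: continuous_on_add)
qed

lemma fe_space_scale:
 assumes "f \<in> fe_space k \<Omega> T"
 shows "(\<lambda>x. r * f x) \<in> fe_space k \<Omega> T"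
proof -
 have "\<exists>p\<in>Q_poly k. \<forall>xi\<in>cbox 0 1. r * f (bilinear_map K xi) = p xi" if K: "K \<in> T" for K
 proof -
  obtain p where "p \<in> Q_poly k" "\<forall>xi\<in>cbox 0 1. f (bilinear_map K xi) = p xi"
   using assms K unfolding fe_space_def by fastforce
  then show ?thesis by (intro bexI[OF _ Q_poly_scale[of p k r]]) auto
 qed
 then show ?thesis using assms unfolding fe_space_def by (auto intro: continuous_on_mult_left)
qed

lemma fe_space_zero: "(\<lambda>_. 0) \<in> fe_space k \<Omega> T"
 unfolding fe_space_def by (auto intro: bexI[OF _ Q_poly_zero])

lemma fe_space_sum: "finite A ==> (!!a. a \<in> A ==> f a \<in> fe_space k \<Omega> T) ==> (\<lambda>x. \<Sum>a\<in>A. f a x) \<in> fe_space k \<Omega> T"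
 by (induction A rule: finite_induct) (auto intro: fe_space_zero fe_space_add)

lemma V_space_zero: "(\<lambda>_. 0) \<in> V_space \<Omega> T"
 unfolding V_space_def by (simp add: fe_space_zero)

lemma V_space_add: "f \<in> V_space \<Omega> T ==> g \<in> V_space \<Omega> T ==> (\<lambda>x. f x + g x) \<in> V_space \<Omega> T"
 unfolding V_space_def by (auto intro: fe_space_add)

lemma V_space_scale: "f \<in> V_space \<Omega> T ==> (\<lambda>x. r *\<^sub>R f x) \<in> V_space \<Omega> T"
 unfolding V_space_def by (auto intro: fe_space_scale)

lemma V_space_sum: "finite A ==> (!!a. a \<in> A ==> f a \<in> V_space \<Omega> T) ==> (\<lambda>x. \<Sum>a\<in>A. f a x) \<in> V_space \<Omega> T"
 by (induction A rule: finite_induct) (auto intro: V_space_zero V_space_add)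

lemma continuous_on_cross2:
 assumes "continuous_on S f" "continuous_on S g"
 shows "continuous_on S (\<lambda>x. cross2 (f x) (g x))"
 unfolding cross2_def
 by (rule continuous_on_diff; rule continuous_on_mult; rule continuous_on_component; rule assms)

lemma continuous_on_dF:
 "continuous_on S (\<lambda>xi. dF1 K (xi $ 2))" "continuous_on S (\<lambda>xi. dF2 K (xi $ 1))"
 by (cases K; simp; intro continuous_intros)+

lemma lagrange_nodesI:
 "K \<in> T ==> i <= k ==> j <= k ==> bilinear_map K (vector [real i / real k, real j / real k]) \<in> lagrange_nodes k T"
 unfolding lagrange_nodes_def by blast

context fe_mesh
begin

lemma fe_eq_0:
 assumes f: "f \<in> fe_space k \<Omega> T" and k: "1 <= k" and z: "!!N. N \<in> lagrange_nodes k T ==> f N = 0"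
 shows "f x = 0"
proof (cases "x \<in> closure \<Omega>")
 case True
 then obtain K where K: "K \<in> T" "x \<in> quad_elem K" by (rule closure_cases)
 obtain p where p: "p \<in> Q_poly k" "\<forall>xi\<in>cbox 0 1. f (bilinear_map K xi) = p xi"
  using f K unfolding fe_space_def by fastforce
 obtain xi where xi: "xi \<in> cbox 0 1" "x = bilinear_map K xi"
  using K(2) unfolding quad_elem_def by (elim imageE) (rule that)
 have "p (vector [real i / real k, real j / real k]) = 0" if ij: "i <= k" "j <= k" for i j
 proof -
  have "vector [real i / real k, real j / real k] \<in> cbox 0 (1 :: real^2)"
   using ij k by (simp add: cbox_unit)
  moreover have "bilinear_map K (vector [real i / real k, real j / real k]) \<in> lagrange_nodes k T"
   by (rule lagrange_nodesI[OF K(1) ij])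
  ultimately show ?thesis using p(2) z by force
 qed
 from Q_poly_eq_0[OF p(1) k this] show ?thesis using p(2) xi by simp
qed (use f in \<open>simp add: fe_space_def\<close>)

lemma fe_edge:
 assumes f: "f \<in> fe_space k \<Omega> T" and k: "k = 1 \<or> k = 2" and K: "K \<in> T" "(a, b) \<in> sides K"
 shows "\<exists>h. poly1 k h \<and> (\<forall>r\<in>{0..1}. f (linepath a b r) = h r)"
  "i <= k ==> linepath a b (real i / real k) \<in> lagrange_nodes k T"
proof -
 obtain p where p: "p \<in> Q_poly k" "\<forall>xi\<in>cbox 0 1. f (bilinear_map K xi) = p xi"
  using f K unfolding fe_space_def by fastforce
 obtain \<zeta> :: "real => real^2" where \<zeta>: "!!r. r \<in> {0..1} ==> \<zeta> r \<in> cbox 0 1" "!!r. bilinear_map K (\<zeta> r) = linepath a b r"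
  "!!p. p \<in> Q_poly k ==> poly1 k (\<lambda>r. p (\<zeta> r))"
  "!!i. i <= k ==> \<exists>i'\<le>k. \<exists>j'\<le>k. \<zeta> (real i / real k) = vector [real i' / real k, real j' / real k]"
  using edge_param[OF _ k, of a b K thesis] K(2) by auto
 have "f (linepath a b r) = p (\<zeta> r)" if "r \<in> {0..1}" for r
  using p(2) \<zeta>(1)[OF that] unfolding \<zeta>(2)[symmetric] by simp
 then show "\<exists>h. poly1 k h \<and> (\<forall>r\<in>{0..1}. f (linepath a b r) = h r)"
  by (intro exI[of _ "\<lambda>r. p (\<zeta> r)"]) (simp add: \<zeta>(3)[OF p(1)])
 show "linepath a b (real i / real k) \<in> lagrange_nodes k T" if "i <= k"
  using \<zeta>(4)[OF that] lagrange_nodesI[OF K(1), of _ k] unfolding \<zeta>(2)[symmetric] by (elim exE conjE) simp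
qed

text \<open>\<open>V_space\<close> asks for zeros on the whole boundary, while nodal functions come
  with zeros at boundary nodes. A side with an inner point on the boundary lies in it with all its
  \<open>k + 1\<close> nodes, and these determine the polynomial along the side.\<close>

lemma fe_frontier_0:
 assumes f: "f \<in> fe_space k \<Omega> T" and k: "k = 1 \<or> k = 2"
  and z: "!!N. N \<in> lagrange_nodes k T ==> N \<in> frontier \<Omega> ==> f N = 0" and x: "x \<in> frontier \<Omega>"
 shows "f x = 0"
proof -
 have k1: "1 <= k" using k by auto
 have "x \<in> closure \<Omega>" "x \<notin> \<Omega>" using x frontier_eq by auto
 then obtain K where K: "K \<in> T" "x \<in> quad_elem K" by (elim closure_cases)
 moreover have "x \<notin> bilinear_map K ` box 0 1" using elem_interior_subset[OF K(1)] \<open>x \<notin> \<Omega>\<close> by auto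
 ultimately obtain a b where ab: "(a, b) \<in> sides K" "x \<in> closed_segment a b"
  using quad_elem_decomp[OF convex_T[OF K(1)] K(2)] by auto
 note nodes = fe_edge(2)[OF f k K(1) ab(1)]
 show ?thesis
 proof (cases "x \<in> open_segment a b")
  case True
  note fr = frontier_side[OF K(1) ab(1) True x]
  obtain h where h: "poly1 k h" "\<forall>r\<in>{0..1}. f (linepath a b r) = h r" using fe_edge(1)[OF f k K(1) ab(1)] by (elim exE conjE)
  have "h (real i / real k) = 0" if i: "i <= k" for i
  proof -
   have r: "real i / real k \<in> {0..1}" using i k1 by simp
   then have "linepath a b (real i / real k) \<in> frontier \<Omega>" using fr linepath_in_path[OF r, of a b] by auto
   then show ?thesis using h(2) r z[OF nodes[OF i]] by auto
  qed
  then have h0: "h r = 0" for r using poly1_eqI[OF h(1) poly1_zero k1] by simp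
  obtain r where "r \<in> {0..1}" "x = linepath a b r"
   using ab(2) unfolding linepath_image_01[symmetric] by (elim imageE) (rule that)
  then show ?thesis using h(2) h0 by simp
 next
  case False
  then have "x = linepath a b (real 0 / real k) \<or> x = linepath a b (real k / real k)"
   using ab(2) k1 by (auto simp: open_segment_def linepath_def)
  then show ?thesis using nodes[of 0] nodes[of k] z[of x] x by auto
 qed
qed

text \<open>The basis sets are described by nodal values, so it must be shown that such functions
  exist. The interpolants on the elements fit together because along a common edge both are
  polynomials of degree at most \<open>k\<close> with the same \<open>k + 1\<close> nodal
  values.\<close>

theorem nodal_interpolant:
 assumes k: "k = 1 \<or> k = 2"
 shows "\<exists>u\<in>fe_space k \<Omega> T. \<forall>N\<in>lagrange_nodes k T. u N = g N"
proof -
 have k1: "1 <= k" using k by auto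
 have "\<forall>K. \<exists>p. p \<in> Q_poly k \<and> (\<forall>i\<le>k. \<forall>j\<le>k. p (vector [real i / real k, real j / real k]) =
  g (bilinear_map K (vector [real i / real k, real j / real k])))"
  using Q_poly_interpolation[OF k, of "\<lambda>i j. g (bilinear_map _ (vector [real i / real k, real j / real k]))"] by blast
 from choice[OF this] obtain P where P': "\<forall>K. P K \<in> Q_poly k \<and> (\<forall>i\<le>k. \<forall>j\<le>k. P K (vector [real i / real k, real j / real k]) =
  g (bilinear_map K (vector [real i / real k, real j / real k])))" by (elim exE)
 have P: "P K \<in> Q_poly k"
  "i <= k ==> j <= k ==> P K (vector [real i / real k, real j / real k]) = g (bilinear_map K (vector [real i / real k, real j / real k]))" for K i j
  using spec[OF P', of K] by simp_all
 \<comment> \<open>The reference interpolant carried over to the element; the inverse map is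
   continuous because the reference square is compact.\<close>
 define w where "w K x = P K (the_inv_into (cbox 0 1) (bilinear_map K) x)" for K x
 have w: "w K (bilinear_map K xi) = P K xi" if "K \<in> T" "xi \<in> cbox 0 1" for K xi
  unfolding w_def using the_inv_into_f_f[OF bilinear_map_inj[OF convex_T[OF that(1)]] that(2)] by simp
 have wc: "continuous_on (quad_elem K) (w K)" if "K \<in> T" for K
  unfolding w_def[abs_def] quad_elem_def
  by (intro continuous_on_compose2[OF continuous_Q_poly[OF P(1), of UNIV]] continuous_on_inv_into continuous_bilinear_map
    compact_cbox bilinear_map_inj convex_T that) auto
 have wn: "w K (bilinear_map K (vector [real i / real k, real j / real k])) = g (bilinear_map K (vector [real i / real k, real j / real k]))"
  if "K \<in> T" "i <= k" "j <= k" for K i j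
  using that k1 by (subst w) (auto simp: cbox_unit P(2))
 have wv: "w K v = g v" if "K \<in> T" "v \<in> quad_vertices K" for K v
  using vertex_param[OF that(2) k1] wn[OF that(1)] by auto
 have we: "\<exists>h. poly1 k h \<and> (\<forall>r\<in>{0..1}. w K (linepath a b r) = h r) \<and> (\<forall>i\<le>k. h (real i / real k) = g (linepath a b (real i / real k)))"
  if K: "K \<in> T" "(a, b) \<in> sides K \<or> (b, a) \<in> sides K" for K a b
 proof -
  obtain \<zeta> :: "real => real^2" where \<zeta>: "!!r. r \<in> {0..1} ==> \<zeta> r \<in> cbox 0 1" "!!r. bilinear_map K (\<zeta> r) = linepath a b r"
   "!!p. p \<in> Q_poly k ==> poly1 k (\<lambda>r. p (\<zeta> r))"
   "!!i. i <= k ==> \<exists>i'\<le>k. \<exists>j'\<le>k. \<zeta> (real i / real k) = vector [real i' / real k, real j' / real k]"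
   using edge_param[OF K(2) k, of thesis] by auto
  have "w K (linepath a b r) = P K (\<zeta> r)" if "r \<in> {0..1}" for r
   using w[OF K(1) \<zeta>(1)[OF that]] unfolding \<zeta>(2) .
  moreover have "P K (\<zeta> (real i / real k)) = g (linepath a b (real i / real k))" if "i <= k" for i
   using \<zeta>(4)[OF that] P(2)[of _ _ K] unfolding \<zeta>(2)[symmetric] by auto
  ultimately show ?thesis by (intro exI[of _ "\<lambda>r. P K (\<zeta> r)"]) (simp add: \<zeta>(3)[OF P(1)])
 qed
 have agree: "w K x = w L x" if KL: "K \<in> T" "L \<in> T" and x: "x \<in> quad_elem K" "x \<in> quad_elem L" for K L x
 proof (cases "K = L")
  case False
  have "quad_elem K \<inter> quad_elem L ~= {}" using x by auto
  with meet[OF KL False] consider p where "p \<in> quad_vertices K" "p \<in> quad_vertices L" "quad_elem K \<inter> quad_elem L = {p}"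
   | e where "e \<in> quad_edges K" "e \<in> quad_edges L" "quad_elem K \<inter> quad_elem L = e" by auto
  then show ?thesis
  proof cases
   case 1
   then have "x = p" using x by auto
   then show ?thesis using wv[OF KL(1) 1(1)] wv[OF KL(2) 1(2)] by simp
  next
   case 2
   obtain a b where ab: "(a, b) \<in> sides K" "e = closed_segment a b" using 2(1) unfolding quad_edges_sides by auto
   obtain c d where cd: "(c, d) \<in> sides L" "e = closed_segment c d" using 2(2) unfolding quad_edges_sides by auto
   have "{c, d} = {a, b}" using ab(2) cd(2) closed_segment_eq[of c d a b] by simp
   then have L: "(a, b) \<in> sides L \<or> (b, a) \<in> sides L" using cd(1) by (auto simp: doubleton_eq_iff)
   obtain h where h: "poly1 k h" "\<forall>r\<in>{0..1}. w K (linepath a b r) = h r" "\<forall>i\<le>k. h (real i / real k) = g (linepath a b (real i / real k))"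
    using we[OF KL(1), of a b] ab(1) by auto
   obtain h' where h': "poly1 k h'" "\<forall>r\<in>{0..1}. w L (linepath a b r) = h' r" "\<forall>i\<le>k. h' (real i / real k) = g (linepath a b (real i / real k))"
    using we[OF KL(2) L] by auto
   have "h r = h' r" for r by (rule poly1_eqI[OF h(1) h'(1) k1]) (simp add: h(3) h'(3))
   moreover have "x \<in> closed_segment a b" using x 2(3) ab(2) by auto
   then obtain r where "r \<in> {0..1}" "x = linepath a b r"
    unfolding linepath_image_01[symmetric] by (elim imageE) (rule that)
   ultimately show ?thesis using h(2) h'(2) by simp
  qed
 qed simp
 \<comment> \<open>The choice of the element is immaterial by \<open>agree\<close>.\<close>
 define u where "u x = (if x \<in> closure \<Omega> then w (SOME K. K \<in> T \<and> x \<in> quad_elem K) x else 0)" for x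
 have u: "u x = w K x" if K: "K \<in> T" "x \<in> quad_elem K" for K x
 proof -
  have S: "(SOME K. K \<in> T \<and> x \<in> quad_elem K) \<in> T \<and> x \<in> quad_elem (SOME K. K \<in> T \<and> x \<in> quad_elem K)"
   by (rule someI[of "\<lambda>K. K \<in> T \<and> x \<in> quad_elem K" K]) (simp add: K)
  have "x \<in> closure \<Omega>" using elem_subset[OF K(1)] K(2) by (rule subsetD)
  then show ?thesis
   unfolding u_def using agree[OF conjunct1[OF S] K(1) conjunct2[OF S] K(2)] by (simp only: if_True)
 qed
 have uF: "u (bilinear_map K xi) = P K xi" if "K \<in> T" "xi \<in> cbox 0 1" for K xi
 proof -
  have "bilinear_map K xi \<in> quad_elem K" using that(2) unfolding quad_elem_def by (rule imageI)
  then show ?thesis using u[OF that(1)] w[OF that] by simp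
 qed
 have "continuous_on (\<Union>K\<in>T. quad_elem K) u"
 proof (rule continuous_on_closed_Union[OF finT])
  show "closed (quad_elem K)" for K by (rule compact_imp_closed[OF compact_quad_elem])
  show "continuous_on (quad_elem K) u" if "K \<in> T" for K
   using wc[OF that] u[OF that] continuous_on_cong[of "quad_elem K" "quad_elem K" u "w K"] by simp
 qed
 then have "u \<in> fe_space k \<Omega> T"
  unfolding fe_space_def cov using P(1) uF by (auto simp: u_def)
 moreover have "u N = g N" if N: "N \<in> lagrange_nodes k T" for N
 proof -
  obtain K i j where K: "K \<in> T" "i <= k" "j <= k" "N = bilinear_map K (vector [real i / real k, real j / real k])"
   using N unfolding lagrange_nodes_def by blast
  have "vector [real i / real k, real j / real k] \<in> cbox 0 (1 :: real^2)"
   using K k1 by (simp add: cbox_unit)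
  from uF[OF K(1) this] show ?thesis unfolding K(4) using P(2)[OF K(2,3)] by simp
 qed
 ultimately show ?thesis by (intro bexI[of _ u]) auto
qed

lemma nodal_basis_fun:
 assumes "k = 1 \<or> k = 2"
 shows "\<exists>u\<in>fe_space k \<Omega> T. \<forall>N'\<in>lagrange_nodes k T. u N' = (if N' = N then 1 else 0)"
 by (rule nodal_interpolant[OF assms])

lemma Q_node:
 assumes "\<phi> \<in> Q_basis \<Omega> T"
 shows "\<exists>N. N \<in> lagrange_nodes 1 T \<and> (\<forall>N'\<in>lagrange_nodes 1 T. \<phi> N' = (if N' = N then 1 else 0))"
 using assms unfolding Q_basis_def by auto

text \<open>Evaluation at the nodes \<open>N \<phi>\<close> is the dual basis: it gives independence
  and, with \<open>fe_eq_0\<close>, the expansion.\<close>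

lemma Q_basis_coords:
 obtains N where "!!\<phi>. \<phi> \<in> Q_basis \<Omega> T ==> N \<phi> \<in> lagrange_nodes 1 T"
  "!!\<phi> \<psi>. \<phi> \<in> Q_basis \<Omega> T ==> \<psi> \<in> Q_basis \<Omega> T ==> \<phi> (N \<psi>) = (if \<phi> = \<psi> then 1 else 0)"
  "!!q x. finite (Q_basis \<Omega> T) ==> q \<in> Q_space \<Omega> T ==> q x = (\<Sum>\<phi>\<in>Q_basis \<Omega> T. q (N \<phi>) * \<phi> x)"
proof -
 have "\<exists>N. \<forall>\<phi>. \<phi> \<in> Q_basis \<Omega> T --> N \<phi> \<in> lagrange_nodes 1 T \<and> (\<forall>N'\<in>lagrange_nodes 1 T. \<phi> N' = (if N' = N \<phi> then 1 else 0))"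
  using Q_node by (intro choice) auto
 then obtain N where N: "!!\<phi>. \<phi> \<in> Q_basis \<Omega> T ==> N \<phi> \<in> lagrange_nodes 1 T"
  "!!\<phi> N'. \<phi> \<in> Q_basis \<Omega> T ==> N' \<in> lagrange_nodes 1 T ==> \<phi> N' = (if N' = N \<phi> then 1 else 0)"
  by (elim exE) auto
 have fe: "\<phi> \<in> fe_space 1 \<Omega> T" if "\<phi> \<in> Q_basis \<Omega> T" for \<phi> using that unfolding Q_basis_def Q_space_def by auto
 have inj: "\<phi> = \<psi>" if "\<phi> \<in> Q_basis \<Omega> T" "\<psi> \<in> Q_basis \<Omega> T" "N \<phi> = N \<psi>" for \<phi> \<psi>
 proof
  fix x
  have "\<phi> x + (-1) * \<psi> x = 0"
   by (rule fe_eq_0[OF fe_space_add[OF fe[OF that(1)] fe_space_scale[OF fe[OF that(2)]]]]) (simp_all add: N(2)[OF that(1)] N(2)[OF that(2)] that(3))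
  then show "\<phi> x = \<psi> x" by simp
 qed
 have delta: "\<phi> (N \<psi>) = (if \<phi> = \<psi> then 1 else 0)" if "\<phi> \<in> Q_basis \<Omega> T" "\<psi> \<in> Q_basis \<Omega> T" for \<phi> \<psi>
  using N(2)[OF that(1) N(1)[OF that(2)]] inj[OF that] by auto
 have span: "q x = (\<Sum>\<phi>\<in>Q_basis \<Omega> T. q (N \<phi>) * \<phi> x)" if fin: "finite (Q_basis \<Omega> T)" and q: "q \<in> Q_space \<Omega> T" for q x
 proof -
  have "q x + (-1) * (\<Sum>\<phi>\<in>Q_basis \<Omega> T. q (N \<phi>) * \<phi> x) = 0"
  proof (rule fe_eq_0)
   show "(\<lambda>x. q x + (-1) * (\<Sum>\<phi>\<in>Q_basis \<Omega> T. q (N \<phi>) * \<phi> x)) \<in> fe_space 1 \<Omega> T"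
    using q fin fe by (intro fe_space_add fe_space_scale fe_space_sum) (auto simp: Q_space_def)
   fix M assume M: "M \<in> lagrange_nodes 1 T"
   obtain u where u: "u \<in> fe_space 1 \<Omega> T" "\<forall>N'\<in>lagrange_nodes 1 T. u N' = (if N' = M then 1 else 0)"
    using nodal_basis_fun[of 1 M] by auto
   then have uB: "u \<in> Q_basis \<Omega> T" using M unfolding Q_basis_def Q_space_def by auto
   have "N u = M" using N(1)[OF uB] N(2)[OF uB M] u(2) M by (auto split: if_splits)
   have "(\<Sum>\<phi>\<in>Q_basis \<Omega> T. q (N \<phi>) * \<phi> M) = (\<Sum>\<phi>\<in>Q_basis \<Omega> T. if \<phi> = u then q M else 0)"
   proof (rule sum.cong[OF refl])
    fix \<phi> assume "\<phi> \<in> Q_basis \<Omega> T"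
    then have "\<phi> M = (if \<phi> = u then 1 else 0)" using delta[OF _ uB, of \<phi>] \<open>N u = M\<close> by simp
    then show "q (N \<phi>) * \<phi> M = (if \<phi> = u then q M else 0)" using \<open>N u = M\<close> by simp
   qed
   then show "q M + (-1) * (\<Sum>\<phi>\<in>Q_basis \<Omega> T. q (N \<phi>) * \<phi> M) = 0" using fin uB by simp
  qed simp
  then show ?thesis by simp
 qed
 show ?thesis by (rule that[OF N(1) delta span])
qed

text \<open>As for the pressures, with a component \<open>c \<phi>\<close> attached to each node.
  The new point is the boundary: the functions that complete the basis vanish on all of it by
  \<open>fe_frontier_0\<close>.\<close>

lemma V_basis_coords:
 obtains N c where
  "!!\<phi> \<psi>. \<phi> \<in> V_basis \<Omega> T ==> \<psi> \<in> V_basis \<Omega> T ==> \<phi> (N \<psi>) $ c \<psi> = (if \<phi> = \<psi> then 1 else 0)"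
  "!!v x. finite (V_basis \<Omega> T) ==> v \<in> V_space \<Omega> T ==> v x = (\<Sum>\<phi>\<in>V_basis \<Omega> T. (v (N \<phi>) $ c \<phi>) *\<^sub>R \<phi> x)"
proof -
 let ?L = "lagrange_nodes 2 T"
 let ?P = "\<lambda>\<phi> z. fst z \<in> ?L - frontier \<Omega> \<and> (\<forall>N'\<in>?L. \<phi> N' = (if N' = fst z then axis (snd z) (1::real) else 0))"
 have "\<forall>\<phi>\<in>V_basis \<Omega> T. \<exists>z. ?P \<phi> z"
 proof
  fix \<phi> assume "\<phi> \<in> V_basis \<Omega> T"
  then obtain M c where "M \<in> ?L - frontier \<Omega>" "\<forall>N'\<in>?L. \<phi> N' = (if N' = M then axis c 1 else 0)"
   unfolding V_basis_def by (elim CollectE conjE bexE exE) (rule that)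
  then show "\<exists>z. ?P \<phi> z" by (intro exI[of _ "(M, c)"]) simp
 qed
 then obtain f where f: "\<forall>\<phi>\<in>V_basis \<Omega> T. ?P \<phi> (f \<phi>)" unfolding bchoice_iff by (elim exE)
 define N where "N \<phi> = fst (f \<phi>)" for \<phi>
 define c where "c \<phi> = snd (f \<phi>)" for \<phi>
 have N: "N \<phi> \<in> ?L - frontier \<Omega>" "!!N'. N' \<in> ?L ==> \<phi> N' = (if N' = N \<phi> then axis (c \<phi>) (1::real) else 0)"
  if "\<phi> \<in> V_basis \<Omega> T" for \<phi>
  using bspec[OF f that] unfolding N_def c_def by simp_all
 have V: "\<phi> \<in> V_space \<Omega> T" if "\<phi> \<in> V_basis \<Omega> T" for \<phi> using that unfolding V_basis_def by auto
 have vext: "v x = w x" if "v \<in> V_space \<Omega> T" "w \<in> V_space \<Omega> T" "!!M. M \<in> ?L ==> v M = w M" for v w x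
 proof -
  have "v x $ i + (-1) * w x $ i = 0" for i
   by (rule fe_eq_0[OF fe_space_add[OF _ fe_space_scale], of "\<lambda>x. v x $ i" 2 "\<lambda>x. w x $ i"])
    (use that in \<open>auto simp: V_space_def\<close>)
  then show ?thesis by (simp add: cart_eq_iff)
 qed
 have inj: "\<phi> = \<psi>" if "\<phi> \<in> V_basis \<Omega> T" "\<psi> \<in> V_basis \<Omega> T" "N \<phi> = N \<psi>" "c \<phi> = c \<psi>" for \<phi> \<psi>
 proof
  fix x
  show "\<phi> x = \<psi> x"
   by (rule vext[OF V[OF that(1)] V[OF that(2)]]) (simp add: N(2)[OF that(1)] N(2)[OF that(2)] that(3,4))
 qed
 have delta: "\<phi> (N \<psi>) $ c \<psi> = (if \<phi> = \<psi> then 1 else 0)" if "\<phi> \<in> V_basis \<Omega> T" "\<psi> \<in> V_basis \<Omega> T" for \<phi> \<psi>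
  using N(2)[OF that(1), of "N \<psi>"] N(1)[OF that(2)] inj[OF that] by (auto simp: axis_def)
 have span: "v x = (\<Sum>\<phi>\<in>V_basis \<Omega> T. (v (N \<phi>) $ c \<phi>) *\<^sub>R \<phi> x)" if fin: "finite (V_basis \<Omega> T)" and v: "v \<in> V_space \<Omega> T" for v x
 proof (rule vext[OF v])
  show w: "(\<lambda>x. \<Sum>\<phi>\<in>V_basis \<Omega> T. (v (N \<phi>) $ c \<phi>) *\<^sub>R \<phi> x) \<in> V_space \<Omega> T"
   using fin V by (intro V_space_sum V_space_scale)
  fix M assume M: "M \<in> ?L"
  show "v M = (\<Sum>\<phi>\<in>V_basis \<Omega> T. (v (N \<phi>) $ c \<phi>) *\<^sub>R \<phi> M)"
  proof (cases "M \<in> frontier \<Omega>")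
   case True
   then show ?thesis using v w unfolding V_space_def by auto
  next
   case False
   have "v M $ i = (\<Sum>\<phi>\<in>V_basis \<Omega> T. (v (N \<phi>) $ c \<phi>) *\<^sub>R \<phi> M) $ i" for i
   proof -
    obtain u where u: "u \<in> fe_space 2 \<Omega> T" "\<forall>N'\<in>?L. u N' = (if N' = M then 1 else 0)"
     using nodal_basis_fun[of 2 M] by auto
    define U :: "real^2 => real^2" where "U x = u x *\<^sub>R axis i 1" for x
    have "u x = 0" if "x \<in> frontier \<Omega>" for x
     using False u(2) by (intro fe_frontier_0[OF u(1) _ _ that]) auto
    moreover have "(\<lambda>x. U x $ j) \<in> fe_space 2 \<Omega> T" for j
    proof (cases "i = j")
     case True
     then show ?thesis using u(1) by (simp add: U_def)
    next
     case False
     then show ?thesis using fe_space_zero by (simp add: U_def axis_def)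
    qed
    ultimately have "U \<in> V_space \<Omega> T" unfolding V_space_def by (auto simp: U_def)
    moreover have UN: "\<forall>N'\<in>?L. U N' = (if N' = M then axis i 1 else 0)" using u(2) by (auto simp: U_def)
    ultimately have UB: "U \<in> V_basis \<Omega> T" using M False unfolding V_basis_def by blast
    have ax: "axis i (1::real) ~= 0" by simp
    have NU: "N U = M" using N(1)[OF UB] N(2)[OF UB M] UN M ax by (auto split: if_splits)
    have cU: "c U = i" using N(2)[OF UB M] UN M NU by (auto simp: axis_eq_axis)
    have "(\<Sum>\<phi>\<in>V_basis \<Omega> T. (v (N \<phi>) $ c \<phi>) *\<^sub>R \<phi> M) $ i = (\<Sum>\<phi>\<in>V_basis \<Omega> T. if \<phi> = U then v M $ i else 0)"
     unfolding sum_component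
    proof (rule sum.cong[OF refl])
     fix \<phi> assume "\<phi> \<in> V_basis \<Omega> T"
     then have "\<phi> M $ i = (if \<phi> = U then 1 else 0)" using delta[OF _ UB, of \<phi>] NU cU by simp
     then show "((v (N \<phi>) $ c \<phi>) *\<^sub>R \<phi> M) $ i = (if \<phi> = U then v M $ i else 0)" using NU cU by simp
    qed
    then show ?thesis using fin UB by simp
   qed
   then show ?thesis by (simp add: cart_eq_iff)
  qed
 qed
 show ?thesis by (rule that[OF delta span])
qed

text \<open>On an open element the gradient is a function of the reference coordinate that stays
  continuous up to the closed square, since the Jacobian is positive there. Boundedness of the
  gradient has its source here.\<close>

lemma V_space_grad_elem:
 assumes v: "v \<in> V_space \<Omega> T" and K: "K \<in> T"
 shows "\<exists>M. continuous_on (cbox 0 1) M \<and>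
  (\<forall>xi\<in>box 0 1. v differentiable (at (bilinear_map K xi)) \<and> grad v (bilinear_map K xi) = M xi)"
proof -
 have "\<forall>i. \<exists>p. p \<in> Q_poly 2 \<and> (\<forall>xi\<in>cbox 0 1. v (bilinear_map K xi) $ i = p xi)"
  using v K unfolding V_space_def fe_space_def by blast
 then obtain P where P: "!!i. P i \<in> Q_poly 2" "!!i xi. xi \<in> cbox 0 1 ==> v (bilinear_map K xi) $ i = P i xi"
  by (elim choice[THEN exE]) (rule that, simp_all)
 have "\<forall>i. \<exists>d. continuous_on UNIV (fst d) \<and> continuous_on UNIV (snd d) \<and>
  (\<forall>xi. (P i has_derivative (\<lambda>h. fst d xi * h $ 1 + snd d xi * h $ 2)) (at xi))"
  using Q_poly_derivative[OF P(1)] by force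
 from choice[OF this] obtain d where d': "\<forall>i. continuous_on UNIV (fst (d i)) \<and> continuous_on UNIV (snd (d i)) \<and>
  (\<forall>xi. (P i has_derivative (\<lambda>h. fst (d i) xi * h $ 1 + snd (d i) xi * h $ 2)) (at xi))" by (elim exE)
 have d: "continuous_on UNIV (fst (d i))" "continuous_on UNIV (snd (d i))"
  "(P i has_derivative (\<lambda>h. fst (d i) xi * h $ 1 + snd (d i) xi * h $ 2)) (at xi)" for i xi
  using spec[OF d', of i] by simp_all
 note cx = convex_T[OF K]
 define G where "G = the_inv_into (cbox 0 1) (bilinear_map K)"
 have G: "G (bilinear_map K xi) = xi" if "xi \<in> cbox 0 1" for xi
  unfolding G_def by (rule the_inv_into_f_f[OF bilinear_map_inj[OF cx] that])
 \<comment> \<open>The derivative of the inverse map, by Cramer's rule.\<close>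
 define DG :: "real^2 => real^2 => real^2" where
  "DG xi h = vector [cross2 h (dF2 K (xi $ 1)) / jac K xi, cross2 (dF1 K (xi $ 2)) h / jac K xi]" for xi h
 define D where "D i xi h = fst (d i) xi * DG xi h $ 1 + snd (d i) xi * DG xi h $ 2" for i xi h
 define M :: "real^2 => real^2^2" where "M xi = (\<chi> i j. D i xi (axis j 1))" for xi
 have bc: "box 0 1 \<subseteq> (cbox 0 1 :: (real^2) set)" by (rule box_subset_cbox)
 have dG: "(G has_derivative DG xi) (at (bilinear_map K xi))" if xi: "xi \<in> box 0 1" for xi
 proof (rule has_derivative_inverse_on[OF open_box bilinear_map_has_derivative _ _ xi])
  show "G (bilinear_map K \<eta>) = \<eta>" if "\<eta> \<in> box 0 1" for \<eta> using G bc that by auto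
  have J: "jac K xi ~= 0" using jac_pos[OF cx, of xi] bc xi by auto
  have "(cross2 h (dF2 K (xi $ 1)) / jac K xi) *\<^sub>R dF1 K (xi $ 2) + (cross2 (dF1 K (xi $ 2)) h / jac K xi) *\<^sub>R dF2 K (xi $ 1) = h" for h
  proof -
   have "cross2 h (dF2 K (xi $ 1)) * dF1 K (xi $ 2) $ i + cross2 (dF1 K (xi $ 2)) h * dF2 K (xi $ 1) $ i = jac K xi * h $ i" for i
    using exhaust_2[of i] by (auto simp: jac_def cross2_def algebra_simps)
   then show ?thesis using J by (simp add: cart_eq_iff add_divide_distrib[symmetric])
  qed
  then show "(\<lambda>h. h $ 1 *\<^sub>R dF1 K (xi $ 2) + h $ 2 *\<^sub>R dF2 K (xi $ 1)) \<circ> DG xi = id"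
   by (simp add: fun_eq_iff DG_def)
 qed
 have v_eq: "v x = P 1 (G x) *\<^sub>R axis 1 1 + P 2 (G x) *\<^sub>R axis 2 1" if x: "x \<in> bilinear_map K ` box 0 1" for x
 proof -
  obtain xi where xi: "xi \<in> box 0 1" "x = bilinear_map K xi" using x by (elim imageE) (rule that)
  have "v x $ i = P i (G x)" for i
   unfolding xi(2) using P(2)[OF subsetD[OF bc xi(1)]] G[OF subsetD[OF bc xi(1)]] by simp
  then show ?thesis by (simp add: cart_eq_iff forall_2 axis_def)
 qed
 have dv: "(v has_derivative (\<lambda>h. D 1 xi h *\<^sub>R axis 1 1 + D 2 xi h *\<^sub>R axis 2 1)) (at (bilinear_map K xi))" if xi: "xi \<in> box 0 1" for xi
 proof -
  have Gxi: "G (bilinear_map K xi) = xi" using G bc xi by auto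
  have dP: "((\<lambda>x. P i (G x)) has_derivative (\<lambda>h. D i xi h)) (at (bilinear_map K xi))" for i
   unfolding D_def using has_derivative_compose[OF dG[OF xi] d(3)[of i "G (bilinear_map K xi)"]] unfolding Gxi .
  have "((\<lambda>x. P 1 (G x) *\<^sub>R axis 1 1 + P 2 (G x) *\<^sub>R axis 2 1) has_derivative
   (\<lambda>h. D 1 xi h *\<^sub>R axis 1 1 + D 2 xi h *\<^sub>R axis 2 1)) (at (bilinear_map K xi))"
   by (intro has_derivative_add has_derivative_scaleR_left dP)
  then show ?thesis
   by (rule has_derivative_transform_within_open[OF _ open_quad_interior[OF cx]]) (use xi v_eq in auto)
 qed
 have "continuous_on (cbox 0 1) M"
 proof -
  have J: "jac K xi ~= 0" if "xi \<in> cbox 0 1" for xi using jac_pos[OF cx that] by simp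
  have c2: "continuous_on (cbox 0 1) (jac K)"
   unfolding jac_def[abs_def] by (rule continuous_on_cross2[OF continuous_on_dF])
  have c3: "continuous_on (cbox 0 1) (fst (d i))" "continuous_on (cbox 0 1) (snd (d i))" for i
   by (rule continuous_on_subset[OF d(1)], simp, rule continuous_on_subset[OF d(2)], simp)
  have c4: "continuous_on (cbox 0 1) (\<lambda>xi. fst (d i) xi * (cross2 h (dF2 K (xi $ 1)) / jac K xi) +
    snd (d i) xi * (cross2 (dF1 K (xi $ 2)) h / jac K xi))" for i h
  proof (rule continuous_on_add)
   show "continuous_on (cbox 0 1) (\<lambda>xi. fst (d i) xi * (cross2 h (dF2 K (xi $ 1)) / jac K xi))"
    by (rule continuous_on_mult[OF c3(1) continuous_on_divide[OF continuous_on_cross2[OF continuous_on_const continuous_on_dF(2)] c2]])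
     (simp add: J)
   show "continuous_on (cbox 0 1) (\<lambda>xi. snd (d i) xi * (cross2 (dF1 K (xi $ 2)) h / jac K xi))"
    by (rule continuous_on_mult[OF c3(2) continuous_on_divide[OF continuous_on_cross2[OF continuous_on_dF(1) continuous_on_const] c2]])
     (simp add: J)
  qed
  show ?thesis
   unfolding M_def[abs_def] D_def DG_def vector_2 by (intro continuous_on_vec_lambda c4)
 qed
 moreover have "grad v (bilinear_map K xi) = M xi" if xi: "xi \<in> box 0 1" for xi
 proof -
  have e: "frechet_derivative v (at (bilinear_map K xi)) = (\<lambda>h. D 1 xi h *\<^sub>R axis 1 1 + D 2 xi h *\<^sub>R axis 2 1)"
   by (rule frechet_derivative_at[OF dv[OF xi], symmetric])
  show ?thesis unfolding grad_def e matrix_def M_def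
   by (simp add: cart_eq_iff forall_2 axis_def)
 qed
 moreover have "v differentiable (at (bilinear_map K xi))" if "xi \<in> box 0 1" for xi
  using dv[OF that] unfolding differentiable_def by blast
 ultimately show ?thesis by (intro exI[of _ M]) auto
qed

text \<open>The link between the finite elements and the analysis on the plane: trace inequality,
  mean value and energy apply to discrete velocities through this property.\<close>

theorem V_space_pw_smooth:
 assumes v: "v \<in> V_space \<Omega> T"
 shows "pw_smooth \<Omega> (mesh_sides T) v"
proof -
 let ?S = "skel (mesh_sides T)"
 have v0: "v x = 0" if "x \<notin> \<Omega>" for x
 proof (cases "x \<in> closure \<Omega>")
  case True
  then show ?thesis using v that frontier_eq unfolding V_space_def by auto
 next
  case False
  then show ?thesis using v unfolding V_space_def fe_space_def by (auto simp: cart_eq_iff)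
 qed
 have cont: "continuous_on UNIV v"
 proof -
  have c: "continuous_on (closure \<Omega>) v"
   using v unfolding V_space_def fe_space_def continuous_on_componentwise[of "closure \<Omega>" v] Basis_real2
   by (auto simp: inner_axis)
  have "continuous_on (closure \<Omega> \<union> (- \<Omega>)) v"
   using open_dom by (intro continuous_on_closed_Un c) (auto intro: continuous_on_eq[OF continuous_on_const[of _ 0]] simp: v0)
  moreover have "closure \<Omega> \<union> (- \<Omega>) = UNIV" using closure_subset by auto
  ultimately show ?thesis by simp
 qed
 have "\<exists>M. \<forall>K. K \<in> T --> continuous_on (cbox 0 1) (M K) \<and>
  (\<forall>xi\<in>box 0 1. v differentiable (at (bilinear_map K xi)) \<and> grad v (bilinear_map K xi) = M K xi)"
  using V_space_grad_elem[OF v] by (intro choice) auto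
 then obtain M where M: "\<forall>K. K \<in> T --> continuous_on (cbox 0 1) (M K) \<and>
  (\<forall>xi\<in>box 0 1. v differentiable (at (bilinear_map K xi)) \<and> grad v (bilinear_map K xi) = M K xi)" by (elim exE)
 have Mc: "continuous_on (cbox 0 1) (M K)" if "K \<in> T" for K using spec[OF M, of K] that by simp
 have Md: "v differentiable (at (bilinear_map K xi))" and Mg: "grad v (bilinear_map K xi) = M K xi"
  if "K \<in> T" "xi \<in> box 0 1" for K xi using spec[OF M, of K] that by simp_all
 have ext: "v differentiable (at x)" "grad v x = 0" if x: "x \<notin> closure \<Omega>" for x
 proof -
  have "(v has_derivative (\<lambda>_. 0)) (at x)"
  proof (rule has_derivative_transform_within_open[of "\<lambda>_. 0" _ _ _ "- closure \<Omega>"])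
   show "0 = v y" if "y \<in> - closure \<Omega>" for y using v0[of y] that closure_subset by force
  qed (use x in auto)
  then show "v differentiable (at x)" by (rule differentiableI)
  have fd: "frechet_derivative v (at x) = (\<lambda>_. 0)"
   by (rule frechet_derivative_at[symmetric]) fact
  show "grad v x = 0" unfolding grad_def fd by (simp add: matrix_def cart_eq_iff)
 qed
 have df: "v differentiable (at x)" if "x \<notin> ?S" for x
 proof (cases "x \<in> closure \<Omega>")
  case True
  then show ?thesis using off_skel[OF True that] Md by auto
 qed (rule ext)
 have cg: "isCont (grad v) x" if xS: "x \<notin> ?S" for x
 proof (cases "x \<in> closure \<Omega>")
  case True
  then obtain K where K: "K \<in> T" "x \<in> bilinear_map K ` box 0 1" using off_skel[OF True xS] by auto
  let ?G = "the_inv_into (cbox 0 1) (bilinear_map K)"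
  have inj: "inj_on (bilinear_map K) (cbox 0 1)" by (rule bilinear_map_inj[OF convex_T[OF K(1)]])
  have "continuous_on (bilinear_map K ` cbox 0 1) (\<lambda>y. M K (?G y))"
   by (rule continuous_on_compose2[OF Mc[OF K(1)] continuous_on_inv_into[OF continuous_bilinear_map compact_cbox inj]])
    (auto intro: the_inv_into_into[OF inj])
  then have "continuous_on (bilinear_map K ` box 0 1) (\<lambda>y. M K (?G y))"
   by (rule continuous_on_subset) (intro image_mono box_subset_cbox)
  then have "continuous_on (bilinear_map K ` box 0 1) (grad v)"
  proof (rule continuous_on_eq)
   fix y assume "y \<in> bilinear_map K ` box 0 1"
   then obtain xi where xi: "xi \<in> box 0 1" "y = bilinear_map K xi" by (elim imageE) (rule that)
   then have "?G y = xi" using the_inv_into_f_f[OF inj] box_subset_cbox[of "0::real^2" 1] by auto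
   then show "M K (?G y) = grad v y" using Mg[OF K(1) xi(1)] xi(2) by simp
  qed
  then have "\<forall>y\<in>bilinear_map K ` box 0 1. isCont (grad v) y"
   by (simp only: continuous_on_eq_continuous_at[OF open_quad_interior[OF convex_T[OF K(1)]]])
  then show ?thesis using K(2) by (rule bspec)
 next
  case False
  have "continuous_on (- closure \<Omega>) (grad v)"
   by (rule continuous_on_eq[OF continuous_on_const[of _ 0]]) (simp add: ext(2))
  then show ?thesis using False by (simp add: continuous_on_eq_continuous_at open_Compl)
 qed
 have "bounded (\<Union>K\<in>T. M K ` cbox 0 1)"
  using finT Mc by (intro bounded_UN ballI compact_imp_bounded compact_continuous_image compact_cbox) auto
 then obtain B where B: "0 < B" "!!y. y \<in> (\<Union>K\<in>T. M K ` cbox 0 1) ==> norm y <= B"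
  unfolding bounded_pos by auto
 have bd: "norm (grad v x) <= B" if xS: "x \<notin> ?S" for x
 proof (cases "x \<in> closure \<Omega>")
  case True
  then obtain K xi where K: "K \<in> T" "xi \<in> box 0 1" "x = bilinear_map K xi" using off_skel[OF True xS] by auto
  then have "grad v x \<in> (\<Union>K\<in>T. M K ` cbox 0 1)" using Mg[OF K(1,2)] box_subset_cbox[of "0::real^2" 1] by auto
  then show ?thesis by (rule B(2))
 qed (use ext(2) B(1) in simp)
 have out: "grad v x = 0" if x: "x \<notin> ?S" "x \<notin> \<Omega>" for x
 proof (cases "x \<in> closure \<Omega>")
  case True
  from off_skel[OF this x(1)] obtain K where K: "K \<in> T" "x \<in> bilinear_map K ` box 0 1" by (elim bexE)
  show ?thesis using subsetD[OF elem_interior_subset[OF K(1)] K(2)] x(2) by simp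
 qed (rule ext(2))
 show ?thesis
  unfolding pw_smooth_def using finite_mesh_sides cont df cg bd out v0
  by (auto intro: continuous_at_imp_continuous_on)
qed

end

section \<open>Bilinear forms and their matrices\<close>

definition comb :: "(real^2 => 'a::real_vector) list => real Matrix.vec => real^2 => 'a" where
 "comb fs x p = (\<Sum>i<length fs. vec_index x i *\<^sub>R (fs ! i) p)"

definition fun_subspace :: "(real^2 => 'a::real_vector) set => bool" where
 "fun_subspace S \<longleftrightarrow> (\<lambda>_. 0) \<in> S \<and> (\<forall>f\<in>S. \<forall>g\<in>S. (\<lambda>x. f x + g x) \<in> S) \<and> (\<forall>f\<in>S. \<forall>r. (\<lambda>x. r *\<^sub>R f x) \<in> S)"

definition linear_form :: "(real^2 => 'a::real_vector) set => ((real^2 => 'a) => real) => bool" where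
 "linear_form S F \<longleftrightarrow> (\<forall>f\<in>S. \<forall>g\<in>S. F (\<lambda>x. f x + g x) = F f + F g) \<and> (\<forall>f\<in>S. \<forall>r. F (\<lambda>x. r *\<^sub>R f x) = r * F f)"

text \<open>Linearity is asked on subspaces only: integrals and derivatives are total operations
  here and fail to be additive for functions that are not integrable or not differentiable.\<close>

definition bilinear_form :: "(real^2 => 'a::real_vector) set => (real^2 => 'b::real_vector) set =>
  ((real^2 => 'a) => (real^2 => 'b) => real) => bool" where
 "bilinear_form S R G \<longleftrightarrow> fun_subspace S \<and> fun_subspace R \<and>
  (\<forall>g\<in>R. linear_form S (\<lambda>f. G f g)) \<and> (\<forall>f\<in>S. linear_form R (G f))"

lemma comb_in: assumes S: "fun_subspace S" and fs: "set fs \<subseteq> S" shows "comb fs x \<in> S"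
proof -
 have "k <= length fs ==> (\<lambda>p. \<Sum>i<k. vec_index x i *\<^sub>R (fs ! i) p) \<in> S" for k
 proof (induction k)
  case 0
  then show ?case using S by (simp add: fun_subspace_def)
 next
  case (Suc k)
  then have "fs ! k \<in> S" using fs nth_mem[of k fs] by auto
  then show ?case using Suc S unfolding fun_subspace_def sum.lessThan_Suc by simp
 qed
 then show ?thesis unfolding comb_def[abs_def] by simp
qed

lemma linear_form_comb:
 assumes S: "fun_subspace S" and F: "linear_form S F" and fs: "set fs \<subseteq> S"
 shows "F (comb fs x) = (\<Sum>i<length fs. vec_index x i * F (fs ! i))"
proof -
 have "k <= length fs ==> (\<lambda>p. \<Sum>i<k. vec_index x i *\<^sub>R (fs ! i) p) \<in> S \<and>
  F (\<lambda>p. \<Sum>i<k. vec_index x i *\<^sub>R (fs ! i) p) = (\<Sum>i<k. vec_index x i * F (fs ! i))" for k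
 proof (induction k)
  case 0
  have z: "(\<lambda>_. 0) \<in> S" using S by (simp add: fun_subspace_def)
  from conjunct2[OF F[unfolded linear_form_def], THEN bspec, OF z, THEN spec, of 0]
  show ?case using z by simp
 next
  case (Suc k)
  then have fk: "fs ! k \<in> S" using fs nth_mem[of k fs] by auto
  let ?h = "\<lambda>p. \<Sum>i<k. vec_index x i *\<^sub>R (fs ! i) p" and ?g = "\<lambda>p. vec_index x k *\<^sub>R (fs ! k) p"
  have g: "?g \<in> S" "F ?g = vec_index x k * F (fs ! k)"
   using fk S F unfolding fun_subspace_def linear_form_def by simp_all
  have h: "?h \<in> S" "F ?h = (\<Sum>i<k. vec_index x i * F (fs ! i))" using Suc by simp_all
  have "(\<lambda>p. ?h p + ?g p) \<in> S" using S g(1) h(1) unfolding fun_subspace_def by simp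
  moreover have "F (\<lambda>p. ?h p + ?g p) = F ?h + F ?g" using F g(1) h(1) unfolding linear_form_def by simp
  ultimately show ?case using g(2) h(2) by simp
 qed
 then show ?thesis unfolding comb_def[abs_def] by simp
qed

lemma bilinear_form_mat:
 assumes G: "bilinear_form S R G" and fs: "set fs \<subseteq> S" and gs: "set gs \<subseteq> R"
  and w: "w \<in> carrier_vec (length fs)" and x: "x \<in> carrier_vec (length gs)"
 shows "scalar_prod w (Matrix.mat (length fs) (length gs) (\<lambda>(i, j). G (fs ! i) (gs ! j)) *\<^sub>v x) = G (comb fs w) (comb gs x)"
proof -
 have S: "fun_subspace S" "fun_subspace R" using G by (simp_all add: bilinear_form_def)
 have "comb gs x \<in> R" by (rule comb_in[OF S(2) gs])
 then have "linear_form S (\<lambda>f. G f (comb gs x))" using G by (simp add: bilinear_form_def)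
 from linear_form_comb[OF S(1) this fs]
 have e: "G (comb fs w) (comb gs x) = (\<Sum>i<length fs. vec_index w i * G (fs ! i) (comb gs x))" .
 have "G (fs ! i) (comb gs x) = (\<Sum>j<length gs. vec_index x j * G (fs ! i) (gs ! j))" if "i < length fs" for i
 proof -
  have "fs ! i \<in> S" using fs nth_mem[OF that] by auto
  then have "linear_form R (G (fs ! i))" using G by (simp add: bilinear_form_def)
  then show ?thesis by (rule linear_form_comb[OF S(2) _ gs])
 qed
 then show ?thesis unfolding e using w x
  by (simp add: scalar_prod_def row_def atLeast0LessThan mult.commute)
qed

lemma bilinear_form_uminus: "bilinear_form S R G ==> bilinear_form S R (\<lambda>f g. - G f g)"
 unfolding bilinear_form_def linear_form_def by simp

lemma bilinear_form_swap: "bilinear_form S R G ==> bilinear_form R S (\<lambda>g f. G f g)"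
 unfolding bilinear_form_def by simp

lemma fun_subspace_V: "fun_subspace (V_space \<Omega> T)"
 unfolding fun_subspace_def by (simp add: V_space_zero V_space_add V_space_scale)

lemma fun_subspace_Q: "fun_subspace (Q_space \<Omega> T)"
 unfolding fun_subspace_def Q_space_def by (simp add: fe_space_zero fe_space_add fe_space_scale)

text \<open>Bounded Borel functions supported in \<Omega>. Products of two of them are integrable
  over a bounded \<Omega> and, with \<open>UNIV\<close> in its place, for the finite arc length
  measure, so all forms in use are well behaved on such functions.\<close>

definition bsf :: "(real^2) set => (real^2 => 'a::euclidean_space) set" where
 "bsf \<Omega> = {f. f \<in> borel_measurable borel \<and> (\<exists>M. \<forall>x. norm (f x) <= M) \<and> (\<forall>x. x \<notin> \<Omega> --> f x = 0)}"

lemma bsf_add: "f \<in> bsf \<Omega> ==> g \<in> bsf \<Omega> ==> (\<lambda>x. f x + g x) \<in> bsf \<Omega>"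
 unfolding bsf_def
proof clarify
 fix M N assume m: "f \<in> borel_measurable borel" "g \<in> borel_measurable borel" and b: "\<forall>x. norm (f x) <= M" "\<forall>x. norm (g x) <= N"
  and z: "\<forall>x. x \<notin> \<Omega> --> f x = 0" "\<forall>x. x \<notin> \<Omega> --> g x = 0"
 have "norm (f x + g x) <= M + N" for x using norm_triangle_ineq[of "f x" "g x"] b(1)[rule_format, of x] b(2)[rule_format, of x] by linarith
 then show "(\<lambda>x. f x + g x) \<in> borel_measurable borel \<and> (\<exists>M. \<forall>x. norm (f x + g x) <= M) \<and> (\<forall>x. x \<notin> \<Omega> --> f x + g x = 0)"
  using m z by auto
qed

lemma bsf_scale: "f \<in> bsf \<Omega> ==> (\<lambda>x. r *\<^sub>R f x) \<in> bsf \<Omega>"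
 unfolding bsf_def
proof clarify
 fix M assume m: "f \<in> borel_measurable borel" and b: "\<forall>x. norm (f x) <= M" and z: "\<forall>x. x \<notin> \<Omega> --> f x = 0"
 have "norm (r *\<^sub>R f x) <= \<bar>r\<bar> * M" for x using b by (simp add: mult_left_mono)
 then show "(\<lambda>x. r *\<^sub>R f x) \<in> borel_measurable borel \<and> (\<exists>M. \<forall>x. norm (r *\<^sub>R f x) <= M) \<and> (\<forall>x. x \<notin> \<Omega> --> r *\<^sub>R f x = 0)"
  using m z by auto
qed

lemma bsf_zero: "(\<lambda>_. 0) \<in> bsf \<Omega>"
 unfolding bsf_def by auto

lemma fun_subspace_bsf: "fun_subspace (bsf \<Omega>)"
 unfolding fun_subspace_def by (simp add: bsf_zero bsf_add bsf_scale)

lemma bsf_inner_bound: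
 assumes "f \<in> bsf \<Omega>" "g \<in> bsf \<Omega>"
 shows "(\<lambda>x. f x \<bullet> g x) \<in> borel_measurable borel" "\<exists>K. \<forall>x. \<bar>f x \<bullet> g x\<bar> <= K"
proof -
 have m [measurable]: "f \<in> borel_measurable borel" "g \<in> borel_measurable borel" using assms by (simp_all add: bsf_def)
 show "(\<lambda>x. f x \<bullet> g x) \<in> borel_measurable borel" by measurable
 obtain M N where b: "\<forall>x. norm (f x) <= M" "\<forall>x. norm (g x) <= N" using assms by (auto simp: bsf_def)
 have "\<bar>f x \<bullet> g x\<bar> <= M * N" for x
 proof -
  have "\<bar>f x \<bullet> g x\<bar> <= norm (f x) * norm (g x)" by (rule Cauchy_Schwarz_ineq2)
  also have "\<dots> <= M * N" using b order_trans[OF norm_ge_zero[of "f x"] b(1)[rule_format, of x]] by (intro mult_mono) auto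
  finally show ?thesis .
 qed
 then show "\<exists>K. \<forall>x. \<bar>f x \<bullet> g x\<bar> <= K" by auto
qed

lemma bsf_inner_integrable:
 assumes "bounded \<Omega>" "f \<in> bsf \<Omega>" "g \<in> bsf \<Omega>"
 shows "integrable lborel (\<lambda>x. f x \<bullet> g x)"
proof -
 obtain K where K: "\<forall>x. \<bar>f x \<bullet> g x\<bar> <= K" using bsf_inner_bound(2)[OF assms(2,3)] by (elim exE)
 show ?thesis
  by (rule integrable_bounded_support[OF bsf_inner_bound(1)[OF assms(2,3)], of K \<Omega>])
   (use K assms in \<open>auto simp: bsf_def\<close>)
qed

lemma bilinear_form_bsf:
 fixes dummy :: "'a::euclidean_space"
 assumes "bounded \<Omega>"
 shows "bilinear_form (bsf \<Omega> :: (real^2 => 'a) set) (bsf \<Omega>) (\<lambda>f g. \<integral>x. f x \<bullet> g x \<partial>lborel)"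
 unfolding bilinear_form_def linear_form_def
 by (auto simp: fun_subspace_bsf inner_add_left inner_add_right bsf_inner_integrable[OF assms] intro!: Bochner_Integration.integral_add)

text \<open>All forms over the domain are one inner product composed with linear maps of the
  arguments: the corrected gradient, its trace, or the restriction of a pressure to
  \<Omega>.\<close>

lemma bilinear_form_pullback:
 assumes G: "bilinear_form S R G" and S': "fun_subspace S'" and R': "fun_subspace R'"
  and p: "!!f. f \<in> S' ==> p f \<in> S" "!!f g. f \<in> S' ==> g \<in> S' ==> p (\<lambda>x. f x + g x) = (\<lambda>x. p f x + p g x)"
   "!!f r. f \<in> S' ==> p (\<lambda>x. r *\<^sub>R f x) = (\<lambda>x. r *\<^sub>R p f x)"
  and q: "!!f. f \<in> R' ==> q f \<in> R" "!!f g. f \<in> R' ==> g \<in> R' ==> q (\<lambda>x. f x + g x) = (\<lambda>x. q f x + q g x)"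
   "!!f r. f \<in> R' ==> q (\<lambda>x. r *\<^sub>R f x) = (\<lambda>x. r *\<^sub>R q f x)"
  and H: "!!f g. f \<in> S' ==> g \<in> R' ==> H f g = G (p f) (q g)"
 shows "bilinear_form S' R' H"
proof -
 have S'2: "(\<lambda>x. f x + g x) \<in> S'" "(\<lambda>x. r *\<^sub>R f x) \<in> S'" if "f \<in> S'" "g \<in> S'" for f g r
  using S' that by (simp_all add: fun_subspace_def)
 have R'2: "(\<lambda>x. f x + g x) \<in> R'" "(\<lambda>x. r *\<^sub>R f x) \<in> R'" if "f \<in> R'" "g \<in> R'" for f g r
  using R' that by (simp_all add: fun_subspace_def)
 have G1: "G (\<lambda>x. f x + g x) h = G f h + G g h" "G (\<lambda>x. r *\<^sub>R f x) h = r * G f h" if "f \<in> S" "g \<in> S" "h \<in> R" for f g h r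
  using G that by (simp_all add: bilinear_form_def linear_form_def)
 have G2: "G h (\<lambda>x. f x + g x) = G h f + G h g" "G h (\<lambda>x. r *\<^sub>R f x) = r * G h f" if "f \<in> R" "g \<in> R" "h \<in> S" for f g h r
  using G that by (simp_all add: bilinear_form_def linear_form_def)
 show ?thesis
  unfolding bilinear_form_def linear_form_def
 proof (intro conjI ballI allI S' R')
  fix h f g r assume h: "h \<in> R'" and f: "f \<in> S'"
  show "H (\<lambda>x. r *\<^sub>R f x) h = r * H f h"
   using H[OF S'2(2)[OF f f] h] H[OF f h] p(3)[OF f] G1(2)[OF p(1)[OF f] p(1)[OF f] q(1)[OF h]] by simp
  assume g: "g \<in> S'"
  show "H (\<lambda>x. f x + g x) h = H f h + H g h"
   using H[OF S'2(1)[OF f g] h] H[OF f h] H[OF g h] p(2)[OF f g] G1(1)[OF p(1)[OF f] p(1)[OF g] q(1)[OF h]] by simp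
 next
  fix h f g r assume h: "h \<in> S'" and f: "f \<in> R'"
  show "H h (\<lambda>x. r *\<^sub>R f x) = r * H h f"
   using H[OF h R'2(2)[OF f f]] H[OF h f] q(3)[OF f] G2(2)[OF q(1)[OF f] q(1)[OF f] p(1)[OF h]] by simp
  assume g: "g \<in> R'"
  show "H h (\<lambda>x. f x + g x) = H h f + H h g"
   using H[OF h R'2(1)[OF f g]] H[OF h f] H[OF h g] q(2)[OF f g] G2(1)[OF q(1)[OF f] q(1)[OF g] p(1)[OF h]] by simp
 qed
qed

section \<open>Gradient and divergence of discrete velocities as linear maps\<close>

lemma bgrad_add:
 assumes v: "pw_smooth \<Omega> E v" and w: "pw_smooth \<Omega> E w"
 shows "bgrad E (\<lambda>x. v x + w x) = (\<lambda>x. bgrad E v x + bgrad E w x)"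
proof
 fix x
 show "bgrad E (\<lambda>x. v x + w x) x = bgrad E v x + bgrad E w x"
 proof (cases "x \<in> skel E")
  case False
  have "v differentiable (at x)" "w differentiable (at x)" using v w False by (simp_all add: pw_smooth_def)
  then have "((\<lambda>x. v x + w x) has_derivative (\<lambda>h. grad v x *v h + grad w x *v h)) (at x)"
   by (intro has_derivative_add has_derivative_grad)
  then have "frechet_derivative (\<lambda>x. v x + w x) (at x) = (\<lambda>h. (grad v x + grad w x) *v h)"
   unfolding matrix_vector_mult_add_rdistrib by (rule frechet_derivative_at[symmetric])
  then have "grad (\<lambda>x. v x + w x) x = grad v x + grad w x"
   unfolding grad_def[of "\<lambda>x. v x + w x"] by (simp add: matrix_of_matrix_vector_mul)
  then show ?thesis using False by (simp add: bgrad_def)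
 qed (simp add: bgrad_def)
qed

lemma bgrad_scale:
 assumes v: "pw_smooth \<Omega> E v"
 shows "bgrad E (\<lambda>x. r *\<^sub>R v x) = (\<lambda>x. r *\<^sub>R bgrad E v x)"
proof
 fix x
 show "bgrad E (\<lambda>x. r *\<^sub>R v x) x = r *\<^sub>R bgrad E v x"
 proof (cases "x \<in> skel E")
  case False
  have "v differentiable (at x)" using v False by (simp add: pw_smooth_def)
  then have "((\<lambda>x. r *\<^sub>R v x) has_derivative (\<lambda>h. r *\<^sub>R (grad v x *v h))) (at x)"
   by (intro has_derivative_scaleR_right has_derivative_grad)
  then have "frechet_derivative (\<lambda>x. r *\<^sub>R v x) (at x) = (\<lambda>h. (r *\<^sub>R grad v x) *v h)"
   unfolding scaleR_matrix_vector_assoc[symmetric] by (rule frechet_derivative_at[symmetric])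
  then have "grad (\<lambda>x. r *\<^sub>R v x) x = r *\<^sub>R grad v x"
   unfolding grad_def[of "\<lambda>x. r *\<^sub>R v x"] by (simp add: matrix_of_matrix_vector_mul)
  then show ?thesis using False by (simp add: bgrad_def)
 qed (simp add: bgrad_def)
qed

lemma bgrad_bsf:
 assumes v: "pw_smooth \<Omega> E v"
 shows "bgrad E v \<in> bsf \<Omega>"
proof -
 obtain M where "\<forall>x. norm (bgrad E v x) <= M" using bgrad_bounded[OF v] by auto
 moreover have "bgrad E v x = 0" if "x \<notin> \<Omega>" for x using v that by (simp add: bgrad_def pw_smooth_def)
 ultimately show ?thesis using bgrad_measurable[OF v] unfolding bsf_def by auto
qed

lemma trace_2: "trace (A :: real^2^2) = A $ 1 $ 1 + A $ 2 $ 2"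
 by (simp add: trace_def sum_2)

lemma trace_scale: "trace (r *\<^sub>R A :: real^2^2) = r * trace A"
 by (simp add: trace_2 distrib_left)

lemma trace_bgrad_bsf:
 assumes v: "pw_smooth \<Omega> E v"
 shows "(\<lambda>x. trace (bgrad E v x)) \<in> bsf \<Omega>"
proof -
 have b: "bgrad E v \<in> bsf \<Omega>" by (rule bgrad_bsf[OF v])
 then obtain M where M: "!!x. norm (bgrad E v x) <= M" by (auto simp: bsf_def)
 have "\<bar>trace (bgrad E v x)\<bar> <= 2 * M" for x
 proof -
  have "\<bar>bgrad E v x $ i $ i\<bar> <= M" for i
   using component_le_norm_cart[of "bgrad E v x $ i" i] Finite_Cartesian_Product.norm_nth_le[of "bgrad E v x" i] M[of x] by simp
  from this[of 1] this[of 2] show ?thesis unfolding trace_2 by linarith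
 qed
 moreover have "(\<lambda>x. trace (bgrad E v x)) \<in> borel_measurable borel"
  unfolding trace_2 by (intro borel_measurable_add bgrad_nth_measurable[OF v])
 ultimately show ?thesis using b unfolding bsf_def by (auto simp: trace_2)
qed

text \<open>The trace inequality holds for any segment, here one starting at \<open>a\<close>. Zero
  energy makes the mean square on it vanish, and continuity then forces the value at
  \<open>a\<close> to be 0. This plays the part of a Poincare inequality.\<close>

lemma denergy_eq_0:
 assumes v: "pw_smooth \<Omega> E v" and \<Omega>: "bounded \<Omega>" and d: "denergy E v = 0"
 shows "v a = 0"
proof (rule ccontr)
 assume va: "v a ~= 0"
 define b where "b = a + axis 1 1"
 have "axis 1 (1::real) ~= (0 :: real^2)" by simp
 then have ab: "a ~= b" by (simp add: b_def)
 obtain K where "\<forall>E v. pw_smooth \<Omega> E v --> Hhalf_sq {(a, b)} v <= ennreal K * denergy E v"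
  using trace_inequality[of "{(a, b)}" \<Omega>] ab \<Omega> by auto
 then have "Hhalf_sq {(a, b)} v <= 0" using v d by fastforce
 then have "(\<integral>\<^sup>+x. ennreal ((norm (v x))\<^sup>2) \<partial>arc_measure {(a, b)}) = 0" unfolding Hhalf_sq_def by simp
 moreover have vm: "v \<in> borel_measurable borel" by (rule pw_smooth_measurable[OF v])
 have m: "(\<lambda>x. ennreal ((norm (v x))\<^sup>2)) \<in> borel_measurable borel" using vm by measurable
 have "(\<integral>\<^sup>+x. ennreal ((norm (v x))\<^sup>2) \<partial>arc_measure {(a, b)}) = segint a b (\<lambda>x. ennreal ((norm (v x))\<^sup>2))"
  using nn_integral_arc[OF m, of "{(a, b)}"] by simp
 ultimately have s0: "segint a b (\<lambda>x. ennreal ((norm (v x))\<^sup>2)) = 0" by simp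
 have "continuous_on UNIV v" using v by (simp add: pw_smooth_def)
 then have "continuous_on UNIV (\<lambda>t. norm (v (linepath a b t)))"
  by (intro continuous_on_norm continuous_on_compose2[of UNIV v UNIV "linepath a b"] continuous_on_linepath) auto
 then have "isCont (\<lambda>t. norm (v (linepath a b t))) 0" by (simp add: continuous_on_eq_continuous_at)
 moreover have "0 < norm (v a) / 2" using va by simp
 ultimately obtain \<delta> where \<delta>: "0 < \<delta>" "!!t. dist t 0 < \<delta> ==> dist (norm (v (linepath a b t))) (norm (v (linepath a b 0))) < norm (v a) / 2"
  unfolding continuous_at_eps_delta by blast
 define q where "q = min \<delta> 1 / 2"
 have q: "0 < q" "q <= 1" "q < \<delta>" using \<delta>(1) by (auto simp: q_def)
 have "ennreal (dist a b * ((norm (v a) / 2)\<^sup>2 * (q - 0))) <= segint a b (\<lambda>x. ennreal ((norm (v x))\<^sup>2))"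
 proof (rule segint_ge)
  fix t assume t: "t \<in> {0..q}"
  then have "dist (norm (v (linepath a b t))) (norm (v (linepath a b 0))) < norm (v a) / 2"
   using q by (intro \<delta>(2)) (simp add: dist_real_def)
  moreover have "linepath a b 0 = a" by (simp add: linepath_def)
  ultimately have "\<bar>norm (v (linepath a b t)) - norm (v a)\<bar> < norm (v a) / 2" by (simp only: dist_real_def)
  then have "norm (v a) / 2 <= norm (v (linepath a b t))" by linarith
  then have "(norm (v a) / 2)\<^sup>2 <= (norm (v (linepath a b t)))\<^sup>2" by (rule power_mono) simp
  then show "ennreal ((norm (v a) / 2)\<^sup>2) <= ennreal ((norm (v (linepath a b t)))\<^sup>2)" by (rule ennreal_leI)
 qed (use q in auto)
 then have "dist a b * ((norm (v a) / 2)\<^sup>2 * q) <= 0" unfolding s0 by (simp add: ennreal_eq_0_iff)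
 moreover have "0 < dist a b * ((norm (v a) / 2)\<^sup>2 * q)" using ab q va by simp
 ultimately show False by linarith
qed

context fe_mesh
begin

abbreviation "E \<equiv> mesh_sides T"

lemma L2_grad:
 assumes v: "v \<in> V_space \<Omega> T" and w: "w \<in> V_space \<Omega> T"
 shows "L2_inner \<Omega> (grad v) (grad w) = (\<integral>x. bgrad E v x \<bullet> bgrad E w x \<partial>lborel)"
 unfolding L2_inner_def
proof (rule set_integral_off_skel[OF finite_mesh_sides])
 note bv = bgrad_bsf[OF V_space_pw_smooth[OF v]] and bw = bgrad_bsf[OF V_space_pw_smooth[OF w]]
 show "(\<lambda>x. bgrad E v x \<bullet> bgrad E w x) \<in> borel_measurable borel" by (rule bsf_inner_bound(1)[OF bv bw])
 show "bgrad E v x \<bullet> bgrad E w x = 0" if "x \<notin> \<Omega>" for x using bv that by (simp add: bsf_def)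
qed (simp add: bgrad_def)

lemma Q_bsf:
 assumes q: "q \<in> Q_space \<Omega> T"
 shows "(\<lambda>x. indicator \<Omega> x * q x) \<in> bsf \<Omega>"
proof -
 have c: "continuous_on (closure \<Omega>) q" using q by (simp add: Q_space_def fe_space_def)
 have "compact (closure \<Omega>)" using bounded_dom by (simp add: compact_closure)
 then have "bounded (q ` closure \<Omega>)" by (intro compact_imp_bounded compact_continuous_image c)
 then obtain M where M: "0 < M" "!!x. x \<in> closure \<Omega> ==> \<bar>q x\<bar> <= M" unfolding bounded_pos by auto
 have b: "\<forall>x. norm (indicator \<Omega> x * q x) <= M"
  using M closure_subset[of \<Omega>] by (auto simp: indicator_def)
 have m: "(\<lambda>x. indicator \<Omega> x *\<^sub>R q x) \<in> borel_measurable borel"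
  using open_dom by (intro borel_measurable_continuous_on_indicator continuous_on_subset[OF c closure_subset]) auto
 show ?thesis unfolding bsf_def mem_Collect_eq
  using b m unfolding real_scaleR_def by (intro conjI exI[of _ M]) (assumption, assumption, simp)
qed

lemma L2_div:
 assumes v: "v \<in> V_space \<Omega> T" and q: "q \<in> Q_space \<Omega> T"
 shows "L2_inner \<Omega> (divergence v) q = (\<integral>x. trace (bgrad E v x) \<bullet> (indicator \<Omega> x * q x) \<partial>lborel)"
 unfolding L2_inner_def
proof (rule set_integral_off_skel[OF finite_mesh_sides])
 show "(\<lambda>x. trace (bgrad E v x) \<bullet> (indicator \<Omega> x * q x)) \<in> borel_measurable borel"
  by (rule bsf_inner_bound(1)[OF trace_bgrad_bsf[OF V_space_pw_smooth[OF v]] Q_bsf[OF q]])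
qed (simp_all add: bgrad_def divergence_def)

lemma L2_Q:
 assumes q: "q \<in> Q_space \<Omega> T" and r: "r \<in> Q_space \<Omega> T"
 shows "L2_inner \<Omega> q r = (\<integral>x. (indicator \<Omega> x * q x) \<bullet> (indicator \<Omega> x * r x) \<partial>lborel)"
 unfolding L2_inner_def
proof (rule set_integral_off_skel[of "{}"])
 show "(\<lambda>x. (indicator \<Omega> x * q x) \<bullet> (indicator \<Omega> x * r x)) \<in> borel_measurable borel"
  by (rule bsf_inner_bound(1)[OF Q_bsf[OF q] Q_bsf[OF r]])
qed simp_all

lemma bilinear_A: "bilinear_form (V_space \<Omega> T) (V_space \<Omega> T) (\<lambda>v w. L2_inner \<Omega> (grad v) (grad w))"
 by (rule bilinear_form_pullback[OF bilinear_form_bsf[OF bounded_dom] fun_subspace_V fun_subspace_V, where p = "bgrad E" and q = "bgrad E"])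
  (simp_all add: bgrad_bsf[OF V_space_pw_smooth] bgrad_add[OF V_space_pw_smooth V_space_pw_smooth] bgrad_scale[OF V_space_pw_smooth] L2_grad)

lemma bilinear_B: "bilinear_form (V_space \<Omega> T) (Q_space \<Omega> T) (\<lambda>v q. L2_inner \<Omega> (divergence v) q)"
 by (rule bilinear_form_pullback[OF bilinear_form_bsf[OF bounded_dom] fun_subspace_V fun_subspace_Q,
    where p = "\<lambda>v x. trace (bgrad E v x)" and q = "\<lambda>q x. indicator \<Omega> x * q x"])
  (simp_all add: trace_bgrad_bsf[OF V_space_pw_smooth] Q_bsf bgrad_add[OF V_space_pw_smooth V_space_pw_smooth]
   bgrad_scale[OF V_space_pw_smooth] L2_div Determinants.trace_add trace_scale distrib_left fun_eq_iff)

lemma bilinear_Mp: "bilinear_form (Q_space \<Omega> T) (Q_space \<Omega> T) (\<lambda>q r. L2_inner \<Omega> q r)"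
 by (rule bilinear_form_pullback[OF bilinear_form_bsf[OF bounded_dom] fun_subspace_Q fun_subspace_Q,
    where p = "\<lambda>q x. indicator \<Omega> x * q x" and q = "\<lambda>q x. indicator \<Omega> x * q x"])
  (simp_all add: Q_bsf L2_Q distrib_left fun_eq_iff)

lemma energy_denergy:
 assumes v: "v \<in> V_space \<Omega> T"
 shows "denergy E v = ennreal (L2_inner \<Omega> (grad v) (grad v))" "0 <= L2_inner \<Omega> (grad v) (grad v)"
proof -
 note b = bgrad_bsf[OF V_space_pw_smooth[OF v]]
 show "denergy E v = ennreal (L2_inner \<Omega> (grad v) (grad v))"
  unfolding denergy_def L2_grad[OF v v] power2_norm_eq_inner
  by (rule nn_integral_eq_integral[OF bsf_inner_integrable[OF bounded_dom b b]]) simp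
 show "0 <= L2_inner \<Omega> (grad v) (grad v)" unfolding L2_grad[OF v v] by simp
qed

lemma energy_pos:
 assumes v: "v \<in> V_space \<Omega> T" and ne: "v ~= (\<lambda>_. 0)"
 shows "0 < L2_inner \<Omega> (grad v) (grad v)"
proof (rule ccontr)
 assume "\<not> ?thesis"
 then have "L2_inner \<Omega> (grad v) (grad v) = 0" using energy_denergy(2)[OF v] by linarith
 then have "denergy E v = 0" using energy_denergy(1)[OF v] by simp
 then have "v = (\<lambda>_. 0)" using denergy_eq_0[OF V_space_pw_smooth[OF v] bounded_dom] by (intro ext)
 then show False using ne by simp
qed

text \<open>The inf-sup conditions divide by the full norm, while the equations are controlled in
  the energy; this direction allows the former to be replaced by the latter.\<close>

lemma H1_norm_ge: "sqrt (L2_inner \<Omega> (grad v) (grad v)) <= H1_norm \<Omega> v" if v: "v \<in> V_space \<Omega> T"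
 using energy_denergy(2)[OF v] unfolding H1_norm_def L2_norm_def by (intro real_sqrt_le_mono) simp

lemma L2_grad_CS:
 assumes v: "v \<in> V_space \<Omega> T" and w: "w \<in> V_space \<Omega> T"
 shows "\<bar>L2_inner \<Omega> (grad v) (grad w)\<bar> <= sqrt (L2_inner \<Omega> (grad v) (grad v)) * sqrt (L2_inner \<Omega> (grad w) (grad w))"
proof -
 let ?a = "\<lambda>v w. L2_inner \<Omega> (grad v) (grad w)"
 have lin: "?a (\<lambda>x. f x + g x) h = ?a f h + ?a g h" "?a (\<lambda>x. r *\<^sub>R f x) h = r * ?a f h"
  "?a h (\<lambda>x. f x + g x) = ?a h f + ?a h g" "?a h (\<lambda>x. r *\<^sub>R f x) = r * ?a h f"
  if "f \<in> V_space \<Omega> T" "g \<in> V_space \<Omega> T" "h \<in> V_space \<Omega> T" for f g h r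
  using bilinear_A that unfolding bilinear_form_def linear_form_def by simp_all
 have sym: "?a w v = ?a v w" unfolding L2_inner_def by (simp add: inner_commute)
 show ?thesis
 proof (cases "w = (\<lambda>_. 0)")
  case True
  have "?a v (\<lambda>x. 0 *\<^sub>R w x) = 0 * ?a v w" by (rule lin(4)[OF w w v])
  then show ?thesis using True energy_denergy(2)[OF v] energy_denergy(2)[OF w] by simp
 next
  case False
  have p: "0 < ?a w w" by (rule energy_pos[OF w False])
  \<comment> \<open>The minimizer of the quadratic polynomial in \<open>r\<close>; its minimum times
    \<open>?a w w\<close> is the Gram determinant.\<close>
  define r where "r = - ?a v w / ?a w w"
  have rw: "(\<lambda>x. r *\<^sub>R w x) \<in> V_space \<Omega> T" by (rule V_space_scale[OF w])
  have s: "(\<lambda>x. v x + r *\<^sub>R w x) \<in> V_space \<Omega> T" by (rule V_space_add[OF v rw])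
  have "0 <= ?a (\<lambda>x. v x + r *\<^sub>R w x) (\<lambda>x. v x + r *\<^sub>R w x)" by (rule energy_denergy(2)[OF s])
  also have "\<dots> = ?a v v + 2 * r * ?a v w + r * r * ?a w w"
   using lin(1)[OF v rw s] lin(3)[OF v rw v] lin(3)[OF v rw rw] lin(2)[OF w w v] lin(2)[OF w w w] lin(2)[OF w w rw] lin(4)[OF w w v] lin(4)[OF w w w] sym
   by (simp add: algebra_simps)
  finally have "0 <= (?a v v + 2 * r * ?a v w + r * r * ?a w w) * ?a w w" using p by simp
  also have "\<dots> = ?a v v * ?a w w - (?a v w)\<^sup>2" using p by (simp add: r_def field_simps power2_eq_square)
  finally have "(?a v w)\<^sup>2 <= ?a v v * ?a w w" by simp
  then have "sqrt ((?a v w)\<^sup>2) <= sqrt (?a v v * ?a w w)" by (rule real_sqrt_le_mono)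
  then show ?thesis by (simp add: real_sqrt_mult)
 qed
qed

text \<open>The constant pressure is entered as the indicator of the closure, the representative
  that belongs to \<open>Q_space\<close>.\<close>

lemma L2_div_one:
 assumes v: "v \<in> V_space \<Omega> T"
 shows "L2_inner \<Omega> (divergence v) (indicator (closure \<Omega>)) = 0"
proof -
 have "L2_inner \<Omega> (divergence v) (indicator (closure \<Omega>)) = (\<integral>x. trace (bgrad E v x) \<partial>lborel)"
  unfolding L2_inner_def
 proof (rule set_integral_off_skel[OF finite_mesh_sides])
  note b = trace_bgrad_bsf[OF V_space_pw_smooth[OF v]]
  show "(\<lambda>x. trace (bgrad E v x)) \<in> borel_measurable borel" "!!x. x \<notin> \<Omega> ==> trace (bgrad E v x) = 0"
   using b by (simp_all add: bsf_def)
  show "divergence v x \<bullet> indicator (closure \<Omega>) x = trace (bgrad E v x)" if "x \<in> \<Omega>" "x \<notin> skel E" for x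
   using that closure_subset[of \<Omega>] by (auto simp: divergence_def bgrad_def indicator_def)
 qed
 also have "\<dots> = 0"
  using integral_bgrad_diag[OF V_space_pw_smooth[OF v] bounded_dom] unfolding trace_2 by simp
 finally show ?thesis .
qed

lemma one_Q_space: "indicator (closure \<Omega>) \<in> Q_space \<Omega> T"
 unfolding Q_space_def fe_space_def
proof (intro CollectI conjI ballI allI impI)
 show "continuous_on (closure \<Omega>) (indicator (closure \<Omega>) :: real^2 => real)"
  by (rule continuous_on_eq[OF continuous_on_const[of _ 1]]) simp
 fix K assume K: "K \<in> T"
 have "(\<lambda>_. 1) \<in> Q_poly 1"
  unfolding Q_poly_def by (auto intro!: exI[of _ "\<lambda>i j. if i = 0 \<and> j = 0 then 1 else 0"] simp: fun_eq_iff)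
 moreover have "bilinear_map K xi \<in> closure \<Omega>" if "xi \<in> cbox 0 1" for xi
  using subsetD[OF elem_subset[OF K]] that unfolding quad_elem_def by blast
 ultimately show "\<exists>p\<in>Q_poly 1. \<forall>xi\<in>cbox 0 1. indicator (closure \<Omega>) (bilinear_map K xi) = p xi"
  by (intro bexI[of _ "\<lambda>_. 1"]) auto
qed simp

lemma Q_mean: "q \<in> Q_space \<Omega> T ==> (LINT x:\<Omega>|lebesgue. q x) = L2_inner \<Omega> (indicator (closure \<Omega>)) q"
 unfolding L2_inner_def set_lebesgue_integral_def
 by (intro Bochner_Integration.integral_cong refl) (use closure_subset[of \<Omega>] in \<open>auto simp: indicator_def\<close>)

lemma L2_Q_nonneg: "0 <= L2_inner \<Omega> q q" if "q \<in> Q_space \<Omega> T"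
 unfolding L2_Q[OF that that] by (rule integral_nonneg_AE) simp

lemma L2_Q_eq_0:
 assumes q: "q \<in> Q_space \<Omega> T" and z: "L2_inner \<Omega> q q = 0"
 shows "q x = 0"
proof -
 let ?f = "\<lambda>x. indicator \<Omega> x * q x"
 have "AE x in lborel. ?f x \<bullet> ?f x = 0"
  using z unfolding L2_Q[OF q q]
  by (subst (asm) integral_nonneg_eq_0_iff_AE[OF bsf_inner_integrable[OF bounded_dom Q_bsf[OF q] Q_bsf[OF q]]]) auto
 then have ae: "AE x in lborel. x \<in> \<Omega> --> q x = 0" by (rule eventually_mono) (auto simp: indicator_def)
 have c: "continuous_on (closure \<Omega>) q" and out: "!!x. x \<notin> closure \<Omega> ==> q x = 0"
  using q by (simp_all add: Q_space_def fe_space_def)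
 have c\<Omega>: "continuous_on \<Omega> q" by (rule continuous_on_subset[OF c closure_subset])
 have in0: "q x = 0" if x: "x \<in> \<Omega>" for x
 proof (rule ccontr)
  assume "q x ~= 0"
  define N where "N = \<Omega> \<inter> q -` (- {0})"
  have "open N" unfolding N_def by (rule continuous_open_preimage[OF c\<Omega> open_dom open_Compl[OF closed_singleton]])
  moreover have "x \<in> N" using x \<open>q x ~= 0\<close> by (simp add: N_def)
  ultimately have "emeasure lborel N ~= 0" using open_not_negligible[of N] null_sets_completion_iff[of N lborel]
   by (auto simp: negligible_iff_null_sets null_sets_def)
  moreover have "AE x in lborel. x \<notin> N" using ae by (rule eventually_mono) (auto simp: N_def)
  then have "N \<in> null_sets lborel" using AE_iff_null_sets[of N lborel] \<open>open N\<close> by simp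
  ultimately show False by (simp add: null_sets_def)
 qed
 show ?thesis
 proof (cases "x \<in> closure \<Omega>")
  case True
  show ?thesis by (rule continuous_constant_on_closure[OF c in0 True])
 qed (rule out)
qed

end

section \<open>Energy estimates\<close>

lemma comb_list_sum:
 assumes "distinct fs"
 shows "(\<Sum>i<length fs. F (fs ! i)) = (\<Sum>f\<in>set fs. F f)"
 by (rule sum.reindex_bij_betw[OF bij_betw_nth[OF assms refl refl]])

context fe_mesh
begin

lemma V_comb:
 assumes \<phi>s: "enumerates \<phi>s (V_basis \<Omega> T)"
 shows "set \<phi>s \<subseteq> V_space \<Omega> T"
  and "v \<in> V_space \<Omega> T ==> \<exists>w\<in>carrier_vec (length \<phi>s). comb \<phi>s w = v"
  and "x \<in> carrier_vec (length \<phi>s) ==> comb \<phi>s x = (\<lambda>_. 0) ==> x = 0\<^sub>v (length \<phi>s)"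
proof -
 have d: "distinct \<phi>s" and s: "set \<phi>s = V_basis \<Omega> T" using \<phi>s by (simp_all add: enumerates_def)
 show "set \<phi>s \<subseteq> V_space \<Omega> T" unfolding s by (auto simp: V_basis_def)
 obtain N c where delta: "!!\<phi> \<psi>. \<phi> \<in> V_basis \<Omega> T ==> \<psi> \<in> V_basis \<Omega> T ==> \<phi> (N \<psi>) $ c \<psi> = (if \<phi> = \<psi> then 1 else 0)"
  and span: "!!v x. finite (V_basis \<Omega> T) ==> v \<in> V_space \<Omega> T ==> v x = (\<Sum>\<phi>\<in>V_basis \<Omega> T. (v (N \<phi>) $ c \<phi>) *\<^sub>R \<phi> x)"
  by (rule V_basis_coords) (rule that)
 have fin: "finite (V_basis \<Omega> T)" unfolding s[symmetric] by simp
 show "\<exists>w\<in>carrier_vec (length \<phi>s). comb \<phi>s w = v" if v: "v \<in> V_space \<Omega> T"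
 proof (intro bexI ext)
  let ?w = "Matrix.vec (length \<phi>s) (\<lambda>i. v (N (\<phi>s ! i)) $ c (\<phi>s ! i))"
  show "?w \<in> carrier_vec (length \<phi>s)" by simp
  fix x
  have "comb \<phi>s ?w x = (\<Sum>i<length \<phi>s. (v (N (\<phi>s ! i)) $ c (\<phi>s ! i)) *\<^sub>R (\<phi>s ! i) x)"
   unfolding comb_def by (intro sum.cong refl) simp
  also have "\<dots> = (\<Sum>\<phi>\<in>set \<phi>s. (v (N \<phi>) $ c \<phi>) *\<^sub>R \<phi> x)" by (rule comb_list_sum[OF d])
  also have "\<dots> = v x" unfolding s span[OF fin v, of x, symmetric] ..
  finally show "comb \<phi>s ?w x = v x" .
 qed
 show "x = 0\<^sub>v (length \<phi>s)" if x: "x \<in> carrier_vec (length \<phi>s)" and z: "comb \<phi>s x = (\<lambda>_. 0)"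
 proof (rule eq_vecI)
  fix i assume i: "i < dim_vec (0\<^sub>v (length \<phi>s) :: real Matrix.vec)"
  let ?\<psi> = "\<phi>s ! i"
  have i': "i < length \<phi>s" using i by simp
  have B: "\<phi>s ! j \<in> V_basis \<Omega> T" if "j < length \<phi>s" for j using nth_mem[OF that] s by simp
  have "0 = comb \<phi>s x (N ?\<psi>) $ c ?\<psi>" unfolding z by simp
  also have "\<dots> = (\<Sum>j<length \<phi>s. vec_index x j * ((\<phi>s ! j) (N ?\<psi>) $ c ?\<psi>))" by (simp add: comb_def)
  also have "\<dots> = (\<Sum>j<length \<phi>s. if j = i then vec_index x j else 0)"
  proof (rule sum.cong[OF refl])
   fix j assume "j \<in> {..<length \<phi>s}"
   then show "vec_index x j * ((\<phi>s ! j) (N ?\<psi>) $ c ?\<psi>) = (if j = i then vec_index x j else 0)"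
    using delta[OF B B, of j i] i' nth_eq_iff_index_eq[OF d, of j i] by simp
  qed
  also have "\<dots> = vec_index x i" using i' by simp
  finally show "vec_index x i = vec_index (0\<^sub>v (length \<phi>s)) i" using i' by simp
 qed (use x in simp)
qed

lemma Q_comb:
 assumes ps: "enumerates ps (Q_basis \<Omega> T)"
 shows "set ps \<subseteq> Q_space \<Omega> T"
  and "q \<in> Q_space \<Omega> T ==> \<exists>w\<in>carrier_vec (length ps). comb ps w = q"
  and "x \<in> carrier_vec (length ps) ==> comb ps x = (\<lambda>_. 0) ==> x = 0\<^sub>v (length ps)"
proof -
 have d: "distinct ps" and s: "set ps = Q_basis \<Omega> T" using ps by (simp_all add: enumerates_def)
 show "set ps \<subseteq> Q_space \<Omega> T" unfolding s by (auto simp: Q_basis_def)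
 obtain N where delta: "!!\<phi> \<psi>. \<phi> \<in> Q_basis \<Omega> T ==> \<psi> \<in> Q_basis \<Omega> T ==> \<phi> (N \<psi>) = (if \<phi> = \<psi> then 1 else 0)"
  and span: "!!q x. finite (Q_basis \<Omega> T) ==> q \<in> Q_space \<Omega> T ==> q x = (\<Sum>\<phi>\<in>Q_basis \<Omega> T. q (N \<phi>) * \<phi> x)"
  by (rule Q_basis_coords) (rule that)
 have fin: "finite (Q_basis \<Omega> T)" unfolding s[symmetric] by simp
 show "\<exists>w\<in>carrier_vec (length ps). comb ps w = q" if q: "q \<in> Q_space \<Omega> T"
 proof (intro bexI ext)
  let ?w = "Matrix.vec (length ps) (\<lambda>i. q (N (ps ! i)))"
  show "?w \<in> carrier_vec (length ps)" by simp
  fix x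
  have "comb ps ?w x = (\<Sum>i<length ps. q (N (ps ! i)) * (ps ! i) x)"
   unfolding comb_def by (intro sum.cong refl) simp
  also have "\<dots> = (\<Sum>\<phi>\<in>set ps. q (N \<phi>) * \<phi> x)" by (rule comb_list_sum[OF d])
  also have "\<dots> = q x" unfolding s span[OF fin q, of x, symmetric] ..
  finally show "comb ps ?w x = q x" .
 qed
 show "x = 0\<^sub>v (length ps)" if x: "x \<in> carrier_vec (length ps)" and z: "comb ps x = (\<lambda>_. 0)"
 proof (rule eq_vecI)
  fix i assume i: "i < dim_vec (0\<^sub>v (length ps) :: real Matrix.vec)"
  have i': "i < length ps" using i by simp
  have B: "ps ! j \<in> Q_basis \<Omega> T" if "j < length ps" for j using nth_mem[OF that] s by simp
  have "0 = comb ps x (N (ps ! i))" unfolding z by simp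
  also have "\<dots> = (\<Sum>j<length ps. if j = i then vec_index x j else 0)"
   unfolding comb_def
  proof (rule sum.cong[OF refl])
   fix j assume "j \<in> {..<length ps}"
   then show "vec_index x j *\<^sub>R (ps ! j) (N (ps ! i)) = (if j = i then vec_index x j else 0)"
    using delta[OF B B, of j i] i' nth_eq_iff_index_eq[OF d, of j i] by simp
  qed
  also have "\<dots> = vec_index x i" using i' by simp
  finally show "vec_index x i = vec_index (0\<^sub>v (length ps)) i" using i' by simp
 qed (use x in simp)
qed

lemma V_bsf: "v \<in> V_space \<Omega> T ==> v \<in> bsf UNIV"
proof -
 assume v: "v \<in> V_space \<Omega> T"
 note p = V_space_pw_smooth[OF v]
 have c: "continuous_on UNIV v" and z: "!!x. x \<notin> \<Omega> ==> v x = 0" using p by (simp_all add: pw_smooth_def)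
 have "compact (closure \<Omega>)" using bounded_dom by (simp add: compact_closure)
 then have "bounded (v ` closure \<Omega>)"
  by (intro compact_imp_bounded compact_continuous_image continuous_on_subset[OF c]) auto
 then obtain M where M: "0 < M" "!!x. x \<in> closure \<Omega> ==> norm (v x) <= M" unfolding bounded_pos by auto
 have "norm (v x) <= M" for x
  using M z[of x] subsetD[OF closure_subset, of x \<Omega>] by (cases "x \<in> \<Omega>") auto
 then show "v \<in> bsf UNIV" using pw_smooth_measurable[OF p] by (auto simp: bsf_def)
qed

end

section \<open>Multiplier coefficients and the mass matrix of the interface\<close>

context seg_mesh
begin

lemma bilinear_pairing: "bilinear_form (bsf UNIV) (bsf UNIV) (pairing T)"
proof -
 have i: "integrable (arc_measure T) (\<lambda>x. f x \<bullet> g x)" if fg: "f \<in> bsf UNIV" "g \<in> bsf UNIV" for f g :: "real^2 => real^2"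
 proof -
  obtain K where "\<forall>x. \<bar>f x \<bullet> g x\<bar> <= K" using bsf_inner_bound(2)[OF fg] by (elim exE)
  then show ?thesis by (intro arc_bounded_integrable[OF bsf_inner_bound(1)[OF fg], of K]) simp
 qed
 show ?thesis
  unfolding bilinear_form_def linear_form_def pairing_def
  by (auto simp: fun_subspace_bsf inner_add_left inner_add_right i intro!: Bochner_Integration.integral_add)
qed

lemma Lambda_bsf:
 assumes "segval T U V \<nu>"
 shows "\<nu> \<in> bsf UNIV"
proof -
 have "norm (\<nu> x) <= sqrt (\<Sum>e\<in>T. endsq U V e)" for x
  using segval_bounded[OF assms, of x] by (rule real_le_rsqrt)
 then show ?thesis using segval_measurable[OF assms] by (auto simp: bsf_def)
qed

text \<open>A shape function is indexed by the ordered pair whose first entry is its node, whatever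
  orientation \<open>T\<close> stores; accordingly the value 1 appears in the first or in the second
  family.\<close>

lemma segval_shape:
 assumes ab: "(a, b) \<in> T \<or> (b, a) \<in> T"
 shows "segval T (\<lambda>e. if e = (a, b) then axis c 1 else 0) (\<lambda>e. if e = (b, a) then axis c 1 else 0) (segment_shape a b c)"
proof -
 have nab: "a ~= b" using ab ne by auto
 have sc: "r *\<^sub>R axis c 1 = (axis c r :: real^2)" for r by (simp add: cart_eq_iff axis_def)
 have 1: "segment_shape a b c (linepath p q t) =
   (1 - t) *\<^sub>R (if (p, q) = (a, b) then axis c 1 else 0) + t *\<^sub>R (if (p, q) = (b, a) then axis c 1 else 0)"
  if pq: "(p, q) \<in> T" and t: "t \<in> {0<..<1}" for p q t
 proof -
  have x: "linepath p q t \<in> open_segment p q" by (rule linepath_open_segment[OF ne[OF pq] t])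
  have t': "t \<in> {0..1}" using t by simp
  consider "(p, q) = (a, b)" | "(p, q) = (b, a)" | "(p, q) ~= (a, b)" "(p, q) ~= (b, a)" by auto
  then show ?thesis
  proof cases
   case 1
   then show ?thesis using x nab dist_linepath_ends(2)[OF t', of a b] by (simp add: segment_shape_def sc)
  next
   case 2
   then have "linepath p q t \<in> open_segment a b" using x by (simp add: open_segment_commute)
   then show ?thesis using 2 nab dist_linepath_ends(1)[OF t', of b a] by (simp add: segment_shape_def sc dist_commute)
  next
   case 3
   have n: "linepath p q t \<notin> open_segment a b"
   proof
    assume o: "linepath p q t \<in> open_segment a b"
    from ab show False
    proof
     assume "(a, b) \<in> T"
     from open_disjoint[OF pq this x o] show False using 3 by simp
    next
     assume "(b, a) \<in> T"
     from open_disjoint[OF pq this x] o show False using 3 by (simp add: open_segment_commute)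
    qed
   qed
   show ?thesis by (simp only: segment_shape_def n 3 if_False scaleR_zero_right add_0_right)
  qed
 qed
 have 2: "segment_shape a b c x = 0" if "x \<notin> (\<Union>(a, b)\<in>T. open_segment a b)" for x
 proof -
  have "x \<notin> open_segment a b" using that ab by (auto simp: open_segment_commute[of b a])
  then show ?thesis by (simp add: segment_shape_def)
 qed
 show ?thesis
  unfolding segval_def
 proof (intro conjI allI impI)
  show "\<forall>(p, q)\<in>T. \<forall>t\<in>{0<..<1}. segment_shape a b c (linepath p q t) =
   (1 - t) *\<^sub>R (if (p, q) = (a, b) then axis c 1 else 0) + t *\<^sub>R (if (p, q) = (b, a) then axis c 1 else 0)"
   by clarify (rule 1; assumption)
 qed (rule 2)
qed

lemma pairing_local_bound:
 assumes e: "(a, b) \<in> T" and sv: "segval T U V \<nu>" and \<psi>: "\<psi> \<in> bsf UNIV" "!!x. norm (\<psi> x) <= 1"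
  "!!x. x \<notin> open_segment a b ==> \<psi> x = 0"
 shows "\<bar>pairing T \<psi> \<nu>\<bar> <= dist a b * sqrt (endsq U V (a, b))"
proof -
 interpret \<mu>: finite_measure "arc_measure T" by (rule finite_measure_arc[OF fin])
 let ?O = "open_segment a b" and ?s = "sqrt (endsq U V (a, b))"
 have bd: "\<bar>\<psi> x \<bullet> \<nu> x\<bar> <= indicator ?O x * ?s" for x
 proof (cases "x \<in> ?O")
  case True
  obtain t where t: "t \<in> {0<..<1}" "x = linepath a b t" by (rule open_segment_param[OF True])
  have "(norm (\<nu> x))\<^sup>2 <= endsq U V (a, b)" using segval_norm_le[OF sv e t(1)] by (simp add: t(2) endsq_def)
  then have "norm (\<nu> x) <= ?s" by (rule real_le_rsqrt)
  then have "norm (\<psi> x) * norm (\<nu> x) <= 1 * ?s" using \<psi>(2) by (intro mult_mono) auto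
  then show ?thesis using Cauchy_Schwarz_ineq2[of "\<psi> x" "\<nu> x"] True by simp
 qed (simp add: \<psi>(3))
 have m: "(\<lambda>x. \<psi> x \<bullet> \<nu> x) \<in> borel_measurable borel" by (rule bsf_inner_bound(1)[OF \<psi>(1) Lambda_bsf[OF sv]])
 have b2: "\<bar>indicator ?O x * ?s\<bar> <= ?s" for x by (simp add: indicator_def)
 have i1: "integrable (arc_measure T) (\<lambda>x. \<psi> x \<bullet> \<nu> x)"
  by (rule arc_bounded_integrable[OF m, of ?s]) (use order_trans[OF bd] b2 in \<open>force simp: indicator_def\<close>)
 have i2: "integrable (arc_measure T) (\<lambda>x. indicator ?O x * ?s)"
  by (rule arc_bounded_integrable[of _ ?s]) (measurable, rule b2)
 have "\<bar>pairing T \<psi> \<nu>\<bar> <= (\<integral>x. \<bar>\<psi> x \<bullet> \<nu> x\<bar> \<partial>arc_measure T)"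
  unfolding pairing_def by (rule integral_abs_bound)
 moreover have "(\<integral>x. \<bar>\<psi> x \<bullet> \<nu> x\<bar> \<partial>arc_measure T) <= (\<integral>x. indicator ?O x * ?s \<partial>arc_measure T)"
  using i1 by (intro integral_mono i2 bd integrable_abs)
 moreover have "(\<integral>x. indicator ?O x * ?s \<partial>arc_measure T) = measure (arc_measure T) ?O * ?s" by simp
 moreover have "measure (arc_measure T) ?O <= dist a b"
  using emeasure_open_segment_le[OF e] by (simp add: \<mu>.emeasure_eq_measure)
 then have "measure (arc_measure T) ?O * ?s <= dist a b * ?s" by (rule mult_right_mono) simp
 ultimately show ?thesis by linarith
qed

lemma segment_shape_props:
 shows "norm (segment_shape a b c x) <= 1" "x \<notin> open_segment a b ==> segment_shape a b c x = 0"
proof -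
 show "x \<notin> open_segment a b ==> segment_shape a b c x = 0" by (simp add: segment_shape_def)
 show "norm (segment_shape a b c x) <= 1"
 proof (cases "x \<in> open_segment a b")
  case True
  then obtain t where t: "t \<in> {0<..<1}" "x = linepath a b t" by (rule open_segment_param)
  have nab: "a ~= b" using True by auto
  have "dist x b / dist a b = 1 - t" using dist_linepath_ends(2)[of t a b] t nab by simp
  moreover have "axis c (1 - t) = (1 - t) *\<^sub>R (axis c 1 :: real^2)"
   by (simp add: cart_eq_iff axis_def)
  ultimately show ?thesis using t True by (simp add: segment_shape_def norm_axis_1)
 qed (simp add: segment_shape_def)
qed

text \<open>The sum of squared pairings is the squared length of the mass matrix applied to
  \<open>z\<close>. Each shape function is bounded by 1 and lives on one segment, so its pairing is
  at most \<open>h\<close> times the root of \<open>endsq\<close>; a segment carries four of them,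
  two end points times two components. The final implication holds because the coefficients are the
  end point values.\<close>

lemma Lambda_comb:
 assumes \<psi>s: "enumerates \<psi>s (Lambda_basis T)" and hb: "\<forall>e\<in>T. dist (fst e) (snd e) <= h"
 shows "set \<psi>s \<subseteq> bsf UNIV"
  and "\<exists>U V. segval T U V (comb \<psi>s z) \<and>
   (\<Sum>i<length \<psi>s. (pairing T (\<psi>s ! i) (comb \<psi>s z))\<^sup>2) <= 4 * (h\<^sup>2 * (\<Sum>e\<in>T. endsq U V e)) \<and>
   ((\<Sum>e\<in>T. endsq U V e) = 0 --> (\<forall>i<length \<psi>s. vec_index z i = 0))"
proof -
 let ?l = "length \<psi>s"
 have h: "dist a b <= h" if "(a, b) \<in> T" for a b using bspec[OF hb that] by simp
 have d: "distinct \<psi>s" and s: "set \<psi>s = Lambda_basis T" using \<psi>s by (simp_all add: enumerates_def)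
 have "\<forall>i. \<exists>k. i < ?l --> \<psi>s ! i = segment_shape (fst (fst k)) (snd (fst k)) (snd k) \<and> (fst k \<in> T \<or> prod.swap (fst k) \<in> T)"
 proof
  fix i
  show "\<exists>k. i < ?l --> \<psi>s ! i = segment_shape (fst (fst k)) (snd (fst k)) (snd k) \<and> (fst k \<in> T \<or> prod.swap (fst k) \<in> T)"
  proof (cases "i < ?l")
   case True
   then have "\<psi>s ! i \<in> Lambda_basis T" unfolding s[symmetric] by (rule nth_mem)
   then obtain a b c where "\<psi>s ! i = segment_shape a b c" "(a, b) \<in> T \<or> (b, a) \<in> T"
    unfolding Lambda_basis_def by (elim CollectE exE conjE) (rule that)
   then show ?thesis by (intro exI[of _ "((a, b), c)"]) simp
  qed simp
 qed
 from choice[OF this] obtain kap where kap: "\<forall>i. i < ?l --> \<psi>s ! i = segment_shape (fst (fst (kap i))) (snd (fst (kap i))) (snd (kap i)) \<and>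
  (fst (kap i) \<in> T \<or> prod.swap (fst (kap i)) \<in> T)" by (elim exE)
 have shape: "\<psi>s ! i = segment_shape (fst (fst (kap i))) (snd (fst (kap i))) (snd (kap i))"
  and mem: "fst (kap i) \<in> T \<or> prod.swap (fst (kap i)) \<in> T" if "i < ?l" for i
  using spec[OF kap, of i] that by simp_all
 have inj: "i = j" if "i < ?l" "j < ?l" "kap i = kap j" for i j
  using shape[OF that(1)] shape[OF that(2)] that nth_eq_iff_index_eq[OF d that(1,2)] by simp
 define u where "u i e = (if e = fst (kap i) then axis (snd (kap i)) (1::real) else (0 :: real^2))" for i and e :: edge
 define v where "v i e = (if e = prod.swap (fst (kap i)) then axis (snd (kap i)) (1::real) else (0 :: real^2))" for i and e :: edge
 have sv: "segval T (u i) (v i) (\<psi>s ! i)" if "i < ?l" for i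
  using segval_shape[of "fst (fst (kap i))" "snd (fst (kap i))" "snd (kap i)"] mem[OF that]
  unfolding shape[OF that] u_def[abs_def] v_def[abs_def] by (simp add: prod.swap_def)
 show sub: "set \<psi>s \<subseteq> bsf UNIV"
 proof
  fix \<psi> assume "\<psi> \<in> set \<psi>s"
  then obtain i where "i < ?l" "\<psi>s ! i = \<psi>" unfolding in_set_conv_nth by (elim exE conjE)
  then show "\<psi> \<in> bsf UNIV" using Lambda_bsf[OF sv] by auto
 qed
 define U where "U e = (\<Sum>i<?l. vec_index z i *\<^sub>R u i e)" for e
 define V where "V e = (\<Sum>i<?l. vec_index z i *\<^sub>R v i e)" for e
 have S: "segval T U V (comb \<psi>s z)"
  unfolding segval_def
 proof (intro conjI ballI allI impI, clarify)
  fix a b and t :: real assume e: "(a, b) \<in> T" and t: "t \<in> {0<..<1}"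
  have "(\<psi>s ! i) (linepath a b t) = (1 - t) *\<^sub>R u i (a, b) + t *\<^sub>R v i (a, b)" if "i < ?l" for i
   using sv[OF that] e t unfolding segval_def by fast
  then have "comb \<psi>s z (linepath a b t) = (\<Sum>i<?l. (1 - t) *\<^sub>R (vec_index z i *\<^sub>R u i (a, b)) + t *\<^sub>R (vec_index z i *\<^sub>R v i (a, b)))"
   unfolding comb_def by (intro sum.cong refl) (simp add: scaleR_add_right mult.commute)
  then show "comb \<psi>s z (linepath a b t) = (1 - t) *\<^sub>R U (a, b) + t *\<^sub>R V (a, b)"
   by (simp add: U_def V_def sum.distrib scaleR_sum_right)
 next
  fix x assume x: "x \<notin> (\<Union>(a, b)\<in>T. open_segment a b)"
  have "(\<psi>s ! i) x = 0" if "i < ?l" for i using sv[OF that] x unfolding segval_def by blast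
  then show "comb \<psi>s z x = 0" by (simp add: comb_def)
 qed
 \<comment> \<open>The segment carrying the shape function, in the orientation stored in
   \<open>T\<close>.\<close>
 define \<epsilon> where "\<epsilon> i = (if fst (kap i) \<in> T then fst (kap i) else prod.swap (fst (kap i)))" for i
 have \<epsilon>T: "\<epsilon> i \<in> T" if "i < ?l" for i using mem[OF that] by (auto simp: \<epsilon>_def)
 have local: "(pairing T (\<psi>s ! i) (comb \<psi>s z))\<^sup>2 <= h\<^sup>2 * endsq U V (\<epsilon> i)" if i: "i < ?l" for i
 proof -
  obtain a b where ab: "\<epsilon> i = (a, b)" by (cases "\<epsilon> i")
  have e: "(a, b) \<in> T" using \<epsilon>T[OF i] ab by simp
  have os: "open_segment a b = open_segment (fst (fst (kap i))) (snd (fst (kap i)))"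
   using ab unfolding \<epsilon>_def by (cases "fst (kap i)") (auto split: if_splits simp: open_segment_commute)
  have "\<bar>pairing T (\<psi>s ! i) (comb \<psi>s z)\<bar> <= dist a b * sqrt (endsq U V (a, b))"
  proof (rule pairing_local_bound[OF e S])
   show "\<psi>s ! i \<in> bsf UNIV" using sub nth_mem[OF i] by (rule subsetD)
   show "norm ((\<psi>s ! i) x) <= 1" for x unfolding shape[OF i] by (rule segment_shape_props(1))
   show "(\<psi>s ! i) x = 0" if "x \<notin> open_segment a b" for x
    using that unfolding shape[OF i] os by (rule segment_shape_props(2))
  qed
  also have "\<dots> <= h * sqrt (endsq U V (a, b))" by (intro mult_right_mono h e) simp
  finally have "\<bar>pairing T (\<psi>s ! i) (comb \<psi>s z)\<bar>\<^sup>2 <= (h * sqrt (endsq U V (a, b)))\<^sup>2" by (rule power_mono) simp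
  then show ?thesis by (simp add: ab power_mult_distrib)
 qed
 \<comment> \<open>Segment, end point and component determine the shape function; this injectivity
   is the count of four per segment.\<close>
 define ta where "ta i = (\<epsilon> i, fst (kap i) \<in> T, snd (kap i))" for i
 have injta: "inj_on ta {..<?l}"
 proof (rule inj_onI)
  fix i j assume ij: "i \<in> {..<?l}" "j \<in> {..<?l}" "ta i = ta j"
  then have "fst (kap i) = fst (kap j)" "snd (kap i) = snd (kap j)"
   unfolding ta_def \<epsilon>_def by (auto split: if_splits simp: prod_eq_iff)
  then have "kap i = kap j" by (simp add: prod_eq_iff)
  then show "i = j" using inj ij by simp
 qed
 have "(\<Sum>i<?l. endsq U V (\<epsilon> i)) = (\<Sum>t\<in>ta ` {..<?l}. endsq U V (fst t))"
  unfolding sum.reindex[OF injta] by (simp add: ta_def)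
 also have "\<dots> <= (\<Sum>t\<in>T \<times> (UNIV :: (bool \<times> 2) set). endsq U V (fst t))"
  using \<epsilon>T fin by (intro sum_mono2) (auto simp: ta_def)
 also have "\<dots> = (\<Sum>e\<in>T. \<Sum>k\<in>(UNIV :: (bool \<times> 2) set). endsq U V e)"
  unfolding sum.cartesian_product by (simp add: case_prod_beta)
 also have "\<dots> = 4 * (\<Sum>e\<in>T. endsq U V e)" by (simp add: sum_distrib_left)
 finally have cnt: "(\<Sum>i<?l. endsq U V (\<epsilon> i)) <= 4 * (\<Sum>e\<in>T. endsq U V e)" .
 have "(\<Sum>i<?l. (pairing T (\<psi>s ! i) (comb \<psi>s z))\<^sup>2) <= (\<Sum>i<?l. h\<^sup>2 * endsq U V (\<epsilon> i))"
  by (intro sum_mono local) simp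
 also have "\<dots> = h\<^sup>2 * (\<Sum>i<?l. endsq U V (\<epsilon> i))" by (simp add: sum_distrib_left)
 also have "\<dots> <= h\<^sup>2 * (4 * (\<Sum>e\<in>T. endsq U V e))" by (rule mult_left_mono[OF cnt]) simp
 finally have bound: "(\<Sum>i<?l. (pairing T (\<psi>s ! i) (comb \<psi>s z))\<^sup>2) <= 4 * (h\<^sup>2 * (\<Sum>e\<in>T. endsq U V e))" by (simp add: mult_ac)
 have coord: "vec_index z i = 0" if zero: "(\<Sum>e\<in>T. endsq U V e) = 0" and i: "i < ?l" for i
 proof -
  have "endsq U V e = 0" if "e \<in> T" for e
   using zero that sum_nonneg_eq_0_iff[OF fin, of "endsq U V"] by simp
  then have UV: "U e = 0" "V e = 0" if "e \<in> T" for e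
   using that by (auto simp: endsq_def add_nonneg_eq_0_iff)
  have ax: "axis c (1::real) $ c' = (if c = c' then 1 else 0)" for c c' :: 2 by (simp add: axis_def)
  have k: "fst (kap i) = fst (kap j) \<and> snd (kap j) = snd (kap i) \<longleftrightarrow> j = i" if "j < ?l" for j
   using inj[OF i that] by (auto simp: prod_eq_iff)
  show ?thesis
  proof (cases "fst (kap i) \<in> T")
   case True
   have "0 = U (fst (kap i)) $ snd (kap i)" using UV(1)[OF True] by simp
   also have "\<dots> = (\<Sum>j<?l. if j = i then vec_index z j else 0)"
    unfolding U_def sum_component u_def using k by (intro sum.cong refl) (auto simp: ax)
   also have "\<dots> = vec_index z i" using i by simp
   finally show ?thesis by simp
  next
   case False
   then have sT: "prod.swap (fst (kap i)) \<in> T" using mem[OF i] by simp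
   have "0 = V (prod.swap (fst (kap i))) $ snd (kap i)" using UV(2)[OF sT] by simp
   also have "\<dots> = (\<Sum>j<?l. if j = i then vec_index z j else 0)"
    unfolding V_def sum_component v_def using k by (intro sum.cong refl) (auto simp: ax prod_eq_iff)
   also have "\<dots> = vec_index z i" using i by simp
   finally show ?thesis by simp
  qed
 qed
 show "\<exists>U V. segval T U V (comb \<psi>s z) \<and>
   (\<Sum>i<length \<psi>s. (pairing T (\<psi>s ! i) (comb \<psi>s z))\<^sup>2) <= 4 * (h\<^sup>2 * (\<Sum>e\<in>T. endsq U V e)) \<and>
   ((\<Sum>e\<in>T. endsq U V e) = 0 --> (\<forall>i<length \<psi>s. vec_index z i = 0))"
  by (rule exI[of _ U], rule exI[of _ V], intro conjI impI allI S bound coord)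
qed

lemma dual_norm_nonneg:
 assumes "segval T U V \<nu>"
 shows "0 <= Hminushalf_norm T \<nu>"
 using pairing_le_dual_norm[OF mesh assms, of "\<lambda>_. 0" 1] by (simp add: Hhalf_sq_def pairing_def)

text \<open>Combined with the inverse inequality this makes the mass matrix injective: zero mean
  square gives zero dual norm, hence zero end point values.\<close>

lemma dual_norm_0:
 assumes sv: "segval T U V \<nu>" and z: "pairing T \<nu> \<nu> = 0"
 shows "Hminushalf_norm T \<nu> = 0"
proof -
 have b: "\<nu> \<in> bsf UNIV" by (rule Lambda_bsf[OF sv])
 obtain K where "\<forall>x. \<bar>\<nu> x \<bullet> \<nu> x\<bar> <= K" using bsf_inner_bound(2)[OF b b] by (elim exE)
 then have i: "integrable (arc_measure T) (\<lambda>x. \<nu> x \<bullet> \<nu> x)"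
  by (intro arc_bounded_integrable[OF bsf_inner_bound(1)[OF b b], of K]) simp
 have "AE x in arc_measure T. \<nu> x \<bullet> \<nu> x = 0"
  using z unfolding pairing_def by (subst (asm) integral_nonneg_eq_0_iff_AE[OF i]) auto
 then have ae: "AE x in arc_measure T. \<nu> x = 0" by simp
 have z0: "pairing T \<nu> w = 0" for w
  unfolding pairing_def by (rule integral_eq_zero_AE) (use ae in \<open>rule eventually_mono; simp\<close>)
 have "(\<lambda>_. 0) \<in> {w \<in> Hhalf T. Hhalf_norm T w <= 1}"
  by (simp add: Hhalf_def Hhalf_norm_def Hhalf_sq_def)
 then have "{w \<in> Hhalf T. Hhalf_norm T w <= 1} ~= {}" by (rule ex_in_conv[THEN iffD1, OF exI])
 from cSUP_const[OF this, of "0 :: real"] show ?thesis unfolding Hminushalf_norm_def z0 .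
qed

end

text \<open>One pair of meshes, with the trace constant \<open>K\<close> and the inverse constant
  \<open>C\<close> as parameters; the bound derived from them then visibly contains no other trace
  of the meshes.\<close>

locale coupled_meshes = fe_mesh \<Omega> T + S: seg_mesh \<Gamma> T\<^sub>\<Gamma> for \<Omega> T \<Gamma> T\<^sub>\<Gamma> +
 fixes \<beta>\<^sub>1 \<beta>\<^sub>2 K C :: real
 assumes \<beta>1: "0 < \<beta>\<^sub>1" and \<beta>2: "0 < \<beta>\<^sub>2" and K: "0 < K" and C: "0 < C"
  and is1: "inf_sup_div \<beta>\<^sub>1 \<Omega> T" and is2: "inf_sup_mult \<beta>\<^sub>2 \<Omega> T T\<^sub>\<Gamma>"
  and trace_ineq: "!!v. v \<in> V_space \<Omega> T ==> Hhalf_sq T\<^sub>\<Gamma> v <= ennreal (K * L2_inner \<Omega> (grad v) (grad v))"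
  and inverse: "!!U V \<nu>. segval T\<^sub>\<Gamma> U V \<nu> ==>
   (mesh_size T\<^sub>\<Gamma>)\<^sup>2 * (\<Sum>e\<in>T\<^sub>\<Gamma>. endsq U V e) <= C * (Hminushalf_norm T\<^sub>\<Gamma> \<nu>)\<^sup>2"
begin

text \<open>The first term comes from the pressure: 1 for the energy and
  \<open>sqrt K / \<beta>\<^sub>2\<close> for the multiplier in the momentum equation, divided by
  the inf-sup constant. The second comes from the multiplier, with 4 from \<open>Lambda_comb\<close>
  and \<open>C\<close> from the inverse inequality.\<close>

definition bnd :: "real => real => real" where
 "bnd \<gamma> \<delta> = ((1 + sqrt K / \<beta>\<^sub>2) / \<beta>\<^sub>1)\<^sup>2 / \<gamma> + 4 * C / (\<beta>\<^sub>2\<^sup>2 * \<delta>)"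

lemma H1_pos:
 assumes "v \<in> V_space \<Omega> T" "v ~= (\<lambda>_. 0)"
 shows "0 < H1_norm \<Omega> v"
 by (rule order_less_le_trans[OF _ H1_norm_ge[OF assms(1)]]) (simp add: energy_pos[OF assms])

text \<open>Discrete velocities in the kernel of the divergence control the multiplier, arbitrary discrete
 velocities then control the pressure; \<open>s\<close> is the quotient of these contributions by the energy.\<close>

lemma energy_bound:
 assumes u: "u \<in> V_space \<Omega> T" "u ~= (\<lambda>_. 0)" and p: "p \<in> Q_space \<Omega> T" and sv: "segval T\<^sub>\<Gamma> U V \<nu>"
  and \<gamma>: "0 < \<gamma>" and \<delta>: "0 < \<delta>" and s: "0 < s"
  and e1: "!!v. v \<in> V_space \<Omega> T ==> L2_inner \<Omega> (grad v) (grad u) = - L2_inner \<Omega> (divergence v) p + pairing T\<^sub>\<Gamma> \<nu> v"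
  and e2: "!!q. q \<in> Q_space \<Omega> T ==> L2_inner \<Omega> q p = - (s * \<gamma> * L2_inner \<Omega> (divergence u) q)"
  and e3: "X = s * \<delta> * pairing T\<^sub>\<Gamma> \<nu> u" and X: "X <= 4 * ((mesh_size T\<^sub>\<Gamma>)\<^sup>2 * (\<Sum>e\<in>T\<^sub>\<Gamma>. endsq U V e))"
 shows "s <= bnd \<gamma> \<delta>"
proof -
 let ?a = "\<lambda>v w. L2_inner \<Omega> (grad v) (grad w)" and ?d = "\<lambda>v q. L2_inner \<Omega> (divergence v) q"
 let ?H = "Hminushalf_norm T\<^sub>\<Gamma> \<nu>"
 define e where "e = ?a u u"
 have e: "0 < e" unfolding e_def by (rule energy_pos[OF u])
 have cs: "?a v u <= sqrt (?a v v) * sqrt e" "- ?a v u <= sqrt (?a v v) * sqrt e" if "v \<in> V_space \<Omega> T" for v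
  using L2_grad_CS[OF that u(1)] unfolding e_def by linarith+
 have H0: "0 <= ?H" by (rule S.dual_norm_nonneg[OF sv])
 have "ereal (\<beta>\<^sub>2 * ?H) <= (SUP v\<in>K0_space \<Omega> T - {\<lambda>_. 0}. ereal (pairing T\<^sub>\<Gamma> \<nu> v / H1_norm \<Omega> v))"
  by (rule bspec[OF is2[unfolded inf_sup_mult_def] segval_Lambda_space[OF sv]])
 also have "\<dots> <= ereal (sqrt e)"
 proof (rule SUP_least)
  fix v assume v: "v \<in> K0_space \<Omega> T - {\<lambda>_. 0}"
  then have vV: "v \<in> V_space \<Omega> T" "v ~= (\<lambda>_. 0)" and "?d v p = 0" using p by (auto simp: K0_space_def)
  then have "pairing T\<^sub>\<Gamma> \<nu> v = ?a v u" using e1[OF vV(1)] by simp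
  also have "\<dots> <= sqrt (?a v v) * sqrt e" by (rule cs(1)[OF vV(1)])
  also have "\<dots> <= H1_norm \<Omega> v * sqrt e" using e by (intro mult_right_mono H1_norm_ge vV) simp
  finally show "ereal (pairing T\<^sub>\<Gamma> \<nu> v / H1_norm \<Omega> v) <= ereal (sqrt e)"
   using H1_pos[OF vV] by (simp add: divide_le_eq mult.commute)
 qed
 finally have Hb: "\<beta>\<^sub>2 * ?H <= sqrt e" by simp
 then have H1: "?H <= sqrt e / \<beta>\<^sub>2" using \<beta>2 by (simp add: le_divide_eq mult.commute)
 define R where "R = (1 + sqrt K / \<beta>\<^sub>2) * sqrt e"
 have R0: "0 <= R" using K \<beta>2 e by (simp add: R_def)
 have mean: "(LINT x:\<Omega>|lebesgue. p x) = 0"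
  unfolding Q_mean[OF p] using e2[OF one_Q_space] L2_div_one[OF u(1)] by simp
 have "ereal (\<beta>\<^sub>1 * L2_norm \<Omega> p) <= (SUP v\<in>V_space \<Omega> T - {\<lambda>_. 0}. ereal (?d v p / H1_norm \<Omega> v))"
  by (rule bspec[OF is1[unfolded inf_sup_div_def] p, THEN mp, OF mean])
 also have "\<dots> <= ereal R"
 proof (rule SUP_least)
  fix v assume "v \<in> V_space \<Omega> T - {\<lambda>_. 0}"
  then have vV: "v \<in> V_space \<Omega> T" "v ~= (\<lambda>_. 0)" by auto
  define r where "r = sqrt (?a v v)"
  have av: "0 < ?a v v" by (rule energy_pos[OF vV])
  then have r: "0 < r" by (simp add: r_def)
  have Kr: "(sqrt K * r)\<^sup>2 = K * ?a v v" using K av by (simp add: r_def power_mult_distrib)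
  \<comment> \<open>The trace bound extends control of the multiplier from the divergence kernel to
    arbitrary discrete velocities.\<close>
  have "pairing T\<^sub>\<Gamma> \<nu> v <= (sqrt K * r) * ?H"
  proof (rule pairing_le_dual_norm[OF S.mesh sv])
   show "v \<in> borel_measurable borel" by (rule pw_smooth_measurable[OF V_space_pw_smooth[OF vV(1)]])
   show "0 < sqrt K * r" using K r by simp
   show "Hhalf_sq T\<^sub>\<Gamma> v <= ennreal ((sqrt K * r)\<^sup>2)" unfolding Kr by (rule trace_ineq[OF vV(1)])
  qed
  also have "\<dots> <= (sqrt K * r) * (sqrt e / \<beta>\<^sub>2)" using K r by (intro mult_left_mono H1) simp
  finally have "?d v p <= r * R"
   using e1[OF vV(1)] cs(2)[OF vV(1)] by (simp add: R_def r_def[symmetric] algebra_simps)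
  also have "\<dots> <= H1_norm \<Omega> v * R" using R0 unfolding r_def by (intro mult_right_mono H1_norm_ge vV)
  finally show "ereal (?d v p / H1_norm \<Omega> v) <= ereal R"
   using H1_pos[OF vV] by (simp add: divide_le_eq mult.commute)
 qed
 finally have "\<beta>\<^sub>1 * L2_norm \<Omega> p <= R" by simp
 then have "L2_norm \<Omega> p <= R / \<beta>\<^sub>1" using \<beta>1 by (simp add: le_divide_eq mult.commute)
 then have "(L2_norm \<Omega> p)\<^sup>2 <= (R / \<beta>\<^sub>1)\<^sup>2" using L2_Q_nonneg[OF p] by (intro power_mono) (simp_all add: L2_norm_def)
 then have pp: "L2_inner \<Omega> p p <= ((1 + sqrt K / \<beta>\<^sub>2) / \<beta>\<^sub>1)\<^sup>2 * e"
  using L2_Q_nonneg[OF p] e by (simp add: L2_norm_def R_def power_divide power_mult_distrib)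
 have "?H\<^sup>2 <= (sqrt e / \<beta>\<^sub>2)\<^sup>2" by (rule power_mono[OF H1 H0])
 then have HH: "?H\<^sup>2 <= e / \<beta>\<^sub>2\<^sup>2" using e by (simp add: power_divide)
 have "X <= 4 * (C * ?H\<^sup>2)" using X inverse[OF sv] by simp
 also have "\<dots> <= 4 * (C * (e / \<beta>\<^sub>2\<^sup>2))" using C by (intro mult_left_mono HH) simp_all
 finally have Xb: "X <= 4 * C / \<beta>\<^sub>2\<^sup>2 * e" by simp
 have ee: "e = - ?d u p + pairing T\<^sub>\<Gamma> \<nu> u" unfolding e_def by (rule e1[OF u(1)])
 have "s * e = - (s * ?d u p) + s * pairing T\<^sub>\<Gamma> \<nu> u" unfolding ee by (simp add: algebra_simps)
 also have "\<dots> = L2_inner \<Omega> p p / \<gamma> + X / \<delta>" using e2[OF p] e3 \<gamma> \<delta> by simp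
 also have "\<dots> <= (((1 + sqrt K / \<beta>\<^sub>2) / \<beta>\<^sub>1)\<^sup>2 * e) / \<gamma> + (4 * C / \<beta>\<^sub>2\<^sup>2 * e) / \<delta>"
  using \<gamma> \<delta> by (intro add_mono divide_right_mono pp Xb) simp_all
 also have "\<dots> = bnd \<gamma> \<delta> * e" by (simp add: bnd_def distrib_right)
 finally show ?thesis using e by simp
qed

end

section \<open>Passage between coefficient vectors and functions\<close>

lemma pairing_commute: "pairing T f g = pairing T g f"
 by (simp add: pairing_def inner_commute)

lemma L2_inner_commute: "L2_inner \<Omega> f g = L2_inner \<Omega> g f"
 by (simp add: L2_inner_def inner_commute)

lemma transpose_symmetric_mat:
 assumes "!!i j. i < n ==> j < n ==> f (i, j) = f (j, i)"
 shows "transpose_mat (Matrix.mat n n f) = Matrix.mat n n f"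
 by (rule eq_matI) (use assms in auto)

lemma scalar_prod_self: "scalar_prod v v = (\<Sum>i<dim_vec v. (vec_index v i)\<^sup>2)" for v :: "real Matrix.vec"
 by (simp add: scalar_prod_def atLeast0LessThan power2_eq_square)

text \<open>The form of the square is the squared length of the image, so an injective symmetric
  matrix has a definite square, whatever its own sign.\<close>

lemma spd_square:
 fixes M :: "real mat"
 assumes M: "M \<in> carrier_mat n n" "transpose_mat M = M"
  and ker: "!!x. x \<in> carrier_vec n ==> M *\<^sub>v x = 0\<^sub>v n ==> x = 0\<^sub>v n"
 shows "x \<in> carrier_vec n ==> scalar_prod x ((M * M) *\<^sub>v x) = scalar_prod (M *\<^sub>v x) (M *\<^sub>v x)" "spd n (M * M)"
proof -
 have e: "scalar_prod x ((M * M) *\<^sub>v x) = scalar_prod (M *\<^sub>v x) (M *\<^sub>v x)" if x: "x \<in> carrier_vec n" for x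
 proof -
  have Mx: "M *\<^sub>v x \<in> carrier_vec n" using M x by simp
  have "(M * M) *\<^sub>v x = M *\<^sub>v (M *\<^sub>v x)" by (rule assoc_mult_mat_vec[OF M(1) M(1) x])
  then show ?thesis using transpose_vec_mult_scalar[OF M(1) Mx x] M(2) by simp
 qed
 then show "x \<in> carrier_vec n ==> scalar_prod x ((M * M) *\<^sub>v x) = scalar_prod (M *\<^sub>v x) (M *\<^sub>v x)" .
 have "0 < scalar_prod x ((M * M) *\<^sub>v x)" if x: "x \<in> carrier_vec n" "x ~= 0\<^sub>v n" for x
 proof -
  have d: "dim_vec (M *\<^sub>v x) = n" using M by simp
  have "M *\<^sub>v x ~= 0\<^sub>v n" using ker x by auto
  then have "\<exists>i<n. vec_index (M *\<^sub>v x) i ~= 0" using d by (auto intro!: eq_vecI)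
  then obtain i where i: "i < n" "vec_index (M *\<^sub>v x) i ~= 0" by auto
  have "0 < (vec_index (M *\<^sub>v x) i)\<^sup>2" using i(2) by simp
  also have "\<dots> <= (\<Sum>i<n. (vec_index (M *\<^sub>v x) i)\<^sup>2)" using i(1) by (intro member_le_sum) auto
  finally show ?thesis unfolding e[OF x(1)] scalar_prod_self d .
 qed
 moreover have "transpose_mat (M * M) = M * M" using transpose_mult[OF M(1) M(1)] M(2) by simp
 ultimately show "spd n (M * M)" using M(1) by (auto simp: spd_def quad_form_def)
qed

context coupled_meshes
begin

text \<open>Each matrix form is a bilinear form evaluated at \<open>comb\<close>. Under this
  dictionary the requirements of \<open>saddle_point\<close> become positivity of energies and
  norms, and the reduced eigenvalue problem becomes the set of equations in
  \<open>energy_bound\<close>.\<close>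

theorem spectral_equivalence:
 assumes \<phi>s: "enumerates \<phi>s (V_basis \<Omega> T)" and ps: "enumerates ps (Q_basis \<Omega> T)" and \<psi>s: "enumerates \<psi>s (Lambda_basis T\<^sub>\<Gamma>)"
  and \<gamma>: "0 < \<gamma>" and \<delta>: "0 < \<delta>"
 defines "MA \<equiv> A_matrix \<Omega> \<phi>s" and "MB \<equiv> B_matrix \<Omega> \<phi>s ps" and "MC \<equiv> C_matrix T\<^sub>\<Gamma> \<phi>s \<psi>s"
  and "MQ \<equiv> Mp_matrix \<Omega> ps" and "MD \<equiv> Mlambda_matrix T\<^sub>\<Gamma> \<psi>s"
 shows "1 / (1 + bnd \<gamma> \<delta>) <= lower_bound \<gamma> \<delta> MA MB MC MQ (MD * MD)"
  and "spectrum (map_mat complex_of_real (precond_system \<gamma> \<delta> MA MB MC MQ (MD * MD))) - {0}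
   \<subseteq> complex_of_real ` {lower_bound \<gamma> \<delta> MA MB MC MQ (MD * MD)..1}"
proof -
 define n where "n = length \<phi>s"
 define m where "m = length ps"
 define l where "l = length \<psi>s"
 note V = V_comb(1)[OF \<phi>s] V_comb(2,3)[OF \<phi>s, folded n_def]
 note Q = Q_comb(1)[OF ps] Q_comb(2,3)[OF ps, folded m_def]
 have h: "dist a b <= mesh_size T\<^sub>\<Gamma>" if "(a, b) \<in> T\<^sub>\<Gamma>" for a b
  unfolding mesh_size_def using S.fin that by (intro Max_ge) force+
 then have "\<forall>e\<in>T\<^sub>\<Gamma>. dist (fst e) (snd e) <= mesh_size T\<^sub>\<Gamma>" by simp
 note L = S.Lambda_comb[OF \<psi>s this]
 have \<phi>b: "set \<phi>s \<subseteq> bsf UNIV" using V(1) V_bsf by auto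
 have fA: "scalar_prod w (MA *\<^sub>v x) = L2_inner \<Omega> (grad (comb \<phi>s w)) (grad (comb \<phi>s x))"
  if "w \<in> carrier_vec n" "x \<in> carrier_vec n" for w x
  unfolding MA_def A_matrix_def by (rule bilinear_form_mat[OF bilinear_A V(1) V(1) that[unfolded n_def]])
 have fQ: "scalar_prod w (MQ *\<^sub>v x) = L2_inner \<Omega> (comb ps w) (comb ps x)"
  if "w \<in> carrier_vec m" "x \<in> carrier_vec m" for w x
  unfolding MQ_def Mp_matrix_def by (rule bilinear_form_mat[OF bilinear_Mp Q(1) Q(1) that[unfolded m_def]])
 have fB: "scalar_prod y (MB *\<^sub>v w) = - L2_inner \<Omega> (divergence (comb \<phi>s w)) (comb ps y)"
  if "y \<in> carrier_vec m" "w \<in> carrier_vec n" for y w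
  unfolding MB_def B_matrix_def
  by (rule bilinear_form_mat[OF bilinear_form_swap[OF bilinear_form_uminus[OF bilinear_B]] Q(1) V(1) that(1)[unfolded m_def] that(2)[unfolded n_def]])
 have fC: "scalar_prod z (MC *\<^sub>v w) = pairing T\<^sub>\<Gamma> (comb \<psi>s z) (comb \<phi>s w)"
  if "z \<in> carrier_vec l" "w \<in> carrier_vec n" for z w
  unfolding MC_def C_matrix_def pairing_commute[of T\<^sub>\<Gamma> "comb \<psi>s z"]
  by (rule bilinear_form_mat[OF bilinear_form_swap[OF S.bilinear_pairing] L(1) \<phi>b that(1)[unfolded l_def] that(2)[unfolded n_def]])
 have cA: "MA \<in> carrier_mat n n" and cB: "MB \<in> carrier_mat m n" and cC: "MC \<in> carrier_mat l n"
  and cQ: "MQ \<in> carrier_mat m m" and cL: "MD \<in> carrier_mat l l"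
  by (simp_all add: MA_def MB_def MC_def MQ_def MD_def A_matrix_def B_matrix_def C_matrix_def Mp_matrix_def Mlambda_matrix_def n_def m_def l_def)
 have uV: "comb \<phi>s x \<in> V_space \<Omega> T" for x by (rule comb_in[OF fun_subspace_V V(1)])
 have pQ: "comb ps x \<in> Q_space \<Omega> T" for x by (rule comb_in[OF fun_subspace_Q Q(1)])
 have spA: "spd n MA"
  unfolding spd_def quad_form_def
 proof (intro conjI ballI impI cA)
  show "transpose_mat MA = MA" unfolding MA_def A_matrix_def
   by (rule transpose_symmetric_mat) (simp add: L2_inner_commute)
  fix x :: "real Matrix.vec" assume x: "x \<in> carrier_vec n" "x ~= 0\<^sub>v n"
  then have "comb \<phi>s x ~= (\<lambda>_. 0)" using V(3) by auto
  then show "0 < scalar_prod x (MA *\<^sub>v x)" unfolding fA[OF x(1) x(1)] by (rule energy_pos[OF uV])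
 qed
 have spQ: "spd m MQ"
  unfolding spd_def quad_form_def
 proof (intro conjI ballI impI cQ)
  show "transpose_mat MQ = MQ" unfolding MQ_def Mp_matrix_def
   by (rule transpose_symmetric_mat) (simp add: L2_inner_commute)
  fix x :: "real Matrix.vec" assume x: "x \<in> carrier_vec m" "x ~= 0\<^sub>v m"
  then have ne: "comb ps x ~= (\<lambda>_. 0)" using Q(3) by auto
  have "L2_inner \<Omega> (comb ps x) (comb ps x) ~= 0"
  proof
   assume "L2_inner \<Omega> (comb ps x) (comb ps x) = 0"
   then have "comb ps x = (\<lambda>_. 0)" by (intro ext L2_Q_eq_0[OF pQ])
   then show False using ne by simp
  qed
  then show "0 < scalar_prod x (MQ *\<^sub>v x)" unfolding fQ[OF x(1) x(1)] using L2_Q_nonneg[OF pQ[of x]] by linarith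
 qed
 have Lz: "vec_index (MD *\<^sub>v z) i = pairing T\<^sub>\<Gamma> (\<psi>s ! i) (comb \<psi>s z)" if z: "z \<in> carrier_vec l" and i: "i < l" for z i
 proof -
  have "\<psi>s ! i \<in> bsf UNIV" using L(1) nth_mem[OF i[unfolded l_def]] by (rule subsetD)
  then have "linear_form (bsf UNIV) (pairing T\<^sub>\<Gamma> (\<psi>s ! i))" using S.bilinear_pairing by (simp add: bilinear_form_def)
  from linear_form_comb[OF fun_subspace_bsf this L(1), of z]
  show ?thesis using z i by (simp add: MD_def Mlambda_matrix_def l_def scalar_prod_def row_def atLeast0LessThan mult.commute)
 qed
 have tL: "transpose_mat MD = MD" unfolding MD_def Mlambda_matrix_def
  by (rule transpose_symmetric_mat) (simp add: pairing_commute)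
 have kerL: "z = 0\<^sub>v l" if z: "z \<in> carrier_vec l" and 0: "MD *\<^sub>v z = 0\<^sub>v l" for z
 proof -
  obtain U V' where UV: "segval T\<^sub>\<Gamma> U V' (comb \<psi>s z)"
   "(\<Sum>e\<in>T\<^sub>\<Gamma>. endsq U V' e) = 0 --> (\<forall>i<length \<psi>s. vec_index z i = 0)" using L(2)[of z] by (elim exE conjE) (rule that)
  have nb: "comb \<psi>s z \<in> bsf UNIV" by (rule S.Lambda_bsf[OF UV(1)])
  then have "linear_form (bsf UNIV) (\<lambda>f. pairing T\<^sub>\<Gamma> f (comb \<psi>s z))" using S.bilinear_pairing by (simp add: bilinear_form_def)
  from linear_form_comb[OF fun_subspace_bsf this L(1), of z]
  have "pairing T\<^sub>\<Gamma> (comb \<psi>s z) (comb \<psi>s z) = (\<Sum>i<l. vec_index z i * vec_index (MD *\<^sub>v z) i)"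
   using Lz[OF z] by (simp add: l_def)
  then have "pairing T\<^sub>\<Gamma> (comb \<psi>s z) (comb \<psi>s z) = 0" unfolding 0 by simp
  then have "Hminushalf_norm T\<^sub>\<Gamma> (comb \<psi>s z) = 0" by (rule S.dual_norm_0[OF UV(1)])
  then have le: "(mesh_size T\<^sub>\<Gamma>)\<^sup>2 * (\<Sum>e\<in>T\<^sub>\<Gamma>. endsq U V' e) <= 0" using inverse[OF UV(1)] by simp
  have "(\<Sum>e\<in>T\<^sub>\<Gamma>. endsq U V' e) = 0"
  \<comment> \<open>A positive mesh size, needed for the cancellation, requires a segment; without
    segments the sum is empty.\<close>
  proof (cases "T\<^sub>\<Gamma> = {}")
   case False
   then obtain a b where ab: "(a, b) \<in> T\<^sub>\<Gamma>" by auto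
   have "0 < dist a b" using S.ne[OF ab] by simp
   then have "0 < mesh_size T\<^sub>\<Gamma>" using h[OF ab] by linarith
   then have "(\<Sum>e\<in>T\<^sub>\<Gamma>. endsq U V' e) <= 0" using le by (simp add: mult_le_0_iff)
   moreover have "0 <= (\<Sum>e\<in>T\<^sub>\<Gamma>. endsq U V' e)" by (simp add: sum_nonneg)
   ultimately show ?thesis by linarith
  qed simp
  then have "\<forall>i<l. vec_index z i = 0" using UV(2) by (simp add: l_def)
  then show ?thesis using z by (intro eq_vecI) auto
 qed
 have sq1: "scalar_prod z ((MD * MD) *\<^sub>v z) = scalar_prod (MD *\<^sub>v z) (MD *\<^sub>v z)" if "z \<in> carrier_vec l" for z
  by (rule spd_square(1)[OF cL tL _ that]) (rule kerL; assumption)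
 have sq2: "spd l (MD * MD)" by (rule spd_square(2)[OF cL tL]) (rule kerL; assumption)
 interpret sp: saddle_point n m l MA MB MC MQ "MD * MD" \<gamma> \<delta>
  by unfold_locales (fact spA spQ sq2 cB cC \<gamma> \<delta>)+
 have pos: "0 < bnd \<gamma> \<delta>"
 proof -
  have "0 < 4 * C / (\<beta>\<^sub>2\<^sup>2 * \<delta>)" using C \<beta>2 \<delta> by simp
  moreover have "0 <= ((1 + sqrt K / \<beta>\<^sub>2) / \<beta>\<^sub>1)\<^sup>2 / \<gamma>" using \<gamma> by simp
  ultimately show ?thesis unfolding bnd_def by linarith
 qed
 have bound: "s <= bnd \<gamma> \<delta>"
  if x: "x \<in> carrier_vec n" "x ~= 0\<^sub>v n" and y: "y \<in> carrier_vec m" and z: "z \<in> carrier_vec l" and s: "0 < s"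
   and H1: "!!w. w \<in> carrier_vec n ==> scalar_prod w (MA *\<^sub>v x) = scalar_prod (MB *\<^sub>v w) y + scalar_prod (MC *\<^sub>v w) z"
   and H2: "!!q. q \<in> carrier_vec m ==> scalar_prod q (MQ *\<^sub>v y) = s * \<gamma> * scalar_prod q (MB *\<^sub>v x)"
   and H3: "!!\<mu>. \<mu> \<in> carrier_vec l ==> scalar_prod \<mu> ((MD * MD) *\<^sub>v z) = s * \<delta> * scalar_prod \<mu> (MC *\<^sub>v x)" for x y z s
 proof -
  obtain U V' where UV: "segval T\<^sub>\<Gamma> U V' (comb \<psi>s z)"
   "(\<Sum>i<length \<psi>s. (pairing T\<^sub>\<Gamma> (\<psi>s ! i) (comb \<psi>s z))\<^sup>2) <= 4 * ((mesh_size T\<^sub>\<Gamma>)\<^sup>2 * (\<Sum>e\<in>T\<^sub>\<Gamma>. endsq U V' e))"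
   using L(2)[of z] by (elim exE conjE) (rule that)
  show ?thesis
  proof (rule energy_bound[OF uV _ pQ UV(1) \<gamma> \<delta> s])
   show "comb \<phi>s x ~= (\<lambda>_. 0)" using V(3)[OF x(1)] x(2) by auto
   fix v assume "v \<in> V_space \<Omega> T"
   then obtain w where w: "w \<in> carrier_vec n" "comb \<phi>s w = v" using V(2) by auto
   have "scalar_prod (MB *\<^sub>v w) y = scalar_prod y (MB *\<^sub>v w)" "scalar_prod (MC *\<^sub>v w) z = scalar_prod z (MC *\<^sub>v w)"
    using cB cC w(1) y z by (intro comm_scalar_prod[of _ m] comm_scalar_prod[of _ l]; simp)+
   then show "L2_inner \<Omega> (grad v) (grad (comb \<phi>s x)) = - L2_inner \<Omega> (divergence v) (comb ps y) + pairing T\<^sub>\<Gamma> (comb \<psi>s z) v"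
    using H1[OF w(1)] fA[OF w(1) x(1)] fB[OF y w(1)] fC[OF z w(1)] w(2) by simp
  next
   fix q assume "q \<in> Q_space \<Omega> T"
   then obtain w where w: "w \<in> carrier_vec m" "comb ps w = q" using Q(2) by auto
   show "L2_inner \<Omega> q (comb ps y) = - (s * \<gamma> * L2_inner \<Omega> (divergence (comb \<phi>s x)) q)"
    using H2[OF w(1)] fQ[OF w(1) y] fB[OF w(1) x(1)] w(2) by simp
  next
   show "scalar_prod z ((MD * MD) *\<^sub>v z) = s * \<delta> * pairing T\<^sub>\<Gamma> (comb \<psi>s z) (comb \<phi>s x)"
    using H3[OF z] fC[OF z x(1)] by simp
   have "dim_row MD = l" using cL by simp
   \<comment> \<open>\<open>W\<close> is the square of the symmetric mass matrix, so its form at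
     \<open>z\<close> is the squared length of \<open>MD *\<^sub>v z\<close>, whose entries are the
     pairings bounded in \<open>Lambda_comb\<close>.\<close>
   then have "scalar_prod z ((MD * MD) *\<^sub>v z) = (\<Sum>i<l. (pairing T\<^sub>\<Gamma> (\<psi>s ! i) (comb \<psi>s z))\<^sup>2)"
    unfolding sq1[OF z] scalar_prod_self using Lz[OF z] by simp
   then show "scalar_prod z ((MD * MD) *\<^sub>v z) <= 4 * ((mesh_size T\<^sub>\<Gamma>)\<^sup>2 * (\<Sum>e\<in>T\<^sub>\<Gamma>. endsq U V' e))"
    using UV(2) by (simp add: l_def)
  qed
 qed
 show "1 / (1 + bnd \<gamma> \<delta>) <= lower_bound \<gamma> \<delta> MA MB MC MQ (MD * MD)"
  by (rule sp.spectral_bound(1)[OF pos bound])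
 show "spectrum (map_mat complex_of_real (precond_system \<gamma> \<delta> MA MB MC MQ (MD * MD))) - {0}
   \<subseteq> complex_of_real ` {lower_bound \<gamma> \<delta> MA MB MC MQ (MD * MD)..1}"
  by (rule sp.spectral_bound(2)[OF pos bound])
qed

end

theorem theorem4:
  fixes \<Omega> \<omega> :: "(real^2) set" and \<gamma> \<delta> \<beta>\<^sub>1 \<beta>\<^sub>2 \<sigma> :: real
  assumes "lipschitz_domain \<Omega>"
    and "closed \<omega>" and "bounded \<omega>" and "\<omega> \<subseteq> \<Omega>" and "lipschitz_boundary \<omega>"
    and "\<gamma> > 0" and "\<delta> > 0" and "\<beta>\<^sub>1 > 0" and "\<beta>\<^sub>2 > 0" and "\<sigma> > 0"
  shows "\<exists>c>0. \<forall>T\<^sub>\<Omega> T\<^sub>\<Gamma> \<phi>s ps \<psi>s.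
    quad_mesh \<Omega> T\<^sub>\<Omega> \<and> segment_mesh (frontier \<omega>) T\<^sub>\<Gamma> \<and> quasi_uniform \<sigma> T\<^sub>\<Gamma> \<and>
    inf_sup_div \<beta>\<^sub>1 \<Omega> T\<^sub>\<Omega> \<and> inf_sup_mult \<beta>\<^sub>2 \<Omega> T\<^sub>\<Omega> T\<^sub>\<Gamma> \<and>
    enumerates \<phi>s (V_basis \<Omega> T\<^sub>\<Omega>) \<and> enumerates ps (Q_basis \<Omega> T\<^sub>\<Omega>) \<and>
    enumerates \<psi>s (Lambda_basis T\<^sub>\<Gamma>) \<longrightarrow>
    (let A = A_matrix \<Omega> \<phi>s; B = B_matrix \<Omega> \<phi>s ps; C = C_matrix T\<^sub>\<Gamma> \<phi>s \<psi>s;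
         Q = Mp_matrix \<Omega> ps; W = Mlambda_matrix T\<^sub>\<Gamma> \<psi>s * Mlambda_matrix T\<^sub>\<Gamma> \<psi>s;
         b = lower_bound \<gamma> \<delta> A B C Q W
     in c \<le> b \<and>
        spectrum (map_mat complex_of_real (precond_system \<gamma> \<delta> A B C Q W)) - {0}
          \<subseteq> complex_of_real ` {b..1})"
proof (cases "\<exists>T0. segment_mesh (frontier \<omega>) T0")
 \<comment> \<open>If no mesh resolves the boundary of \<omega>, the claim about all meshes is
   vacuous.\<close>
 case False
 then show ?thesis by (intro exI[of _ 1]) simp
next
 case True
 then obtain T0 where T0: "segment_mesh (frontier \<omega>) T0" by (elim exE)
 interpret Z: seg_mesh "frontier \<omega>" T0 by standard (rule T0)
 have bdd: "bounded \<Omega>" using assms(1) by (simp add: lipschitz_domain_def)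
 obtain K where K: "0 <= K" "\<forall>E v. pw_smooth \<Omega> E v --> Hhalf_sq T0 v <= ennreal K * denergy E v"
 proof -
  have "\<exists>K\<ge>0. \<forall>E v. pw_smooth \<Omega> E v --> Hhalf_sq T0 v <= ennreal K * denergy E v"
   by (rule trace_inequality[OF Z.fin _ bdd]) (rule Z.ne)
  then show thesis by (elim exE conjE) (rule that)
 qed
 obtain C where C: "0 < C" "\<forall>T U V \<nu>. segment_mesh (frontier \<omega>) T --> quasi_uniform \<sigma> T --> segval T U V \<nu> -->
   (mesh_size T)\<^sup>2 * (\<Sum>e\<in>T. endsq U V e) <= C * (Hminushalf_norm T \<nu>)\<^sup>2"
  using inverse_inequality[OF assms(10), of "frontier \<omega>"] by (elim exE conjE)
 \<comment> \<open>The value of \<open>bnd\<close> for constants fixed before any mesh;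
   \<open>K + 1\<close> replaces the trace constant, which is only known to be nonnegative.\<close>
 define S where "S = ((1 + sqrt (K + 1) / \<beta>\<^sub>2) / \<beta>\<^sub>1)\<^sup>2 / \<gamma> + 4 * C / (\<beta>\<^sub>2\<^sup>2 * \<delta>)"
 have S: "0 <= S" using assms C(1) by (simp add: S_def)
 show ?thesis
 proof (intro exI[of _ "1 / (1 + S)"] conjI allI impI, goal_cases)
  case 1
  then show ?case using S by simp
 next
  case (2 T\<^sub>\<Omega> T\<^sub>\<Gamma> \<phi>s ps \<psi>s)
  then have mO: "quad_mesh \<Omega> T\<^sub>\<Omega>" and mG: "segment_mesh (frontier \<omega>) T\<^sub>\<Gamma>" and qu: "quasi_uniform \<sigma> T\<^sub>\<Gamma>"
   and isup: "inf_sup_div \<beta>\<^sub>1 \<Omega> T\<^sub>\<Omega>" "inf_sup_mult \<beta>\<^sub>2 \<Omega> T\<^sub>\<Omega> T\<^sub>\<Gamma>"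
   and en: "enumerates \<phi>s (V_basis \<Omega> T\<^sub>\<Omega>)" "enumerates ps (Q_basis \<Omega> T\<^sub>\<Omega>)" "enumerates \<psi>s (Lambda_basis T\<^sub>\<Gamma>)"
   by simp_all
  interpret F: fe_mesh \<Omega> T\<^sub>\<Omega> by standard (rule assms(1), rule mO)
  interpret G: seg_mesh "frontier \<omega>" T\<^sub>\<Gamma> by standard (rule mG)
  have tr: "Hhalf_sq T\<^sub>\<Gamma> v <= ennreal ((K + 1) * L2_inner \<Omega> (grad v) (grad v))" if v: "v \<in> V_space \<Omega> T\<^sub>\<Omega>" for v
  proof -
   \<comment> \<open>The trace inequality was obtained on \<open>T0\<close>; the norm depends on the
     mesh through the arc length measure only, which is the same for both.\<close>
   have "Hhalf_sq T\<^sub>\<Gamma> v = Hhalf_sq T0 v" unfolding Hhalf_sq_def arc_measure_mesh_eq[OF mG T0] ..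
   also have "\<dots> <= ennreal K * denergy (mesh_sides T\<^sub>\<Omega>) v" using K(2) F.V_space_pw_smooth[OF v] by simp
   also have "\<dots> = ennreal (K * L2_inner \<Omega> (grad v) (grad v))"
    unfolding F.energy_denergy(1)[OF v] using K(1) F.energy_denergy(2)[OF v] by (simp add: ennreal_mult)
   also have "\<dots> <= ennreal ((K + 1) * L2_inner \<Omega> (grad v) (grad v))"
    using F.energy_denergy(2)[OF v] by (intro ennreal_leI mult_right_mono) simp_all
   finally show ?thesis .
  qed
  interpret M: coupled_meshes \<Omega> T\<^sub>\<Omega> "frontier \<omega>" T\<^sub>\<Gamma> \<beta>\<^sub>1 \<beta>\<^sub>2 "K + 1" C
  proof unfold_locales
   show "0 < K + 1" using K(1) by simp
   show "(mesh_size T\<^sub>\<Gamma>)\<^sup>2 * (\<Sum>e\<in>T\<^sub>\<Gamma>. endsq U V e) <= C * (Hminushalf_norm T\<^sub>\<Gamma> \<nu>)\<^sup>2" if "segval T\<^sub>\<Gamma> U V \<nu>" for U V \<nu>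
    using C(2) mG qu that by simp
  qed (fact assms(8,9) C(1) isup tr)+
  show ?case
   using M.spectral_equivalence[OF en assms(6,7)] unfolding Let_def M.bnd_def S_def by simp
 qed
qed

end
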